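(* Let $0<p,q<\infty$, $\omega\in\mathcal{D}$, and let $g$ be an analytic function on $\mathbb{D}$. (1) If $p\leq q$, then the following conditions are equivalent: (a) $J_g:AT^{\infty}_p(\omega)\to AT^{\infty}_q(\omega)$ is compact; (b) $J_g:AT^0_p(\omega)\to AT^0_q(\omega)$ is compact; (c) $\lim_{|z|\to1^-}|g'(z)|(1-|z|)\widehat{\omega}(z)^{\frac1q-\frac1p}=0$. (2) If $p>q$, then the following conditions are equivalent: (a) $J_g:AT^{\infty}_p(\omega)\to AT^{\infty}_q(\omega)$ is compact; (b) $J_g:AT^0_p(\omega)\to AT^0_q(\omega)$ is compact; (c) $J_g:AT^{\infty}_p(\omega)\to AT^0_q(\omega)$ is bounded; (d) $g\in AT^0_{\frac{pq}{p-q}}(\omega)$.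
   Context: $\mathbb{D}$ is the open unit disk of $\mathbb{C}$, $dA$ is Lebesgue area measure on $\mathbb{D}$, and $\mathcal{H}(\mathbb{D})$ is the space of analytic functions on $\mathbb{D}$. Volterra operator: for $g\in\mathcal{H}(\mathbb{D})$, $J_gf(z)=\int_0^zf(\zeta)g'(\zeta)\,d\zeta$ for $z\in\mathbb{D}$, $f\in\mathcal{H}(\mathbb{D})$. An operator between (quasi-)normed spaces is compact if it maps bounded sets to relatively compact sets. Weights: a weight is a function $\omega:\mathbb{D}\to[0,\infty)$ integrable over $\mathbb{D}$ and not a.e. zero; it is radial if $\omega(z)=\omega(|z|)$ for all $z$. For a radial weight put $\widehat{\omega}(z)=\int_{|z|}^1\omega(s)\,ds$. A radial weight $\omega$ is in $\widehat{\mathcal{D}}$ if there is $C\ge1$ with $\widehat{\omega}(r)\le C\widehat{\omega}\left(\frac{1+r}{2}\right)$ for all $0\le r<1$; it is in $\check{\mathcal{D}}$ if there are $K>1$ and $C>1$ with $\widehat{\omega}(r)\ge C\widehat{\omega}\left(1-\frac{1-r}{K}\right)$ for all $0\le r<1$. $\mathcal{D}:=\widehat{\mathcal{D}}\cap\check{\mathcal{D}}$. Tent spaces: the Carleson squares are $S(0):=\mathbb{D}$ and $S(re^{i\theta}):=\{\rho e^{it}:r\le\rho<1,\ |t-\theta|\le\frac{1-r}{2}\}$ for $0<r<1$. For $0<q<\infty$, $T^{\infty}_q(\omega)$ consists of the measurable functions $f$ on $\mathbb{D}$ with $$\|f\|_{T^{\infty}_q(\omega)}:=\sup_{a\in\mathbb{D}}\left(\frac{1}{1-|a|}\int_{S(a)}|f|^q\,\omega\,dA\right)^{1/q}<\infty,$$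 and $T^0_q(\omega)$ is the subspace of those $f\in T^{\infty}_q(\omega)$ with $\lim_{|a|\to1^-}\frac{1}{1-|a|}\int_{S(a)}|f|^q\,\omega\,dA=0$. Set $AT^{\infty}_q(\omega):=T^{\infty}_q(\omega)\cap\mathcal{H}(\mathbb{D})$ and $AT^0_q(\omega):=T^0_q(\omega)\cap\mathcal{H}(\mathbb{D})$, with the inherited (quasi-)norm. *)

theory Defs
  imports "HOL-Complex_Analysis.Complex_Analysis"
begin

abbreviation disk :: "complex set" ("\<DD>")
  where "\<DD> \<equiv> ball 0 1"

text \<open>HOL functions are total.  An analytic function on the disk is represented by its extension
  by \<open>0\<close>, so that equality in this set is equality of functions on the disk.\<close>

definition analytic_disk :: "(complex \<Rightarrow> complex) set" ("\<H>\<DD>")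
  where "\<H>\<DD> = {f. f holomorphic_on \<DD> \<and> (\<forall>z. z \<notin> \<DD> \<longrightarrow> f z = 0)}"

definition volterra :: "(complex \<Rightarrow> complex) \<Rightarrow> (complex \<Rightarrow> complex) \<Rightarrow> complex \<Rightarrow> complex"
  where "volterra g f z =
    (if z \<in> \<DD> then contour_integral (linepath 0 z) (\<lambda>\<zeta>. f \<zeta> * deriv g \<zeta>) else 0)"

text \<open>The filter of \<open>|z| \<rightarrow> 1\<^sup>-\<close>.\<close>

definition to_circle :: "complex filter"
  where "to_circle = filtercomap norm (at_left 1)"


subsection \<open>Weights\<close>

definition weight :: "(complex \<Rightarrow> real) \<Rightarrow> bool"
  where "weight \<omega> \<longleftrightarrow>
    (\<forall>z\<in>\<DD>. 0 \<le> \<omega> z) \<and>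
    integrable (lebesgue_on \<DD>) \<omega> \<and>
    \<not> (AE z in lebesgue_on \<DD>. \<omega> z = 0)"

definition radial_weight :: "(complex \<Rightarrow> real) \<Rightarrow> bool"
  where "radial_weight \<omega> \<longleftrightarrow> weight \<omega> \<and> (\<forall>z\<in>\<DD>. \<omega> z = \<omega> (of_real (norm z)))"

text \<open>The tail integral takes values in \<open>[0,\<infinity>]\<close>, because integrability over the disk does not make
  the integral of \<open>\<omega>\<close> over \<open>[0,1)\<close> finite.  For the weights in \<open>D_hat\<close> it is finite and positive
  at every point of the disk.\<close>

definition tail :: "(complex \<Rightarrow> real) \<Rightarrow> complex \<Rightarrow> ennreal"
  where "tail \<omega> z = (\<integral>\<^sup>+ s\<in>{norm z..<1}. ennreal (\<omega> (of_real s)) \<partial>lebesgue)"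

definition D_hat :: "(complex \<Rightarrow> real) set"
  where "D_hat = {\<omega>. radial_weight \<omega> \<and>
    (\<exists>C::real. C \<ge> 1 \<and> (\<forall>r::real. 0 \<le> r \<and> r < 1 \<longrightarrow>
      tail \<omega> (of_real r) \<le> ennreal C * tail \<omega> (of_real ((1 + r) / 2))))}"

definition D_check :: "(complex \<Rightarrow> real) set"
  where "D_check = {\<omega>. radial_weight \<omega> \<and>
    (\<exists>K C::real. K > 1 \<and> C > 1 \<and> (\<forall>r::real. 0 \<le> r \<and> r < 1 \<longrightarrow>
      tail \<omega> (of_real r) \<ge> ennreal C * tail \<omega> (of_real (1 - (1 - r) / K))))}"

definition D_class :: "(complex \<Rightarrow> real) set"
  where "D_class = D_hat \<inter> D_check"


subsection \<open>Tent spaces\<close>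

text \<open>Since \<open>t\<close> ranges over all reals, any argument of \<open>a\<close> in place of \<open>Arg a\<close> gives the same
  set.\<close>

definition carleson_square :: "complex \<Rightarrow> complex set"
  where "carleson_square a =
    (if a = 0 then \<DD>
     else {rcis \<rho> t | \<rho> t. norm a \<le> \<rho> \<and> \<rho> < 1 \<and> \<bar>t - Arg a\<bar> \<le> (1 - norm a) / 2})"

definition tent_mean ::
    "real \<Rightarrow> (complex \<Rightarrow> real) \<Rightarrow> (complex \<Rightarrow> complex) \<Rightarrow> complex \<Rightarrow> ennreal"
  where "tent_mean q \<omega> f a =
    ennreal (1 / (1 - norm a)) *
    (\<integral>\<^sup>+ z\<in>carleson_square a. ennreal (norm (f z) powr q * \<omega> z) \<partial>lebesgue)"

definition enn_powr :: "ennreal \<Rightarrow> real \<Rightarrow> ennreal"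
  where "enn_powr x s = (if x = \<infinity> then \<infinity> else ennreal (enn2real x powr s))"
  \<comment> \<open>meant for \<open>s > 0\<close> only\<close>

definition tent_norm :: "real \<Rightarrow> (complex \<Rightarrow> real) \<Rightarrow> (complex \<Rightarrow> complex) \<Rightarrow> ennreal"
  where "tent_norm q \<omega> f = (SUP a\<in>\<DD>. enn_powr (tent_mean q \<omega> f a) (1 / q))"

definition T_inf :: "real \<Rightarrow> (complex \<Rightarrow> real) \<Rightarrow> (complex \<Rightarrow> complex) set"
  where "T_inf q \<omega> = {f. f \<in> borel_measurable (lebesgue_on \<DD>) \<and> tent_norm q \<omega> f < \<infinity>}"

definition T_zero :: "real \<Rightarrow> (complex \<Rightarrow> real) \<Rightarrow> (complex \<Rightarrow> complex) set"
  where "T_zero q \<omega> = {f \<in> T_inf q \<omega>. (tent_mean q \<omega> f \<longlongrightarrow> 0) to_circle}"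

definition AT_inf :: "real \<Rightarrow> (complex \<Rightarrow> real) \<Rightarrow> (complex \<Rightarrow> complex) set"
  where "AT_inf q \<omega> = T_inf q \<omega> \<inter> \<H>\<DD>"

definition AT_zero :: "real \<Rightarrow> (complex \<Rightarrow> real) \<Rightarrow> (complex \<Rightarrow> complex) set"
  where "AT_zero q \<omega> = T_zero q \<omega> \<inter> \<H>\<DD>"


subsection \<open>Bounded and compact operators between quasi-normed function spaces\<close>

text \<open>The topology of the quasi-norm \<open>N\<close> on \<open>X\<close>.  For a mere quasi-norm the balls
  \<open>{h \<in> X. N (h - f) < e}\<close> need not be open, but they form a neighbourhood base at \<open>f\<close>.\<close>

definition qnorm_open :: "('a \<Rightarrow> complex) set \<Rightarrow> (('a \<Rightarrow> complex) \<Rightarrow> ennreal) \<Rightarrow>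
    ('a \<Rightarrow> complex) set \<Rightarrow> bool"
  where "qnorm_open X N U \<longleftrightarrow> U \<subseteq> X \<and>
    (\<forall>f\<in>U. \<exists>e::real. e > 0 \<and> (\<forall>h\<in>X. N (\<lambda>x. h x - f x) < ennreal e \<longrightarrow> h \<in> U))"

definition qnorm_topology ::
    "('a \<Rightarrow> complex) set \<Rightarrow> (('a \<Rightarrow> complex) \<Rightarrow> ennreal) \<Rightarrow> ('a \<Rightarrow> complex) topology"
  where "qnorm_topology X N = topology (qnorm_open X N)"

lemma istopology_qnorm_open: "istopology (qnorm_open X N)"
  unfolding istopology_def
proof (intro conjI allI impI)
  fix S T assume S: "qnorm_open X N S" and T: "qnorm_open X N T"
  show "qnorm_open X N (S \<inter> T)"
    unfolding qnorm_open_def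
  proof (intro conjI ballI)
    show "S \<inter> T \<subseteq> X" using S by (auto simp: qnorm_open_def)
  next
    fix f assume f: "f \<in> S \<inter> T"
    obtain d where d: "d > 0" "\<forall>h\<in>X. N (\<lambda>x. h x - f x) < ennreal d \<longrightarrow> h \<in> S"
      using S f unfolding qnorm_open_def by blast
    obtain e where e: "e > 0" "\<forall>h\<in>X. N (\<lambda>x. h x - f x) < ennreal e \<longrightarrow> h \<in> T"
      using T f unfolding qnorm_open_def by blast
    have "ennreal (min d e) \<le> ennreal d" "ennreal (min d e) \<le> ennreal e"
      by (auto intro: ennreal_leI)
    then have "\<forall>h\<in>X. N (\<lambda>x. h x - f x) < ennreal (min d e) \<longrightarrow> h \<in> S \<inter> T"
      using d(2) e(2) by (meson IntI order_less_le_trans)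
    then show "\<exists>e>0. \<forall>h\<in>X. N (\<lambda>x. h x - f x) < ennreal e \<longrightarrow> h \<in> S \<inter> T"
      using d(1) e(1) by (intro exI[of _ "min d e"]) simp
  qed
next
  fix K assume "\<forall>S\<in>K. qnorm_open X N S"
  then show "qnorm_open X N (\<Union>K)"
    unfolding qnorm_open_def by (fast intro: Union_least)
qed

lemma openin_qnorm_topology: "openin (qnorm_topology X N) = qnorm_open X N"
  unfolding qnorm_topology_def by (rule topology_inverse'[OF istopology_qnorm_open])

lemma topspace_qnorm_topology: "topspace (qnorm_topology X N) = X"
proof
  show "topspace (qnorm_topology X N) \<subseteq> X"
    unfolding topspace_def openin_qnorm_topology by (auto simp: qnorm_open_def)
  have "openin (qnorm_topology X N) X"
    unfolding openin_qnorm_topology qnorm_open_def by (auto intro: exI[of _ 1])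
  then show "X \<subseteq> topspace (qnorm_topology X N)"
    by (rule openin_subset)
qed

definition bounded_op ::
    "('a \<Rightarrow> complex) set \<Rightarrow> (('a \<Rightarrow> complex) \<Rightarrow> ennreal) \<Rightarrow>
     ('b \<Rightarrow> complex) set \<Rightarrow> (('b \<Rightarrow> complex) \<Rightarrow> ennreal) \<Rightarrow>
     (('a \<Rightarrow> complex) \<Rightarrow> ('b \<Rightarrow> complex)) \<Rightarrow> bool"
  where "bounded_op X NX Y NY T \<longleftrightarrow>
    T ` X \<subseteq> Y \<and> (\<exists>C::real. \<forall>f\<in>X. NY (T f) \<le> ennreal C * NX f)"

definition compact_op ::
    "('a \<Rightarrow> complex) set \<Rightarrow> (('a \<Rightarrow> complex) \<Rightarrow> ennreal) \<Rightarrow>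
     ('b \<Rightarrow> complex) set \<Rightarrow> (('b \<Rightarrow> complex) \<Rightarrow> ennreal) \<Rightarrow>
     (('a \<Rightarrow> complex) \<Rightarrow> ('b \<Rightarrow> complex)) \<Rightarrow> bool"
  where "compact_op X NX Y NY T \<longleftrightarrow>
    T ` X \<subseteq> Y \<and>
    (\<forall>B. B \<subseteq> X \<and> (\<exists>M::real. \<forall>f\<in>B. NX f \<le> ennreal M) \<longrightarrow>
      compactin (qnorm_topology Y NY) (qnorm_topology Y NY closure_of (T ` B)))"

end

theory Submission
 imports Defs
begin

text \<open>Write \<open>W n\<close> for the tail of the weight at radius \<open>1 - 2^(-n)\<close> and \<open>w k = W n / 2^n\<close> for a dyadic box \<open>k\<close> of
  level \<open>n\<close>.  By subharmonicity and the doubling conditions, \<open>f\<close> lies in the tent space iff the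
  \<open>q\<close>-th powers of the box maxima of \<open>|f|\<close> form a Carleson sequence with respect to \<open>w\<close>; by a Hardy
  inequality on the dyadic tree the same holds with \<open>(1 - |z|) |f'|\<close> when \<open>f(0) = 0\<close>.  So the Volterra
  operator becomes multiplication by the box maxima \<open>d k\<close> of \<open>(1 - |z|) |g'|\<close>.  For \<open>p \<le> q\<close> the
  multiplier is controlled pointwise, for \<open>p > q\<close> by Young's inequality, and Montel's theorem gives
  compactness.  Conversely, the operator is tested on sums of powers of the kernels
  \<open>2^(-n) / (1 - cnj a * z)\<close> over finite sets of nodes, where averaging over all subsets of the nodes
  replaces Khinchine's inequality.\<close>

text \<open>The exponents may lie below one, so the argument uses no duality and necessity comes
  from explicit functions. Kernel sums over nodes of level at least N, with Carleson-bounded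
  coefficients, stay bounded in the tent space and tend to 0 locally uniformly as N grows;
  compactness then forces their images to 0 in norm. For p <= q one node at a time suffices. For p >
  q, with s = pq/(p - q), coefficients y with y^p proportional to d^s are extremal, because (y d)^q
  is then proportional to d^s as well. A bounded map into the vanishing space yields in this way
  only bounded means of d^s; their decay needs one function built from infinitely many blocks of
  nodes. All bounds are carried as functions of the level: a bounded one describes the full tent
  space, a null sequence the vanishing one, so the same inequalities serve both. Compactness is
  characterised for every domain and range between the vanishing and the full tent spaces, which
  covers (a) and (b) at once.\<close>

abbreviation hol :: "(complex => complex) => bool" where
 "hol f == f holomorphic_on \<DD>"

lemmas hol_cont = holomorphic_on_imp_continuous_on

subsection \<open>Circle means on the disk\<close>

lemma disk_measurable [measurable]: "\<DD> : sets borel"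
 by simp

section \<open>Rotation invariance of area and polar coordinates\<close>

lemma nn_integral_lborel_shift:
 fixes h :: "real => ennreal"
 assumes [measurable]: "h : borel_measurable borel"
 shows "(\<integral>\<^sup>+t. h (t + a) \<partial>lborel) = (\<integral>\<^sup>+t. h t \<partial>lborel)"
proof -
 have "(\<integral>\<^sup>+t. h t \<partial>lborel) = (\<integral>\<^sup>+t. h t \<partial>distr lborel borel ((+) a))"
  by (simp add: lborel_distr_plus)
 also have "... = (\<integral>\<^sup>+t. h (a + t) \<partial>lborel)"
  by (subst nn_integral_distr) auto
 finally show ?thesis by (simp add: add.commute)
qed

text \<open>The shifted period [a, a + c] is cut at c, and the part beyond c is moved back by one
  period.\<close>

lemma nn_integral_periodic_shift:
 fixes h :: "real => ennreal"
 assumes [measurable]: "h : borel_measurable borel" and per: "!!t. h (t + c) = h t"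
  and a: "0 <= a" "a <= c"
 shows "(\<integral>\<^sup>+t\<in>{0..c}. h (t + a) \<partial>lborel) = (\<integral>\<^sup>+t\<in>{0..c}. h t \<partial>lborel)"
proof -
 have "(\<integral>\<^sup>+t\<in>{0..c}. h (t + a) \<partial>lborel) = (\<integral>\<^sup>+t. h (t + a) * indicator {a..a+c} (t + a) \<partial>lborel)"
  by (intro nn_integral_cong) (auto simp: indicator_def)
 also have "... = (\<integral>\<^sup>+t. h t * indicator {a..a+c} t \<partial>lborel)"
  by (rule nn_integral_lborel_shift) auto
 also have "... = (\<integral>\<^sup>+t. h t * indicator {a..c} t + h t * indicator {c<..a+c} t \<partial>lborel)"
  using a by (intro nn_integral_cong) (auto simp: indicator_def)
 also have "... = (\<integral>\<^sup>+t. h t * indicator {a..c} t \<partial>lborel) + (\<integral>\<^sup>+t. h t * indicator {c<..a+c} t \<partial>lborel)"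
  by (rule nn_integral_add) auto
 also have "(\<integral>\<^sup>+t. h t * indicator {c<..a+c} t \<partial>lborel)
   = (\<integral>\<^sup>+t. h (t + c) * indicator {c<..a+c} (t + c) \<partial>lborel)"
  by (rule nn_integral_lborel_shift[symmetric]) auto
 also have "... = (\<integral>\<^sup>+t. h t * indicator {0<..a} t \<partial>lborel)"
  by (intro nn_integral_cong) (auto simp: indicator_def per)
 also have "(\<integral>\<^sup>+t. h t * indicator {a..c} t \<partial>lborel) + (\<integral>\<^sup>+t. h t * indicator {0<..a} t \<partial>lborel)
   = (\<integral>\<^sup>+t. h t * indicator {a..c} t + h t * indicator {0<..a} t \<partial>lborel)"
  by (rule nn_integral_add[symmetric]) auto
 \<comment> \<open>The two pieces overlap in a and miss 0, which is a null set.\<close>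
 also have "... = (\<integral>\<^sup>+t\<in>{0..c}. h t \<partial>lborel)"
 proof (rule nn_integral_cong_AE)
  have "AE t in lborel. t ~= 0 & t ~= a"
   using AE_lborel_singleton[of 0] AE_lborel_singleton[of a] by eventually_elim auto
  thus "AE t in lborel. h t * indicator {a..c} t + h t * indicator {0<..a} t = h t * indicator {0..c} t"
   by (rule eventually_mono) (use a in \<open>auto simp: indicator_def\<close>)
 qed
 finally show ?thesis .
qed

text \<open>Multiplication by \<open>cis t\<close> is conjugate to an orthogonal map of the real
  plane. Invariance is transported through the identification \<open>?\<iota>\<close>, which
  preserves the measure of boxes and hence Lebesgue measure.\<close>

lemma distr_lborel_cis: "distr lborel borel (%z. cis t * z) = lborel"
proof -
 let ?\<iota> = "%v::real^2. Complex (v$1) (v$2)"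
 have lin: "linear ?\<iota>"
  by (rule linearI) (auto simp: complex_eq_iff)
 hence m\<iota>[measurable]: "?\<iota> : borel_measurable borel"
  by (intro borel_measurable_continuous_onI linear_continuous_on) (simp add: linear_conv_bounded_linear)
 have D: "lborel = distr lborel borel ?\<iota>"
 proof (rule lborel_eqI)
  fix l u :: complex assume le: "!!b. b : Basis ==> l \<bullet> b <= u \<bullet> b"
  have lu: "Re l <= Re u" "Im l <= Im u" using le[of 1] le[of \<i>] by (auto simp: Basis_complex_def)
  let ?l = "vector [Re l, Im l] :: real^2" and ?u = "vector [Re u, Im u] :: real^2"
  have "?\<iota> -` box l u = box ?l ?u"
   by (auto simp: mem_box_cart forall_2 in_box_complex_iff vector_2)
  moreover have "emeasure lborel (box ?l ?u) = (\<Prod>b\<in>Basis. (u - l) \<bullet> b)"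
  proof -
   have B: "(Basis::(real^2) set) = {axis 1 1, axis 2 1}"
    by (auto simp: Basis_vec_def exhaust_2) (metis exhaust_2)
   have "emeasure lborel (box ?l ?u) = (\<Prod>b\<in>Basis. (?u - ?l) \<bullet> b)"
    using lu by (intro emeasure_lborel_box) (auto simp: B inner_axis)
   also have "(\<Prod>b\<in>Basis. (?u - ?l) \<bullet> b) = (Re u - Re l) * (Im u - Im l)"
   proof -
    have "axis 1 1 ~= (axis 2 1 :: real^2)" by (simp add: axis_eq_axis)
    thus ?thesis unfolding B by (simp add: inner_axis)
   qed
   finally show ?thesis by (simp add: Basis_complex_def)
  qed
  ultimately show "emeasure (distr lborel borel ?\<iota>) (box l u) = (\<Prod>b\<in>Basis. (u - l) \<bullet> b)"
   by (subst emeasure_distr) auto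
 qed simp
 have em: "emeasure lborel (?\<iota> -` A) = emeasure lborel A" if "A : sets borel" for A
 proof -
  have "emeasure lborel A = emeasure (distr lborel borel ?\<iota>) A"
   by (rule arg_cong[where f="%M. emeasure M A", OF D])
  also have "... = emeasure lborel (?\<iota> -` A)"
   using that m\<iota> by (subst emeasure_distr) simp_all
  finally show ?thesis by simp
 qed
 \<comment> \<open>The rotation by -t: it maps a set onto its preimage under multiplication by
   \<open>cis t\<close>.\<close>
 let ?R = "%v::real^2. vector [cos t * v$1 + sin t * v$2, cos t * v$2 - sin t * v$1] :: real^2"
 have sc: "(cos t)\<^sup>2 + (sin t)\<^sup>2 = 1" by simp
 have linR: "linear ?R" by (rule linearI) (auto simp: vec_eq_iff forall_2 algebra_simps)
 have ort: "orthogonal_transformation ?R"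
  unfolding orthogonal_transformation
 proof (intro conjI linR allI)
  fix v :: "real^2"
  have "(c * x + d * y)\<^sup>2 + (c * y - d * x)\<^sup>2 = (c\<^sup>2 + d\<^sup>2) * (x\<^sup>2 + y\<^sup>2)" for c d x y :: real
   by (simp add: power2_eq_square algebra_simps)
  from this[of "cos t" "v$1" "sin t" "v$2"] show "norm (?R v) = norm v"
   by (simp add: norm_vec_def L2_set_def sum_2 sc)
 qed
 have "lborel = distr lborel borel (%z. cis t * z)"
 proof (rule lborel_eqI)
  fix l u :: complex assume le: "!!b. b : Basis ==> l \<bullet> b <= u \<bullet> b"
  let ?B = "box l u"
  have mc[measurable]: "(%z. cis t * z) : borel_measurable borel"
   by (intro borel_measurable_continuous_onI continuous_intros)
  have pre: "(%z. cis t * z) -` ?B : sets borel"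
   using measurable_sets[OF mc, of ?B] by simp
  have S: "?\<iota> -` ((%z. cis t * z) -` ?B) = ?R ` (?\<iota> -` ?B)"
  proof -
   have inv: "cis t * ?\<iota> (?R v) = ?\<iota> v" for v
   proof -
    have "c * (c * x + d * y) - d * (c * y - d * x) = (c\<^sup>2 + d\<^sup>2) * x"
       "c * (c * y - d * x) + d * (c * x + d * y) = (c\<^sup>2 + d\<^sup>2) * y" for c d x y :: real
     by (simp_all add: power2_eq_square algebra_simps)
    from this(1)[of "cos t" "v$1" "sin t" "v$2"] this(2)[of "cos t" "v$2" "sin t" "v$1"]
    show ?thesis by (simp add: complex_eq_iff sc)
   qed
   show ?thesis
   proof (rule set_eqI)
    fix v
    obtain w where w: "v = ?R w"
     by (rule surjE[OF orthogonal_transformation_surj[OF ort], of v])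
    have "inj ?R" using ort by (rule orthogonal_transformation_inj)
    hence "v : ?R ` (?\<iota> -` ?B) \<longleftrightarrow> w : ?\<iota> -` ?B" unfolding w by (rule inj_image_mem_iff)
    also have "... \<longleftrightarrow> cis t * ?\<iota> (?R w) : ?B" unfolding inv by simp
    finally show "v : ?\<iota> -` ((%z. cis t * z) -` ?B) \<longleftrightarrow> v : ?R ` (?\<iota> -` ?B)"
     unfolding w by simp
   qed
  qed
  have op: "open (?\<iota> -` ?B)"
   using lin by (intro open_vimage linear_continuous_on) (simp_all add: linear_conv_bounded_linear open_box)
  have fin: "?\<iota> -` ?B : lmeasurable"
   unfolding fmeasurable_def using em[of ?B] emeasure_lborel_box_finite[of l u] op by simp
  have "measure lebesgue (?R ` (?\<iota> -` ?B)) = measure lebesgue (?\<iota> -` ?B)"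
   "?R ` (?\<iota> -` ?B) : lmeasurable"
   using measure_orthogonal_image[OF ort fin] measurable_orthogonal_image[OF ort fin] by auto
  hence e1: "emeasure lebesgue (?R ` (?\<iota> -` ?B)) = emeasure lebesgue (?\<iota> -` ?B)"
   by (simp only: emeasure_eq_measure2[OF fin] emeasure_eq_measure2[of "?R ` (?\<iota> -` ?B)"])
  hence "emeasure lborel (?\<iota> -` ((%z. cis t * z) -` ?B)) = emeasure lborel (?\<iota> -` ?B)"
  proof -
   have L: "emeasure lebesgue A = emeasure lborel A" if "A : sets lborel" for A :: "(real^2) set"
    using that by (simp add: emeasure_completion sets_completionI_sets)
   have s1: "?\<iota> -` ?B : sets lborel" using op by simp
   have s2: "?R ` (?\<iota> -` ?B) : sets lborel"
    unfolding S[symmetric] using measurable_sets[OF m\<iota> pre] by simp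
   show ?thesis unfolding S L[OF s1, symmetric] L[OF s2, symmetric] by (rule e1)
  qed
  hence "emeasure lborel ((%z. cis t * z) -` ?B) = emeasure lborel ?B"
   using pre by (simp add: em)
  thus "emeasure (distr lborel borel (%z. cis t * z)) ?B = (\<Prod>b\<in>Basis. (u - l) \<bullet> b)"
   using le by (subst emeasure_distr) (auto simp: emeasure_lborel_box)
 qed simp
 thus ?thesis by simp
qed

lemma nn_integral_lborel_cis:
 assumes [measurable]: "f : borel_measurable borel"
 shows "(\<integral>\<^sup>+z. f (cis t * z) \<partial>lborel) = (\<integral>\<^sup>+z. f z \<partial>lborel)"
proof -
 have [measurable]: "(%z. cis t * z) : borel_measurable borel"
  by (intro borel_measurable_continuous_onI continuous_intros)
 have "(\<integral>\<^sup>+z. f z \<partial>lborel) = (\<integral>\<^sup>+z. f z \<partial>distr lborel borel (%z. cis t * z))"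
  by (simp add: distr_lborel_cis)
 also have "... = (\<integral>\<^sup>+z. f (cis t * z) \<partial>lborel)"
  by (subst nn_integral_distr) auto
 finally show ?thesis by simp
qed

text \<open>Both measures are compared on half-lines, where one side is a difference of areas of
  concentric discs and the other an elementary integral of 2 pi s.\<close>

lemma distr_norm_disk:
 "distr (density lborel (indicator \<DD>)) borel norm
  = density lborel (%s::real. ennreal (2 * pi * s) * indicator {0..<1} s)" (is "?M = ?N")
proof (rule measure_eqI_lessThan)
 have [measurable]: "indicator \<DD> : borel_measurable (borel :: complex measure)"
  by (rule borel_measurable_indicator) simp
 have area: "emeasure lborel (ball (0::complex) r) = ennreal (pi * r\<^sup>2)" if "0 <= r" for r
  using emeasure_ball[OF that, of "0::complex"] by (simp add: unit_ball_vol_2 power2_eq_square)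
 have cb: "emeasure lborel (cball (0::complex) r) = ennreal (pi * r\<^sup>2)" if "0 <= r" for r
  using emeasure_cball[OF that, of "0::complex"] by (simp add: unit_ball_vol_2 power2_eq_square)
 have M: "emeasure ?M {x<..} = emeasure lborel (\<DD> Int {z. x < norm z})" for x
 proof -
  have "emeasure ?M {x<..} = emeasure (density lborel (indicator \<DD>)) {z::complex. x < norm z}"
   by (subst emeasure_distr) (auto simp: vimage_def)
  also have "... = (\<integral>\<^sup>+z. indicator \<DD> z * indicator {z. x < norm z} z \<partial>lborel)"
   by (subst emeasure_density) simp_all
  also have "... = (\<integral>\<^sup>+z. indicator (\<DD> Int {z. x < norm z}) z \<partial>lborel)"
   by (intro nn_integral_cong) (simp add: indicator_def)
  also have "... = emeasure lborel (\<DD> Int {z. x < norm z})"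
   by (rule nn_integral_indicator) simp
  finally show ?thesis .
 qed
 have F: "(\<integral>\<^sup>+s. ennreal (2 * pi * s) * indicator {a..1} s \<partial>lborel) = ennreal (pi - pi * a\<^sup>2)"
  if "0 <= a" "a <= 1" for a
 proof -
  have "(\<integral>\<^sup>+s. ennreal (2 * pi * s) * indicator {a..1} s \<partial>lborel) = ennreal (pi * 1\<^sup>2 - pi * a\<^sup>2)"
   using that by (intro nn_integral_FTC_Icc) (auto intro!: derivative_eq_intros)
  thus ?thesis by simp
 qed
 have N: "emeasure ?N {x<..} = ennreal (pi - pi * (min 1 (max x 0))\<^sup>2)" for x
 proof -
  let ?a = "min 1 (max x 0)"
  have "emeasure ?N {x<..} = (\<integral>\<^sup>+s. ennreal (2 * pi * s) * indicator {0..<1} s * indicator {x<..} s \<partial>lborel)"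
   by (subst emeasure_density) auto
  also have "... = (\<integral>\<^sup>+s. ennreal (2 * pi * s) * indicator {?a..1} s \<partial>lborel)"
  proof (rule nn_integral_cong_AE)
   have "AE s in lborel. s ~= 0 & s ~= x & s ~= 1"
    using AE_lborel_singleton[of 0] AE_lborel_singleton[of x] AE_lborel_singleton[of 1]
    by eventually_elim auto
   thus "AE s in lborel. ennreal (2 * pi * s) * indicator {0..<1} s * indicator {x<..} s
     = ennreal (2 * pi * s) * indicator {?a..1} s"
    by eventually_elim (auto simp: indicator_def)
  qed
  finally show ?thesis using F[of ?a] by simp
 qed
 show "emeasure ?M {x<..} < \<infinity>" for x
 proof -
  have "emeasure ?M {x<..} <= emeasure lborel \<DD>" unfolding M by (intro emeasure_mono) auto
  also have "... < \<infinity>" using area[of 1] by simp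
  finally show ?thesis .
 qed
 show "emeasure ?M {x<..} = emeasure ?N {x<..}" for x
 proof -
  consider "x < 0" | "0 <= x" "x < 1" | "1 <= x" by linarith
  hence "emeasure lborel (\<DD> Int {z. x < norm z}) = ennreal (pi - pi * (min 1 (max x 0))\<^sup>2)"
  proof cases
   case 1
   have "x < norm z" for z :: complex using 1 norm_ge_zero[of z] by linarith
   hence "\<DD> Int {z. x < norm z} = \<DD>" by blast
   thus ?thesis using 1 area[of 1] by simp
  next
   case 2
   have "\<DD> Int {z. x < norm z} = \<DD> - cball 0 x" by auto
   also have "emeasure lborel ... = emeasure lborel \<DD> - emeasure lborel (cball (0::complex) x)"
    using 2 by (intro emeasure_Diff) (auto simp: cb)
   also have "... = ennreal (pi - pi * x\<^sup>2)"
    using 2 area[of 1] by (simp add: cb ennreal_minus)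
   finally show ?thesis using 2 by simp
  next
   case 3
   hence "\<DD> Int {z. x < norm z} = {}" by auto
   thus ?thesis using 3 by simp
  qed
  thus ?thesis unfolding M N .
 qed
qed simp_all

text \<open>The integral over the disk does not change when the integrand is rotated, so 2 pi times
  it is the integral over t of the rotated integrals. After Fubini the inner integral over t depends
  on |z| only, and \<open>distr_norm_disk\<close> gives the law of |z|.\<close>

lemma nn_integral_disk_polar:
 fixes \<phi> :: "complex => ennreal"
 assumes [measurable]: "\<phi> : borel_measurable borel"
 shows "(\<integral>\<^sup>+z\<in>\<DD>. \<phi> z \<partial>lborel)
  = (\<integral>\<^sup>+s\<in>{0..<1}. ennreal s * (\<integral>\<^sup>+t\<in>{0..2*pi}. \<phi> (rcis s t) \<partial>lborel) \<partial>lborel)"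
proof -
 have mc[measurable]: "(%p. cis (snd p) * fst p) : borel_measurable (borel \<Otimes>\<^sub>M borel)"
  unfolding borel_prod cis_conv_exp
  by (intro borel_measurable_continuous_onI continuous_intros)
 have mc1[measurable]: "(%z. cis t * z) : borel_measurable borel" for t
  by (intro borel_measurable_continuous_onI continuous_intros)
 have mc2[measurable]: "(%p. rcis (fst p) (snd p)) : borel_measurable (borel \<Otimes>\<^sub>M borel)"
  unfolding borel_prod rcis_def cis_conv_exp
  by (intro borel_measurable_continuous_onI continuous_intros)
 have mc3[measurable]: "(%t. rcis s t) : borel_measurable borel" for s
  unfolding rcis_def cis_conv_exp
  by (intro borel_measurable_continuous_onI continuous_intros)
 have joint[measurable]: "(%p. \<phi> (cis (snd p) * fst p)) : borel_measurable (borel \<Otimes>\<^sub>M borel)"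
  by (rule measurable_compose[OF mc assms])
 have sec[measurable]: "(%z. \<phi> (cis t * z)) : borel_measurable borel" for t
  by (rule measurable_compose[OF mc1 assms])
 have sec2[measurable]: "(%t. \<phi> (cis t * z)) : borel_measurable borel" for z
  by (rule measurable_compose[OF _ assms])
   (auto simp: cis_conv_exp intro!: borel_measurable_continuous_onI continuous_intros)
 define \<Phi> where "\<Phi> s = (\<integral>\<^sup>+t\<in>{0..2*pi}. \<phi> (rcis s t) \<partial>lborel)" for s
 have m\<Phi>[measurable]: "\<Phi> : borel_measurable borel"
  unfolding \<Phi>_def using mc2 by measurable
 have rad: "(\<integral>\<^sup>+t\<in>{0..2*pi}. \<phi> (cis t * z) \<partial>lborel) = \<Phi> (norm z)" for z
 proof -
  have z: "cis t * z = rcis (norm z) (t + Arg2pi z)" for t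
  proof -
   have "z = rcis (norm z) (Arg2pi z)"
    using Arg2pi_eq[of z] by (simp add: rcis_def cis_conv_exp)
   hence "cis t * z = cis t * rcis (norm z) (Arg2pi z)" by simp
   also have "... = rcis (norm z) (t + Arg2pi z)"
    by (simp add: rcis_def cis_mult[symmetric] mult.left_commute)
   finally show ?thesis .
  qed
  have "(%t. \<phi> (rcis (norm z) t)) : borel_measurable borel" by measurable
  thus ?thesis unfolding z \<Phi>_def
   by (rule nn_integral_periodic_shift)
     (use Arg2pi_ge_0[of z] Arg2pi_lt_2pi[of z] in \<open>auto simp: rcis_def cis_mult[symmetric]\<close>)
 qed
 have "ennreal (2 * pi) * (\<integral>\<^sup>+z\<in>\<DD>. \<phi> z \<partial>lborel)
   = (\<integral>\<^sup>+t. (\<integral>\<^sup>+z\<in>\<DD>. \<phi> z \<partial>lborel) * indicator {0..2*pi} t \<partial>lborel)"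
  by (subst nn_integral_cmult_indicator) (simp_all add: mult.commute)
 also have "... = (\<integral>\<^sup>+t. (\<integral>\<^sup>+z. \<phi> (cis t * z) * indicator \<DD> z \<partial>lborel) * indicator {0..2*pi} t \<partial>lborel)"
 proof (rule nn_integral_cong)
  fix t :: real
  have "(\<integral>\<^sup>+z\<in>\<DD>. \<phi> z \<partial>lborel) = (\<integral>\<^sup>+z. \<phi> (cis t * z) * indicator \<DD> (cis t * z) \<partial>lborel)"
   by (rule nn_integral_lborel_cis[symmetric]) measurable
  thus "(\<integral>\<^sup>+z\<in>\<DD>. \<phi> z \<partial>lborel) * indicator {0..2*pi} t
    = (\<integral>\<^sup>+z. \<phi> (cis t * z) * indicator \<DD> z \<partial>lborel) * indicator {0..2*pi} t"
   by (simp add: indicator_def norm_mult)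
 qed
 also have "... = (\<integral>\<^sup>+t. (\<integral>\<^sup>+z. \<phi> (cis t * z) * indicator \<DD> z * indicator {0..2*pi} t \<partial>lborel) \<partial>lborel)"
  by (rule nn_integral_cong, rule nn_integral_multc[symmetric])
    (intro borel_measurable_times_ennreal borel_measurable_indicator; simp add: sec)
 also have "... = (\<integral>\<^sup>+z. (\<integral>\<^sup>+t. \<phi> (cis t * z) * indicator \<DD> z * indicator {0..2*pi} t \<partial>lborel) \<partial>lborel)"
 proof (rule lborel_pair.Fubini')
  have "(%p. indicator \<DD> (fst p) :: ennreal) : borel_measurable (borel \<Otimes>\<^sub>M borel)"
   "(%p. indicator {0..2*pi} (snd p) :: ennreal) : borel_measurable (borel \<Otimes>\<^sub>M borel)"
   by measurable
  hence "(%p. \<phi> (cis (snd p) * fst p) * indicator \<DD> (fst p) * indicator {0..2*pi} (snd p))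
    : borel_measurable (borel \<Otimes>\<^sub>M borel)"
   using joint by (intro borel_measurable_times_ennreal)
  thus "case_prod (%z t. \<phi> (cis t * z) * indicator \<DD> z * indicator {0..2*pi} t)
    : borel_measurable (lborel \<Otimes>\<^sub>M lborel)"
   by (simp add: case_prod_unfold cong: measurable_cong_sets)
 qed
 also have "... = (\<integral>\<^sup>+z. \<Phi> (norm z) * indicator \<DD> z \<partial>lborel)"
 proof (intro nn_integral_cong)
  fix z :: complex
  have "(\<integral>\<^sup>+t. \<phi> (cis t * z) * indicator \<DD> z * indicator {0..2*pi} t \<partial>lborel)
    = (\<integral>\<^sup>+t. (\<phi> (cis t * z) * indicator {0..2*pi} t) * indicator \<DD> z \<partial>lborel)"
   by (simp add: mult_ac)
  also have "... = (\<integral>\<^sup>+t\<in>{0..2*pi}. \<phi> (cis t * z) \<partial>lborel) * indicator \<DD> z"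
   by (rule nn_integral_multc) (intro borel_measurable_times_ennreal borel_measurable_indicator; simp add: sec2)
  finally show "(\<integral>\<^sup>+t. \<phi> (cis t * z) * indicator \<DD> z * indicator {0..2*pi} t \<partial>lborel) = \<Phi> (norm z) * indicator \<DD> z"
   by (simp add: rad)
 qed
 also have "... = (\<integral>\<^sup>+z. \<Phi> (norm z) \<partial>density lborel (indicator \<DD>))"
  by (subst nn_integral_density) (auto simp: mult.commute)
 also have "... = (\<integral>\<^sup>+s. \<Phi> s \<partial>distr (density lborel (indicator \<DD>)) borel (norm :: complex => real))"
  by (subst nn_integral_distr) auto
 also have "... = (\<integral>\<^sup>+s. ennreal (2 * pi * s) * indicator {0..<1} s * \<Phi> s \<partial>lborel)"
  unfolding distr_norm_disk by (subst nn_integral_density) auto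
 also have "... = (\<integral>\<^sup>+s. ennreal (2 * pi) * (ennreal s * \<Phi> s * indicator {0..<1} s) \<partial>lborel)"
  by (intro nn_integral_cong) (auto simp: indicator_def ennreal_mult' mult_ac)
 also have "... = ennreal (2 * pi) * (\<integral>\<^sup>+s\<in>{0..<1}. ennreal s * \<Phi> s \<partial>lborel)"
  by (rule nn_integral_cmult) auto
 finally show ?thesis
  by (simp add: \<Phi>_def ennreal_mult_cancel_left)
qed

section \<open>Monotonicity of the circle means of |F|^q\<close>

text \<open>On the circle z times its conjugate is the constant s^2, so the product loses one degree
  in both factors. The induction on \<open>p\<close> runs for all \<open>q\<close>.\<close>

lemma Re_mult_cnj_poly_on_sphere:
 "\<exists>r. \<forall>z\<in>sphere 0 s. Re (poly p z * cnj (poly q z)) = Re (poly r z)"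
proof (induction p arbitrary: q)
 case 0
 show ?case by (rule exI[of _ 0]) simp
next
 case (pCons a p)
 obtain b q' where q: "q = pCons b q'" by (cases q) auto
 obtain r where r: "\<forall>z\<in>sphere 0 s. Re (poly p z * cnj (poly q' z)) = Re (poly r z)"
  using pCons.IH by blast
 have "Re (poly (pCons a p) z * cnj (poly q z))
   = Re (poly (smult (cnj a) q + smult (cnj b) (pCons 0 p) + smult (of_real (s\<^sup>2)) r) z)"
  if z: "z : sphere 0 s" for z
 proof -
  have zz: "z * cnj z = of_real (s\<^sup>2)" using z by (simp add: complex_norm_square[symmetric])
  have "poly (pCons a p) z * cnj (poly q z)
    = a * cnj (poly q z) + cnj b * (z * poly p z) + (z * cnj z) * (poly p z * cnj (poly q' z))"
   by (simp add: q algebra_simps)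
  moreover have "poly (smult (cnj a) q + smult (cnj b) (pCons 0 p) + smult (of_real (s\<^sup>2)) r) z
    = cnj a * poly q z + cnj b * (z * poly p z) + of_real (s\<^sup>2) * poly r z" by simp
  moreover have "Re (X + Y + of_real (s\<^sup>2) * w) = Re X + Re Y + s\<^sup>2 * Re w" for X Y w by simp
  moreover have "Re (a * cnj (poly q z)) = Re (cnj a * poly q z)" by simp
  ultimately show ?thesis using bspec[OF r z] unfolding zz by presburger
 qed
 thus ?case by blast
qed

text \<open>Stone-Weierstrass on the circle. Real parts of polynomials are chosen because they
  extend to the plane as real parts of entire functions, which can be exponentiated.\<close>

lemma Re_poly_approx_on_sphere:
 fixes f :: "complex => real"
 assumes "continuous_on (sphere 0 s) f" "0 < e"
 obtains p where "!!z. z : sphere 0 s ==> \<bar>f z - Re (poly p z)\<bar> < e"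
proof -
 let ?R = "{f. \<exists>p. \<forall>z\<in>sphere 0 s. f z = Re (poly p z)}"
 interpret function_ring_on ?R "sphere (0::complex) s"
 proof
  show "continuous_on (sphere 0 s) f" if f: "f : ?R" for f :: "complex => real"
  proof -
   obtain p where p: "\<forall>z\<in>sphere 0 s. f z = Re (poly p z)" using f by auto
   have "continuous_on (sphere 0 s) (%z. Re (poly p z))" by (intro continuous_intros)
   thus ?thesis using p by (subst continuous_on_cong[OF refl]) auto
  qed
  show "(%z. f z + g z) : ?R" if fg: "f : ?R" "g : ?R" for f g
  proof -
   obtain p q where "\<forall>z\<in>sphere 0 s. f z = Re (poly p z)" "\<forall>z\<in>sphere 0 s. g z = Re (poly q z)"
    using fg by auto
   thus ?thesis by (auto intro!: exI[of _ "p + q"])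
  qed
  show "(%z. f z * g z) : ?R" if fg: "f : ?R" "g : ?R" for f g
  proof -
   obtain p q where pq: "\<forall>z\<in>sphere 0 s. f z = Re (poly p z)" "\<forall>z\<in>sphere 0 s. g z = Re (poly q z)"
    using fg by auto
   obtain r where r: "\<forall>z\<in>sphere 0 s. Re (poly p z * cnj (poly q z)) = Re (poly r z)"
    using Re_mult_cnj_poly_on_sphere by blast
   \<comment> \<open>Re P times Re Q is half the real part of P Q + P cnj Q.\<close>
   have "f z * g z = Re (poly (smult (1/2) (p * q + r)) z)" if "z : sphere 0 s" for z
    using bspec[OF r that] pq that by (simp add: field_simps)
   thus ?thesis by blast
  qed
  show "(%_. c) : ?R" for c by (auto intro!: exI[of _ "[:of_real c:]"])
  show "\<exists>f\<in>?R. f x ~= f y" if "x ~= y" for x y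
  proof (cases "Re x = Re y")
   case False
   have "Re : ?R" by (auto intro!: exI[of _ "[:0, 1:]"])
   thus ?thesis using False by blast
  next
   case True
   have "Im : ?R" by (auto intro!: exI[of _ "[:0, -\<i>:]"])
   moreover have "Im x ~= Im y" using True that complex_eqI by blast
   ultimately show ?thesis by blast
  qed
 qed simp
 obtain g where g: "g : ?R" "\<forall>x\<in>sphere 0 s. \<bar>f x - g x\<bar> < e"
  using Stone_Weierstrass_basic[OF assms] by blast
 then obtain p where "\<forall>z\<in>sphere 0 s. g z = Re (poly p z)" by blast
 thus ?thesis using that[of p] g(2) by simp
qed

lemma nn_integral_continuous_interval:
 fixes g :: "real => real"
 assumes "continuous_on {a..b} g" "!!t. t : {a..b} ==> 0 <= g t"
 shows "(\<integral>\<^sup>+t\<in>{a..b}. ennreal (g t) \<partial>lborel) = ennreal (integral {a..b} g)"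
proof -
 have hi: "(g has_integral integral {a..b} g) {a..b}"
  using assms(1) by (intro integrable_integral integrable_continuous_real)
 have "(\<integral>\<^sup>+t. ennreal (if t : {a..b} then g t else 0) \<partial>lborel) = ennreal (integral {a..b} g)"
 proof (rule nn_integral_has_integral_lborel)
  show "(%t. if t : {a..b} then g t else 0) : borel_measurable borel"
   using borel_measurable_continuous_on_if[of "{a..b}" g "%_. 0"] assms(1) by simp
  show "((%t. if t : {a..b} then g t else 0) has_integral integral {a..b} g) UNIV"
   using hi has_integral_restrict_UNIV[of "{a..b}" g] by (simp only:)
 qed (use assms(2) in auto)
 moreover have "(\<integral>\<^sup>+t\<in>{a..b}. ennreal (g t) \<partial>lborel) = (\<integral>\<^sup>+t. ennreal (if t : {a..b} then g t else 0) \<partial>lborel)"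
  by (intro nn_integral_cong) (simp add: indicator_def)
 ultimately show ?thesis by simp
qed

lemma integral_periodic_shift:
 fixes h :: "real => real"
 assumes cont: "continuous_on UNIV h" and nn: "!!t. 0 <= h t" and per: "!!t. h (t + c) = h t"
  and a: "0 <= a" "a <= c"
 shows "integral {0..c} (%t. h (t + a)) = integral {0..c} h"
proof -
 have [measurable]: "h : borel_measurable borel" by (rule borel_measurable_continuous_onI[OF cont])
 have c1: "continuous_on {0..c} (%t. h (t + a))"
  by (rule continuous_on_compose2[OF cont]) (auto intro!: continuous_intros)
 have c2: "continuous_on {0..c} h" using cont continuous_on_subset by blast
 have "ennreal (integral {0..c} (%t. h (t + a))) = ennreal (integral {0..c} h)"
  using nn_integral_periodic_shift[of "%t. ennreal (h t)" c a] a per nn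
  by (simp add: nn_integral_continuous_interval[OF c1] nn_integral_continuous_interval[OF c2])
 moreover have "0 <= integral {0..c} (%t. h (t + a))" "0 <= integral {0..c} h"
  using nn by (auto intro!: integral_nonneg integrable_continuous_real c1 c2)
 ultimately show ?thesis by simp
qed

lemma continuous_on_rcis: "continuous_on UNIV (%t. rcis s t)"
 unfolding rcis_def cis_conv_exp by (intro continuous_intros)

lemma continuous_on_norm_powr:
 fixes f :: "'a::topological_space => 'b::real_normed_vector"
 assumes "continuous_on A f" "0 < q"
 shows "continuous_on A (%x. norm (f x) powr q)"
 using assms by (intro continuous_on_powr' continuous_intros) auto

text \<open>The integrand is multiplied by the fixed unimodular function \<open>\<phi>\<close> that
  turns H into |H| on the circle of radius r. The result \<open>\<Psi>\<close> is entire in w,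
  equals the mean at radius r for w = r, and is at most the mean at radius s for |w| = s; the
  maximum principle compares the two.\<close>

lemma norm_integral_mean_mono:
 assumes H: "H holomorphic_on UNIV" "!!z. H z ~= 0" and rs: "0 <= r" "r <= s"
 shows "integral {0..2*pi} (%t. norm (H (rcis r t))) <= integral {0..2*pi} (%t. norm (H (rcis s t)))"
proof -
 have cH: "continuous_on UNIV H" by (rule hol_cont[OF H(1)])
 define \<phi> where "\<phi> t = cnj (H (rcis r t)) / of_real (norm (H (rcis r t)))" for t
 have c\<phi>: "continuous_on A \<phi>" for A
  unfolding \<phi>_def using H(2)
  by (intro continuous_intros continuous_on_compose2[OF cH] continuous_on_subset[OF continuous_on_rcis])
    auto
 have n\<phi>: "norm (\<phi> t) = 1" for t using H(2) by (simp add: \<phi>_def norm_divide)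
 define \<Psi> where "\<Psi> w = integral (cbox 0 (2*pi)) (%t. H (w * cis t) * \<phi> t)" for w
 have cont_cis: "continuous_on A (%t. w * cis t)" for A w
  unfolding cis_conv_exp by (intro continuous_intros)
 have cI: "continuous_on A (%t. H (w * cis t) * \<phi> t)" for A w
  by (intro continuous_intros continuous_on_compose2[OF cH cont_cis] c\<phi>) auto
 have c2: "continuous_on A (%t. norm (H (rcis s t)))" for s A
  by (intro continuous_intros continuous_on_compose2[OF cH] continuous_on_subset[OF continuous_on_rcis])
    auto
 have hol: "\<Psi> holomorphic_on UNIV"
  unfolding \<Psi>_def
 proof (rule leibniz_rule_holomorphic[where fx="%w t. deriv H (w * cis t) * cis t * \<phi> t"])
  show "((%w. H (w * cis t) * \<phi> t) has_field_derivative deriv H (w * cis t) * cis t * \<phi> t) (at w within UNIV)"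
   for w t
  proof -
   have "(H has_field_derivative deriv H (w * cis t)) (at (w * cis t))"
    using H(1) holomorphic_derivI by blast
   hence "((%w. H (w * cis t)) has_field_derivative deriv H (w * cis t) * cis t) (at w)"
    by (rule DERIV_chain2) (auto intro!: derivative_eq_intros)
   thus ?thesis by (auto intro!: derivative_eq_intros)
  qed
  show "(%t. H (w * cis t) * \<phi> t) integrable_on cbox 0 (2*pi)" for w
   by (intro integrable_continuous cI)
  have "deriv H holomorphic_on UNIV" using H(1) holomorphic_deriv by blast
  hence cd: "continuous_on UNIV (deriv H)" by (rule hol_cont)
  have c0: "continuous_on B (%x. cis (snd x))" for B :: "(complex \<times> real) set"
   unfolding cis_conv_exp by (intro continuous_intros)
  show "continuous_on (UNIV \<times> cbox 0 (2*pi)) (%(w, t). deriv H (w * cis t) * cis t * \<phi> t)"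
   unfolding case_prod_unfold
   by (intro continuous_intros continuous_on_compose2[OF cd] continuous_on_compose2[OF c\<phi>] c0) auto
 qed simp
 have bd: "norm (\<Psi> w) <= integral {0..2*pi} (%t. norm (H (rcis s t)))" if w: "norm w = s" for w
 proof -
  have w': "w * cis t = rcis s (t + Arg2pi w)" for t
  proof -
   have "w = rcis s (Arg2pi w)" using Arg2pi_eq[of w] w by (simp add: rcis_def cis_conv_exp)
   hence "w * cis t = rcis s (Arg2pi w) * cis t" by simp
   also have "... = rcis s (t + Arg2pi w)"
    by (simp add: rcis_def cis_mult add.commute)
   finally show ?thesis .
  qed
  have i1: "(%t. H (w * cis t) * \<phi> t) integrable_on cbox 0 (2*pi)"
   by (intro integrable_continuous cI)
  have i2: "(%t. norm (H (rcis s (t + Arg2pi w)))) integrable_on cbox 0 (2*pi)"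
   by (intro integrable_continuous continuous_on_compose2[OF c2[of UNIV]] continuous_intros) auto
  have "norm (\<Psi> w) <= integral (cbox 0 (2*pi)) (%t. norm (H (rcis s (t + Arg2pi w))))"
   unfolding \<Psi>_def
   by (rule integral_norm_bound_integral[OF i1 i2]) (simp add: w' norm_mult n\<phi>)
  also have "... = integral {0..2*pi} (%t. norm (H (rcis s t)))"
   unfolding cbox_interval
   by (rule integral_periodic_shift[where h="%t. norm (H (rcis s t))"])
     (use Arg2pi_ge_0[of w] Arg2pi_lt_2pi[of w] c2 in \<open>auto simp: rcis_def cis_mult[symmetric]\<close>)
  finally show ?thesis .
 qed
 have "norm (\<Psi> (of_real r)) <= integral {0..2*pi} (%t. norm (H (rcis s t)))"
 proof (rule maximum_modulus_frontier[where S="cball 0 s" and f=\<Psi>])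
  show "\<Psi> holomorphic_on interior (cball 0 s)" using hol holomorphic_on_subset by blast
  show "continuous_on (closure (cball 0 s)) \<Psi>"
   using hol hol_cont continuous_on_subset by blast
  show "norm (\<Psi> z) <= integral {0..2*pi} (%t. norm (H (rcis s t)))" if "z : frontier (cball 0 s)" for z
  proof (rule bd)
   have "z : cball 0 s" using that frontier_subset_closed[of "cball (0::complex) s"] by auto
   thus "norm z = s" using that rs by (cases "s = 0") auto
  qed
 qed (use rs in auto)
 also have "\<Psi> (of_real r) = of_real (integral {0..2*pi} (%t. norm (H (rcis r t))))"
 proof -
  have "H (of_real r * cis t) * \<phi> t = of_real (norm (H (rcis r t)))" for t
   using H(2)[of "rcis r t"] complex_norm_square[of "H (rcis r t)"]
   by (simp add: \<phi>_def rcis_def field_simps power2_eq_square)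
  moreover have "((%t. complex_of_real (norm (H (rcis r t)))) has_integral
    of_real (integral {0..2*pi} (%t. norm (H (rcis r t))))) {0..2*pi}"
   by (intro has_integral_of_real integrable_integral integrable_continuous_real c2)
  ultimately show ?thesis unfolding \<Psi>_def by (simp add: integral_unique)
 qed
 finally show ?thesis by (simp add: abs_le_iff)
qed

text \<open>|F|^q is replaced by the modulus of the zero-free function H = exp P, where Re P lies
  slightly above ln (|F|^q + e) on the circle of radius s. There |F|^q <= |H|, hence also inside, by
  the maximum principle for F exp(-P/q); and |H| is at most exp(2e) (|F|^q + e) on the circle.
  Finally e tends to 0.\<close>

lemma powr_mean_mono:
 assumes F: "F holomorphic_on ball 0 R" and q: "0 < q" and rs: "0 <= r" "r <= s" "s < R"
 shows "integral {0..2*pi} (%t. norm (F (rcis r t)) powr q)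
    <= integral {0..2*pi} (%t. norm (F (rcis s t)) powr q)"
proof (cases "s = 0")
 case True
 thus ?thesis using rs by simp
next
 case False
 with rs have s: "0 < s" by simp
 have cF: "continuous_on (cball 0 s) F"
  using hol_cont[OF F] rs by (auto intro: continuous_on_subset)
 have cu: "continuous_on A (%t. norm (F (rcis \<rho> t)) powr q)" if "0 <= \<rho>" "\<rho> <= s" for \<rho> A
  using that q
  by (intro continuous_on_norm_powr continuous_on_compose2[OF cF] continuous_on_subset[OF continuous_on_rcis])
    (auto simp: norm_mult rcis_def)
 let ?A = "%\<rho>. integral {0..2*pi} (%t. norm (F (rcis \<rho> t)) powr q)"
 have "?A r <= exp (2 * e) * (?A s + 2 * pi * e)" if e: "e > 0" for e
 proof -
  have cs: "continuous_on (sphere 0 s) F" using cF continuous_on_subset sphere_cball by blast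
  \<comment> \<open>The summand \<open>e\<close> keeps the logarithm finite at the zeros of
    \<open>F\<close>.\<close>
  have "continuous_on (sphere 0 s) (%z. ln (norm (F z) powr q + e))"
   by (intro continuous_on_ln continuous_on_add continuous_on_norm_powr cs q continuous_intros)
    (use e in \<open>auto simp: add_nonneg_eq_0_iff\<close>)
  then obtain p where p: "!!z. z : sphere 0 s ==> \<bar>ln (norm (F z) powr q + e) - Re (poly p z)\<bar> < e"
   using Re_poly_approx_on_sphere e by blast
  \<comment> \<open>The shift by \<open>e\<close> turns the two-sided approximation into one from
    above.\<close>
  define P where "P z = poly p z + of_real e" for z
  define H where "H z = exp (P z)" for z
  have HH: "H holomorphic_on UNIV" unfolding H_def P_def by (intro holomorphic_intros)
  have cH: "continuous_on UNIV H" by (rule hol_cont[OF HH])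
  have nH: "norm (H z) = exp (Re (P z))" for z by (simp add: H_def)
  have up: "norm (F z) powr q <= norm (H z)" and lo: "norm (H z) <= exp (2*e) * (norm (F z) powr q + e)"
   if "z : sphere 0 s" for z
  proof -
   have pos: "norm (F z) powr q + e > 0" using e by (simp add: add_nonneg_pos)
   have "ln (norm (F z) powr q + e) <= Re (P z)" using p[OF that] by (simp add: P_def)
   hence "norm (F z) powr q + e <= exp (Re (P z))" using pos by (metis exp_le_cancel_iff exp_ln)
   thus "norm (F z) powr q <= norm (H z)" using e nH by simp
   have "Re (P z) <= 2 * e + ln (norm (F z) powr q + e)" using p[OF that] by (simp add: P_def)
   hence "exp (Re (P z)) <= exp (2*e) * exp (ln (norm (F z) powr q + e))"
    by (simp add: exp_add[symmetric])
   thus "norm (H z) <= exp (2*e) * (norm (F z) powr q + e)" using pos nH by simp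
  qed
  have le: "norm (F z) powr q <= norm (H z)" if z: "z : cball 0 s" for z
  proof -
   have eq: "norm (F z * exp (- (P z / of_real q))) powr q = norm (F z) powr q / norm (H z)" for z
   proof -
    have "norm (exp (- (P z / of_real q))) = exp (- (Re (P z) / q))" by simp
    hence "norm (exp (- (P z / of_real q))) powr q = exp (- Re (P z))"
     using q by (simp only: exp_powr_real) simp
    thus ?thesis
     by (simp add: norm_mult powr_mult nH exp_minus divide_inverse del: norm_exp_eq_Re)
   qed
   have "norm (F z * exp (- (P z / of_real q))) <= 1"
   proof (rule maximum_modulus_frontier[where S="cball 0 s" and f="%z. F z * exp (- (P z / of_real q))"])
    show "(%z. F z * exp (- (P z / of_real q))) holomorphic_on interior (cball 0 s)"
     unfolding P_def using q rs
     by (intro holomorphic_intros holomorphic_on_subset[OF F]) auto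
    show "continuous_on (closure (cball 0 s)) (%z. F z * exp (- (P z / of_real q)))"
     unfolding P_def using q cF by (intro continuous_intros) auto
    fix z assume "z : frontier (cball (0::complex) s)"
    hence z: "z : sphere 0 s" using s by simp
    have "norm (F z * exp (- (P z / of_real q))) powr q <= 1"
     unfolding eq using up[OF z] by (simp add: H_def divide_le_eq)
    thus "norm (F z * exp (- (P z / of_real q))) <= 1"
     using q by (metis powr_le1 powr_less_mono2 powr_one_eq_one linorder_not_le zero_le_one order_less_le_trans order_less_irrefl)
   qed (use z in auto)
   hence "norm (F z * exp (- (P z / of_real q))) powr q <= 1" using q by (simp add: powr_le1)
   thus ?thesis unfolding eq by (simp add: H_def divide_le_eq)
  qed
  have cn: "continuous_on A (%t. norm (H (rcis \<rho> t)))" for \<rho> A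
   by (intro continuous_intros continuous_on_compose2[OF cH] continuous_on_subset[OF continuous_on_rcis]) auto
  have "?A r <= integral {0..2*pi} (%t. norm (H (rcis r t)))"
   using rs by (intro integral_le integrable_continuous_real cu cn le) auto
  also have "... <= integral {0..2*pi} (%t. norm (H (rcis s t)))"
   by (rule norm_integral_mean_mono[OF HH]) (use rs in \<open>auto simp: H_def\<close>)
  also have "... <= integral {0..2*pi} (%t. exp (2*e) * (norm (F (rcis s t)) powr q + e))"
   using s by (intro integral_le integrable_continuous_real cn lo continuous_intros cu) auto
  also have "... = exp (2*e) * (?A s + 2 * pi * e)"
   using s by (simp add: integral_add integrable_continuous_real cu)
  finally show ?thesis .
 qed
 hence "\<forall>\<^sub>F e in at_right 0. ?A r <= exp (2 * e) * (?A s + 2 * pi * e)"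
  by (auto simp: eventually_at_filter)
 moreover have "((%e. exp (2 * e) * (?A s + 2 * pi * e)) \<longlongrightarrow> exp (2 * 0) * (?A s + 2 * pi * 0)) (at_right 0)"
  by (intro tendsto_intros)
 ultimately show ?thesis
  using tendsto_lowerbound[of "%e. exp (2 * e) * (?A s + 2 * pi * e)"] by fastforce
qed

lemma nn_powr_mean_mono:
 assumes F: "F holomorphic_on ball 0 R" and q: "0 < q" and rs: "0 <= r" "r <= s" "s < R"
 shows "(\<integral>\<^sup>+t\<in>{0..2*pi}. ennreal (norm (F (rcis r t)) powr q) \<partial>lborel)
    <= (\<integral>\<^sup>+t\<in>{0..2*pi}. ennreal (norm (F (rcis s t)) powr q) \<partial>lborel)"
proof -
 have cF: "continuous_on (ball 0 R) F"
  by (rule hol_cont[OF F])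
 have cu: "continuous_on A (%t. norm (F (rcis \<rho> t)) powr q)" if "0 <= \<rho>" "\<rho> < R" for \<rho> A
  using that q
  by (intro continuous_on_norm_powr continuous_on_compose2[OF cF] continuous_on_subset[OF continuous_on_rcis])
    (auto simp: norm_mult rcis_def)
 show ?thesis using rs powr_mean_mono[OF F q rs]
  by (simp add: nn_integral_continuous_interval cu ennreal_leI)
qed

text \<open>After rescaling to the unit disk every circle mean is at least the value at the centre,
  which is the mean at radius 0. Integration in polar coordinates gives the area version.\<close>

lemma powr_norm_submean_disk:
 assumes F: "F holomorphic_on S" and S: "ball z0 \<rho> <= S" and \<rho>: "0 < \<rho>" and q: "0 < q"
 shows "ennreal (pi * \<rho>\<^sup>2 * norm (F z0) powr q) <= (\<integral>\<^sup>+z\<in>ball z0 \<rho>. ennreal (norm (F z) powr q) \<partial>lborel)"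
proof -
 define G where "G w = F (z0 + of_real \<rho> * w)" for w
 have im: "z0 + of_real \<rho> * w : ball z0 \<rho>" if "w : \<DD>" for w
  using that \<rho> by (simp add: dist_norm norm_mult)
 have G: "G holomorphic_on ball 0 1"
  unfolding G_def
  by (rule holomorphic_on_compose_gen[of "%w. z0 + of_real \<rho> * w" _ F, unfolded o_def])
    (use im S F in \<open>auto intro!: holomorphic_intros\<close>)
 define \<phi> where "\<phi> w = (if w : \<DD> then ennreal (norm (G w) powr q) else 0)" for w
 have cu: "continuous_on \<DD> (%w. norm (G w) powr q)"
  using q by (intro continuous_on_norm_powr hol_cont[OF G])
 have m\<phi>[measurable]: "\<phi> : borel_measurable borel"
 proof -
  have "(%w. if w : \<DD> then norm (G w) powr q else 0) : borel_measurable borel"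
   by (rule borel_measurable_continuous_on_if[OF _ cu]) (auto intro: continuous_intros)
  hence "(%w. ennreal (if w : \<DD> then norm (G w) powr q else 0)) : borel_measurable borel"
   by measurable
  moreover have "(%w. ennreal (if w : \<DD> then norm (G w) powr q else 0)) = \<phi>"
   by (auto simp: \<phi>_def)
  ultimately show ?thesis by (simp only:)
 qed
 let ?c = "norm (F z0) powr q"
 have c0: "norm (G (rcis 0 t)) powr q = ?c" for t by (simp add: G_def rcis_def)
 have "ennreal (pi * ?c) = (\<integral>\<^sup>+s. ennreal (2 * pi * ?c * s) * indicator {0..1} s \<partial>lborel)"
 proof -
  have "(\<integral>\<^sup>+s. ennreal (2 * pi * ?c * s) * indicator {0..1} s \<partial>lborel) = ennreal (pi * ?c * 1\<^sup>2 - pi * ?c * 0\<^sup>2)"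
   by (intro nn_integral_FTC_Icc) (auto intro!: derivative_eq_intros)
  thus ?thesis by simp
 qed
 also have "... = (\<integral>\<^sup>+s. ennreal (2 * pi * ?c * s) * indicator {0..<1} s \<partial>lborel)"
  using AE_lborel_singleton[of 1] by (intro nn_integral_cong_AE) (auto elim!: eventually_mono simp: indicator_def)
 also have "... <= (\<integral>\<^sup>+s\<in>{0..<1}. ennreal s * (\<integral>\<^sup>+t\<in>{0..2*pi}. \<phi> (rcis s t) \<partial>lborel) \<partial>lborel)"
 proof (intro nn_integral_mono)
  fix s :: real
  show "ennreal (2 * pi * ?c * s) * indicator {0..<1} s
    <= ennreal s * (\<integral>\<^sup>+t\<in>{0..2*pi}. \<phi> (rcis s t) \<partial>lborel) * indicator {0..<1} s"
  proof (cases "0 <= s & s < 1")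
   case True
   have "ennreal (2 * pi * ?c) = (\<integral>\<^sup>+t\<in>{0..2*pi}. ennreal (norm (G (rcis 0 t)) powr q) \<partial>lborel)"
    by (simp only: c0) (simp add: nn_integral_cmult_indicator ennreal_mult' mult_ac)
   also have "... <= (\<integral>\<^sup>+t\<in>{0..2*pi}. ennreal (norm (G (rcis s t)) powr q) \<partial>lborel)"
    using True by (intro nn_powr_mean_mono[OF G q]) auto
   also have "... = (\<integral>\<^sup>+t\<in>{0..2*pi}. \<phi> (rcis s t) \<partial>lborel)"
    using True by (intro nn_integral_cong) (auto simp: \<phi>_def)
   finally have "ennreal s * ennreal (2 * pi * ?c) <= ennreal s * (\<integral>\<^sup>+t\<in>{0..2*pi}. \<phi> (rcis s t) \<partial>lborel)"
    by (rule mult_left_mono) simp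
   thus ?thesis using True by (simp add: ennreal_mult'[symmetric] mult_ac)
  qed auto
 qed
 also have "... = (\<integral>\<^sup>+w\<in>\<DD>. \<phi> w \<partial>lborel)" by (rule nn_integral_disk_polar[symmetric]) measurable
 also have "... = (\<integral>\<^sup>+w. \<phi> w \<partial>lborel)" by (intro nn_integral_cong) (auto simp: \<phi>_def)
 finally have A: "ennreal (pi * ?c) <= (\<integral>\<^sup>+w. \<phi> w \<partial>lborel)" .
 define \<psi> where "\<psi> z = \<phi> ((z - z0) /\<^sub>R \<rho>)" for z
 have m\<psi>[measurable]: "\<psi> : borel_measurable borel" unfolding \<psi>_def by measurable
 have "(\<integral>\<^sup>+z. \<psi> z \<partial>lborel) = (\<integral>\<^sup>+z. \<psi> z \<partial>density (distr lborel borel (%x. z0 + \<rho> *\<^sub>R x)) (%_. \<bar>\<rho>\<bar>^DIM(complex)))"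
  using lborel_affine[of \<rho> z0] \<rho> by simp
 also have "... = (\<integral>\<^sup>+z. ennreal (\<rho>\<^sup>2) * \<psi> (z0 + \<rho> *\<^sub>R z) \<partial>lborel)"
  by (simp add: nn_integral_density nn_integral_distr)
 also have "... = ennreal (\<rho>\<^sup>2) * (\<integral>\<^sup>+w. \<phi> w \<partial>lborel)"
  using \<rho> by (simp add: nn_integral_cmult \<psi>_def)
 finally have B: "(\<integral>\<^sup>+z. \<psi> z \<partial>lborel) = ennreal (\<rho>\<^sup>2) * (\<integral>\<^sup>+w. \<phi> w \<partial>lborel)" .
 have "ennreal (pi * \<rho>\<^sup>2 * ?c) = ennreal (\<rho>\<^sup>2) * ennreal (pi * ?c)"
  by (simp add: ennreal_mult'[symmetric] mult_ac)
 also have "... <= (\<integral>\<^sup>+z. \<psi> z \<partial>lborel)" unfolding B by (intro mult_left_mono A) simp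
 also have "... = (\<integral>\<^sup>+z\<in>ball z0 \<rho>. ennreal (norm (F z) powr q) \<partial>lborel)"
 proof (intro nn_integral_cong)
  fix z
  have "(z - z0) /\<^sub>R \<rho> : \<DD> \<longleftrightarrow> z : ball z0 \<rho>"
  proof -
   have "norm ((z - z0) /\<^sub>R \<rho>) = norm (z - z0) / \<rho>" using \<rho> by (simp add: divide_inverse mult.commute)
   thus ?thesis using \<rho> by (simp only: mem_ball dist_norm) (simp add: norm_minus_commute)
  qed
  moreover have "z0 + of_real \<rho> * ((z - z0) /\<^sub>R \<rho>) = z" using \<rho> by (simp add: scaleR_conv_of_real field_simps)
  ultimately show "\<psi> z = ennreal (norm (F z) powr q) * indicator (ball z0 \<rho>) z"
   by (auto simp: \<psi>_def \<phi>_def G_def indicator_def)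
 qed
 finally show ?thesis .
qed

subsection \<open>Dyadic means\<close>

definition boxes :: "nat => (nat \<times> nat) set" where
 "boxes H = (SIGMA n:{..H}. {..<2^n})"

definition node :: "nat \<times> nat => bool" where
 "node k \<longleftrightarrow> snd k < 2 ^ fst k"

definition anc :: "nat => nat \<times> nat => nat \<times> nat" where
 "anc l k = (l, snd k div 2 ^ (fst k - l))"

definition below :: "nat \<times> nat => nat \<times> nat => bool" where
 "below k K \<longleftrightarrow> fst K <= fst k & anc (fst K) k = K"

text \<open>Adjacency is cyclic because the boxes of one level lie around a circle. It is reflexive,
  so that a box counts among its own neighbours.\<close>

definition adj :: "nat => nat => nat => bool" where
 "adj l a b \<longleftrightarrow> a = b \<or> b = (a + 1) mod 2^l \<or> a = (b + 1) mod 2^l"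

definition near :: "nat => nat \<times> nat => nat \<times> nat => bool" where
 "near l j k \<longleftrightarrow> l <= fst j & l <= fst k & adj l (snd (anc l j)) (snd (anc l k))"

text \<open>2^(-prox) acts as the distance between two boxes: up to a factor 4 it bounds |1 - conj a
  z| from below, where a is the corner of box j and z lies in box k.\<close>

definition prox :: "nat \<times> nat => nat \<times> nat => nat" where
 "prox j k = Max {l. near l j k}"

definition nbrs :: "nat \<times> nat => (nat \<times> nat) set" where
 "nbrs v = {u. fst u = fst v & node u & adj (fst v) (snd u) (snd v)}"

text \<open>The Hardy inequality, the kernel estimate and the sampling lemma all return bounds of
  this shape: a bound at one level acts on deeper levels with geometric loss. Boundedness and
  convergence to 0 survive.\<close>

definition conv :: "real => (nat => real) => nat => real" where
 "conv \<theta> b N = (\<Sum>l\<le>N. \<theta> ^ (N - l) * b l)"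

lemma finite_boxes [simp]: "finite (boxes H)"
 by (simp add: boxes_def)

lemma mem_boxes: "k : boxes H \<longleftrightarrow> node k & fst k <= H"
 by (cases k) (auto simp: boxes_def node_def)

lemma fst_anc [simp]: "fst (anc l k) = l"
 by (simp add: anc_def)

lemma anc_self [simp]: "anc (fst k) k = k"
 by (simp add: anc_def)

lemma anc_anc: "l <= m ==> m <= fst k ==> anc l (anc m k) = anc l k"
 by (simp add: anc_def div_mult2_eq[symmetric] power_add[symmetric])

lemma node_anc: "node k ==> l <= fst k ==> node (anc l k)"
 by (simp add: node_def anc_def less_mult_imp_div_less power_add[symmetric])

lemma below_anc: "l <= fst k ==> below k (anc l k)"
 by (simp add: below_def)

lemma below_refl [simp]: "below k k"
 by (simp add: below_def)

lemma below_anc_eq: "below k K ==> l <= fst K ==> anc l k = anc l K"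
 unfolding below_def using anc_anc by metis

text \<open>The descendants of \<open>K\<close> at level n form an interval of 2^(n - fst K)
  consecutive indices.\<close>

lemma sum_below_level:
 fixes \<phi> :: "nat => real"
 assumes K: "node K"
 shows "(\<Sum>k | k : boxes H & below k K. \<phi> (fst k)) = (\<Sum>n=fst K..H. 2 ^ (n - fst K) * \<phi> n)"
proof -
 have eq: "{k. k : boxes H & below k K}
   = (SIGMA n:{fst K..H}. {snd K * 2^(n - fst K) ..< (snd K + 1) * 2^(n - fst K)})" (is "?L = ?R")
 proof (rule set_eqI)
  fix k :: "nat \<times> nat"
  have d: "(snd k div 2^d = snd K) \<longleftrightarrow> snd K * 2^d <= snd k & snd k < (snd K + 1) * 2^d" for d
  proof -
   have "snd k div 2^d = snd K \<longleftrightarrow> snd K <= snd k div 2^d & snd k div 2^d < snd K + 1" by auto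
   thus ?thesis by (simp add: less_eq_div_iff_mult_less_eq div_less_iff_less_mult)
  qed
  have "snd k < 2 ^ fst k" if "fst K <= fst k" "snd k < (snd K + 1) * 2^(fst k - fst K)"
  proof -
   have "snd K + 1 <= 2 ^ fst K" using K by (simp add: node_def)
   hence "(snd K + 1) * 2^(fst k - fst K) <= 2 ^ fst K * 2^(fst k - fst K)" by (rule mult_right_mono) simp
   also have "... = 2 ^ fst k" using that by (simp add: power_add[symmetric])
   finally show ?thesis using that by simp
  qed
  moreover have "k : ?L \<longleftrightarrow> snd k < 2 ^ fst k & fst k <= H & fst K <= fst k & snd k div 2 ^ (fst k - fst K) = snd K"
   by (auto simp: mem_boxes below_def anc_def node_def prod_eq_iff)
  moreover have "k : ?R \<longleftrightarrow> fst K <= fst k & fst k <= H &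
    snd K * 2^(fst k - fst K) <= snd k & snd k < (snd K + 1) * 2^(fst k - fst K)"
   by (cases k) auto
  ultimately show "k : ?L \<longleftrightarrow> k : ?R" unfolding d by blast
 qed
 have "(\<Sum>k\<in>?L. \<phi> (fst k)) = (\<Sum>n=fst K..H. \<Sum>j\<in>{snd K * 2^(n - fst K) ..< (snd K + 1) * 2^(n - fst K)}. \<phi> n)"
  unfolding eq by (subst sum.Sigma) (auto simp: case_prod_unfold)
 thus ?thesis by (simp add: algebra_simps)
qed

lemma finite_below [simp]: "finite {k. k : boxes H & P k}"
 by (rule finite_subset[OF _ finite_boxes[of H]]) auto

lemma finite_below' [simp]: "finite {k. node k & fst k <= H & P k}"
 using finite_below[of H P] by (simp add: mem_boxes conj_assoc)

lemma adj_sym: "adj l a b ==> adj l b a"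
 by (auto simp: adj_def)

text \<open>Only the wrap-around needs care: halving the last index and 0 gives the last index and 0
  of the coarser level.\<close>

lemma adj_half: assumes "adj (Suc l) a b" "a < 2^Suc l" "b < 2^Suc l" shows "adj l (a div 2) (b div 2)"
proof -
 have *: "adj l (a div 2) (((a + 1) mod 2^Suc l) div 2)" if a: "a < 2^Suc l" for a
 proof (cases "a + 1 = 2^Suc l")
  case True
  hence "(a + 1) mod 2^Suc l = 0" by simp
  moreover have "a div 2 + 1 = 2^l" using True by auto
  ultimately show ?thesis by (simp add: adj_def)
 next
  case False
  hence s: "(a + 1) mod 2^Suc l = a + 1" using a by simp
  have "(a + 1) div 2 = a div 2 \<or> (a + 1) div 2 = a div 2 + 1" by linarith
  moreover have "(a + 1) div 2 < 2^l" using False a by auto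
  ultimately show ?thesis unfolding s adj_def by auto
 qed
 consider "a = b" | "b = (a + 1) mod 2^Suc l" | "a = (b + 1) mod 2^Suc l"
  using assms(1) by (auto simp: adj_def)
 thus ?thesis
 proof cases
  case 1
  thus ?thesis by (simp add: adj_def)
 next
  case 2
  thus ?thesis using *[OF assms(2)] by simp
 next
  case 3
  thus ?thesis using *[OF assms(3)] by (simp add: adj_sym)
 qed
qed

text \<open>Touching ancestors have touching parents, so the levels at which two nodes are near form
  an initial segment.\<close>

lemma near_mono:
 assumes "near l j k" "node j" "node k" "i <= l" shows "near i j k"
 using \<open>i <= l\<close> \<open>near l j k\<close>
proof (induction i rule: inc_induct)
 case (step i)
 hence n: "near (Suc i) j k" by simp
 hence le: "Suc i <= fst j" "Suc i <= fst k" by (auto simp: near_def)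
 have a: "anc i j = (i, snd (anc (Suc i) j) div 2)" "anc i k = (i, snd (anc (Suc i) k) div 2)"
  using le anc_anc[of i "Suc i" j] anc_anc[of i "Suc i" k] by (simp_all add: anc_def)
 have "snd (anc (Suc i) j) < 2^Suc i" "snd (anc (Suc i) k) < 2^Suc i"
  using node_anc[OF \<open>node j\<close> le(1)] node_anc[OF \<open>node k\<close> le(2)] by (simp_all add: node_def)
 thus ?case using n le a adj_half[of i] by (simp add: near_def)
qed

lemma near_0: "node j ==> node k ==> near 0 j k"
 by (simp add: near_def adj_def anc_def node_def)

lemma finite_near: "finite {l. near l j k}"
 by (rule finite_subset[of _ "{..fst j}"]) (auto simp: near_def)

lemma prox_near: "node j ==> node k ==> near (prox j k) j k"
 unfolding prox_def using Max_in[OF finite_near] near_0 by blast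

lemma prox_ge: "near l j k ==> l <= prox j k"
 unfolding prox_def using Max_ge[OF finite_near] by blast

text \<open>In natural numbers modulo 2^n the predecessor is reached by adding 2^n - 1.\<close>

lemma nbrs_subset:
 "nbrs v <= {v, (fst v, (snd v + 1) mod 2^fst v), (fst v, (snd v + (2^fst v - 1)) mod 2^fst v)}"
proof
 fix u assume u: "u : nbrs v"
 have "snd u = (snd v + (2^fst v - 1)) mod 2^fst v" if "snd v = (snd u + 1) mod 2^fst v"
 proof -
  have lt: "snd u < 2^fst v" using u by (auto simp: nbrs_def node_def)
  have "(snd v + (2^fst v - 1)) mod 2^fst v = (snd u + 1 + (2^fst v - 1)) mod 2^fst v"
   unfolding that by (rule mod_add_left_eq)
  also have "snd u + 1 + (2^fst v - 1) = snd u + 2^fst v" by simp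
  finally show ?thesis using lt by simp
 qed
 thus "u : {v, (fst v, (snd v + 1) mod 2^fst v), (fst v, (snd v + (2^fst v - 1)) mod 2^fst v)}"
  using u by (cases u; cases v) (auto simp: nbrs_def adj_def)
qed

lemma finite_nbrs [simp]: "finite (nbrs v)"
 by (rule finite_subset[OF nbrs_subset]) simp

lemma card_nbrs: "card (nbrs v) <= 3"
 by (rule order_trans[OF card_mono[OF _ nbrs_subset]]) (simp_all add: card_insert_if)

lemma sum_near_le:
 fixes f :: "nat \<times> nat => real"
 assumes I: "finite I" "!!j. j : I ==> node j" and f: "!!j. j : I ==> 0 <= f j"
 shows "(\<Sum>j | j : I & fst v <= fst j & adj (fst v) (snd (anc (fst v) j)) (snd v). f j)
   <= (\<Sum>u\<in>nbrs v. \<Sum>j | j : I & below j u. f j)"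
proof -
 let ?P = "%j. fst v <= fst j & adj (fst v) (snd (anc (fst v) j)) (snd v)"
 have "(\<Sum>j | j : I & ?P j. f j) = (\<Sum>j\<in>I. if ?P j then f j else 0)"
  using I(1) by (simp add: sum.inter_filter)
 also have "... <= (\<Sum>j\<in>I. \<Sum>u | u : nbrs v & below j u. f j)"
 proof (rule sum_mono)
  fix j assume j: "j : I"
  show "(if ?P j then f j else 0) <= (\<Sum>u | u : nbrs v & below j u. f j)"
  proof (cases "?P j")
   case True
   hence "anc (fst v) j : {u. u : nbrs v & below j u}"
    using I(2)[OF j] by (auto simp: nbrs_def below_anc node_anc)
   hence "f j <= (\<Sum>u | u : nbrs v & below j u. f j)"
    by (intro member_le_sum[of "anc (fst v) j" _ "%_. f j"]) (auto intro: f[OF j])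
   thus ?thesis using True by simp
  qed (use f[OF j] in auto)
 qed
 also have "... = (\<Sum>u\<in>nbrs v. \<Sum>j | j : I & below j u. f j)"
  by (rule sum.swap_restrict) (simp_all add: I)
 finally show ?thesis .
qed

section \<open>Weighted power sums and geometric convolution\<close>

text \<open>With m the largest quotient a/eta, the sum is at most m times the sum of eta, and m^q is
  one of the terms on the right. One bound thus stands in for Hoelder's inequality when q >= 1 and
  for subadditivity when q < 1.\<close>

lemma powr_sum_le:
 fixes a \<eta> :: "'a => real"
 assumes A: "finite A" and a: "!!i. i : A ==> 0 <= a i" and \<eta>: "!!i. i : A ==> 0 < \<eta> i" and q: "0 < q"
 shows "(\<Sum>i\<in>A. a i) powr q <= (\<Sum>i\<in>A. \<eta> i) powr q * (\<Sum>i\<in>A. (a i / \<eta> i) powr q)"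
proof (cases "A = {}")
 case False
 define m where "m = Max ((%i. a i / \<eta> i) ` A)"
 have "m : (%i. a i / \<eta> i) ` A" unfolding m_def using A False by (intro Max_in) auto
 then obtain j where j: "j : A" "m = a j / \<eta> j" by auto
 have m0: "0 <= m" using j a \<eta> by (simp add: less_imp_le)
 have "a i <= m * \<eta> i" if "i : A" for i
 proof -
  have "a i / \<eta> i <= m" unfolding m_def using A that by (intro Max_ge) auto
  thus ?thesis using \<eta>[OF that] by (simp add: divide_le_eq)
 qed
 hence "(\<Sum>i\<in>A. a i) <= (\<Sum>i\<in>A. \<eta> i) * m"
  by (subst mult.commute) (auto simp: sum_distrib_left intro!: sum_mono)
 hence "(\<Sum>i\<in>A. a i) powr q <= ((\<Sum>i\<in>A. \<eta> i) * m) powr q"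
  using q a by (intro powr_mono2) (auto intro: sum_nonneg)
 also have "... = (\<Sum>i\<in>A. \<eta> i) powr q * m powr q"
  by (rule powr_mult)
 also have "m powr q <= (\<Sum>i\<in>A. (a i / \<eta> i) powr q)"
  unfolding j(2) by (rule member_le_sum[of j]) (use j A in auto)
 finally show ?thesis by (simp add: mult_left_mono)
qed simp

lemma sum_geometric_le:
 fixes r :: real
 assumes "0 <= r" "r < 1" "finite A" "inj_on e A"
 shows "(\<Sum>i\<in>A. r ^ e i) <= 1 / (1 - r)"
proof -
 have "(\<Sum>i\<in>A. r ^ e i) = (\<Sum>i\<in>e ` A. r ^ i)" using assms by (simp add: sum.reindex)
 also have "... <= (\<Sum>i. r ^ i)"
  using assms by (intro sum_le_suminf summable_geometric) auto
 also have "... = 1 / (1 - r)" using assms by (intro suminf_geometric) auto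
 finally show ?thesis .
qed

lemma conv_nonneg: "0 <= \<theta> ==> (!!n. 0 <= b n) ==> 0 <= conv \<theta> b N"
 unfolding conv_def by (intro sum_nonneg) auto

lemma conv_bound:
 assumes "0 <= \<theta>" "\<theta> < 1" "!!n. b n <= B" "0 <= B"
 shows "conv \<theta> b N <= B / (1 - \<theta>)"
proof -
 have "conv \<theta> b N <= (\<Sum>l\<le>N. \<theta> ^ (N - l) * B)"
  unfolding conv_def using assms by (intro sum_mono mult_left_mono) auto
 also have "... = (\<Sum>l\<le>N. \<theta> ^ (N - l)) * B" by (simp add: sum_distrib_right)
 also have "... <= 1 / (1 - \<theta>) * B"
  using assms by (intro mult_right_mono sum_geometric_le) (auto simp: inj_on_def)
 finally show ?thesis by simp
qed

text \<open>Terms from levels below \<open>M\<close> carry the factor theta^(N - M); the remaining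
  ones carry a small value of \<open>b\<close>.\<close>

lemma conv_tendsto_0:
 assumes \<theta>: "0 <= \<theta>" "\<theta> < 1" and b: "!!n. 0 <= b n" "b \<longlonglongrightarrow> 0"
 shows "conv \<theta> b \<longlonglongrightarrow> 0"
proof -
 have "convergent b" using b(2) by (auto simp: convergent_def)
 then obtain B where "0 < B" "\<forall>n. norm (b n) <= B"
  using convergent_imp_Bseq BseqE by blast
 hence B: "!!n. b n <= B" "0 <= B" by (auto simp: abs_le_iff)
 show ?thesis
 proof (rule LIMSEQ_I)
  fix e :: real assume e: "0 < e"
  have "0 < e * (1 - \<theta>) / 2" using e \<theta> by simp
  then obtain M where M: "!!n. n \<ge> M ==> norm (b n - 0) < e * (1 - \<theta>) / 2"
   using LIMSEQ_D[OF b(2)] by blast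
  have "(%N. \<theta> ^ (N - M) * (B * M)) \<longlonglongrightarrow> 0 * (B * M)"
  proof (intro tendsto_mult tendsto_const)
   show "(%N. \<theta> ^ (N - M)) \<longlonglongrightarrow> 0"
    by (rule LIMSEQ_offset[of _ M]) (use \<theta> in \<open>auto intro: LIMSEQ_power_zero\<close>)
  qed
  then obtain M2 where M2: "!!N. N \<ge> M2 ==> norm (\<theta> ^ (N - M) * (B * M) - 0) < e / 2"
   using LIMSEQ_D[of "%N. \<theta> ^ (N - M) * (B * M)" 0 "e / 2"] e by auto
  have "norm (conv \<theta> b N - 0) < e" if N: "N \<ge> max M M2" for N
  proof -
   have "conv \<theta> b N = (\<Sum>l\<in>{..<M}. \<theta> ^ (N - l) * b l) + (\<Sum>l\<in>{M..N}. \<theta> ^ (N - l) * b l)"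
    unfolding conv_def using N by (subst sum.union_disjoint[symmetric]) (auto intro!: sum.cong)
   also have "(\<Sum>l\<in>{..<M}. \<theta> ^ (N - l) * b l) <= (\<Sum>l\<in>{..<M}. \<theta> ^ (N - M) * B)"
    using \<theta> b B N by (intro sum_mono mult_mono power_decreasing) auto
   also have "... = \<theta> ^ (N - M) * (B * M)" by simp
   also have "... < e / 2" using M2[of N] N by (simp add: abs_less_iff)
   also have "(\<Sum>l\<in>{M..N}. \<theta> ^ (N - l) * b l) <= (\<Sum>l\<in>{M..N}. \<theta> ^ (N - l) * (e * (1 - \<theta>) / 2))"
   proof (intro sum_mono mult_left_mono)
    fix l assume "l : {M..N}"
    hence "norm (b l - 0) < e * (1 - \<theta>) / 2" by (intro M) auto
    thus "b l <= e * (1 - \<theta>) / 2" by (simp add: abs_less_iff)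
   qed (use \<theta> in auto)
   also have "... = (\<Sum>l\<in>{M..N}. \<theta> ^ (N - l)) * (e * (1 - \<theta>) / 2)" by (simp add: sum_distrib_right)
   also have "... <= 1 / (1 - \<theta>) * (e * (1 - \<theta>) / 2)"
    using \<theta> e by (intro mult_right_mono sum_geometric_le) (auto simp: inj_on_def)
   also have "... = e / 2" using \<theta> by simp
   finally have "conv \<theta> b N < e" by simp
   thus ?thesis using conv_nonneg[of \<theta> b N] \<theta> b by simp
  qed
  thus "\<exists>no. \<forall>N\<ge>no. norm (conv \<theta> b N - 0) < e" by blast
 qed
qed

section \<open>Carleson sequences and the Hardy inequality\<close>

text \<open>\<open>W_dbl\<close> is the doubling condition of \<open>D_hat\<close>;
  \<open>W_decay\<close> is what the reverse condition of \<open>D_check\<close> gives at dyadic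
  radii.\<close>

locale dyadic_weight =
 fixes W :: "nat => real" and \<rho> cr cd :: real
 assumes W_pos: "!!n. 0 < W n"
  and W_dbl: "!!n. W n <= cd * W (Suc n)"
  and W_decay: "!!n i. W (n + i) <= cr * \<rho> ^ i * W n"
  and \<rho>: "0 < \<rho>" "\<rho> < 1"
begin

definition w :: "nat \<times> nat => real" where
 "w k = W (fst k) / 2 ^ fst k"

text \<open>The discrete mean over a Carleson square, with 2^(-fst K) in place of 1 - |a|. The
  cutoff at level \<open>H\<close> keeps every sum finite.\<close>

definition cmean :: "(nat \<times> nat => real) => nat => nat \<times> nat => real" where
 "cmean x H K = 2 ^ fst K * (\<Sum>k | k : boxes H & below k K. x k * w k)"

text \<open>The bound depends on the level alone and is uniform in the cutoff. Constant bounds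
  express a Carleson condition, null sequences a vanishing one.\<close>

definition carl :: "(nat \<times> nat => real) => (nat => real) => bool" where
 "carl x b \<longleftrightarrow> (\<forall>H K. node K --> cmean x H K <= b (fst K))"

lemma w_pos: "0 < w k" by (simp add: w_def W_pos)

lemma cr_ge_1: "1 <= cr"
 using W_decay[of 0 0] W_pos[of 0] by simp

lemma cd_pos: "0 < cd"
proof (rule ccontr)
 assume "~ 0 < cd"
 hence "cd * W (Suc 0) <= 0" using W_pos[of "Suc 0"] by (simp add: mult_le_0_iff)
 thus False using W_dbl[of 0] W_pos[of 0] by simp
qed

lemma W_dbl_iter: "W n <= cd ^ i * W (n + i)"
proof (induction i)
 case (Suc i)
 have "cd ^ i * W (n + i) <= cd ^ i * (cd * W (Suc (n + i)))"
  using cd_pos by (intro mult_left_mono W_dbl) auto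
 thus ?case using Suc by (simp add: mult_ac)
qed simp

lemma carlD: "carl x b ==> node K ==> cmean x H K <= b (fst K)"
 unfolding carl_def by blast

lemma cmean_mono:
 assumes "!!k. node k ==> below k K ==> x k <= y k"
 shows "cmean x H K <= cmean y H K"
 unfolding cmean_def using assms less_imp_le[OF w_pos]
 by (intro mult_left_mono sum_mono mult_right_mono) (auto simp: mem_boxes)

lemma carl_mono:
 assumes "carl y b" "!!k. node k ==> x k <= y k" "!!n. b n <= c n"
 shows "carl x c"
 using assms cmean_mono[of _ x y] unfolding carl_def by (meson order_trans)

lemma cmean_add: "cmean (%k. x k + y k) H K = cmean x H K + cmean y H K"
 by (simp add: cmean_def sum.distrib algebra_simps)

lemma cmean_cmult: "cmean (%k. c * x k) H K = c * cmean x H K"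
 by (simp add: cmean_def sum_distrib_left algebra_simps)

lemma carl_add: "carl x b ==> carl y c ==> carl (%k. x k + y k) (%n. b n + c n)"
 by (simp add: carl_def cmean_add add_mono)

lemma carl_cmult: "carl x b ==> 0 <= c ==> carl (%k. c * x k) (%n. c * b n)"
 by (simp add: carl_def cmean_cmult mult_left_mono)

lemma cmean_nonneg: "(!!k. node k ==> 0 <= x k) ==> 0 <= cmean x H K"
 unfolding cmean_def using less_imp_le[OF w_pos]
 by (intro mult_nonneg_nonneg sum_nonneg) (auto simp: mem_boxes)

text \<open>With cutoff at the level of k the mean over k consists of the single term k. This is the
  growth estimate of the tent space.\<close>

lemma carl_pointwise:
 assumes "carl x b" "!!k. node k ==> 0 <= x k" "node k"
 shows "x k * W (fst k) <= b (fst k)"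
proof -
 have "x k * w k <= (\<Sum>i | i : boxes (fst k) & below i k. x i * w i)"
  using assms less_imp_le[OF w_pos]
  by (intro member_le_sum finite_below) (auto simp: mem_boxes intro!: mult_nonneg_nonneg)
 hence "2 ^ fst k * (x k * w k) <= cmean x (fst k) k" by (simp add: cmean_def)
 also have "... <= b (fst k)" by (rule carlD[OF assms(1,3)])
 finally show ?thesis by (simp add: w_def)
qed

lemma sum_below_le_carl:
 assumes "carl x b" "node K"
 shows "(\<Sum>k | k : boxes H & below k K. x k * w k) <= b (fst K) / 2 ^ fst K"
 using carlD[OF assms, of H] by (simp add: cmean_def pos_le_divide_eq mult.commute)

text \<open>The 2^i descendants i levels down have total weight at most cr rho^i \<open>w K\<close>;
  this decay leaves room for an extra factor c^i as long as c rho < 1.\<close>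

lemma w_sum:
 assumes c: "0 < c" "c * \<rho> < 1" and K: "node K"
 shows "(\<Sum>k | k : boxes H & below k K. w k * c ^ (fst k - fst K)) <= cr / (1 - c * \<rho>) * w K"
proof -
 have "(\<Sum>k | k : boxes H & below k K. w k * c ^ (fst k - fst K))
   = (\<Sum>n=fst K..H. 2 ^ (n - fst K) * (W n / 2 ^ n * c ^ (n - fst K)))"
  unfolding w_def by (rule sum_below_level[OF K])
 also have "... <= (\<Sum>n=fst K..H. cr * w K * (c * \<rho>) ^ (n - fst K))"
 proof (rule sum_mono)
  fix n assume "n : {fst K..H}"
  hence n: "n = fst K + (n - fst K)" by simp
  define i where "i = n - fst K"
  have "2 ^ i * (W (fst K + i) / 2 ^ (fst K + i) * c ^ i) = W (fst K + i) / 2 ^ fst K * c ^ i"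
   by (simp add: power_add field_simps)
  also have "... <= (cr * \<rho> ^ i * W (fst K)) / 2 ^ fst K * c ^ i"
   using c by (intro mult_right_mono divide_right_mono W_decay) auto
  also have "... = cr * w K * (c * \<rho>) ^ i" by (simp add: w_def power_mult_distrib)
  finally show "2 ^ (n - fst K) * (W n / 2 ^ n * c ^ (n - fst K)) <= cr * w K * (c * \<rho>) ^ (n - fst K)"
   using n by (simp add: i_def)
 qed
 also have "... = cr * w K * (\<Sum>n=fst K..H. (c * \<rho>) ^ (n - fst K))" by (simp add: sum_distrib_left)
 also have "... <= cr * w K * (1 / (1 - c * \<rho>))"
  using c \<rho> cr_ge_1 less_imp_le[OF w_pos]
  by (intro mult_left_mono sum_geometric_le) (auto simp: inj_on_def)
 finally show ?thesis by simp
qed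

text \<open>\<open>powr_sum_le\<close> with geometric weights in the distance to the ancestor
  reduces the claim to a double sum over nodes and ancestors. Ancestors inside the tent of K are
  handled by \<open>w_sum\<close>, those above K by the pointwise bound, and the latter produce the
  convolution.\<close>

lemma hardy:
 assumes q: "0 < q"
 obtains C \<theta> where "0 < C" "0 < \<theta>" "\<theta> < 1"
  "!!x d b. [|!!k. node k ==> 0 <= d k; !!k. node k ==> 0 <= x k; !!n. 0 <= b n;
   !!k. node k ==> x k <= (\<Sum>l\<le>fst k. d (anc l k)); carl (%k. d k powr q) b|]
   ==> carl (%k. x k powr q) (%N. C * conv \<theta> b N)"
proof -
 \<comment> \<open>The decay rate is split into two equal factors: one pays for the weights c^i with
   c = 1/\<tau>, the other is left for the geometric series.\<close>
 define \<tau> where "\<tau> = sqrt \<rho>"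
 have \<tau>: "0 < \<tau>" "\<tau> < 1" "\<tau> * \<tau> = \<rho>" using \<rho> by (auto simp: \<tau>_def)
 define \<sigma> where "\<sigma> = \<tau> powr (1 / q)"
 have \<sigma>: "0 < \<sigma>" "\<sigma> < 1" using \<tau> q powr_less_mono2[of "1 / q" \<tau> 1] by (auto simp: \<sigma>_def)
 have \<sigma>q: "\<sigma> powr q = \<tau>" using \<tau> q by (simp add: \<sigma>_def powr_powr)
 define c where "c = 1 / \<tau>"
 have c: "0 < c" "c * \<rho> < 1" "c * \<rho> = \<tau>" using \<tau> by (auto simp: c_def field_simps)
 define C1 where "C1 = (1 / (1 - \<sigma>)) powr q"
 define C2 where "C2 = cr / (1 - c * \<rho>)"
 have C1: "0 < C1" using \<sigma> by (simp add: C1_def)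
 have C2: "0 < C2" using c cr_ge_1 by (simp add: C2_def)
 show thesis
 proof (rule that[of "C1 * C2 * cr" \<tau>])
  show "0 < C1 * C2 * cr" using C1 C2 cr_ge_1 by simp
 next
  fix x d :: "nat \<times> nat => real" and b :: "nat => real"
  assume d: "!!k. node k ==> 0 <= d k" and x: "!!k. node k ==> 0 <= x k" and b: "!!n. 0 <= b n"
   and xd: "!!k. node k ==> x k <= (\<Sum>l\<le>fst k. d (anc l k))"
   and cd: "carl (%k. d k powr q) b"
  let ?D = "%k. d k powr q"
  have pw: "x k powr q <= C1 * (\<Sum>l\<le>fst k. ?D (anc l k) * c ^ (fst k - l))" if k: "node k" for k
  proof -
   let ?\<eta> = "%l. \<sigma> ^ (fst k - l)"
   have dn: "0 <= d (anc l k)" if "l <= fst k" for l using d node_anc[OF k that] by simp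
   have "x k powr q <= (\<Sum>l\<le>fst k. d (anc l k)) powr q"
    using q by (intro powr_mono2 xd x k) auto
   also have "... <= (\<Sum>l\<le>fst k. ?\<eta> l) powr q * (\<Sum>l\<le>fst k. (d (anc l k) / ?\<eta> l) powr q)"
    using \<sigma> q dn by (intro powr_sum_le) auto
   also have "... <= C1 * (\<Sum>l\<le>fst k. (d (anc l k) / ?\<eta> l) powr q)"
    unfolding C1_def using \<sigma> q
    by (intro mult_right_mono powr_mono2 sum_geometric_le) (auto simp: inj_on_def intro!: sum_nonneg)
   also have "(\<Sum>l\<le>fst k. (d (anc l k) / ?\<eta> l) powr q) = (\<Sum>l\<le>fst k. ?D (anc l k) * c ^ (fst k - l))"
   proof (rule sum.cong)
    fix l assume "l : {..fst k}"
    hence "(d (anc l k) / ?\<eta> l) powr q = ?D (anc l k) / (\<sigma> ^ (fst k - l)) powr q"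
     by (intro powr_divide)
    also have "(\<sigma> ^ (fst k - l)) powr q = \<tau> ^ (fst k - l)"
     using \<sigma> by (simp add: powr_power[symmetric] powr_realpow[symmetric] powr_powr mult.commute \<sigma>q[symmetric])
    finally show "(d (anc l k) / ?\<eta> l) powr q = ?D (anc l k) * c ^ (fst k - l)"
     by (simp add: c_def power_divide)
   qed simp
   finally show ?thesis .
  qed
  show "carl (%k. x k powr q) (%N. C1 * C2 * cr * conv \<tau> b N)"
   unfolding carl_def
  proof (intro allI impI)
   fix H K assume K: "node K"
   let ?N = "fst K"
   let ?S = "{k. k : boxes H & below k K}"
   let ?f = "%k l. w k * (?D (anc l k) * c ^ (fst k - l))"
   \<comment> \<open>Ancestors within the tent of \<open>K\<close>: exchanging the sums puts each
     box v in front of the weighted mass of its own descendants.\<close>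
   have A: "(\<Sum>k\<in>?S. \<Sum>l\<in>{?N..fst k}. ?f k l) <= C2 * (b ?N / 2 ^ ?N)"
   proof -
    have "(\<Sum>k\<in>?S. \<Sum>l\<in>{?N..fst k}. ?f k l)
     = (\<Sum>k\<in>?S. \<Sum>v | v : ?S & below k v. w k * (?D v * c ^ (fst k - fst v)))"
    proof (rule sum.cong[OF refl])
     fix k assume "k : ?S"
     hence k: "node k" "fst k <= H" "below k K" "?N <= fst k"
      by (auto simp: mem_boxes below_def)
     show "(\<Sum>l\<in>{?N..fst k}. ?f k l) = (\<Sum>v | v : ?S & below k v. w k * (?D v * c ^ (fst k - fst v)))"
     proof (rule sum.reindex_bij_witness[where i=fst and j="%l. anc l k"])
      fix l assume l: "l : {?N..fst k}"
      have "anc ?N (anc l k) = K" using l k anc_anc[of ?N l k] by (simp add: below_def)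
      thus "anc l k : {v. v : ?S & below k v}"
       using l k by (auto simp: mem_boxes node_anc below_anc) (simp add: below_def)
     qed (use k in \<open>auto simp: below_def mem_boxes\<close>)
    qed
    also have "... = (\<Sum>v\<in>?S. \<Sum>k | k : ?S & below k v. w k * (?D v * c ^ (fst k - fst v)))"
     by (rule sum.swap_restrict) auto
    also have "... <= (\<Sum>v\<in>?S. C2 * (?D v * w v))"
    proof (rule sum_mono)
     fix v assume v: "v : ?S"
     have "(\<Sum>k | k : ?S & below k v. w k * (?D v * c ^ (fst k - fst v)))
       <= (\<Sum>k | k : boxes H & below k v. w k * (?D v * c ^ (fst k - fst v)))"
      using less_imp_le[OF w_pos] c by (intro sum_mono2) (auto intro!: mult_nonneg_nonneg)
     also have "... = ?D v * (\<Sum>k | k : boxes H & below k v. w k * c ^ (fst k - fst v))"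
      by (simp add: sum_distrib_left mult_ac)
     also have "... <= ?D v * (C2 * w v)"
      unfolding C2_def using v c by (intro mult_left_mono w_sum) (auto simp: mem_boxes)
     finally show "(\<Sum>k | k : ?S & below k v. w k * (?D v * c ^ (fst k - fst v))) <= C2 * (?D v * w v)"
      by (simp add: mult_ac)
    qed
    also have "... = C2 * (\<Sum>v\<in>?S. ?D v * w v)" by (simp add: sum_distrib_left)
    also have "... <= C2 * (b ?N / 2 ^ ?N)"
     using C2 by (intro mult_left_mono sum_below_le_carl[OF cd K]) auto
    finally show ?thesis .
   qed
   \<comment> \<open>Ancestors above \<open>K\<close> are common to all k below \<open>K\<close>, so
     only the total weight below \<open>K\<close> and the decay of W from level l to level fst K
     enter.\<close>
   have B: "(\<Sum>k\<in>?S. \<Sum>l<?N. ?f k l) <= (\<Sum>l<?N. C2 * cr * \<tau> ^ (?N - l) * b l) / 2 ^ ?N"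
   proof -
    have "(\<Sum>k\<in>?S. \<Sum>l<?N. ?f k l) = (\<Sum>l<?N. \<Sum>k\<in>?S. ?f k l)" by (rule sum.swap)
    also have "... <= (\<Sum>l<?N. C2 * cr * \<tau> ^ (?N - l) * b l / 2 ^ ?N)"
    proof (rule sum_mono)
     fix l assume "l : {..<?N}"
     hence l: "l < ?N" by simp
     let ?v = "anc l K"
     have nv: "node ?v" using node_anc[OF K] l by simp
     have "(\<Sum>k\<in>?S. ?f k l) = (\<Sum>k\<in>?S. ?D ?v * c ^ (?N - l) * (w k * c ^ (fst k - ?N)))"
     proof (rule sum.cong[OF refl])
      fix k assume k: "k : ?S"
      hence "fst k - l = (?N - l) + (fst k - ?N)" using l by (auto simp: below_def)
      moreover have "anc l k = ?v" using k l below_anc_eq by auto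
      ultimately show "?f k l = ?D ?v * c ^ (?N - l) * (w k * c ^ (fst k - ?N))"
       by (simp add: power_add)
     qed
     also have "... = ?D ?v * c ^ (?N - l) * (\<Sum>k\<in>?S. w k * c ^ (fst k - ?N))"
      by (simp add: sum_distrib_left)
     also have "... <= ?D ?v * c ^ (?N - l) * (C2 * w K)"
      unfolding C2_def using c by (intro mult_left_mono w_sum[OF _ _ K]) auto
     also have "... = c ^ (?N - l) * C2 * ?D ?v * (W ?N / 2 ^ ?N)"
      by (simp add: w_def mult_ac)
     also have "... <= c ^ (?N - l) * C2 * ?D ?v * (cr * \<rho> ^ (?N - l) * W l / 2 ^ ?N)"
     proof -
      have "W ?N <= cr * \<rho> ^ (?N - l) * W l" using W_decay[of l "?N - l"] l by simp
      thus ?thesis using c C2 by (intro mult_left_mono divide_right_mono) auto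
     qed
     also have "... = C2 * cr * (c * \<rho>) ^ (?N - l) * (?D ?v * W l) / 2 ^ ?N"
      by (simp add: power_mult_distrib)
     also have "... <= C2 * cr * (c * \<rho>) ^ (?N - l) * b l / 2 ^ ?N"
      using carl_pointwise[OF cd _ nv] c \<rho> C2 cr_ge_1
      by (intro mult_left_mono divide_right_mono) auto
     finally show "(\<Sum>k\<in>?S. ?f k l) <= C2 * cr * \<tau> ^ (?N - l) * b l / 2 ^ ?N"
      using c by simp
    qed
    finally show ?thesis by (simp add: sum_divide_distrib)
   qed
   have "(\<Sum>k\<in>?S. x k powr q * w k) <= (\<Sum>k\<in>?S. C1 * ((\<Sum>l<?N. ?f k l) + (\<Sum>l\<in>{?N..fst k}. ?f k l)))"
   proof (rule sum_mono)
    fix k assume k: "k : ?S"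
    hence kn: "node k" "?N <= fst k" by (auto simp: mem_boxes below_def)
    have "x k powr q * w k <= C1 * (\<Sum>l\<le>fst k. ?D (anc l k) * c ^ (fst k - l)) * w k"
     using less_imp_le[OF w_pos] by (intro mult_right_mono pw kn)
    also have "... = C1 * (\<Sum>l\<le>fst k. ?f k l)" by (simp add: sum_distrib_left sum_distrib_right mult_ac)
    also have "(\<Sum>l\<le>fst k. ?f k l) = (\<Sum>l<?N. ?f k l) + (\<Sum>l\<in>{?N..fst k}. ?f k l)"
     using kn by (subst sum.union_disjoint[symmetric]) (auto intro!: sum.cong)
    finally show "x k powr q * w k <= C1 * ((\<Sum>l<?N. ?f k l) + (\<Sum>l\<in>{?N..fst k}. ?f k l))" .
   qed
   also have "... = C1 * ((\<Sum>k\<in>?S. \<Sum>l<?N. ?f k l) + (\<Sum>k\<in>?S. \<Sum>l\<in>{?N..fst k}. ?f k l))"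
    by (simp only: sum_distrib_left[symmetric] sum.distrib)
   also have "... <= C1 * ((\<Sum>l<?N. C2 * cr * \<tau> ^ (?N - l) * b l) / 2 ^ ?N + C2 * (b ?N / 2 ^ ?N))"
    using C1 A B by (intro mult_left_mono add_mono) auto
   finally have "cmean (%k. x k powr q) H K
     <= 2 ^ ?N * (C1 * ((\<Sum>l<?N. C2 * cr * \<tau> ^ (?N - l) * b l) / 2 ^ ?N + C2 * (b ?N / 2 ^ ?N)))"
    by (simp add: cmean_def)
   also have "... = C1 * ((\<Sum>l<?N. C2 * cr * \<tau> ^ (?N - l) * b l) + C2 * b ?N)"
    by (simp add: field_simps)
   also have "... <= C1 * ((\<Sum>l<?N. C2 * cr * \<tau> ^ (?N - l) * b l) + C2 * cr * b ?N)"
    using C1 C2 cr_ge_1 b[of ?N] by (intro mult_left_mono add_left_mono mult_right_mono) auto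
   also have "... = C1 * C2 * cr * conv \<tau> b ?N"
    by (simp add: conv_def lessThan_Suc_atMost[symmetric] sum_distrib_left algebra_simps)
   finally show "cmean (%k. x k powr q) H K <= C1 * C2 * cr * conv \<tau> b ?N" .
  qed
 qed (use \<tau> in auto)
qed

end

section \<open>Kernel sums on the tree\<close>

lemma power_powr_commute: "0 < x ==> (x ^ n) powr p = (x powr p) ^ n" for x p :: real
 by (simp add: powr_realpow[symmetric] powr_powr mult.commute)

text \<open>The level prox j k is replaced by the sum over all levels l where j and k are near. For
  each l there are at most three neighbours of the ancestor of k, with 2^i descendants i levels down
  against 4^(-i); this gives 3 times 2, and the sum over l gives the rest.\<close>

lemma sum_eta_le:
 assumes \<theta>: "0 < \<theta>" "\<theta> < 1" and I: "finite I" "!!j. j : I ==> node j" and k: "node k"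
 shows "(\<Sum>j\<in>I. (1/4) ^ (fst j - prox j k) * \<theta> ^ (fst k - prox j k)) <= 6 / (1 - \<theta> :: real)"
proof -
 let ?f = "%j l. (1/4) ^ (fst j - l) * \<theta> ^ (fst k - l)"
 obtain H where H: "!!j. j : I ==> fst j <= H"
  using finite_nat_set_iff_bounded_le[of "fst ` I"] I(1) by auto
 have "(\<Sum>j\<in>I. ?f j (prox j k)) <= (\<Sum>j\<in>I. \<Sum>l | l : {..fst k} & near l j k. ?f j l)"
 proof (rule sum_mono)
  fix j assume j: "j : I"
  have "prox j k : {l. l : {..fst k} & near l j k}"
   using prox_near[OF I(2)[OF j] k] by (auto simp: near_def)
  thus "?f j (prox j k) <= (\<Sum>l | l : {..fst k} & near l j k. ?f j l)"
   using \<theta> by (intro member_le_sum[where f="?f j"]) auto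
 qed
 also have "... = (\<Sum>l\<in>{..fst k}. \<Sum>j | j : I & near l j k. ?f j l)"
  by (rule sum.swap_restrict) (auto simp: I)
 also have "... <= (\<Sum>l\<in>{..fst k}. \<theta> ^ (fst k - l) * 6)"
 proof (rule sum_mono)
  fix l assume "l : {..fst k}"
  hence l: "l <= fst k" by simp
  let ?v = "anc l k"
  have nv: "node ?v" using node_anc[OF k l] .
  have "(\<Sum>j | j : I & near l j k. ?f j l)
    = (\<Sum>j | j : I & fst ?v <= fst j & adj (fst ?v) (snd (anc (fst ?v) j)) (snd ?v). ?f j l)"
   using l by (intro sum.cong) (auto simp: near_def)
  also have "... <= (\<Sum>u\<in>nbrs ?v. \<Sum>j | j : I & below j u. ?f j l)"
   using \<theta> by (intro sum_near_le I) auto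
  also have "... <= (\<Sum>u\<in>nbrs ?v. \<theta> ^ (fst k - l) * 2)"
  proof (rule sum_mono)
   fix u assume u: "u : nbrs ?v"
   hence fu: "fst u = l" "node u" by (auto simp: nbrs_def)
   have "(\<Sum>j | j : I & below j u. ?f j l) <= (\<Sum>j | j : boxes H & below j u. ?f j l)"
    using \<theta> H I by (intro sum_mono2) (auto simp: mem_boxes)
   also have "... = (\<Sum>n=fst u..H. 2 ^ (n - fst u) * ((1/4) ^ (n - l) * \<theta> ^ (fst k - l)))"
    by (rule sum_below_level[OF fu(2)])
   also have "... = (\<Sum>n=l..H. (1/2) ^ (n - l)) * \<theta> ^ (fst k - l)"
    by (simp add: fu sum_distrib_right power_mult_distrib[symmetric] mult.assoc[symmetric])
   also have "... <= (1 / (1 - 1/2)) * \<theta> ^ (fst k - l)"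
    using \<theta> by (intro mult_right_mono sum_geometric_le) (auto simp: inj_on_def)
   finally show "(\<Sum>j | j : I & below j u. ?f j l) <= \<theta> ^ (fst k - l) * 2" by simp
  qed
  also have "... = real (card (nbrs ?v)) * (\<theta> ^ (fst k - l) * 2)" by simp
  also have "... <= 3 * (\<theta> ^ (fst k - l) * 2)"
   using \<theta> card_nbrs[of ?v] by (intro mult_right_mono) auto
  finally show "(\<Sum>j | j : I & near l j k. ?f j l) <= \<theta> ^ (fst k - l) * 6" by simp
 qed
 also have "... = (\<Sum>l\<in>{..fst k}. \<theta> ^ (fst k - l)) * 6" by (simp add: sum_distrib_right)
 also have "... <= 1 / (1 - \<theta>) * 6"
  using \<theta> by (intro mult_right_mono sum_geometric_le) (auto simp: inj_on_def)
 finally show ?thesis by simp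
qed

context dyadic_weight begin

text \<open>A node near \<open>K\<close> at level l lies below one of the at most three neighbours
  of the level-l ancestor of \<open>K\<close>.\<close>

lemma near_sum_le_carl:
 assumes I: "finite I" "!!j. j : I ==> node j" and Y: "!!j. j : I ==> 0 <= Y j"
  and carl: "carl (%k. if k : I then Y k else 0) b" and K: "node K" and l: "l <= fst K"
 shows "(\<Sum>j | j : I & near l j K. Y j * w j) <= 3 * b l / 2 ^ l"
proof -
 obtain H where H: "!!j. j : I ==> fst j <= H"
  using finite_nat_set_iff_bounded_le[of "fst ` I"] I(1) by auto
 let ?v = "anc l K"
 have nv: "node ?v" using node_anc[OF K l] .
 have le: "(\<Sum>j | j : I & below j u. Y j * w j) <= b l / 2 ^ l" if u: "u : nbrs ?v" for u
 proof -
  have fu: "fst u = l" "node u" using u by (auto simp: nbrs_def)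
  have "(\<Sum>j | j : I & below j u. Y j * w j)
    = (\<Sum>k | k : boxes H & below k u. (if k : I then Y k else 0) * w k)"
   using H I by (intro sum.mono_neutral_cong_left) (auto simp: mem_boxes)
  also have "... <= b (fst u) / 2 ^ fst u" by (rule sum_below_le_carl[OF carl fu(2)])
  finally show ?thesis using fu by simp
 qed
 have b0: "0 <= b l"
 proof -
  have "0 <= cmean (%k. if k : I then Y k else 0) 0 ?v" using Y by (intro cmean_nonneg) auto
  also have "... <= b (fst ?v)" by (rule carlD[OF carl nv])
  finally show ?thesis by simp
 qed
 have "(\<Sum>j | j : I & near l j K. Y j * w j)
   = (\<Sum>j | j : I & fst ?v <= fst j & adj (fst ?v) (snd (anc (fst ?v) j)) (snd ?v). Y j * w j)"
  using l by (intro sum.cong) (auto simp: near_def)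
 also have "... <= (\<Sum>u\<in>nbrs ?v. \<Sum>j | j : I & below j u. Y j * w j)"
  using Y less_imp_le[OF w_pos] by (intro sum_near_le I) auto
 also have "... <= (\<Sum>u\<in>nbrs ?v. b l / 2 ^ l)" by (intro sum_mono le)
 also have "... = real (card (nbrs ?v)) * (b l / 2 ^ l)" by simp
 also have "... <= 3 * (b l / 2 ^ l)"
  using b0 card_nbrs[of ?v] by (intro mult_right_mono) auto
 finally show ?thesis by simp
qed

text \<open>A Schur type estimate for the matrix of kernels, with the closest common level replaced
  by a sum over all of them. The factor 1/B per level of j beats the doubling of the weight, and the
  growth c per level of k is absorbed by \<open>w_sum\<close>. The 18 is 3 neighbours for k, 2 for a
  geometric series and 3 neighbours for j.\<close>

lemma carl_near_double_sum:
 assumes c: "0 < c" "c * \<rho> < 1" and B: "4 * cd <= B"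
  and I: "finite I" "!!j. j : I ==> node j" and Y: "!!j. j : I ==> 0 <= Y j"
  and carl: "carl (%k. if k : I then Y k else 0) b"
 shows "carl (%k. \<Sum>j\<in>I. \<Sum>l | l : {..fst j} & near l j k. Y j * (1 / B) ^ (fst j - l) * c ^ (fst k - l))
   (%N. 18 * (cr / (1 - c * \<rho>)) * cr * conv (c * \<rho>) b N)"
 unfolding carl_def
proof (intro allI impI)
 fix H K assume K: "node K"
 define C2 where "C2 = cr / (1 - c * \<rho>)"
 have C2: "0 < C2" using c cr_ge_1 by (simp add: C2_def)
 have B0: "0 < B" using B cd_pos by simp
 have w0: "0 <= w k" for k using w_pos[of k] by simp
 let ?N = "fst K"
 let ?S = "{k. k : boxes H & below k K}"
 define T where "T j l = (\<Sum>k | k : ?S & near l j k. w k * c ^ (fst k - l))" for j l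
 have b0: "0 <= b n" for n
 proof -
  have "0 <= cmean (%k. if k : I then Y k else 0) 0 (n, 0)" using Y by (intro cmean_nonneg) auto
  also have "... <= b (fst (n, 0::nat))" by (rule carlD[OF carl]) (simp add: node_def)
  finally show ?thesis by simp
 qed
 \<comment> \<open>Going i levels down costs cd^i for the tail and 2^i for the arc; B >= 4 cd still
   leaves (1/2)^i.\<close>
 have step: "(1 / B) ^ i * (W l / 2 ^ l) <= (1/2) ^ i * (W (l + i) / 2 ^ (l + i))" for l i
 proof -
  have "(1 / B) ^ i * (W l / 2 ^ l) <= (1 / B) ^ i * (cd ^ i * W (l + i) / 2 ^ l)"
   using B0 by (intro mult_left_mono divide_right_mono W_dbl_iter) auto
  also have "... = (2 * cd / B) ^ i * (W (l + i) / 2 ^ (l + i))"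
   by (simp add: power_add power_divide power_mult_distrib)
  also have "... <= (1/2) ^ i * (W (l + i) / 2 ^ (l + i))"
   using B B0 cd_pos less_imp_le[OF W_pos] by (intro mult_right_mono power_mono) (auto simp: field_simps)
  finally show ?thesis .
 qed
 \<comment> \<open>For l not above the level of \<open>K\<close> only those j contribute that are
   near \<open>K\<close>, since nearness passes to coarser levels.\<close>
 have T1: "T j l <= (if near ?N j K then 3 * C2 * (W l / 2 ^ l) else 0)"
  if j: "j : I" and l: "?N <= l" "l <= fst j" for j l
 proof (cases "near ?N j K")
  case False
  have "{k. k : ?S & near l j k} = {}"
  proof (rule ccontr)
   assume "~ ?thesis"
   then obtain k where k: "node k" "below k K" "near l j k" by (auto simp: mem_boxes)
   have "near ?N j k" using near_mono[OF k(3) I(2)[OF j] k(1) l(1)] .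
   hence "near ?N j K" using k(2) by (auto simp: near_def below_def)
   thus False using False by simp
  qed
  thus ?thesis using False by (simp only: T_def) simp
 next
  case True
  let ?v = "anc l j"
  have nv: "node ?v" using node_anc[OF I(2)[OF j] l(2)] .
  have "T j l <= (\<Sum>k | k : boxes H & fst ?v <= fst k & adj (fst ?v) (snd (anc (fst ?v) k)) (snd ?v). w k * c ^ (fst k - l))"
   unfolding T_def using w0 c adj_sym by (intro sum_mono2) (auto simp: near_def)
  also have "... <= (\<Sum>u\<in>nbrs ?v. \<Sum>k | k : boxes H & below k u. w k * c ^ (fst k - l))"
   using w0 c by (intro sum_near_le) (auto simp: mem_boxes)
  also have "... <= (\<Sum>u\<in>nbrs ?v. C2 * (W l / 2 ^ l))"
  proof (rule sum_mono)
   fix u assume u: "u : nbrs ?v"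
   have fu: "fst u = l" "node u" using u by (auto simp: nbrs_def)
   show "(\<Sum>k | k : boxes H & below k u. w k * c ^ (fst k - l)) <= C2 * (W l / 2 ^ l)"
    using w_sum[OF c fu(2), of H] fu by (simp add: C2_def w_def)
  qed
  also have "... = real (card (nbrs ?v)) * (C2 * (W l / 2 ^ l))" by simp
  also have "... <= 3 * (C2 * (W l / 2 ^ l))"
   using card_nbrs[of ?v] C2 less_imp_le[OF W_pos] by (intro mult_right_mono) auto
  finally show ?thesis using True by simp
 qed
 \<comment> \<open>For l coarser than \<open>K\<close> all k below \<open>K\<close> have the same
   level-l ancestor, so they are near j together or not at all.\<close>
 have T2: "T j l <= (if near l j K then C2 * w K * c ^ (?N - l) else 0)"
  if j: "j : I" and l: "l < ?N" for j l
 proof (cases "near l j K")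
  case False
  have "{k. k : ?S & near l j k} = {}"
  proof (rule ccontr)
   assume "~ ?thesis"
   then obtain k where k: "node k" "below k K" "near l j k" by (auto simp: mem_boxes)
   have "near l j K" using k l below_anc_eq[OF k(2), of l] by (auto simp: near_def)
   thus False using False by simp
  qed
  thus ?thesis using False by (simp only: T_def) simp
 next
  case True
  have "T j l <= (\<Sum>k\<in>?S. w k * c ^ (fst k - l))"
   unfolding T_def using w0 c by (intro sum_mono2) auto
  also have "... = (\<Sum>k\<in>?S. c ^ (?N - l) * (w k * c ^ (fst k - ?N)))"
  proof (rule sum.cong[OF refl])
   fix k assume k: "k : ?S"
   hence "fst k - l = (?N - l) + (fst k - ?N)" using l by (auto simp: below_def)
   thus "w k * c ^ (fst k - l) = c ^ (?N - l) * (w k * c ^ (fst k - ?N))"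
    by (simp add: power_add)
  qed
  also have "... = c ^ (?N - l) * (\<Sum>k\<in>?S. w k * c ^ (fst k - ?N))" by (simp add: sum_distrib_left)
  also have "... <= c ^ (?N - l) * (C2 * w K)"
   unfolding C2_def using c by (intro mult_left_mono w_sum[OF _ _ K]) auto
  finally show ?thesis using True by (simp add: mult_ac)
 qed
 let ?g = "%j l. Y j * (1 / B) ^ (fst j - l)"
 have swap: "(\<Sum>k\<in>?S. (\<Sum>j\<in>I. \<Sum>l | l : {..fst j} & near l j k. ?g j l * c ^ (fst k - l)) * w k)
   = (\<Sum>j\<in>I. \<Sum>l\<in>{..fst j}. ?g j l * T j l)"
 proof -
  have "(\<Sum>k\<in>?S. (\<Sum>j\<in>I. \<Sum>l | l : {..fst j} & near l j k. ?g j l * c ^ (fst k - l)) * w k)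
   = (\<Sum>k\<in>?S. \<Sum>j\<in>I. \<Sum>l | l : {..fst j} & near l j k. ?g j l * (w k * c ^ (fst k - l)))"
   by (simp only: sum_distrib_left sum_distrib_right mult_ac)
  also have "... = (\<Sum>j\<in>I. \<Sum>k\<in>?S. \<Sum>l | l : {..fst j} & near l j k. ?g j l * (w k * c ^ (fst k - l)))"
   by (rule sum.swap)
  also have "... = (\<Sum>j\<in>I. \<Sum>l\<in>{..fst j}. \<Sum>k | k : ?S & near l j k. ?g j l * (w k * c ^ (fst k - l)))"
   by (intro sum.cong[OF refl] sum.swap_restrict) auto
  finally show ?thesis by (simp add: T_def sum_distrib_left)
 qed
 have S1: "(\<Sum>j\<in>I. \<Sum>l | l : {..fst j} & ?N <= l. ?g j l * T j l) <= 18 * C2 * b ?N / 2 ^ ?N"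
 proof -
  have "(\<Sum>j\<in>I. \<Sum>l | l : {..fst j} & ?N <= l. ?g j l * T j l)
    <= (\<Sum>j\<in>I. if near ?N j K then 6 * C2 * (Y j * w j) else 0)"
  proof (rule sum_mono)
   fix j assume j: "j : I"
   have "(\<Sum>l | l : {..fst j} & ?N <= l. ?g j l * T j l)
    <= (\<Sum>l | l : {..fst j} & ?N <= l. ?g j l * (if near ?N j K then 3 * C2 * (W l / 2 ^ l) else 0))"
    using Y[OF j] B0 by (intro sum_mono mult_left_mono T1 j) auto
   also have "... <= (if near ?N j K then 6 * C2 * (Y j * w j) else 0)"
   proof (cases "near ?N j K")
    case True
    have "(\<Sum>l | l : {..fst j} & ?N <= l. ?g j l * (3 * C2 * (W l / 2 ^ l)))
     <= (\<Sum>l | l : {..fst j} & ?N <= l. 3 * C2 * Y j * w j * (1/2) ^ (fst j - l))"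
    proof (rule sum_mono)
     fix l assume "l : {l. l : {..fst j} & ?N <= l}"
     hence "l + (fst j - l) = fst j" by simp
     hence "(1 / B) ^ (fst j - l) * (W l / 2 ^ l) <= (1/2) ^ (fst j - l) * w j"
      using step[of "fst j - l" l] by (simp add: w_def)
     hence "3 * C2 * Y j * ((1 / B) ^ (fst j - l) * (W l / 2 ^ l)) <= 3 * C2 * Y j * ((1/2) ^ (fst j - l) * w j)"
      using C2 Y[OF j] by (intro mult_left_mono) auto
     thus "?g j l * (3 * C2 * (W l / 2 ^ l)) <= 3 * C2 * Y j * w j * (1/2) ^ (fst j - l)"
      by (simp only: mult_ac)
    qed
    also have "... = 3 * C2 * Y j * w j * (\<Sum>l | l : {..fst j} & ?N <= l. (1/2) ^ (fst j - l))"
     by (simp add: sum_distrib_left)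
    also have "... <= 3 * C2 * Y j * w j * (1 / (1 - 1/2))"
     using C2 Y[OF j] w0 by (intro mult_left_mono sum_geometric_le) (auto simp: inj_on_def)
    finally show ?thesis using True by (simp add: mult_ac)
   qed simp
   finally show "(\<Sum>l | l : {..fst j} & ?N <= l. ?g j l * T j l)
    <= (if near ?N j K then 6 * C2 * (Y j * w j) else 0)" .
  qed
  also have "... = 6 * C2 * (\<Sum>j | j : I & near ?N j K. Y j * w j)"
   using I(1) by (simp add: sum.inter_filter sum_distrib_left if_distrib cong: if_cong)
  also have "... <= 6 * C2 * (3 * b ?N / 2 ^ ?N)"
   using C2 by (intro mult_left_mono near_sum_le_carl I Y carl K) auto
  finally show ?thesis by simp
 qed
 have S2: "(\<Sum>j\<in>I. \<Sum>l | l : {..fst j} & l < ?N. ?g j l * T j l)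
   <= (\<Sum>l<?N. 3 * C2 * cr * (c * \<rho>) ^ (?N - l) * b l) / 2 ^ ?N"
 proof -
  have "(\<Sum>j\<in>I. \<Sum>l | l : {..fst j} & l < ?N. ?g j l * T j l)
   <= (\<Sum>j\<in>I. \<Sum>l | l : {..<?N} & near l j K. ?g j l * (C2 * w K * c ^ (?N - l)))"
  proof (rule sum_mono)
   fix j assume j: "j : I"
   have "(\<Sum>l | l : {..fst j} & l < ?N. ?g j l * T j l)
     <= (\<Sum>l | l : {..fst j} & l < ?N. ?g j l * (if near l j K then C2 * w K * c ^ (?N - l) else 0))"
    using Y[OF j] B0 by (intro sum_mono mult_left_mono T2 j) auto
   also have "... = (\<Sum>l | l : {..<?N} & near l j K. ?g j l * (C2 * w K * c ^ (?N - l)))"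
    by (rule sum.mono_neutral_cong_right) (auto simp: near_def)
   finally show "(\<Sum>l | l : {..fst j} & l < ?N. ?g j l * T j l)
    <= (\<Sum>l | l : {..<?N} & near l j K. ?g j l * (C2 * w K * c ^ (?N - l)))" .
  qed
  also have "... = (\<Sum>l\<in>{..<?N}. \<Sum>j | j : I & near l j K. ?g j l * (C2 * w K * c ^ (?N - l)))"
   by (rule sum.swap_restrict) (auto simp: I)
  also have "... <= (\<Sum>l\<in>{..<?N}. 3 * C2 * cr * (c * \<rho>) ^ (?N - l) * b l / 2 ^ ?N)"
  proof (rule sum_mono)
   fix l assume "l : {..<?N}"
   hence l: "l < ?N" by simp
   have Wl: "0 < W l / 2 ^ l" using W_pos by simp
   have "(\<Sum>j | j : I & near l j K. ?g j l * (C2 * w K * c ^ (?N - l)))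
     = C2 * w K * c ^ (?N - l) * (\<Sum>j | j : I & near l j K. ?g j l)"
    by (simp add: sum_distrib_left mult_ac)
   also have "... <= C2 * w K * c ^ (?N - l) * (\<Sum>j | j : I & near l j K. Y j * w j / (W l / 2 ^ l))"
   proof (intro mult_left_mono sum_mono)
    fix j assume jj: "j : {j. j : I & near l j K}"
    hence j: "j : I" "l + (fst j - l) = fst j" by (auto simp: near_def)
    have "(1 / B) ^ (fst j - l) * (W l / 2 ^ l) <= (1/2) ^ (fst j - l) * w j"
     using step[of "fst j - l" l] j by (simp add: w_def)
    also have "... <= 1 * w j" using w0 by (intro mult_right_mono power_le_one) auto
    finally have "(1 / B) ^ (fst j - l) <= w j / (W l / 2 ^ l)"
     using Wl by (simp only: pos_le_divide_eq mult_1)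
    hence "Y j * (1 / B) ^ (fst j - l) <= Y j * (w j / (W l / 2 ^ l))"
     using Y[OF j(1)] by (intro mult_left_mono)
    thus "?g j l <= Y j * w j / (W l / 2 ^ l)" by simp
   qed (use C2 w0 c in auto)
   also have "(\<Sum>j | j : I & near l j K. Y j * w j / (W l / 2 ^ l))
     = (\<Sum>j | j : I & near l j K. Y j * w j) / (W l / 2 ^ l)" by (rule sum_divide_distrib[symmetric])
   also have "C2 * w K * c ^ (?N - l) * ((\<Sum>j | j : I & near l j K. Y j * w j) / (W l / 2 ^ l))
     <= C2 * w K * c ^ (?N - l) * (3 * b l / 2 ^ l / (W l / 2 ^ l))"
    using C2 w0 c Wl l
    by (intro mult_left_mono divide_right_mono near_sum_le_carl I Y carl K) auto
   also have "... = 3 * C2 * c ^ (?N - l) * b l * (w K / W l)"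
    using W_pos[of l] by (simp add: field_simps)
   also have "... <= 3 * C2 * c ^ (?N - l) * b l * (cr * \<rho> ^ (?N - l) / 2 ^ ?N)"
   proof (intro mult_left_mono)
    have "W ?N <= cr * \<rho> ^ (?N - l) * W l" using W_decay[of l "?N - l"] l by simp
    hence "W ?N / W l <= cr * \<rho> ^ (?N - l)" using W_pos[of l] by (simp add: pos_divide_le_eq)
    hence "W ?N / W l / 2 ^ ?N <= cr * \<rho> ^ (?N - l) / 2 ^ ?N" by (rule divide_right_mono) simp
    thus "w K / W l <= cr * \<rho> ^ (?N - l) / 2 ^ ?N" by (simp add: w_def mult.commute)
   qed (use C2 c b0 in auto)
   finally show "(\<Sum>j | j : I & near l j K. ?g j l * (C2 * w K * c ^ (?N - l)))
     <= 3 * C2 * cr * (c * \<rho>) ^ (?N - l) * b l / 2 ^ ?N"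
    by (simp add: power_mult_distrib mult_ac)
  qed
  finally show ?thesis by (simp add: sum_divide_distrib)
 qed
 have "(\<Sum>j\<in>I. \<Sum>l\<in>{..fst j}. ?g j l * T j l)
   = (\<Sum>j\<in>I. (\<Sum>l | l : {..fst j} & ?N <= l. ?g j l * T j l) + (\<Sum>l | l : {..fst j} & l < ?N. ?g j l * T j l))"
  by (intro sum.cong[OF refl], subst sum.union_disjoint[symmetric]) (auto intro!: sum.cong)
 also have "... <= 18 * C2 * b ?N / 2 ^ ?N + (\<Sum>l<?N. 3 * C2 * cr * (c * \<rho>) ^ (?N - l) * b l) / 2 ^ ?N"
  unfolding sum.distrib by (intro add_mono S1 S2)
 finally have "cmean (%k. \<Sum>j\<in>I. \<Sum>l | l : {..fst j} & near l j k. ?g j l * c ^ (fst k - l)) H K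
   <= 2 ^ ?N * (18 * C2 * b ?N / 2 ^ ?N + (\<Sum>l<?N. 3 * C2 * cr * (c * \<rho>) ^ (?N - l) * b l) / 2 ^ ?N)"
  unfolding cmean_def swap by (rule mult_left_mono) simp
 also have "... = 18 * C2 * 1 * b ?N + (\<Sum>l<?N. 3 * C2 * cr * ((c * \<rho>) ^ (?N - l) * b l))"
  by (simp add: field_simps)
 also have "... <= 18 * C2 * cr * b ?N + (\<Sum>l<?N. 18 * C2 * cr * ((c * \<rho>) ^ (?N - l) * b l))"
  using C2 cr_ge_1 b0 c \<rho> by (intro add_mono mult_right_mono mult_left_mono sum_mono) auto
 also have "... = 18 * C2 * cr * conv (c * \<rho>) b ?N"
  by (simp add: conv_def lessThan_Suc_atMost[symmetric] sum_distrib_left algebra_simps)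
 finally show "cmean (%k. \<Sum>j\<in>I. \<Sum>l | l : {..fst j} & near l j k. ?g j l * c ^ (fst k - l)) H K
   <= 18 * (cr / (1 - c * \<rho>)) * cr * conv (c * \<rho>) b ?N" by (simp add: C2_def)
qed

lemma kernel_sum:
 assumes p: "0 < p"
 obtains \<theta> m0 where "0 < \<theta>" "\<theta> < 1"
  "!!m. m0 <= m ==> \<exists>C>0. \<forall>I y x b. finite I --> (\<forall>j\<in>I. node j) --> (\<forall>j\<in>I. 0 <= y j) -->
   (\<forall>k. node k --> 0 <= x k & x k <= (\<Sum>j\<in>I. y j * (1/2) ^ (m * (fst j - prox j k)))) -->
   carl (%k. if k : I then y k powr p else 0) b --> carl (%k. x k powr p) (%N. C * conv \<theta> b N)"
proof -
 define \<tau> where "\<tau> = sqrt \<rho>"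
 have \<tau>: "0 < \<tau>" "\<tau> < 1" "\<tau> * \<tau> = \<rho>" using \<rho> by (auto simp: \<tau>_def)
 define \<sigma> where "\<sigma> = \<tau> powr (1 / p)"
 have \<sigma>: "0 < \<sigma>" "\<sigma> < 1" using \<tau> p powr_less_mono2[of "1 / p" \<tau> 1] by (auto simp: \<sigma>_def)
 have \<sigma>p: "\<sigma> powr p = \<tau>" using \<tau> p by (simp add: \<sigma>_def powr_powr)
 define c where "c = 1 / \<tau>"
 have c: "0 < c" "c * \<rho> < 1" "c * \<rho> = \<tau>" using \<tau> by (auto simp: c_def field_simps)
 obtain m0 where m0: "4 * (4 * cd) powr (1 / p) < 2 ^ m0"
  using real_arch_pow[of 2 "4 * (4 * cd) powr (1 / p)"] by auto
 show thesis
 proof (rule that[of \<tau> m0])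
  fix m assume m: "m0 <= m"
  define B where "B = (2 ^ m / 4) powr p"
  have B: "4 * cd <= B"
  proof -
   have "(2::real) ^ m0 <= 2 ^ m" using m by (rule power_increasing) simp
   hence "(4 * cd) powr (1 / p) <= 2 ^ m / 4" using m0 by linarith
   hence "((4 * cd) powr (1 / p)) powr p <= B"
    unfolding B_def using p by (intro powr_mono2) auto
   thus ?thesis using p cd_pos by (simp add: powr_powr)
  qed
  define C0 where "C0 = (6 / (1 - \<sigma>)) powr p"
  have C0: "0 < C0" using \<sigma> by (simp add: C0_def)
  define C where "C = C0 * (18 * (cr / (1 - c * \<rho>)) * cr)"
  have C: "0 < C" using C0 c cr_ge_1 by (simp add: C_def)
  show "\<exists>C>0. \<forall>I y x b. finite I --> (\<forall>j\<in>I. node j) --> (\<forall>j\<in>I. 0 <= y j) -->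
   (\<forall>k. node k --> 0 <= x k & x k <= (\<Sum>j\<in>I. y j * (1/2) ^ (m * (fst j - prox j k)))) -->
   carl (%k. if k : I then y k powr p else 0) b --> carl (%k. x k powr p) (%N. C * conv \<tau> b N)"
  proof (intro exI[of _ C] conjI C allI impI)
   fix I y x b
   assume fI: "finite I" and nI: "\<forall>j\<in>I. node j" and y: "\<forall>j\<in>I. 0 <= y j"
    and x: "\<forall>k. node k --> 0 <= x k & x k <= (\<Sum>j\<in>I. y j * (1/2) ^ (m * (fst j - prox j k)))"
    and ca: "carl (%k. if k : I then y k powr p else 0) b"
   let ?F = "%k. \<Sum>j\<in>I. \<Sum>l | l : {..fst j} & near l j k. y j powr p * (1 / B) ^ (fst j - l) * c ^ (fst k - l)"
   have "carl ?F (%N. 18 * (cr / (1 - c * \<rho>)) * cr * conv (c * \<rho>) b N)"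
    by (rule carl_near_double_sum[OF c(1,2) B fI _ _ ca]) (use nI in auto)
   hence cF: "carl (%k. C0 * ?F k) (%N. C0 * (18 * (cr / (1 - c * \<rho>)) * cr * conv (c * \<rho>) b N))"
    by (rule carl_cmult) (use C0 in simp)
   show "carl (%k. x k powr p) (%N. C * conv \<tau> b N)"
   proof (rule carl_mono[OF cF])
    show "C0 * (18 * (cr / (1 - c * \<rho>)) * cr * conv (c * \<rho>) b n) <= C * conv \<tau> b n" for n
     by (simp add: C_def c(3))
    fix k assume k: "node k"
    let ?e = "%j. fst j - prox j k"
    \<comment> \<open>The factor 1/4 per level of j makes the weights summable in spite of the 2^i
      descendants. What remains of the kernel is (4 / 2^m)^i, whose p-th power is (1/B)^i.\<close>
    let ?\<eta> = "%j. (1/4) ^ ?e j * \<sigma> ^ (fst k - prox j k)"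
    let ?a = "%j. y j * (1/2) ^ (m * ?e j)"
    have "x k powr p <= (\<Sum>j\<in>I. ?a j) powr p"
     using x[rule_format, OF k] p by (intro powr_mono2) auto
    also have "... <= (\<Sum>j\<in>I. ?\<eta> j) powr p * (\<Sum>j\<in>I. (?a j / ?\<eta> j) powr p)"
     using fI y \<sigma> p by (intro powr_sum_le) auto
    also have "... <= C0 * (\<Sum>j\<in>I. (?a j / ?\<eta> j) powr p)"
     unfolding C0_def using \<sigma> p fI nI k
     by (intro mult_right_mono powr_mono2 sum_eta_le) (auto intro!: sum_nonneg)
    also have "(\<Sum>j\<in>I. (?a j / ?\<eta> j) powr p) <= ?F k"
    proof (rule sum_mono)
     fix j assume j: "j : I"
     have "?a j / ?\<eta> j = y j * ((4 / 2 ^ m) ^ ?e j / \<sigma> ^ (fst k - prox j k))"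
      by (simp add: power_mult power_divide)
     hence "(?a j / ?\<eta> j) powr p = y j powr p * (((4 / 2 ^ m) ^ ?e j) powr p / (\<sigma> ^ (fst k - prox j k)) powr p)"
      by (simp add: powr_mult powr_divide)
     also have "((4 / 2 ^ m) ^ ?e j :: real) powr p = (1 / B) ^ ?e j"
      by (subst power_powr_commute) (simp_all add: B_def powr_divide)
     also have "(\<sigma> ^ (fst k - prox j k)) powr p = \<tau> ^ (fst k - prox j k)"
      using \<sigma> by (simp add: powr_realpow[symmetric] powr_powr mult.commute \<sigma>p[symmetric])
     finally have "(?a j / ?\<eta> j) powr p = y j powr p * (1 / B) ^ ?e j * c ^ (fst k - prox j k)"
      by (simp add: c_def power_divide)
     also have "... <= (\<Sum>l | l : {..fst j} & near l j k. y j powr p * (1 / B) ^ (fst j - l) * c ^ (fst k - l))"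
      using prox_near[of j k] nI j k B cd_pos c
      by (intro member_le_sum[where f="%l. y j powr p * (1 / B) ^ (fst j - l) * c ^ (fst k - l)"])
        (auto simp: near_def)
     finally show "(?a j / ?\<eta> j) powr p <= (\<Sum>l | l : {..fst j} & near l j k. y j powr p * (1 / B) ^ (fst j - l) * c ^ (fst k - l))" .
    qed
    finally show "x k powr p <= C0 * ?F k" using C0 by simp
   qed
  qed
 qed (use \<tau> in auto)
qed

end

subsection \<open>The measure of a weight in the class\<close>

definition rad :: "nat => real" where "rad n = 1 - (1/2)^n"

lemma rad_nonneg: "0 <= rad n" and rad_less_1: "rad n < 1" and rad_0 [simp]: "rad 0 = 0"
 by (simp_all add: rad_def power_le_one)

lemma rad_Suc: "rad (Suc n) = (1 + rad n) / 2"
 by (simp add: rad_def field_simps)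

lemma rad_mono: "m <= n ==> rad m <= rad n"
 by (simp add: rad_def power_decreasing)

lemma rad_strict_mono: "m < n ==> rad m < rad n"
 by (simp add: rad_def power_strict_decreasing)

lemma rad_ge_half: "0 < n ==> 1 / 2 <= rad n"
 using rad_mono[of 1 n] by (simp add: rad_def)

lemma rad_tendsto_1: "rad \<longlonglongrightarrow> 1"
proof -
 have "(%n. 1 - (1/2)^n :: real) \<longlonglongrightarrow> 1 - 0" by (intro tendsto_intros LIMSEQ_power_zero) simp
 thus ?thesis by (simp add: rad_def[abs_def])
qed

lemma ex_rad_gt: "r < 1 ==> \<exists>n. r < rad n"
 using order_tendstoD(1)[OF rad_tendsto_1] eventually_sequentially by (metis order_refl)

text \<open>The Borel measure \<open>\<mu>\<close> stands for area with density the weight.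
  \<open>W_ann\<close> says that L consecutive dyadic annuli carry a fixed part of the tail. They
  start at level n + 2, outside the discs on which the submean property is applied at level
  n.\<close>

locale tent_measure = dyadic_weight W \<rho> cr cd
 for W :: "nat => real" and \<rho> cr cd :: real +
 fixes \<mu> :: "complex measure" and ca cl :: real and L :: nat
 assumes sets_\<mu>: "sets \<mu> = sets borel"
  and rot: "!!t. distr \<mu> borel (%z. cis t * z) = \<mu>"
  and \<mu>_ann: "!!n. emeasure \<mu> {z. rad n <= norm z & norm z < rad (Suc n)} <= ennreal (ca * W n)"
  and W_ann: "!!n. ennreal (W n) <= ennreal cl * emeasure \<mu> {z. rad (n + 2) <= norm z & norm z < rad (n + 2 + L)}"
  and fin_\<mu>: "emeasure \<mu> UNIV < \<infinity>"
  and ca_pos: "0 < ca" and cl_pos: "0 < cl"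

section \<open>From a radial weight to a rotation invariant Borel measure\<close>

lemma AE_norm_lborel_disk:
 assumes "AE s in lborel. 0 <= s & s < 1 --> P s"
 shows "AE z in lborel. z : \<DD> --> P (norm (z::complex))"
proof -
 obtain N where N: "N : null_sets lborel" "{s. ~ (0 <= s & s < 1 --> P s)} <= N"
  using assms unfolding eventually_ae_filter by auto
 have [measurable]: "N : sets borel" using N(1) by auto
 have "emeasure (distr (density lborel (indicator \<DD>)) borel norm) N = 0"
 proof -
  have "AE s in lborel. s ~: N" using N(1) by (rule AE_not_in)
  hence "(\<integral>\<^sup>+s. ennreal (2 * pi * s) * indicator {0..<1} s * indicator N s \<partial>lborel) = 0"
   by (subst nn_integral_0_iff_AE) (auto elim!: eventually_mono)
  thus ?thesis unfolding distr_norm_disk by (subst emeasure_density) auto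
 qed
 hence "(\<integral>\<^sup>+z. indicator \<DD> z * indicator (norm -` N) z \<partial>(lborel :: complex measure)) = 0"
 proof -
  assume "emeasure (distr (density lborel (indicator \<DD>)) borel (norm :: complex => real)) N = 0"
  hence "emeasure (density lborel (indicator \<DD>)) ((norm :: complex => real) -` N) = 0"
   by (subst (asm) emeasure_distr) simp_all
  thus ?thesis
   using measurable_sets[of "norm :: complex => real" borel borel N]
   by (subst (asm) emeasure_density) simp_all
 qed
 hence "AE z in (lborel :: complex measure). indicator \<DD> z * indicator (norm -` N) z = (0::ennreal)"
  by (subst (asm) nn_integral_0_iff_AE) auto
 thus ?thesis
 proof (rule eventually_mono)
  fix z :: complex assume "indicator \<DD> z * indicator (norm -` N) z = (0::ennreal)"
  hence "z : \<DD> ==> norm z ~: N" by (auto simp: indicator_def split: if_splits)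
  moreover have "~ P (norm z) ==> z : \<DD> ==> norm z : N" using N(2) by force
  ultimately show "z : \<DD> --> P (norm z)" by blast
 qed
qed

text \<open>The weight is Lebesgue measurable in the plane, while the tail integrates it along one
  radius, which is a null set. The profile \<open>v\<close> is the angular average of a Borel
  version; for almost every radius the exceptional set meets the circle in a null set, so there the
  average is the value of the weight.\<close>

lemma radial_weight_profile:
 assumes "radial_weight \<omega>"
 obtains v :: "real => real" where "v : borel_measurable borel" "!!s. 0 <= v s"
  "AE z in lborel. z : \<DD> --> \<omega> z = v (norm z)"
  "AE s in lborel. 0 <= s & s < 1 --> \<omega> (of_real s) = v s"
proof -
 have \<omega>0: "!!z. z : \<DD> ==> 0 <= \<omega> z" and int: "integrable (lebesgue_on \<DD>) \<omega>"
  and rad: "!!z. z : \<DD> ==> \<omega> z = \<omega> (of_real (norm z))"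
  using assms unfolding radial_weight_def weight_def by blast+
 have "(%z. ennreal (\<omega> z)) : borel_measurable (lebesgue_on \<DD>)"
  by (rule measurable_compose[OF borel_measurable_integrable[OF int] measurable_ennreal])
 hence "(%z. ennreal (\<omega> z) * indicator \<DD> z) : borel_measurable lebesgue"
  by (subst (asm) borel_measurable_restrict_space_iff_ennreal) simp_all
 then obtain g where g[measurable]: "g : borel_measurable lborel"
  and ae: "AE z in lborel. ennreal (\<omega> z) * indicator \<DD> z = g z"
  using completion_ex_borel_measurable by blast
 have [measurable]: "g : borel_measurable borel" using g by simp
 obtain N where N: "N : null_sets lborel" "{z. ennreal (\<omega> z) * indicator \<DD> z ~= g z} <= N"
  using ae unfolding eventually_ae_filter by auto
 have [measurable]: "N : sets borel" using N(1) by auto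
 have mc2[measurable]: "(%p. rcis (fst p) (snd p)) : borel_measurable (borel \<Otimes>\<^sub>M borel)"
  unfolding borel_prod rcis_def cis_conv_exp
  by (intro borel_measurable_continuous_onI continuous_intros)
 have mc3[measurable]: "(%t. rcis s t) : borel_measurable borel" for s
  unfolding rcis_def cis_conv_exp
  by (intro borel_measurable_continuous_onI continuous_intros)
 define h where "h s = (\<integral>\<^sup>+t\<in>{0..2*pi}. g (rcis s t) \<partial>lborel)" for s
 have [measurable]: "h : borel_measurable borel"
  unfolding h_def using mc2 by measurable
 define v where "v s = enn2real (h s) / (2 * pi)" for s
 have vm: "v : borel_measurable borel" unfolding v_def by measurable
 have v0: "0 <= v s" for s by (simp add: v_def)
 define n where "n s = (\<integral>\<^sup>+t\<in>{0..2*pi}. indicator N (rcis s t) \<partial>lborel)" for s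
 have [measurable]: "n : borel_measurable borel"
  unfolding n_def using mc2 by measurable
 have "AE z in lborel. z ~: N" using N(1) by (rule AE_not_in)
 hence "(\<integral>\<^sup>+z\<in>\<DD>. indicator N z \<partial>lborel) = 0"
  by (subst nn_integral_0_iff_AE) (auto elim!: eventually_mono)
 hence "(\<integral>\<^sup>+s\<in>{0..<1}. ennreal s * n s \<partial>lborel) = 0"
  by (subst (asm) nn_integral_disk_polar) (auto simp: n_def)
 hence AEs: "AE s in lborel. ennreal s * n s * indicator {0..<1} s = 0"
  by (subst (asm) nn_integral_0_iff_AE) auto
 have aev: "AE s in lborel. 0 <= s & s < 1 --> s ~= 0 & \<omega> (of_real s) = v s"
  using AEs AE_lborel_singleton[of 0]
 proof eventually_elim
  case (elim s)
  show ?case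
  proof
   assume s: "0 <= s & s < 1"
   hence "n s = 0" using elim by (auto simp: indicator_def)
   hence "AE t in lborel. indicator N (rcis s t) * indicator {0..2*pi} t = (0::ennreal)"
    unfolding n_def by (subst (asm) nn_integral_0_iff_AE) auto
   hence "h s = (\<integral>\<^sup>+t\<in>{0..2*pi}. ennreal (\<omega> (of_real s)) \<partial>lborel)"
    unfolding h_def
   proof (intro nn_integral_cong_AE, elim eventually_mono)
    fix t assume t: "indicator N (rcis s t) * indicator {0..2*pi} t = (0::ennreal)"
    show "g (rcis s t) * indicator {0..2*pi} t = ennreal (\<omega> (of_real s)) * indicator {0..2*pi} t"
    proof (cases "t : {0..2*pi}")
     case True
     hence "rcis s t ~: N" using t by (auto simp: indicator_def split: if_splits)
     hence "~ ennreal (\<omega> (rcis s t)) * indicator \<DD> (rcis s t) ~= g (rcis s t)" using N(2) by blast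
     hence "g (rcis s t) = ennreal (\<omega> (rcis s t)) * indicator \<DD> (rcis s t)" by simp
     moreover have "rcis s t : \<DD>" using s by (simp add: norm_mult rcis_def)
     moreover have "\<omega> (rcis s t) = \<omega> (of_real s)"
      using rad[OF \<open>rcis s t : \<DD>\<close>] s by (simp add: norm_mult rcis_def)
     ultimately show ?thesis by simp
    qed simp
   qed
   also have "... = ennreal (\<omega> (of_real s) * (2 * pi))"
    using \<omega>0[of "of_real s"] s by (subst nn_integral_cmult_indicator) (auto simp: ennreal_mult'')
   finally show "s ~= 0 & \<omega> (of_real s) = v s" using \<omega>0[of "of_real s"] s elim by (simp add: v_def)
  qed
 qed
 show thesis
 proof (rule that[OF vm v0])
  show "AE s in lborel. 0 <= s & s < 1 --> \<omega> (of_real s) = v s"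
   using aev by (rule eventually_mono) auto
  hence "AE z in lborel. z : \<DD> --> \<omega> (of_real (norm (z::complex))) = v (norm z)"
   by (rule AE_norm_lborel_disk)
  thus "AE z in lborel. z : \<DD> --> \<omega> z = v (norm z)"
   by (rule eventually_mono) (metis rad)
 qed
qed

lemma emeasure_radial_density_annulus:
 fixes v :: "real => real"
 assumes [measurable]: "v : borel_measurable borel" and ab: "0 <= a" "b <= 1"
 shows "emeasure (density lborel (%z. indicator \<DD> z * ennreal (v (norm z)))) {z. a <= norm z & norm z < b}
  = (\<integral>\<^sup>+s\<in>{a..<b}. ennreal (2 * pi * s) * ennreal (v s) \<partial>lborel)"
proof -
 have "emeasure (density lborel (%z. indicator \<DD> z * ennreal (v (norm z)))) {z. a <= norm z & norm z < b}
  = (\<integral>\<^sup>+z. indicator \<DD> z * (ennreal (v (norm z)) * indicator {a..<b} (norm z)) \<partial>lborel)"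
  by (subst emeasure_density) (auto intro!: nn_integral_cong simp: indicator_def)
 also have "... = (\<integral>\<^sup>+z. ennreal (v (norm z)) * indicator {a..<b} (norm z) \<partial>density lborel (indicator \<DD>))"
  by (subst nn_integral_density) auto
 also have "... = (\<integral>\<^sup>+s. ennreal (v s) * indicator {a..<b} s \<partial>distr (density lborel (indicator \<DD>)) borel (norm :: complex => real))"
  by (subst nn_integral_distr) auto
 also have "... = (\<integral>\<^sup>+s\<in>{a..<b}. ennreal (2 * pi * s) * ennreal (v s) \<partial>lborel)"
  unfolding distr_norm_disk using ab
  by (subst nn_integral_density) (auto intro!: nn_integral_cong simp: indicator_def)
 finally show ?thesis .
qed

lemma distr_cis_radial_density:
 fixes v :: "real => real"
 assumes [measurable]: "v : borel_measurable borel"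
 defines "\<mu> \<equiv> density lborel (%z::complex. indicator \<DD> z * ennreal (v (norm z)))"
 shows "distr \<mu> borel (%z. cis t * z) = \<mu>"
proof (rule measure_eqI)
 show "sets (distr \<mu> borel (%z. cis t * z)) = sets \<mu>" by (simp add: \<mu>_def)
 fix A assume "A : sets (distr \<mu> borel (%z. cis t * z))"
 hence [measurable]: "A : sets borel" by simp
 have mc[measurable]: "(%z. cis t * z) : borel_measurable borel"
  by (intro borel_measurable_continuous_onI continuous_intros)
 have pre[measurable]: "(%z. cis t * z) -` A : sets borel"
  using measurable_sets[OF mc, of A] by simp
 have "emeasure (distr \<mu> borel (%z. cis t * z)) A = emeasure \<mu> ((%z. cis t * z) -` A)"
  by (subst emeasure_distr) (auto simp: \<mu>_def)
 also have "... = (\<integral>\<^sup>+z. indicator \<DD> z * ennreal (v (norm z)) * indicator ((%z. cis t * z) -` A) z \<partial>lborel)"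
  unfolding \<mu>_def by (subst emeasure_density) auto
 also have "... = (\<integral>\<^sup>+z. indicator \<DD> (cis t * z) * ennreal (v (norm (cis t * z))) * indicator A (cis t * z) \<partial>lborel)"
  by (intro nn_integral_cong) (simp add: indicator_def norm_mult)
 also have "... = (\<integral>\<^sup>+z. indicator \<DD> z * ennreal (v (norm z)) * indicator A z \<partial>lborel)"
  by (rule nn_integral_lborel_cis) measurable
 also have "... = emeasure \<mu> A"
  unfolding \<mu>_def by (subst emeasure_density) auto
 finally show "emeasure (distr \<mu> borel (%z. cis t * z)) A = emeasure \<mu> A" .
qed

text \<open>With the Borel profile in place of the weight, the two class conditions are read off at
  the dyadic radii; the degenerate cases of an infinite or a vanishing tail are excluded on the
  way.\<close>

lemma D_class_tent_measure:
 assumes "\<omega> : D_class"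
 obtains \<rho> cr cd \<mu> ca cl L where
  "tent_measure (%n. enn2real (tail \<omega> (of_real (rad n)))) \<rho> cr cd \<mu> ca cl L"
  "!!f S q. S <= \<DD> ==> (%z. ennreal (norm (f z) powr q) * indicator S z) : borel_measurable borel ==>
   (\<integral>\<^sup>+z\<in>S. ennreal (norm (f z :: complex) powr q * \<omega> z) \<partial>lebesgue) = (\<integral>\<^sup>+z\<in>S. ennreal (norm (f z) powr q) \<partial>\<mu>)"
  "!!z. z : \<DD> ==> 0 < enn2real (tail \<omega> z)"
  "!!z z'. z' : \<DD> ==> norm z <= norm z' ==> enn2real (tail \<omega> z') <= enn2real (tail \<omega> z)"
proof -
 have rw: "radial_weight \<omega>" using assms by (simp add: D_class_def D_hat_def)
 obtain C where C: "1 <= C" "!!r::real. 0 <= r ==> r < 1 ==>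
   tail \<omega> (of_real r) <= ennreal C * tail \<omega> (of_real ((1 + r) / 2))"
  using assms unfolding D_class_def D_hat_def by blast
 obtain K E where KE: "1 < K" "1 < E" "!!r::real. 0 <= r ==> r < 1 ==>
   tail \<omega> (of_real r) \<ge> ennreal E * tail \<omega> (of_real (1 - (1 - r) / K))"
  using assms unfolding D_class_def D_check_def by blast
 obtain v where v[measurable]: "v : borel_measurable borel" and v0: "!!s. 0 <= v s"
  and aez: "AE z in lborel. z : \<DD> --> \<omega> z = v (norm z)"
  and aes: "AE s in lborel. 0 <= s & s < 1 --> \<omega> (of_real s) = v s"
  using radial_weight_profile[OF rw] by blast
 define T where "T r = (\<integral>\<^sup>+s\<in>{r..<1}. ennreal (v s) \<partial>lborel)" for r
 define \<mu> where "\<mu> = density lborel (%z::complex. indicator \<DD> z * ennreal (v (norm z)))"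
 have tailT: "tail \<omega> z = T (norm z)" for z
  unfolding tail_def T_def nn_integral_completion
  by (rule nn_integral_cong_AE, rule eventually_mono[OF aes])
    (use order_trans[OF norm_ge_zero[of z]] in \<open>auto simp: indicator_def\<close>)
 have Tr: "tail \<omega> (of_real r) = T r" if "0 <= r" for r using that by (simp add: tailT)
 have T_anti: "T s <= T r" if "r <= s" for r s
  unfolding T_def using that by (intro nn_integral_mono) (auto simp: indicator_def)
 have T_split: "T a = (\<integral>\<^sup>+s\<in>{a..<b}. ennreal (v s) \<partial>lborel) + T b" if "a <= b" "b <= 1" for a b
 proof -
  have "T a = (\<integral>\<^sup>+s. ennreal (v s) * indicator {a..<b} s + ennreal (v s) * indicator {b..<1} s \<partial>lborel)"
   unfolding T_def using that by (intro nn_integral_cong) (auto simp: indicator_def)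
  thus ?thesis unfolding T_def by (subst (asm) nn_integral_add) auto
 qed
 have int: "(\<integral>\<^sup>+z\<in>\<DD>. ennreal (v (norm z)) \<partial>lborel) < \<infinity>"
 proof -
  have "integrable (lebesgue_on \<DD>) \<omega>" using rw by (simp add: radial_weight_def weight_def)
  hence "(\<integral>\<^sup>+z. ennreal (norm (\<omega> z)) \<partial>lebesgue_on \<DD>) < \<infinity>" by (simp add: integrable_iff_bounded)
  hence "(\<integral>\<^sup>+z\<in>\<DD>. ennreal (norm (\<omega> z)) \<partial>lborel) < \<infinity>"
   by (subst (asm) nn_integral_restrict_space) (simp_all add: nn_integral_completion)
  also have "(\<integral>\<^sup>+z\<in>\<DD>. ennreal (norm (\<omega> z)) \<partial>lborel) = (\<integral>\<^sup>+z\<in>\<DD>. ennreal (v (norm z)) \<partial>lborel)"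
   by (rule nn_integral_cong_AE, rule eventually_mono[OF aez]) (auto simp: indicator_def v0)
  finally show ?thesis .
 qed
 have ann: "emeasure \<mu> {z. a <= norm z & norm z < b} = (\<integral>\<^sup>+s\<in>{a..<b}. ennreal (2 * pi * s) * ennreal (v s) \<partial>lborel)"
  if "0 <= a" "b <= 1" for a b
  unfolding \<mu>_def using emeasure_radial_density_annulus[OF v that] .
 have \<mu>D: "emeasure \<mu> A < \<infinity>" if "A : sets borel" for A
 proof -
  have "emeasure \<mu> A <= emeasure \<mu> UNIV" using that by (intro emeasure_mono) (auto simp: \<mu>_def)
  also have "... = (\<integral>\<^sup>+z\<in>\<DD>. ennreal (v (norm z)) \<partial>lborel)"
   unfolding \<mu>_def by (subst emeasure_density) (auto simp: mult.commute)
  finally show ?thesis using int by simp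
 qed
 have lower: "ennreal pi * (\<integral>\<^sup>+s\<in>{a..<b}. ennreal (v s) \<partial>lborel) <= emeasure \<mu> {z. a <= norm z & norm z < b}"
  if "1/2 <= a" "b <= 1" for a b
 proof -
  have "ennreal pi * (\<integral>\<^sup>+s\<in>{a..<b}. ennreal (v s) \<partial>lborel) = (\<integral>\<^sup>+s\<in>{a..<b}. ennreal pi * ennreal (v s) \<partial>lborel)"
   by (subst nn_integral_cmult[symmetric]) (auto simp: mult_ac)
  also have "... <= (\<integral>\<^sup>+s\<in>{a..<b}. ennreal (2 * pi * s) * ennreal (v s) \<partial>lborel)"
   using that by (intro nn_integral_mono) (auto simp: indicator_def intro!: mult_right_mono ennreal_leI)
  finally show ?thesis using that by (simp add: ann)
 qed
 have upper: "emeasure \<mu> {z. a <= norm z & norm z < b} <= ennreal (2 * pi) * T a"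
  if "0 <= a" "b <= 1" for a b
 proof -
  have "emeasure \<mu> {z. a <= norm z & norm z < b} <= (\<integral>\<^sup>+s\<in>{a..<1}. ennreal (2 * pi) * ennreal (v s) \<partial>lborel)"
   unfolding ann[OF that] using that
   by (intro nn_integral_mono) (auto simp: indicator_def intro!: mult_right_mono ennreal_leI)
  also have "... = ennreal (2 * pi) * T a"
   unfolding T_def by (subst nn_integral_cmult[symmetric]) (auto simp: mult_ac)
  finally show ?thesis .
 qed
 \<comment> \<open>Integrability over the disk controls the tail only away from the origin, where
   the density 2 pi s is at least pi. The doubling condition at r = 0 then makes the whole tail
   finite.\<close>
 have "ennreal pi * T (1/2) <= emeasure \<mu> {z. 1/2 <= norm z & norm z < 1}"
  unfolding T_def by (rule lower) auto
 also have "... < \<infinity>" by (rule \<mu>D) measurable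
 finally have "T (1/2) < \<infinity>" by (auto simp: ennreal_mult_less_top)
 moreover have "T 0 <= ennreal C * T (1/2)" using C(2)[of 0] Tr[of 0] Tr[of "1/2"] by simp
 ultimately have "T 0 < \<infinity>" by (metis ennreal_mult_less_top infinity_ennreal_def ennreal_less_top order_le_less_trans)
 hence Tfin: "T r < \<infinity>" if "0 <= r" for r
  using order_le_less_trans[OF T_anti[OF that]] by blast
 define R where "R r = enn2real (T r)" for r
 have TR: "T r = ennreal (R r)" if "0 <= r" for r using Tfin[OF that] by (simp add: R_def)
 have R0: "0 <= R r" for r by (simp add: R_def)
 define W where "W n = R (rad n)" for n
 have TW: "T (rad n) = ennreal (W n)" for n by (simp add: W_def TR rad_nonneg)
 have R_anti: "R s <= R r" if "0 <= r" "r <= s" for r s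
 proof -
  have "ennreal (R s) <= ennreal (R r)" using T_anti[of r s] that by (simp add: TR[symmetric])
  thus ?thesis by (simp add: R0)
 qed
 have Wd: "W n <= C * W (Suc n)" for n
 proof -
  have "T (rad n) <= ennreal C * T (rad (Suc n))"
   using C(2)[of "rad n"] Tr[of "rad n"] Tr[of "rad (Suc n)"] rad_nonneg rad_less_1 by (simp add: rad_Suc)
  hence "ennreal (W n) <= ennreal (C * W (Suc n))"
   using C(1) by (simp add: TW ennreal_mult' )
  thus ?thesis using C(1) R0 by (simp add: W_def)
 qed
 \<comment> \<open>A vanishing tail would spread inward by doubling to W 0 = 0, so the weight would
   be zero almost everywhere.\<close>
 have Wn0: "W n ~= 0" for n
 proof
  assume "W n = 0"
  moreover have "W 0 <= C ^ n * W n"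
  proof (induction n)
   case (Suc n)
   have "C ^ n * W n <= C ^ n * (C * W (Suc n))" using C(1) by (intro mult_left_mono Wd) auto
   thus ?case using Suc by (simp add: mult_ac)
  qed simp
  ultimately have "W 0 = 0" using R0[of 0] by (simp add: W_def)
  hence "T 0 = 0" using TW[of 0] by simp
  hence "AE s in lborel. ennreal (v s) * indicator {0..<1} s = 0"
   unfolding T_def by (subst (asm) nn_integral_0_iff_AE) auto
  hence "AE s in lborel. 0 <= s & s < 1 --> v s = 0"
   by (rule eventually_mono) (use v0 in \<open>auto simp: indicator_def ennreal_eq_0_iff antisym split: if_splits\<close>)
  hence "AE z in lborel. z : \<DD> --> v (norm (z::complex)) = 0"
   by (rule AE_norm_lborel_disk)
  hence "AE z in lborel. z : \<DD> --> \<omega> z = 0" using aez by eventually_elim auto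
  hence "AE z in lebesgue. z : \<DD> --> \<omega> z = 0" by (rule AE_completion)
  hence "AE z in lebesgue_on \<DD>. \<omega> z = 0" by (subst AE_restrict_space_iff) auto
  thus False using rw by (simp add: radial_weight_def weight_def)
 qed
 have Wp: "0 < W n" for n using Wn0[of n] R0[of "rad n"] by (simp add: W_def)
 \<comment> \<open>The step of \<open>D_check\<close> from 1 - r to (1 - r)/K fits into L dyadic
   levels, so the tail loses a factor E every L levels.\<close>
 obtain L where L: "K < 2 ^ L" using real_arch_pow[of 2 K] by auto
 have L0: "0 < L" using L KE(1) by (cases L) auto
 have WL: "W (n + L) <= W n / E" for n
 proof -
  have "ennreal E * T (1 - (1 - rad n) / K) <= T (rad n)"
   using KE(3)[of "rad n"] Tr[of "rad n"] Tr[of "1 - (1 - rad n) / K"] KE(1) rad_nonneg[of n] rad_less_1[of n]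
   by (simp add: divide_le_eq)
  moreover have "T (rad (n + L)) <= T (1 - (1 - rad n) / K)"
  proof (rule T_anti)
   have "(1/2) ^ n / 2 ^ L <= (1/2) ^ n / K" using L KE(1) by (intro divide_left_mono) auto
   moreover have "1 - rad n = (1/2) ^ n" "rad (n + L) = 1 - (1/2) ^ n / 2 ^ L"
    by (simp_all add: rad_def power_add power_one_over)
   ultimately show "1 - (1 - rad n) / K <= rad (n + L)" by simp
  qed
  ultimately have "ennreal E * T (rad (n + L)) <= T (rad n)" by (meson mult_left_mono order_trans zero_le)
  hence "ennreal (E * W (n + L)) <= ennreal (W n)" using KE(2) by (simp add: TW ennreal_mult')
  hence "E * W (n + L) <= W n" using Wp[of n] by (simp add: less_imp_le)
  thus ?thesis using KE(2) by (simp add: field_simps)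
 qed
 have W_anti: "W (n + i) <= W n" for n i unfolding W_def by (intro R_anti rad_nonneg rad_mono) simp
 have WL': "W (n + L * i) <= W n / E ^ i" for n i
 proof (induction i)
  case (Suc i)
  have "W (n + L * Suc i) = W (n + L * i + L)" by (simp add: algebra_simps)
  also have "... <= W (n + L * i) / E" by (rule WL)
  also have "... <= W n / E ^ i / E" using Suc KE(2) by (intro divide_right_mono) auto
  finally show ?case by (simp add: mult.commute)
 qed simp
 \<comment> \<open>The loss per level; the prefactor E in \<open>Wdec\<close> pays for an incomplete
   block of L levels.\<close>
 define \<rho> where "\<rho> = E powr (- 1 / L)"
 have \<rho>: "0 < \<rho>" "\<rho> < 1"
  using KE(2) L0 powr_less_mono[of "- 1 / L" 0 E] by (auto simp: \<rho>_def)
 have Wdec: "W (n + i) <= E * \<rho> ^ i * W n" for n i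
 proof -
  have "W (n + i) = W (n + L * (i div L) + i mod L)" by (simp add: add.assoc)
  also have "... <= W (n + L * (i div L))" by (rule W_anti)
  also have "... <= W n / E ^ (i div L)" by (rule WL')
  also have "... <= E * \<rho> ^ i * W n"
  proof -
   have "real i / L <= i div L + 1"
   proof -
    have "i < L * (i div L + 1)" using L0 by (metis Suc_eq_plus1 dividend_less_times_div mult.commute mult_Suc_right add.commute)
    hence "real i < real L * (i div L + 1)" by (metis of_nat_less_iff of_nat_mult of_nat_add of_nat_1)
    thus ?thesis using L0 by (simp add: divide_le_eq mult.commute)
   qed
   hence "E powr (- real (i div L)) <= E powr (1 + - real i / L)"
    using KE(2) by (intro powr_mono) auto
   also have "... = E * \<rho> ^ i"
   proof -
    have "\<rho> ^ i = E powr (- real i / L)" using KE(2) by (simp add: \<rho>_def powr_power)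
    moreover have "E powr (1 + - real i / L) = E powr 1 * E powr (- real i / L)" by (rule powr_add)
    ultimately show ?thesis using KE(2) by simp
   qed
   finally have "1 / E ^ (i div L) <= E * \<rho> ^ i"
    using KE(2) by (simp add: powr_minus powr_realpow divide_inverse)
   hence "1 / E ^ (i div L) * W n <= E * \<rho> ^ i * W n"
    using Wp[of n] by (intro mult_right_mono) auto
   thus ?thesis by simp
  qed
  finally show ?thesis .
 qed
 \<comment> \<open>C^2 for the two levels from n to n + 2, pi as lower bound of 2 pi s for s >= 1/2,
   and 1 - 1/E for the part of the tail spent within L levels.\<close>
 define cl where "cl = C ^ 2 / (pi * (1 - 1 / E))"
 have cl: "0 < cl" using C(1) KE(2) by (simp add: cl_def)
 have Wann: "ennreal (W n) <= ennreal cl * emeasure \<mu> {z. rad (n + 2) <= norm z & norm z < rad (n + 2 + L)}" for n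
 proof -
  let ?I = "\<integral>\<^sup>+s\<in>{rad (n+2)..<rad (n+2+L)}. ennreal (v s) \<partial>lborel"
  have sp: "ennreal (W (n+2)) = ?I + ennreal (W (n+2+L))"
   using T_split[of "rad (n+2)" "rad (n+2+L)"] rad_less_1[of "n+2+L"] by (simp add: TW rad_mono)
  hence "?I = ennreal (W (n+2)) - ennreal (W (n+2+L))" by (simp add: ennreal_add_diff_cancel_right)
  also have "... = ennreal (W (n+2) - W (n+2+L))" using Wp by (simp add: ennreal_minus less_imp_le)
  finally have I: "?I = ennreal (W (n+2) - W (n+2+L))" .
  have "W n <= C * (C * W (n+2))"
   using order_trans[OF Wd[of n] mult_left_mono[OF Wd[of "Suc n"]]] C(1) by simp
  also have "... = cl * (pi * ((1 - 1/E) * W (n+2)))" using KE(2) by (simp add: cl_def power2_eq_square)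
  also have "... <= cl * (pi * (W (n+2) - W (n+2+L)))"
   using WL[of "n+2"] cl by (intro mult_left_mono) (auto simp: algebra_simps)
  finally have "ennreal (W n) <= ennreal (cl * (pi * (W (n+2) - W (n+2+L))))" by (rule ennreal_leI)
  also have "... = ennreal cl * (ennreal pi * ?I)" unfolding I using cl by (simp add: ennreal_mult')
  also have "... <= ennreal cl * emeasure \<mu> {z. rad (n + 2) <= norm z & norm z < rad (n + 2 + L)}"
   using rad_ge_half[of "n+2"] rad_less_1[of "n+2+L"] by (intro mult_left_mono lower) auto
  finally show ?thesis .
 qed
 have W_eq: "(%n. enn2real (tail \<omega> (of_real (rad n)))) = W"
  by (rule ext) (simp add: W_def R_def Tr rad_nonneg)
 show thesis
 proof (rule that)
  show "tent_measure (%n. enn2real (tail \<omega> (of_real (rad n)))) \<rho> E C \<mu> (2 * pi) cl L"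
   unfolding W_eq
  proof
   show "sets \<mu> = sets borel" by (simp add: \<mu>_def)
   show "distr \<mu> borel (%z. cis t * z) = \<mu>" for t
    unfolding \<mu>_def by (rule distr_cis_radial_density) simp
   show "emeasure \<mu> {z. rad n <= norm z & norm z < rad (Suc n)} <= ennreal (2 * pi * W n)" for n
    using upper[of "rad n" "rad (Suc n)"] rad_nonneg[of n] rad_less_1[of "Suc n"]
    by (simp add: TW ennreal_mult')
   show "emeasure \<mu> UNIV < \<infinity>" by (rule \<mu>D) simp
  qed (use Wp Wd Wdec \<rho> Wann cl in auto)
  show "(\<integral>\<^sup>+z\<in>S. ennreal (norm (f z :: complex) powr q * \<omega> z) \<partial>lebesgue) = (\<integral>\<^sup>+z\<in>S. ennreal (norm (f z) powr q) \<partial>\<mu>)"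
   if S: "S <= \<DD>" and m: "(%z. ennreal (norm (f z) powr q) * indicator S z) : borel_measurable borel" for f S q
  proof -
   have "(\<integral>\<^sup>+z\<in>S. ennreal (norm (f z) powr q * \<omega> z) \<partial>lebesgue)
     = (\<integral>\<^sup>+z. indicator \<DD> z * ennreal (v (norm z)) * (ennreal (norm (f z) powr q) * indicator S z) \<partial>lborel)"
    unfolding nn_integral_completion
    by (rule nn_integral_cong_AE, rule eventually_mono[OF aez])
      (use S v0 in \<open>auto simp: indicator_def ennreal_mult' mult.commute\<close>)
   also have "... = (\<integral>\<^sup>+z\<in>S. ennreal (norm (f z) powr q) \<partial>\<mu>)"
    unfolding \<mu>_def using m by (subst nn_integral_density) auto
   finally show ?thesis .
  qed
  show "0 < enn2real (tail \<omega> z)" if z: "z : \<DD>" for z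
  proof -
   obtain n where "norm z < rad n" using ex_rad_gt[of "norm z"] z by auto
   hence "W n <= R (norm z)" unfolding W_def by (intro R_anti) auto
   thus ?thesis using Wp[of n] by (simp add: tailT R_def)
  qed
  show "enn2real (tail \<omega> z') <= enn2real (tail \<omega> z)" if "z' : \<DD>" "norm z <= norm z'" for z z'
   using R_anti[of "norm z" "norm z'"] that by (simp add: tailT R_def)
 qed
qed

subsection \<open>Dyadic boxes of the disk\<close>

text \<open>Angles are counted in full turns from 0 to 1, so that dyadic slots are given by
  floors.\<close>

definition turn :: "complex => real" where "turn z = Arg2pi z / (2 * pi)"

definition slot :: "nat => complex => nat" where "slot n z = nat \<lfloor>2 ^ n * turn z\<rfloor>"

definition dbox :: "nat \<times> nat => complex set" where
 "dbox k = {z. rad (fst k) <= norm z & norm z < rad (Suc (fst k)) & slot (fst k) z = snd k}"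

definition tbox :: "nat \<times> nat => complex set" where
 "tbox k = {z. rad (fst k) <= norm z & norm z < 1 & slot (fst k) z = snd k}"

text \<open>The point of least modulus and least angle in the box; the kernels are anchored
  here.\<close>

definition corner :: "nat \<times> nat => complex" where
 "corner k = rcis (rad (fst k)) (2 * pi * (real (snd k) / 2 ^ fst k))"

lemma turn_ge_0 [simp]: "0 <= turn z" and turn_less_1 [simp]: "turn z < 1"
 using Arg2pi_ge_0[of z] Arg2pi_lt_2pi[of z] by (simp_all add: turn_def)

lemma turn_0 [simp]: "turn 0 = 0"
 by (simp add: turn_def)

lemma rcis_turn: "rcis (norm z) (2 * pi * turn z) = z"
 using Arg2pi_eq[of z] by (simp add: turn_def rcis_def cis_conv_exp)

lemma turn_rcis:
 assumes "0 < r" "0 <= x" "x < 1" shows "turn (rcis r (2 * pi * x)) = x"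
proof -
 have "Arg2pi (rcis r (2 * pi * x)) = 2 * pi * x"
  using assms by (intro Arg2pi_unique[of r]) (simp_all add: rcis_def cis_conv_exp)
 thus ?thesis by (simp add: turn_def)
qed

text \<open>Off 0 the angle is the imaginary part of the principal logarithm, increased by 2 pi
  where that is negative, which is a Borel expression.\<close>

lemma turn_measurable [measurable]: "turn : borel_measurable borel"
proof -
 have "turn z = (if z = 0 then 0 else if 0 <= Im (Ln z) then Im (Ln z) / (2 * pi) else Im (Ln z) / (2 * pi) + 1)" for z
 proof (cases "z = 0")
  case False
  let ?a = "if 0 <= Im (Ln z) then Im (Ln z) else Im (Ln z) + 2 * pi"
  have z: "of_real (norm z) * exp (\<i> * of_real (Im (Ln z))) = z"
  proof -
   have "exp (Ln z) = z" using False by simp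
   moreover have "Ln z = of_real (ln (norm z)) + \<i> * of_real (Im (Ln z))"
    using False by (simp add: complex_eq_iff Re_Ln)
   ultimately show ?thesis using False
    by (metis exp_add exp_ln exp_of_real norm_le_zero_iff not_le)
  qed
  have per: "exp (\<i> * (of_real x + 2 * of_real pi)) = exp (\<i> * of_real x)" for x
  proof -
   have "exp (\<i> * (of_real x + 2 * of_real pi)) = exp (\<i> * of_real x) * exp (2 * of_real pi * \<i>)"
    unfolding exp_add[symmetric] by (simp add: algebra_simps)
   thus ?thesis unfolding exp_two_pi_i by simp
  qed
  have "Arg2pi z = ?a"
  proof (rule Arg2pi_unique[of "norm z"])
   show "of_real (norm z) * exp (\<i> * of_real ?a) = z" using z per by simp
   show "0 <= ?a" "?a < 2 * pi"
    using False mpi_less_Im_Ln[of z] Im_Ln_le_pi[of z] pi_gt_zero by (auto simp del: pi_gt_zero)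
  qed (use False in simp)
  thus ?thesis using False by (simp add: turn_def add_divide_distrib)
 qed simp
 hence "turn = (%z. if z = 0 then 0 else if 0 <= Im (Ln z) then Im (Ln z) / (2 * pi) else Im (Ln z) / (2 * pi) + 1)"
  by (rule ext)
 thus ?thesis by (rule ssubst) measurable
qed

lemma slot_eq_iff: "slot n z = j \<longleftrightarrow> real j <= 2 ^ n * turn z & 2 ^ n * turn z < real j + 1"
proof -
 have "slot n z = j \<longleftrightarrow> \<lfloor>2 ^ n * turn z\<rfloor> = int j"
  unfolding slot_def by (simp add: nat_eq_iff)
 thus ?thesis by (simp add: floor_eq_iff)
qed

lemma slot_bounds: "real (slot n z) <= 2 ^ n * turn z" "2 ^ n * turn z < real (slot n z) + 1"
 using slot_eq_iff[of n z "slot n z"] by auto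

lemma slot_less: "slot n z < 2 ^ n"
proof -
 have "2 ^ n * turn z < 2 ^ n * 1" by (intro mult_strict_left_mono) auto
 hence "real (slot n z) < 2 ^ n" using slot_bounds[of n z] by linarith
 thus ?thesis by (metis of_nat_less_iff of_nat_numeral of_nat_power)
qed

text \<open>Passing to an ancestor deletes the last n - l binary digits of the slot number.\<close>

lemma slot_div: assumes "l <= n" shows "slot n z div 2 ^ (n - l) = slot l z"
proof -
 define d where "d = (2::nat) ^ (n - l)"
 define j where "j = slot n z"
 have n: "(2::real) ^ n = 2 ^ l * real d" using assms by (simp add: d_def power_add[symmetric])
 have d: "0 < real d" by (simp add: d_def)
 have "j div d * d <= j" by simp
 hence "real (j div d) * real d <= real j" by (metis of_nat_le_iff of_nat_mult)
 hence "real (j div d) * real d <= 2 ^ l * turn z * real d"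
  using slot_bounds(1)[of n z] by (simp add: n mult_ac j_def)
 hence 1: "real (j div d) <= 2 ^ l * turn z" using d by (rule mult_right_le_imp_le)
 have "j < (j div d + 1) * d" using dividend_less_div_times[of d j] d by simp
 hence "j + 1 <= (j div d + 1) * d" by simp
 hence "real j + 1 <= (real (j div d) + 1) * real d"
  by (metis of_nat_le_iff of_nat_mult of_nat_add of_nat_1)
 hence "2 ^ l * turn z * real d < (real (j div d) + 1) * real d"
  using slot_bounds(2)[of n z] by (simp add: n mult_ac j_def)
 hence 2: "2 ^ l * turn z < real (j div d) + 1" using d by (rule mult_right_less_imp_less[OF _ less_imp_le])
 have "slot l z = j div d" using 1 2 by (simp add: slot_eq_iff)
 thus ?thesis by (simp add: j_def d_def)
qed

lemma slot_0 [simp]: "slot 0 z = 0"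
 using slot_less[of 0 z] by simp

lemma dbox_node: "z : dbox k ==> node k"
 using slot_less[of "fst k" z] by (auto simp: dbox_def node_def)

lemma tbox_node: "z : tbox k ==> node k"
 using slot_less[of "fst k" z] by (auto simp: tbox_def node_def)

lemma slot_anc: "z : dbox k ==> l <= fst k ==> snd (anc l k) = slot l z"
 using slot_div[of l "fst k" z] by (auto simp: dbox_def anc_def)

lemma dbox_anc: "z : dbox k ==> l <= fst k ==> z : tbox (anc l k)"
 using slot_anc[of z k l] rad_mono[of l "fst k"] rad_less_1[of "Suc (fst k)"] by (auto simp: dbox_def tbox_def)

lemma dbox_subset_tbox: "below k K ==> dbox k <= tbox K"
 using dbox_anc[of _ k "fst K"] by (auto simp: below_def)

lemma dbox_subset_disk: "z : dbox k ==> norm z < 1"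
 using rad_less_1[of "Suc (fst k)"] by (auto simp: dbox_def)

lemma ex_level: assumes "0 <= r" "r < 1" obtains n where "rad n <= r" "r < rad (Suc n)"
proof -
 define n where "n = (LEAST n. r < rad n)"
 have n: "r < rad n" unfolding n_def using ex_rad_gt[OF assms(2)] by (rule LeastI_ex)
 then obtain m where m: "n = Suc m" using assms by (cases n) auto
 hence "~ r < rad m" unfolding n_def using not_less_Least[of m "%n. r < rad n"] by (metis lessI n_def)
 thus thesis using that[of m] n m by simp
qed

lemma ex_dbox: assumes "norm z < 1" obtains k where "node k" "z : dbox k"
proof -
 obtain n where "rad n <= norm z" "norm z < rad (Suc n)" using ex_level[of "norm z"] assms by auto
 hence "z : dbox (n, slot n z)" by (simp add: dbox_def)
 thus thesis using that dbox_node by blast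
qed

lemma level_unique: "rad m <= r ==> r < rad (Suc m) ==> rad n <= r ==> r < rad (Suc n) ==> m = n"
 using rad_mono[of "Suc m" n] rad_mono[of "Suc n" m] by (cases m n rule: linorder_cases) auto

lemma dbox_unique: "z : dbox k ==> z : dbox k' ==> k = k'"
 using level_unique[of "fst k" "norm z" "fst k'"] by (auto simp: dbox_def prod_eq_iff)

lemma tbox_ex_dbox: assumes "z : tbox K" obtains k where "node k" "below k K" "z : dbox k"
proof -
 obtain k where k: "node k" "z : dbox k" using ex_dbox assms unfolding tbox_def by blast
 have le: "fst K <= fst k"
 proof (rule ccontr)
  assume "~ fst K <= fst k"
  hence "rad (Suc (fst k)) <= rad (fst K)" by (intro rad_mono) simp
  thus False using k assms by (auto simp: dbox_def tbox_def)
 qed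
 have "anc (fst K) k = K" using slot_anc[OF k(2) le] assms by (auto simp: tbox_def prod_eq_iff)
 thus thesis using that k le by (auto simp: below_def)
qed

lemma norm_corner [simp]: "norm (corner k) = rad (fst k)"
 using rad_nonneg[of "fst k"] by (simp add: corner_def rcis_def norm_mult)

lemma turn_corner: assumes "node k" shows "turn (corner k) = real (snd k) / 2 ^ fst k"
proof (cases "fst k = 0")
 case True
 thus ?thesis using assms by (simp add: node_def corner_def)
next
 case False
 have "real (snd k) < 2 ^ fst k" using assms unfolding node_def by (metis of_nat_less_iff of_nat_numeral of_nat_power)
 thus ?thesis unfolding corner_def using False rad_ge_half[of "fst k"]
  by (intro turn_rcis) (auto simp: field_simps)
qed

lemma corner_in_dbox: "node k ==> corner k : dbox k"
 by (simp add: dbox_def turn_corner slot_eq_iff rad_strict_mono)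

section \<open>Separation of boxes and size of the kernels\<close>

text \<open>|z - w| and |1 - conj w z| differ only in the radial term; since the angular term is
  shared, separation in angle bounds both from below.\<close>

lemma norm_diff_rcis:
 "(norm (rcis r a - rcis s b))\<^sup>2 = (r - s)\<^sup>2 + r * s * (2 * sin ((a - b) / 2))\<^sup>2"
 "(norm (1 - cnj (rcis s b) * rcis r a))\<^sup>2 = (1 - r * s)\<^sup>2 + r * s * (2 * sin ((a - b) / 2))\<^sup>2"
proof -
 have s: "(2 * sin ((a - b) / 2))\<^sup>2 = 2 - 2 * cos (a - b)"
 proof -
  define x where "x = (a - b) / 2"
  have "a - b = 2 * x" by (simp add: x_def)
  thus ?thesis by (simp add: cos_double_sin power_mult_distrib)
 qed
 have c: "cos (a - b) = cos a * cos b + sin a * sin b" by (rule cos_diff)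
 have "(r * cos a - s * cos b)\<^sup>2 + (r * sin a - s * sin b)\<^sup>2 = r\<^sup>2 + s\<^sup>2 - 2 * r * s * (cos a * cos b + sin a * sin b)"
 proof -
  have "(r * ca - s * cb)\<^sup>2 + (r * sa - s * sb)\<^sup>2
    = r\<^sup>2 * (ca\<^sup>2 + sa\<^sup>2) + s\<^sup>2 * (cb\<^sup>2 + sb\<^sup>2) - 2 * r * s * (ca * cb + sa * sb)" for ca cb sa sb
   by (simp add: power2_eq_square algebra_simps)
  from this[of "cos a" "cos b" "sin a" "sin b"]
  show ?thesis by simp
 qed
 thus "(norm (rcis r a - rcis s b))\<^sup>2 = (r - s)\<^sup>2 + r * s * (2 * sin ((a - b) / 2))\<^sup>2"
  unfolding s c cmod_power2 by (simp add: rcis_def) (simp add: power2_eq_square algebra_simps)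
 have "cnj (rcis s b) * rcis r a = rcis (s * r) (a - b)"
  by (simp add: rcis_def cis_cnj cis_mult)
 thus "(norm (1 - cnj (rcis s b) * rcis r a))\<^sup>2 = (1 - r * s)\<^sup>2 + r * s * (2 * sin ((a - b) / 2))\<^sup>2"
 proof -
  assume cr: "cnj (rcis s b) * rcis r a = rcis (s * r) (a - b)"
  have "(1 - x * c)\<^sup>2 + (x * d)\<^sup>2 = 1 - 2 * x * c + x\<^sup>2 * (c\<^sup>2 + d\<^sup>2)" for x c d :: real
   by (simp add: power2_eq_square algebra_simps)
  from this[of "s * r" "cos (a - b)" "sin (a - b)"]
  have "(1 - s * r * cos (a - b))\<^sup>2 + (s * r * sin (a - b))\<^sup>2 = 1 - 2 * (s * r) * cos (a - b) + (s * r)\<^sup>2"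
   by simp
  moreover have "1 - 2 * (s * r) * x + (s * r)\<^sup>2 = (1 - r * s)\<^sup>2 + r * s * (2 - 2 * x)" for x
   by (simp add: power2_eq_square algebra_simps)
  ultimately have "(1 - s * r * cos (a - b))\<^sup>2 + (s * r * sin (a - b))\<^sup>2 = (1 - r * s)\<^sup>2 + r * s * (2 - 2 * cos (a - b))"
   by (rule trans)
  thus ?thesis unfolding s cr cmod_power2 by (simp add: rcis_def)
 qed
qed

text \<open>A weak Jordan inequality: up to pi/3 the derivative of sin x - x/3 is positive as cos x
  >= 1/2; beyond pi/3 the sine is at least 2/3, which exceeds x/3.\<close>

lemma sin_ge_third: assumes "0 <= x" "x <= pi / 2" shows "x / 3 <= sin x"
proof (cases "x <= pi / 3")
 case True
 have "(%x. sin x - x / 3) 0 <= (%x. sin x - x / 3) x"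
 proof (rule DERIV_nonneg_imp_nondecreasing[OF assms(1)])
  fix y assume y: "0 <= y" "y <= x"
  have "cos (pi / 3) <= cos y" using y True by (intro cos_monotone_0_pi_le) auto
  hence "0 <= cos y - 1 / 3" by (simp add: cos_60)
  moreover have "((%x. sin x - x / 3) has_real_derivative cos y - 1 / 3) (at y)"
   by (auto intro!: derivative_eq_intros)
  ultimately show "\<exists>d. ((%x. sin x - x / 3) has_real_derivative d) (at y) & 0 <= d" by blast
 qed
 thus ?thesis by simp
next
 case False
 have "4 / 3 <= sqrt 3" by (rule real_le_rsqrt) (simp add: power2_eq_square)
 hence "2 / 3 <= sin (pi / 3)" by (simp add: sin_60)
 also have "... <= sin x" using False assms by (intro sin_monotone_2pi_le) auto
 finally show ?thesis using assms pi_less_4 by simp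
qed

lemma sin_pi_sq_ge:
 assumes "0 <= \<delta>" "\<delta> <= \<bar>d\<bar>" "\<bar>d\<bar> <= 1 - \<delta>"
 shows "(4 / 3 * \<delta>)\<^sup>2 <= (2 * sin (pi * d))\<^sup>2"
proof -
 define m where "m = min \<bar>d\<bar> (1 - \<bar>d\<bar>)"
 have m: "\<delta> <= m" "0 <= m" "m <= 1/2" using assms unfolding m_def by linarith+
 have "\<bar>sin (pi * d)\<bar> = sin (pi * m)"
 proof -
  have "\<bar>sin (pi * d)\<bar> = \<bar>sin (pi * \<bar>d\<bar>)\<bar>" by (cases "0 <= d") auto
  also have "... = \<bar>sin (pi * m)\<bar>"
  proof (cases "\<bar>d\<bar> <= 1 - \<bar>d\<bar>")
   case False
   have "sin (pi * (1 - \<bar>d\<bar>)) = sin (pi * \<bar>d\<bar>)" by (simp add: right_diff_distrib)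
   thus ?thesis using False by (simp add: m_def min_def)
  qed (simp add: m_def min_def)
  also have "... = sin (pi * m)"
   using m pi_gt_zero by (intro abs_of_nonneg sin_ge_zero) (auto simp: mult_le_cancel_left1)
  finally show ?thesis .
 qed
 moreover have "pi * m / 3 <= sin (pi * m)" using m by (intro sin_ge_third) auto
 moreover have "2 * \<delta> / 3 <= pi * m / 3"
  using m pi_ge_two assms by (intro divide_right_mono mult_mono) auto
 ultimately have "4 / 3 * \<delta> <= \<bar>2 * sin (pi * d)\<bar>" by (simp add: abs_mult)
 thus ?thesis using assms(1) by (metis abs_le_square_iff abs_of_nonneg mult_nonneg_nonneg divide_nonneg_nonneg zero_le_numeral)
qed

text \<open>Between non-adjacent slots at least one full slot lies on either side of the circle,
  which keeps the difference in turns away from both 0 and 1.\<close>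

lemma turn_diff_nonadj:
 assumes "~ adj l (slot l z) (slot l w)"
 shows "1 / 2 ^ l <= \<bar>turn z - turn w\<bar> & \<bar>turn z - turn w\<bar> <= 1 - 1 / 2 ^ l"
proof -
 have *: "1 / 2 ^ l <= turn w - turn z & turn w - turn z <= 1 - 1 / 2 ^ l"
  if na: "~ adj l (slot l z) (slot l w)" and lt: "slot l z < slot l w" for z w
 proof -
  have 1: "slot l z + 2 <= slot l w"
  proof (rule ccontr)
   assume "~ ?thesis"
   hence "slot l w = slot l z + 1" using lt by simp
   hence "slot l w = (slot l z + 1) mod 2 ^ l" using slot_less[of l w] by simp
   thus False using na by (simp add: adj_def)
  qed
  have 2: "slot l w + 2 <= slot l z + 2 ^ l"
  proof (rule ccontr)
   assume "~ ?thesis"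
   hence "slot l w + 1 = 2 ^ l & slot l z = 0" using slot_less[of l w] by linarith
   hence "slot l z = (slot l w + 1) mod 2 ^ l" by simp
   thus False using na by (simp add: adj_def)
  qed
  have "real (slot l z) + 2 <= real (slot l w)" "real (slot l w) + 2 <= real (slot l z) + 2 ^ l"
   using of_nat_mono[OF 1, where 'a=real] of_nat_mono[OF 2, where 'a=real] by simp_all
  hence "1 <= 2 ^ l * (turn w - turn z)" "2 ^ l * (turn w - turn z) <= 2 ^ l - 1"
   using slot_bounds[of l z] slot_bounds[of l w] by (simp_all add: right_diff_distrib)
  thus ?thesis by (simp add: field_simps)
 qed
 have ne: "slot l z ~= slot l w" using assms by (auto simp: adj_def)
 show ?thesis
 proof (cases "slot l z < slot l w")
  case True
  from *[OF assms this] show ?thesis by (simp add: abs_if)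
 next
  case False
  hence "slot l w < slot l z" using ne by simp
  moreover have "~ adj l (slot l w) (slot l z)" using assms adj_sym by blast
  ultimately have "1 / 2 ^ l <= turn z - turn w & turn z - turn w <= 1 - 1 / 2 ^ l" using * by blast
  moreover have "0 < 1 / (2::real) ^ l" by simp
  ultimately show ?thesis by linarith
 qed
qed

text \<open>Moduli at least 1/2 put a factor 1/4 in front of the squared angular term; its root 1/2
  times the 4/3 of \<open>sin_pi_sq_ge\<close> is 2/3.\<close>

lemma nonadj_separation:
 assumes "~ adj l (slot l z) (slot l w)" "1/2 <= norm z" "1/2 <= norm w"
 shows "2 / 3 * (1/2) ^ l <= norm (z - w)" "2 / 3 * (1/2) ^ l <= norm (1 - cnj w * z)"
proof -
 let ?d = "turn z - turn w"
 have z: "z = rcis (norm z) (2 * pi * turn z)" "w = rcis (norm w) (2 * pi * turn w)"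
  by (simp_all add: rcis_turn)
 have half: "(2 * pi * turn z - 2 * pi * turn w) / 2 = pi * ?d" by (simp add: field_simps)
 have s1: "(4 / 3 * (1 / 2 ^ l))\<^sup>2 <= (2 * sin (pi * ?d))\<^sup>2"
  using turn_diff_nonadj[OF assms(1)] by (intro sin_pi_sq_ge) auto
 have s2: "1/2 * (1/2) <= norm z * norm w" using assms by (intro mult_mono) auto
 have S: "1/2 * (1/2) * (4 / 3 * (1 / 2 ^ l))\<^sup>2 <= norm z * norm w * (2 * sin (pi * ?d))\<^sup>2"
  by (rule mult_mono[OF s2 s1]) auto
 have eq: "(2 / 3 * (1/2) ^ l)\<^sup>2 = 1/2 * (1/2) * (4 / 3 * (1 / 2 ^ l :: real))\<^sup>2"
  by (simp add: power_one_over power2_eq_square field_simps)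
 have "(norm (z - w))\<^sup>2 = (norm z - norm w)\<^sup>2 + norm z * norm w * (2 * sin (pi * ?d))\<^sup>2"
  using norm_diff_rcis(1)[of "norm z" "2 * pi * turn z" "norm w" "2 * pi * turn w"]
  unfolding half by (simp add: rcis_turn)
 hence "(2 / 3 * (1/2) ^ l)\<^sup>2 <= (norm (z - w))\<^sup>2"
  unfolding eq using S zero_le_power2[of "norm z - norm w"] by linarith
 thus "2 / 3 * (1/2) ^ l <= norm (z - w)" by (rule power2_le_imp_le) simp
 have "(norm (1 - cnj w * z))\<^sup>2 = (1 - norm z * norm w)\<^sup>2 + norm z * norm w * (2 * sin (pi * ?d))\<^sup>2"
  using norm_diff_rcis(2)[of "norm w" "2 * pi * turn w" "norm z" "2 * pi * turn z"]
  unfolding half by (simp add: rcis_turn)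
 hence "(2 / 3 * (1/2) ^ l)\<^sup>2 <= (norm (1 - cnj w * z))\<^sup>2"
  unfolding eq using S zero_le_power2[of "1 - norm z * norm w"] by linarith
 thus "2 / 3 * (1/2) ^ l <= norm (1 - cnj w * z)" by (rule power2_le_imp_le) simp
qed

lemma norm_one_minus_ge:
 fixes z w :: complex
 assumes "norm w <= 1" "norm z <= 1"
 shows "1 - norm w <= norm (1 - cnj w * z)" "1 - norm z <= norm (1 - cnj w * z)"
proof -
 have "1 - norm w * norm z <= norm (1 - cnj w * z)"
  using norm_triangle_ineq2[of 1 "cnj w * z"] by (simp add: norm_mult)
 moreover have "norm w * norm z <= norm w * 1" "norm w * norm z <= 1 * norm z"
  using assms by (intro mult_left_mono mult_right_mono; simp)+
 ultimately show "1 - norm w <= norm (1 - cnj w * z)" "1 - norm z <= norm (1 - cnj w * z)" by simp_all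
qed

text \<open>If \<open>prox\<close> is the level of one of the two nodes, the distance of the
  corresponding point from the circle suffices. Otherwise the ancestors one level deeper are not
  adjacent, and their angular separation applies.\<close>

lemma kernel_upper:
 assumes j: "node j" and z: "z : dbox k"
 shows "(1/2) ^ fst j <= 4 * (1/2) ^ (fst j - prox j k) * norm (1 - cnj (corner j) * z)"
proof -
 have k: "node k" using z by (rule dbox_node)
 define l where "l = prox j k"
 have l: "near l j k" unfolding l_def using prox_near j k .
 hence le: "l <= fst j" "l <= fst k" by (auto simp: near_def)
 have rw: "norm (corner j) <= 1" "norm z <= 1" using rad_less_1[of "fst j"] dbox_subset_disk[OF z] by auto
 have pw: "(1/2::real) ^ fst j = (1/2) ^ (fst j - l) * (1/2) ^ l"
  using le by (simp add: power_add[symmetric])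
 have "(1/2) ^ l <= 4 * norm (1 - cnj (corner j) * z)"
 proof (cases "l = fst j \<or> l = fst k")
  case True
  thus ?thesis
  proof
   assume "l = fst j"
   hence "(1/2) ^ l = 1 - norm (corner j)" by (simp add: rad_def)
   thus ?thesis using norm_one_minus_ge(1)[OF rw] norm_ge_zero[of "1 - cnj (corner j) * z"] by linarith
  next
   assume "l = fst k"
   hence "norm z < 1 - (1/2) ^ l / 2" using z by (simp add: dbox_def rad_def)
   thus ?thesis
    using norm_one_minus_ge(2)[OF rw] norm_ge_zero[of "1 - cnj (corner j) * z"] by linarith
  qed
 next
  case False
  hence lt: "Suc l <= fst j" "Suc l <= fst k" using le by auto
  have "~ near (Suc l) j k" using prox_ge[of "Suc l" j k] by (auto simp: l_def)
  hence "~ adj (Suc l) (slot (Suc l) (corner j)) (slot (Suc l) z)"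
   using lt slot_anc[OF corner_in_dbox[OF j] lt(1)] slot_anc[OF z lt(2)] by (simp add: near_def)
  hence na: "~ adj (Suc l) (slot (Suc l) z) (slot (Suc l) (corner j))" using adj_sym by blast
  have "1/2 <= norm (corner j)" "1/2 <= norm z"
   using rad_ge_half[of "fst j"] rad_ge_half[of "fst k"] lt z by (auto simp: dbox_def)
  from nonadj_separation(2)[OF na this(2,1)]
  have "2 / 3 * (1/2) ^ Suc l <= norm (1 - cnj (corner j) * z)" .
  hence "(1/2) ^ l <= 3 * norm (1 - cnj (corner j) * z)" by simp
  thus ?thesis using norm_ge_zero[of "1 - cnj (corner j) * z"] by linarith
 qed
 hence "(1/2) ^ (fst j - l) * (1/2) ^ l <= (1/2) ^ (fst j - l) * (4 * norm (1 - cnj (corner j) * z))"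
  by (intro mult_left_mono) auto
 thus ?thesis unfolding pw by (simp add: l_def mult_ac)
qed

text \<open>The radial term is at most 2 * 2^(-N); the angular one is at most 2 pi 2^(-N), rounded
  up to 8 * 2^(-N).\<close>

lemma kernel_lower:
 assumes z: "z : tbox K"
 shows "norm (1 - cnj (corner K) * z) <= 10 * (1/2) ^ fst K"
proof -
 have K: "node K" using z by (rule tbox_node)
 let ?N = "fst K" and ?a = "corner K"
 let ?d = "turn z - turn ?a"
 have half: "(2 * pi * turn z - 2 * pi * turn ?a) / 2 = pi * ?d" by (simp add: field_simps)
 define A where "A = 1 - norm z * norm ?a"
 have r: "rad ?N <= norm z" "norm z < 1" using z by (auto simp: tbox_def)
 have A: "0 <= A" "A <= 2 * (1/2) ^ ?N"
 proof -
  have "norm z * norm ?a <= 1 * 1" using r rad_less_1[of ?N] rad_nonneg[of ?N] by (intro mult_mono) auto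
  thus "0 <= A" by (simp add: A_def)
  have "rad ?N * rad ?N <= norm z * norm ?a" using r rad_nonneg[of ?N] by (intro mult_mono) auto
  moreover have "rad ?N * rad ?N = 1 - 2 * (1/2) ^ ?N + (1/2) ^ ?N * (1/2) ^ ?N"
   by (simp add: rad_def algebra_simps)
  moreover have "(0::real) <= (1/2) ^ ?N * (1/2) ^ ?N" by simp
  ultimately show "A <= 2 * (1/2) ^ ?N" unfolding A_def by linarith
 qed
 have d: "\<bar>?d\<bar> <= (1/2) ^ ?N"
 proof -
  have "slot ?N z = snd K" using z by (simp add: tbox_def)
  hence "real (snd K) <= 2 ^ ?N * turn z" "2 ^ ?N * turn z < real (snd K) + 1"
   using slot_bounds[of ?N z] by auto
  hence "turn z < (real (snd K) + 1) / 2 ^ ?N" "real (snd K) / 2 ^ ?N <= turn z"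
   by (simp_all add: pos_less_divide_eq pos_divide_le_eq mult.commute)
  hence "0 <= ?d" "?d <= 1 / 2 ^ ?N" by (simp_all add: turn_corner[OF K] add_divide_distrib)
  thus ?thesis by (simp add: power_one_over)
 qed
 have s: "\<bar>2 * sin (pi * ?d)\<bar> <= 8 * (1/2) ^ ?N"
 proof -
  have "\<bar>sin (pi * ?d)\<bar> <= pi * \<bar>?d\<bar>" using abs_sin_x_le_abs_x[of "pi * ?d"] by (simp add: abs_mult)
  also have "... <= 4 * (1/2) ^ ?N" using d pi_less_4 by (intro mult_mono) auto
  finally show ?thesis by (simp add: abs_mult)
 qed
 have "(norm (1 - cnj ?a * z))\<^sup>2 = A\<^sup>2 + norm z * norm ?a * (2 * sin (pi * ?d))\<^sup>2"
  using norm_diff_rcis(2)[of "norm ?a" "2 * pi * turn ?a" "norm z" "2 * pi * turn z"]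
  unfolding half by (simp add: rcis_turn[of z] rcis_turn[of ?a, simplified] A_def)
 also have "... <= A\<^sup>2 + 1 * (2 * sin (pi * ?d))\<^sup>2"
 proof -
  have "norm z * norm ?a <= 1 * 1" using r rad_less_1[of ?N] rad_nonneg[of ?N] by (intro mult_mono) auto
  thus ?thesis by (intro add_left_mono mult_right_mono) auto
 qed
 also have "... <= (A + \<bar>2 * sin (pi * ?d)\<bar>)\<^sup>2"
  using A by (simp add: power2_eq_square algebra_simps)
 finally have "norm (1 - cnj ?a * z) <= A + \<bar>2 * sin (pi * ?d)\<bar>"
  by (rule power2_le_imp_le) (use A in simp)
 thus ?thesis using A s by linarith
qed

text \<open>Points of non-adjacent boxes are (2/3) 2^(-n) apart, more than twice 2^(-(n+2)). Hence
  all boxes that come so close to z are neighbours of any one of them.\<close>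

lemma overlap_card:
 assumes J: "finite J" "!!j. j : J ==> \<zeta> j : dbox (n, j)" "!!j. j : J ==> norm (z - \<zeta> j) <= (1/2) ^ (n + 2)"
 shows "card J <= 3"
proof (cases "J = {}")
 case False
 then obtain i where i: "i : J" by auto
 have nodeJ: "node (n, j)" if "j : J" for j using dbox_node[OF J(2)[OF that]] .
 have "adj n j i" if j: "j : J" for j
 proof (cases "n = 0")
  case True
  thus ?thesis using nodeJ[OF j] nodeJ[OF i] by (simp add: node_def adj_def)
 next
  case False
  show ?thesis
  proof (rule ccontr)
   assume "~ ?thesis"
   hence "~ adj n (slot n (\<zeta> j)) (slot n (\<zeta> i))" using J(2)[OF j] J(2)[OF i] by (simp add: dbox_def)
   moreover have "1/2 <= norm (\<zeta> j)" "1/2 <= norm (\<zeta> i)"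
    using J(2)[OF j] J(2)[OF i] rad_ge_half[of n] False by (auto simp: dbox_def)
   ultimately have "2 / 3 * (1/2) ^ n <= norm (\<zeta> j - \<zeta> i)" by (rule nonadj_separation)
   also have "... <= norm (z - \<zeta> j) + norm (z - \<zeta> i)"
    by (metis add.commute dist_norm dist_triangle2 norm_minus_commute)
   also have "... <= (1/2) ^ (n + 2) + (1/2) ^ (n + 2)" by (intro add_mono J j i)
   finally have "2 / 3 * (1/2::real) ^ n <= 1 / 2 * (1/2) ^ n" by (simp add: power_add)
   moreover have "(0::real) < (1/2) ^ n" by simp
   ultimately show False by simp
  qed
 qed
 hence "Pair n ` J <= nbrs (n, i)" using nodeJ by (auto simp: nbrs_def)
 hence "card (Pair n ` J) <= card (nbrs (n, i))" by (intro card_mono) auto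
 thus ?thesis using card_nbrs[of "(n, i)"] by (simp add: card_image inj_on_def)
qed simp

lemma slot_measurable [measurable]: "slot n : measurable borel (count_space UNIV)"
 unfolding slot_def by measurable

lemma dbox_measurable [measurable]: "dbox k : sets borel"
 unfolding dbox_def by measurable

lemma tbox_measurable [measurable]: "tbox k : sets borel"
 unfolding tbox_def by measurable

section \<open>Carleson squares against dyadic tents\<close>

lemma carleson_square_subset: "carleson_square a <= \<DD>"
 by (auto simp: carleson_square_def rcis_def norm_mult)
   (metis abs_of_nonneg norm_ge_zero order_trans)

text \<open>The image of a closed polar rectangle is compact, and the square is that image cut with
  the open disk.\<close>

lemma carleson_square_measurable [measurable]: "carleson_square a : sets borel"
proof (cases "a = 0")
 case False
 let ?R = "cbox (norm a, Arg a - (1 - norm a) / 2) (1, Arg a + (1 - norm a) / 2)"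
 have "carleson_square a = (%p. rcis (fst p) (snd p)) ` ?R Int \<DD>"
 proof (rule set_eqI)
  fix z
  have "norm (rcis \<rho> t) = \<rho>" if "norm a <= \<rho>" for \<rho> t
   using order_trans[OF norm_ge_zero that] by (simp add: rcis_def norm_mult)
  hence nr: "norm (rcis \<rho> t) = \<rho>" if "norm a <= \<rho>" for \<rho> t using that by blast
  have iff: "\<bar>t - Arg a\<bar> <= (1 - norm a) / 2 \<longleftrightarrow> Arg a - (1 - norm a) / 2 <= t & t <= Arg a + (1 - norm a) / 2" for t
   by linarith
  show "z : carleson_square a \<longleftrightarrow> z : (%p. rcis (fst p) (snd p)) ` ?R Int \<DD>"
  proof
   assume "z : carleson_square a"
   then obtain \<rho> t where z: "z = rcis \<rho> t" "norm a <= \<rho>" "\<rho> < 1" "\<bar>t - Arg a\<bar> <= (1 - norm a) / 2"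
    using False by (auto simp: carleson_square_def)
   moreover have "Arg a - (1 - norm a) / 2 <= t & t <= Arg a + (1 - norm a) / 2"
    using z(4) iff by blast
   ultimately have "(\<rho>, t) : ?R" by (simp add: cbox_Pair_eq)
   hence "z : (%p. rcis (fst p) (snd p)) ` ?R" using z(1) by (intro image_eqI[of _ _ "(\<rho>, t)"]) simp_all
   thus "z : (%p. rcis (fst p) (snd p)) ` ?R Int \<DD>" using nr z by simp
  next
   assume "z : (%p. rcis (fst p) (snd p)) ` ?R Int \<DD>"
   then obtain p where p: "p : ?R" "z = rcis (fst p) (snd p)" "norm z < 1" by auto
   from p(1) have "norm a <= fst p" "Arg a - (1 - norm a) / 2 <= snd p & snd p <= Arg a + (1 - norm a) / 2"
    by (cases p, simp add: cbox_Pair_eq)+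
   hence "norm a <= fst p" "\<bar>snd p - Arg a\<bar> <= (1 - norm a) / 2" using iff by blast+
   moreover have "fst p < 1" using nr[OF \<open>norm a <= fst p\<close>, of "snd p"] p by simp
   ultimately show "z : carleson_square a" using False p(2) by (auto simp: carleson_square_def)
  qed
 qed
 moreover have "compact ((%p. rcis (fst p) (snd p)) ` ?R)"
  unfolding rcis_def cis_conv_exp by (intro compact_continuous_image continuous_intros compact_cbox)
 ultimately show ?thesis by (simp only:) (intro sets.Int borel_compact disk_measurable)
qed (simp add: carleson_square_def)

lemma slot_rcis:
 assumes "0 < r" shows "int (slot n (rcis r t)) = \<lfloor>2 ^ n * (t / (2 * pi))\<rfloor> mod 2 ^ n"
proof -
 define x where "x = t / (2 * pi)"
 have "rcis r t = rcis r (2 * pi * frac x)"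
 proof -
  have "t = 2 * pi * frac x + 2 * pi * of_int \<lfloor>x\<rfloor>" by (simp add: frac_def x_def algebra_simps)
  hence "cis t = cis (2 * pi * frac x) * cis (2 * pi * of_int \<lfloor>x\<rfloor>)" by (metis cis_mult)
  also have "cis (2 * pi * of_int \<lfloor>x\<rfloor>) = 1" by (rule cis_multiple_2pi) simp
  finally show ?thesis by (simp add: rcis_def)
 qed
 hence tu: "turn (rcis r t) = frac x" using turn_rcis[OF assms] by (simp add: frac_ge_0 frac_lt_1)
 have "2 ^ n * frac x = 2 ^ n * x - of_int (2 ^ n * \<lfloor>x\<rfloor>)" by (simp add: frac_def right_diff_distrib)
 hence "\<lfloor>2 ^ n * frac x\<rfloor> = \<lfloor>2 ^ n * x\<rfloor> - 2 ^ n * \<lfloor>x\<rfloor>" by (simp only: floor_diff_of_int)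
 moreover have "0 <= \<lfloor>2 ^ n * frac x\<rfloor>" by (simp add: frac_ge_0)
 moreover have "\<lfloor>2 ^ n * frac x\<rfloor> < 2 ^ n"
 proof -
  have "2 ^ n * frac x < 2 ^ n * 1" by (intro mult_strict_left_mono) (auto simp: frac_lt_1)
  thus ?thesis by (simp add: floor_less_iff)
 qed
 ultimately have "\<lfloor>2 ^ n * x\<rfloor> mod 2 ^ n = \<lfloor>2 ^ n * frac x\<rfloor>"
  by (metis add_diff_cancel_left' diff_add_cancel mod_mult_self2 mod_pos_pos_trivial add.commute)
 thus ?thesis using tu \<open>0 <= \<lfloor>2 ^ n * frac x\<rfloor>\<close> by (simp add: slot_def x_def)
qed

text \<open>In turns the square is (1 - |a|)/(2 pi) wide, less than one slot of level N, so it meets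
  at most two consecutive slots. Indices are reduced modulo 2^N for squares that cross angle
  0.\<close>

lemma carleson_square_cover:
 assumes "rad N <= norm a" "norm a < rad (Suc N)"
 obtains J J' where "node (N, J)" "node (N, J')" "carleson_square a <= tbox (N, J) Un tbox (N, J')"
proof (cases "a = 0")
 case True
 have "0 < rad N" if "N ~= 0" using rad_strict_mono[of 0 N] that by simp
 hence "N = 0" using True assms by fastforce
 hence "carleson_square a <= tbox (N, 0) Un tbox (N, 0)"
  using True by (auto simp: carleson_square_def tbox_def)
 thus thesis using that[of 0 0] \<open>N = 0\<close> by (simp add: node_def)
next
 case False
 define f where "f = \<lfloor>2 ^ N * ((Arg a - (1 - norm a) / 2) / (2 * pi))\<rfloor>"
 define J where "J = nat (f mod 2 ^ N)"
 define J' where "J' = nat ((f + 1) mod 2 ^ N)"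
 have Ji: "int J = f mod 2 ^ N" "int J' = (f + 1) mod 2 ^ N" by (simp_all add: J_def J'_def)
 have "int J < int (2 ^ N)" "int J' < int (2 ^ N)" unfolding Ji by simp_all
 hence nodes: "node (N, J)" "node (N, J')" unfolding node_def of_nat_less_iff by simp_all
 have "carleson_square a <= tbox (N, J) Un tbox (N, J')"
 proof
  fix z assume "z : carleson_square a"
  then obtain \<rho> t where z: "z = rcis \<rho> t" "norm a <= \<rho>" "\<rho> < 1" "\<bar>t - Arg a\<bar> <= (1 - norm a) / 2"
   using False by (auto simp: carleson_square_def)
  have \<rho>: "0 < \<rho>" using z False by (smt (verit) zero_less_norm_iff)
  have zt: "Arg a - (1 - norm a) / 2 <= t" "t - Arg a + (1 - norm a) / 2 <= 1 - norm a"
  proof -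
   define h where "h = (1 - norm a) / 2"
   have "1 - norm a = h + h" by (simp add: h_def field_simps)
   thus "Arg a - (1 - norm a) / 2 <= t" "t - Arg a + (1 - norm a) / 2 <= 1 - norm a"
    using z(4) unfolding h_def[symmetric] by linarith+
  qed
  let ?x = "2 ^ N * (t / (2 * pi))" and ?y = "2 ^ N * ((Arg a - (1 - norm a) / 2) / (2 * pi))"
  have "?y <= ?x" using zt by (intro mult_left_mono divide_right_mono) auto
  moreover have "?x < ?y + 1"
  proof -
   have h: "1 - norm a <= (1/2) ^ N" using assms by (simp add: rad_def)
   have "?x - ?y = 2 ^ N * (t - Arg a + (1 - norm a) / 2) / (2 * pi)" by (simp add: field_simps)
   also have "... <= 2 ^ N * ((1/2) ^ N) / (2 * pi)"
    by (rule divide_right_mono[OF mult_left_mono[OF order_trans[OF zt(2) h]]]) simp_all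
   also have "... = 1 / (2 * pi)" by (simp add: power_one_over)
   also have "... < 1" using pi_ge_two by simp
   finally show ?thesis by simp
  qed
  ultimately have "\<lfloor>?x\<rfloor> = f \<or> \<lfloor>?x\<rfloor> = f + 1" unfolding f_def by linarith
  hence "int (slot N z) = int J \<or> int (slot N z) = int J'"
   unfolding Ji z(1) slot_rcis[OF \<rho>] by auto
  moreover have "norm z = \<rho>" using \<rho> z by (simp add: rcis_def norm_mult)
  ultimately show "z : tbox (N, J) Un tbox (N, J')" using z assms by (auto simp: tbox_def)
 qed
 thus thesis using that nodes by blast
qed

text \<open>Three levels up 1 - |a| is 8 * 2^(-N), so the allowed deviation 4 * 2^(-N) exceeds half
  the angular width of the box, pi 2^(-N). For N <= 3 the square at 0 is the whole disk.\<close>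

lemma tbox_subset_carleson_square:
 assumes K: "node K"
 obtains a where "norm a = rad (fst K - 3)" "tbox K <= carleson_square a"
proof (cases "fst K <= 3")
 case True
 hence "norm (0::complex) = rad (fst K - 3)" by simp
 moreover have "tbox K <= carleson_square 0" by (auto simp: tbox_def carleson_square_def)
 ultimately show thesis using that by blast
next
 case False
 let ?N = "fst K"
 define x where "x = (real (snd K) + 1/2) / 2 ^ ?N"
 define a where "a = rcis (rad (?N - 3)) (2 * pi * x)"
 have r: "1/2 <= rad (?N - 3)" using False by (intro rad_ge_half) simp
 have na: "norm a = rad (?N - 3)" using r by (simp add: a_def rcis_def norm_mult)
 have a0: "a ~= 0" using na r by auto
 have "rcis (norm a) (Arg a) = a" by (rule rcis_cmod_Arg)
 hence "cis (Arg a) = cis (2 * pi * x)" using r unfolding na by (simp add: a_def rcis_def)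
 hence "sin (Arg a) = sin (2 * pi * x) & cos (Arg a) = cos (2 * pi * x)"
  by (simp add: complex_eq_iff)
 \<comment> \<open>\<open>Arg a\<close> may differ from the angle of the midpoint by full turns; the
   same number of turns is added to the angle of z below.\<close>
 then obtain m :: int where m: "Arg a = 2 * pi * x + 2 * pi * m" using sin_cos_eq_iff by blast
 have "tbox K <= carleson_square a"
 proof
  fix z assume z: "z : tbox K"
  define t where "t = 2 * pi * turn z + 2 * pi * m"
  have "z = rcis (norm z) t"
  proof -
   have "cis t = cis (2 * pi * turn z) * cis (2 * pi * m)" unfolding t_def by (rule cis_mult[symmetric])
   also have "cis (2 * pi * m) = 1" by (rule cis_multiple_2pi) simp
   finally show ?thesis using rcis_turn[of z] by (simp add: rcis_def)
  qed
  moreover have "norm a <= norm z"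
   using z rad_mono[of "?N - 3" ?N] unfolding na by (auto simp: tbox_def)
  moreover have "norm z < 1" using z by (simp add: tbox_def)
  moreover have "\<bar>t - Arg a\<bar> <= (1 - norm a) / 2"
  proof -
   have "slot ?N z = snd K" using z by (simp add: tbox_def)
   hence "real (snd K) <= 2 ^ ?N * turn z" "2 ^ ?N * turn z < real (snd K) + 1"
    using slot_bounds[of ?N z] by auto
   hence "\<bar>2 ^ ?N * turn z - (real (snd K) + 1/2)\<bar> <= 1/2" unfolding abs_le_iff by linarith
   hence "\<bar>2 ^ ?N * turn z - (real (snd K) + 1/2)\<bar> / 2 ^ ?N <= 1/2 / 2 ^ ?N" by (rule divide_right_mono) simp
   moreover have "turn z - x = (2 ^ ?N * turn z - (real (snd K) + 1/2)) / 2 ^ ?N"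
    by (simp add: x_def field_simps)
   ultimately have "\<bar>turn z - x\<bar> <= 1/2 / 2 ^ ?N" by (simp add: abs_divide)
   hence "2 * pi * \<bar>turn z - x\<bar> <= 2 * 4 * (1/2 / 2 ^ ?N)"
    using pi_less_4 by (intro mult_mono) auto
   moreover have "t - Arg a = 2 * pi * (turn z - x)" by (simp add: t_def m algebra_simps)
   moreover have "(1 - norm a) / 2 = 4 / 2 ^ ?N"
   proof -
    have "(1/2::real) ^ (?N - 3) = 8 / 2 ^ ?N"
    proof -
     have "(2::real) ^ ?N = 2 ^ (?N - 3) * 2 ^ 3" using power_add[of "2::real" "?N - 3" 3] False by simp
     thus ?thesis by (simp add: power_one_over)
    qed
    thus ?thesis by (simp add: na rad_def)
   qed
   ultimately show ?thesis by (simp add: abs_mult)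
  qed
  ultimately show "z : carleson_square a" using a0 by (auto simp: carleson_square_def)
 qed
 thus thesis using that na by blast
qed

lemma vimage_rotation_dbox:
 assumes "node (n, j)"
 shows "(%z. cis (2 * pi * (real j / 2 ^ n)) * z) -` dbox (n, j) = dbox (n, 0)"
proof (cases "n = 0")
 case True
 thus ?thesis using assms by (simp add: node_def)
next
 case False
 define u where "u = real j / 2 ^ n"
 have u0: "0 <= u" by (simp add: u_def)
 have j: "j + 1 <= 2 ^ n" using assms by (simp add: node_def)
 hence j': "real j + 1 <= 2 ^ n" using of_nat_mono[OF j, where 'a=real] by simp
 have tr: "turn (cis (2 * pi * s) * z) = turn z + s" if "z ~= 0" "0 <= turn z + s" "turn z + s < 1" for s z
 proof -
  have "cis (2 * pi * s) * z = cis (2 * pi * s) * rcis (norm z) (2 * pi * turn z)" by (simp add: rcis_turn)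
  also have "... = rcis (norm z) (2 * pi * (turn z + s))"
   by (simp add: rcis_def cis_mult mult.left_commute distrib_left add.commute)
  finally show ?thesis using that turn_rcis[of "norm z" "turn z + s"] by simp
 qed
 have nz: "z ~= 0" if "rad n <= norm z" for z :: complex using that False rad_ge_half[of n] by auto
 show ?thesis unfolding u_def[symmetric]
 proof (rule set_eqI)
  fix z
  let ?y = "cis (2 * pi * u) * z"
  have ny: "norm ?y = norm z" by (simp add: norm_mult)
  show "z : (%z. cis (2 * pi * u) * z) -` dbox (n, j) \<longleftrightarrow> z : dbox (n, 0)"
  proof
   assume "z : dbox (n, 0)"
   hence z: "rad n <= norm z" "norm z < rad (Suc n)" "slot n z = 0" by (auto simp: dbox_def)
   hence t: "2 ^ n * turn z < 1" using slot_bounds[of n z] by simp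
   have "2 ^ n * (turn z + u) < 2 ^ n" using t j' by (simp add: distrib_left u_def)
   hence "turn z + u < 1" by simp
   hence ty: "turn ?y = turn z + u" using nz z by (intro tr) (auto simp: u_def)
   have "slot n ?y = j" unfolding slot_eq_iff ty using t by (simp add: distrib_left u_def)
   thus "z : (%z. cis (2 * pi * u) * z) -` dbox (n, j)" using z by (simp add: dbox_def ny)
  next
   assume "z : (%z. cis (2 * pi * u) * z) -` dbox (n, j)"
   hence y: "rad n <= norm z" "norm z < rad (Suc n)" "slot n ?y = j" by (auto simp: dbox_def ny)
   have b: "real j <= 2 ^ n * turn ?y" "2 ^ n * turn ?y < real j + 1" using slot_bounds[of n ?y] y by auto
   have zy: "z = cis (2 * pi * (- u)) * ?y" by (simp add: mult.assoc[symmetric] cis_mult)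
   have "0 <= turn ?y + - u" using b by (simp add: field_simps u_def)
   moreover have "?y ~= 0" using nz[of ?y] y(1) unfolding ny by blast
   ultimately have "turn (cis (2 * pi * (- u)) * ?y) = turn ?y + - u"
    using turn_less_1[of ?y] u0 by (intro tr) linarith+
   hence "turn z = turn ?y + - u" unfolding zy[symmetric] .
   hence "slot n z = 0" unfolding slot_eq_iff using b by (simp add: right_diff_distrib u_def)
   thus "z : dbox (n, 0)" using y by (simp add: dbox_def)
  qed
 qed
qed

context tent_measure begin

lemma nn_integral_rot:
 assumes [measurable]: "f : borel_measurable borel"
 shows "(\<integral>\<^sup>+z. f (cis t * z) \<partial>\<mu>) = (\<integral>\<^sup>+z. f z \<partial>\<mu>)"
proof -
 have [measurable]: "(%z. cis t * z) : measurable \<mu> borel"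
  unfolding measurable_cong_sets[OF sets_\<mu> refl] by (intro borel_measurable_continuous_onI continuous_intros)
 have "(\<integral>\<^sup>+z. f z \<partial>\<mu>) = (\<integral>\<^sup>+z. f z \<partial>distr \<mu> borel (%z. cis t * z))" by (simp add: rot)
 also have "... = (\<integral>\<^sup>+z. f (cis t * z) \<partial>\<mu>)" by (subst nn_integral_distr) auto
 finally show ?thesis by simp
qed

text \<open>The 2^n boxes of a level are rotations of one another, so each receives an equal share
  of the annulus.\<close>

lemma \<mu>_dbox: assumes k: "node k" shows "emeasure \<mu> (dbox k) <= ennreal (ca * w k)"
proof -
 obtain n j where kk: "k = (n, j)" by (cases k)
 have eq: "emeasure \<mu> (dbox (n, i)) = emeasure \<mu> (dbox (n, 0))" if "node (n, i)" for i
 proof -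
  have m: "(%z. cis (2 * pi * (real i / 2 ^ n)) * z) : measurable \<mu> borel"
   unfolding measurable_cong_sets[OF sets_\<mu> refl] by (intro borel_measurable_continuous_onI continuous_intros)
  have "emeasure \<mu> (dbox (n, i)) = emeasure (distr \<mu> borel (%z. cis (2 * pi * (real i / 2 ^ n)) * z)) (dbox (n, i))"
   by (simp add: rot)
  also have "... = emeasure \<mu> ((%z. cis (2 * pi * (real i / 2 ^ n)) * z) -` dbox (n, i) Int space \<mu>)"
   by (rule emeasure_distr[OF m]) measurable
  also have "space \<mu> = UNIV" using sets_eq_imp_space_eq[OF sets_\<mu>] by simp
  finally show ?thesis unfolding vimage_rotation_dbox[OF that] by simp
 qed
 have "(\<Sum>i<2^n. emeasure \<mu> (dbox (n, i))) = emeasure \<mu> (\<Union>i<2^n. dbox (n, i))"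
  by (rule sum_emeasure) (auto simp: sets_\<mu> disjoint_family_on_def dest: dbox_unique)
 also have "... <= emeasure \<mu> {z. rad n <= norm z & norm z < rad (Suc n)}"
  by (rule emeasure_mono) (auto simp: dbox_def sets_\<mu>)
 also have "... <= ennreal (ca * W n)" by (rule \<mu>_ann)
 also have "(\<Sum>i<2^n. emeasure \<mu> (dbox (n, i))) = (\<Sum>i<(2::nat)^n. emeasure \<mu> (dbox (n, 0)))"
  by (intro sum.cong eq) (auto simp: node_def)
 finally have le: "ennreal (2 ^ n) * emeasure \<mu> (dbox (n, 0)) <= ennreal (ca * W n)"
  by (simp add: ennreal_power[symmetric] ennreal_numeral)
 have "emeasure \<mu> (dbox (n, 0)) = ennreal (1 / 2 ^ n) * (ennreal (2 ^ n) * emeasure \<mu> (dbox (n, 0)))"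
  by (simp add: mult.assoc[symmetric] ennreal_mult'[symmetric])
 also have "... <= ennreal (1 / 2 ^ n) * ennreal (ca * W n)" by (intro mult_left_mono le) simp
 also have "... = ennreal (ca * w k)" by (simp add: kk w_def ennreal_mult'[symmetric])
 finally show ?thesis using eq k unfolding kk by simp
qed

end

subsection \<open>Sampling holomorphic functions\<close>

lemma circle_integral_rot:
 fixes \<phi> :: "complex => ennreal"
 assumes [measurable]: "\<phi> : borel_measurable borel"
 shows "(\<integral>\<^sup>+t\<in>{0..2*pi}. \<phi> (cis t * z) \<partial>lborel) = (\<integral>\<^sup>+t\<in>{0..2*pi}. \<phi> (rcis (norm z) t) \<partial>lborel)"
proof -
 have z: "cis t * z = rcis (norm z) (t + Arg2pi z)" for t
 proof -
  have "z = rcis (norm z) (Arg2pi z)"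
   using Arg2pi_eq[of z] by (simp add: rcis_def cis_conv_exp)
  hence "cis t * z = cis t * rcis (norm z) (Arg2pi z)" by simp
  also have "... = rcis (norm z) (t + Arg2pi z)"
   by (simp add: rcis_def cis_mult[symmetric] mult.left_commute)
  finally show ?thesis .
 qed
 have [measurable]: "(%t. rcis (norm z) t) : borel_measurable borel"
  by (rule borel_measurable_continuous_onI[OF continuous_on_rcis])
 have "(%t. \<phi> (rcis (norm z) t)) : borel_measurable borel" by measurable
 thus ?thesis unfolding z
  by (rule nn_integral_periodic_shift)
    (use Arg2pi_ge_0[of z] Arg2pi_lt_2pi[of z] in \<open>auto simp: rcis_def cis_mult[symmetric]\<close>)
qed

lemma norm_powr_disk_measurable:
 assumes "hol f" "0 < q"
 shows "(%z. ennreal (norm (f z) powr q) * indicator \<DD> z) : borel_measurable borel"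
proof -
 have c: "continuous_on \<DD> (%z. norm (f z) powr q)"
  using assms by (intro continuous_on_norm_powr hol_cont)
 have "(%z. if z : \<DD> then norm (f z) powr q else 0) : borel_measurable borel"
  by (rule borel_measurable_continuous_on_if[OF _ c]) (auto intro: continuous_intros)
 hence "(%z. ennreal (if z : \<DD> then norm (f z) powr q else 0)) : borel_measurable borel" by measurable
 moreover have "(%z. ennreal (if z : \<DD> then norm (f z) powr q else 0)) = (%z. ennreal (norm (f z) powr q) * indicator \<DD> z)"
  by (rule ext) (simp add: indicator_def)
 ultimately show ?thesis by (simp only:)
qed

context tent_measure begin

text \<open>Treating |f|^q \<open>\<mu>\<close> as a measure allows it to be split over boxes and
  tents by additivity; the indicator discards values off the disk.\<close>

definition fm :: "real => (complex => complex) => complex measure" where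
 "fm q f = density \<mu> (%z. ennreal (norm (f z) powr q) * indicator \<DD> z)"

definition tmean :: "real => (complex => complex) => complex => ennreal" where
 "tmean q f a = ennreal (1 / (1 - norm a)) * emeasure (fm q f) (carleson_square a)"

lemma sets_fm [simp]: "sets (fm q f) = sets borel"
 by (simp add: fm_def sets_\<mu>)

lemma measurable_\<mu>: "f : borel_measurable borel ==> f : borel_measurable \<mu>"
 using measurable_cong_sets[OF sets_\<mu> refl] by blast

lemma emeasure_fm:
 assumes "hol f" "0 < q" "A : sets borel"
 shows "emeasure (fm q f) A = (\<integral>\<^sup>+z. ennreal (norm (f z) powr q) * indicator \<DD> z * indicator A z \<partial>\<mu>)"
 unfolding fm_def using assms
 by (subst emeasure_density) (auto intro: measurable_\<mu> norm_powr_disk_measurable simp: sets_\<mu>)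

lemma emeasure_fm_dbox_le:
 assumes f: "hol f" "0 < q" and k: "node k" and X: "!!z. z : dbox k ==> norm (f z) <= X"
 shows "emeasure (fm q f) (dbox k) <= ennreal (ca * (X powr q * w k))"
proof -
 have "emeasure (fm q f) (dbox k) <= (\<integral>\<^sup>+z. ennreal (X powr q) * indicator (dbox k) z \<partial>\<mu>)"
  unfolding emeasure_fm[OF f dbox_measurable] using X f(2)
  by (intro nn_integral_mono) (auto simp: indicator_def intro!: ennreal_leI powr_mono2)
 also have "... = ennreal (X powr q) * emeasure \<mu> (dbox k)"
  by (rule nn_integral_cmult_indicator) (simp add: sets_\<mu>)
 also have "... <= ennreal (X powr q) * ennreal (ca * w k)" by (intro mult_left_mono \<mu>_dbox k) simp
 also have "... = ennreal (ca * (X powr q * w k))" by (simp add: ennreal_mult'[symmetric] mult_ac)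
 finally show ?thesis .
qed

text \<open>The tent is the increasing union of its boxes up to level H, so the bounds for the
  truncated means pass to its measure.\<close>

lemma emeasure_fm_tbox_le:
 assumes f: "hol f" "0 < q" and K: "node K"
  and X: "!!k z. z : dbox k ==> norm (f z) <= X k" and carl: "carl (%k. X k powr q) b"
 shows "emeasure (fm q f) (tbox K) <= ennreal (ca * (b (fst K) / 2 ^ fst K))"
proof -
 define T where "T H = (\<Union>k\<in>{k. k : boxes H & below k K}. dbox k)" for H
 have meas: "T H : sets (fm q f)" for H
  unfolding T_def by (intro sets.finite_UN) simp_all
 have inc: "incseq T" unfolding T_def by (rule incseq_SucI) (auto simp: mem_boxes)
 have "tbox K = (\<Union>H. T H)"
 proof (intro equalityI subsetI)
  fix z assume "z : tbox K"
  then obtain k where "node k" "below k K" "z : dbox k" by (rule tbox_ex_dbox)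
  hence "z : T (fst k)" unfolding T_def by (intro UN_I[of k]) (auto simp: mem_boxes)
  thus "z : (\<Union>H. T H)" by blast
 next
  fix z assume "z : (\<Union>H. T H)"
  then obtain k where "below k K" "z : dbox k" by (auto simp: T_def)
  thus "z : tbox K" using dbox_subset_tbox by blast
 qed
 hence "emeasure (fm q f) (tbox K) = (SUP H. emeasure (fm q f) (T H))"
  using meas inc by (simp add: SUP_emeasure_incseq image_subset_iff)
 also have "... <= ennreal (ca * (b (fst K) / 2 ^ fst K))"
 proof (rule SUP_least)
  fix H
  have "emeasure (fm q f) (T H) <= (\<Sum>k | k : boxes H & below k K. emeasure (fm q f) (dbox k))"
   unfolding T_def by (intro emeasure_subadditive_finite) auto
  also have "... <= (\<Sum>k | k : boxes H & below k K. ennreal (ca * (X k powr q * w k)))"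
   using X by (intro sum_mono emeasure_fm_dbox_le f) (auto simp: mem_boxes)
  also have "... = ennreal (\<Sum>k | k : boxes H & below k K. ca * (X k powr q * w k))"
   using ca_pos less_imp_le[OF w_pos] by (intro sum_ennreal) auto
  also have "... <= ennreal (ca * (b (fst K) / 2 ^ fst K))"
   unfolding sum_distrib_left[symmetric] using ca_pos
   by (intro ennreal_leI mult_left_mono sum_below_le_carl[OF carl K]) auto
  finally show "emeasure (fm q f) (T H) <= ennreal (ca * (b (fst K) / 2 ^ fst K))" .
 qed
 finally show ?thesis .
qed

text \<open>Two tents of level N cover the square and 1/(1 - |a|) <= 2 * 2^N, whence the factor
  4.\<close>

lemma tmean_le:
 assumes f: "hol f" "0 < q"
  and X: "!!k z. z : dbox k ==> norm (f z) <= X k" and carl: "carl (%k. X k powr q) b" and b: "!!n. 0 <= b n"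
  and a: "rad N <= norm a" "norm a < rad (Suc N)"
 shows "tmean q f a <= ennreal (4 * ca * b N)"
proof -
 obtain J J' where J: "node (N, J)" "node (N, J')" "carleson_square a <= tbox (N, J) Un tbox (N, J')"
  using carleson_square_cover[OF a] by blast
 have "emeasure (fm q f) (carleson_square a) <= emeasure (fm q f) (tbox (N, J) Un tbox (N, J'))"
  by (rule emeasure_mono[OF J(3)]) simp
 also have "... <= emeasure (fm q f) (tbox (N, J)) + emeasure (fm q f) (tbox (N, J'))"
  by (rule emeasure_subadditive) simp_all
 also have "... <= ennreal (ca * (b N / 2 ^ N)) + ennreal (ca * (b N / 2 ^ N))"
  using emeasure_fm_tbox_le[OF f J(1) X carl] emeasure_fm_tbox_le[OF f J(2) X carl]
  by (intro add_mono) auto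
 also have "... = ennreal (2 * (ca * (b N / 2 ^ N)))"
  using ca_pos b by (simp add: ennreal_plus[symmetric] del: ennreal_plus)
 finally have e: "emeasure (fm q f) (carleson_square a) <= ennreal (2 * (ca * (b N / 2 ^ N)))" .
 have pos: "0 < 1 - norm a" using a rad_less_1[of "Suc N"] by simp
 have "1 / (1 - norm a) <= 2 * 2 ^ N"
 proof -
  have "1 / (2 * 2 ^ N) <= 1 - norm a" using a(2) by (simp add: rad_def power_one_over)
  thus ?thesis using pos by (simp add: field_simps)
 qed
 hence "tmean q f a <= ennreal (2 * 2 ^ N) * ennreal (2 * (ca * (b N / 2 ^ N)))"
  unfolding tmean_def by (intro mult_mono ennreal_leI e) auto
 also have "... = ennreal (4 * ca * b N)"
  using ca_pos b by (simp add: ennreal_mult'[symmetric])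
 finally show ?thesis .
qed

text \<open>Derivatives will be estimated on circles of radius 2^(-(n+3)) about points of the box,
  so samples may leave the box by that much.\<close>

definition nearbox :: "nat \<times> nat => complex => bool" where
 "nearbox k z \<longleftrightarrow> (\<exists>z'\<in>dbox k. norm (z - z') <= (1/2) ^ (fst k + 3))"

lemma ball_nearbox:
 assumes "nearbox (n, j) z" "z1 : ball z ((1/2) ^ (n + 3))"
 obtains z' where "z' : dbox (n, j)" "norm (z1 - z') <= (1/2) ^ (n + 2)"
  "rad n - (1/2) ^ (n + 2) <= norm z1" "norm z1 < rad (n + 2)"
proof -
 obtain z' where z': "z' : dbox (n, j)" "norm (z - z') <= (1/2) ^ (n + 3)"
  using assms(1) by (auto simp: nearbox_def)
 have "norm (z1 - z') <= norm (z1 - z) + norm (z - z')"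
  using norm_triangle_ineq[of "z1 - z" "z - z'"] by simp
 also have "... <= (1/2) ^ (n + 3) + (1/2) ^ (n + 3)"
  using assms(2) z'(2) by (intro add_mono) (auto simp: dist_norm norm_minus_commute)
 also have "... = (1/2) ^ (n + 2)" by (simp add: power_add power_one_over)
 finally have d: "norm (z1 - z') <= (1/2) ^ (n + 2)" .
 moreover have "norm z' - norm (z1 - z') <= norm z1" "norm z1 <= norm z' + norm (z1 - z')"
  using norm_triangle_ineq2[of z' "z' - z1"] norm_triangle_ineq[of z' "z1 - z'"] by (simp_all add: norm_minus_commute)
 moreover have "rad n <= norm z'" "norm z' < rad (Suc n)" using z' by (auto simp: dbox_def)
 moreover have "rad (n + 2) = rad (Suc n) + (1/2) ^ (n + 2)" by (simp add: rad_def power_add)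
 ultimately have "rad n - (1/2) ^ (n + 2) <= norm z1" "norm z1 < rad (n + 2)" by linarith+
 thus thesis using that z' d by blast
qed

lemma nearbox_norm: "nearbox k z ==> norm z < 1"
 using ball_nearbox[of "fst k" "snd k" z z] rad_less_1[of "fst k + 2"] by force

text \<open>The submean property is applied on discs of radius 2^(-(n+3)) about the samples. At most
  three of them overlap, they lie in an annulus of width 2^(-n), and every circle mean there is at
  most the one at the outer radius.\<close>

lemma level_sum_le_circle_mean:
 assumes F: "hol F" "0 < q" and \<zeta>: "!!j. j < 2 ^ n ==> nearbox (n, j) (\<zeta> j)"
 shows "(\<Sum>j<2^n. ennreal (pi * ((1/2) ^ (n + 3))\<^sup>2 * norm (F (\<zeta> j)) powr q))
   <= ennreal (3 * (1/2) ^ n) * (\<integral>\<^sup>+t\<in>{0..2*pi}. ennreal (norm (F (rcis (rad (n + 2)) t)) powr q) \<partial>lborel)"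
proof -
 define \<phi> where "\<phi> z = ennreal (norm (F z) powr q) * indicator \<DD> z" for z
 have m\<phi>[measurable]: "\<phi> : borel_measurable borel"
  unfolding \<phi>_def using norm_powr_disk_measurable[OF F] .
 define R where "R = {z::complex. rad n - (1/2) ^ (n + 2) <= norm z & norm z < rad (n + 2)}"
 have [measurable]: "R : sets borel" unfolding R_def by measurable
 define M where "M s = (\<integral>\<^sup>+t\<in>{0..2*pi}. ennreal (norm (F (rcis s t)) powr q) \<partial>lborel)" for s
 let ?B = "%j. ball (\<zeta> j) ((1/2) ^ (n + 3))"
 have sub: "?B j <= \<DD>" if "j < 2 ^ n" for j
 proof
  fix z assume "z : ?B j"
  thus "z : \<DD>" using ball_nearbox[OF \<zeta>[OF that]] rad_less_1[of "n + 2"] by (metis dist_0_norm less_trans mem_ball)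
 qed
 have "(\<Sum>j<2^n. ennreal (pi * ((1/2) ^ (n + 3))\<^sup>2 * norm (F (\<zeta> j)) powr q))
   <= (\<Sum>j<2^n. \<integral>\<^sup>+z. \<phi> z * indicator (?B j) z \<partial>lborel)"
 proof (rule sum_mono)
  fix j :: nat assume j: "j : {..<2^n}"
  have "ennreal (pi * ((1/2) ^ (n + 3))\<^sup>2 * norm (F (\<zeta> j)) powr q) <= (\<integral>\<^sup>+z\<in>?B j. ennreal (norm (F z) powr q) \<partial>lborel)"
   using j sub F by (intro powr_norm_submean_disk[of F \<DD>]) auto
  also have "... = (\<integral>\<^sup>+z. \<phi> z * indicator (?B j) z \<partial>lborel)"
   using j sub[of j] by (intro nn_integral_cong) (auto simp: \<phi>_def indicator_def)
  finally show "ennreal (pi * ((1/2) ^ (n + 3))\<^sup>2 * norm (F (\<zeta> j)) powr q) <= (\<integral>\<^sup>+z. \<phi> z * indicator (?B j) z \<partial>lborel)" .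
 qed
 also have "... = (\<integral>\<^sup>+z. (\<Sum>j<2^n. \<phi> z * indicator (?B j) z) \<partial>lborel)"
  by (rule nn_integral_sum[symmetric])
    (intro borel_measurable_times_ennreal borel_measurable_indicator; simp add: m\<phi>)
 also have "... <= (\<integral>\<^sup>+z\<in>\<DD>. 3 * (\<phi> z * indicator R z) \<partial>lborel)"
 proof (rule nn_integral_mono)
  fix z :: complex
  let ?J = "{j. j < 2 ^ n & z : ?B j}"
  have "(\<Sum>j<2^n. \<phi> z * indicator (?B j) z) = (\<Sum>j\<in>?J. \<phi> z)"
   by (rule sum.mono_neutral_cong_right) (auto simp: indicator_def)
  also have "... = of_nat (card ?J) * \<phi> z" by simp
  also have "... <= 3 * (\<phi> z * indicator R z) * indicator \<DD> z"
  proof (cases "?J = {}")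
   case False
   have "\<forall>j\<in>?J. \<exists>z'. z' : dbox (n, j) & norm (z - z') <= (1/2) ^ (n + 2)"
    using ball_nearbox[OF \<zeta>] by (metis (lifting) mem_Collect_eq)
   then obtain \<xi> where \<xi>: "!!j. j : ?J ==> \<xi> j : dbox (n, j) & norm (z - \<xi> j) <= (1/2) ^ (n + 2)" by metis
   have "card ?J <= 3" by (rule overlap_card[of ?J \<xi> n z]) (use \<xi> in auto)
   hence c3: "(of_nat (card ?J) :: ennreal) <= 3" by (metis of_nat_le_iff of_nat_numeral)
   obtain j where j: "j < 2 ^ n" "z : ?B j" using False by auto
   hence "z : R" using ball_nearbox[OF \<zeta>[OF j(1)] j(2)] by (auto simp: R_def)
   moreover have "z : \<DD>" using sub[OF j(1)] j(2) by blast
   ultimately show ?thesis using c3 by (simp add: mult_right_mono)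
  qed (simp only:, simp)
  finally show "(\<Sum>j<2^n. \<phi> z * indicator (?B j) z) <= 3 * (\<phi> z * indicator R z) * indicator \<DD> z" .
 qed
 also have "... = (\<integral>\<^sup>+s\<in>{0..<1}. ennreal s * (\<integral>\<^sup>+t\<in>{0..2*pi}. 3 * (\<phi> (rcis s t) * indicator R (rcis s t)) \<partial>lborel) \<partial>lborel)"
  by (rule nn_integral_disk_polar) measurable
 also have "... <= (\<integral>\<^sup>+s. 3 * M (rad (n + 2)) * indicator {rad n - (1/2) ^ (n + 2)..rad (n + 2)} s \<partial>lborel)"
 proof (rule nn_integral_mono)
  fix s :: real
  show "ennreal s * (\<integral>\<^sup>+t\<in>{0..2*pi}. 3 * (\<phi> (rcis s t) * indicator R (rcis s t)) \<partial>lborel) * indicator {0..<1} s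
    <= 3 * M (rad (n + 2)) * indicator {rad n - (1/2) ^ (n + 2)..rad (n + 2)} s"
  proof (cases "0 <= s & s < 1 & rad n - (1/2) ^ (n + 2) <= s & s < rad (n + 2)")
   case True
   have "(\<integral>\<^sup>+t\<in>{0..2*pi}. 3 * (\<phi> (rcis s t) * indicator R (rcis s t)) \<partial>lborel)
     <= (\<integral>\<^sup>+t. 3 * (ennreal (norm (F (rcis s t)) powr q) * indicator {0..2*pi} t) \<partial>lborel)"
    by (intro nn_integral_mono) (auto simp: \<phi>_def indicator_def)
   also have "... = 3 * M s"
   proof -
    have "continuous_on UNIV (%t. norm (F (rcis s t)) powr q)"
     using True F
     by (intro continuous_on_norm_powr continuous_on_compose2[OF hol_cont[OF F(1)]] continuous_on_rcis)
       (auto simp: rcis_def norm_mult)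
    hence "(%t. norm (F (rcis s t)) powr q) : borel_measurable borel" by (rule borel_measurable_continuous_onI)
    thus ?thesis unfolding M_def by (intro nn_integral_cmult) simp
   qed
   also have "... <= 3 * M (rad (n + 2))"
    unfolding M_def using True rad_less_1[of "n+2"] by (intro mult_left_mono nn_powr_mean_mono[OF F]) auto
   finally have "ennreal s * (\<integral>\<^sup>+t\<in>{0..2*pi}. 3 * (\<phi> (rcis s t) * indicator R (rcis s t)) \<partial>lborel)
     <= 1 * (3 * M (rad (n + 2)))"
    using True by (intro mult_mono) auto
   thus ?thesis using True by simp
  next
   case False
   have "indicator R (rcis s t) = (0::ennreal)" if "0 <= s" "s < 1" for t
    using False that by (auto simp: R_def indicator_def rcis_def norm_mult)
   thus ?thesis by (cases "0 <= s & s < 1") (auto simp: indicator_def)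
  qed
 qed
 also have "... = 3 * M (rad (n + 2)) * emeasure lborel {rad n - (1/2) ^ (n + 2)..rad (n + 2)}"
  by (rule nn_integral_cmult_indicator) simp
 also have "emeasure lborel {rad n - (1/2) ^ (n + 2)..rad (n + 2)} = ennreal ((1/2) ^ n)"
  by (subst emeasure_lborel_Icc) (auto simp: rad_def power_add)
 also have "3 * M (rad (n + 2)) * ennreal ((1/2) ^ n) = ennreal (3 * (1/2) ^ n) * M (rad (n + 2))"
  by (simp add: ennreal_mult' mult_ac)
 finally show ?thesis unfolding M_def .
qed

text \<open>The mean at \<open>rad (n + 2)\<close> is at most the mean at any larger radius.
  Integrated against \<open>\<mu>\<close> over the outer annuli, circle means become integrals of
  |F|^q because \<open>\<mu>\<close> is rotation invariant.\<close>

lemma W_circle_mean_le: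
 assumes F: "hol F" "0 < q"
 shows "ennreal (W n) * (\<integral>\<^sup>+t\<in>{0..2*pi}. ennreal (norm (F (rcis (rad (n + 2)) t)) powr q) \<partial>lborel)
  <= ennreal (2 * pi * cl) * emeasure (fm q F) {z. rad (n + 2) <= norm z & norm z < rad (n + 2 + L)}"
proof -
 define \<phi> where "\<phi> z = ennreal (norm (F z) powr q) * indicator \<DD> z" for z
 have m\<phi>[measurable]: "\<phi> : borel_measurable borel"
  unfolding \<phi>_def using norm_powr_disk_measurable[OF F] .
 define A where "A = {z::complex. rad (n + 2) <= norm z & norm z < rad (n + 2 + L)}"
 have [measurable]: "A : sets borel" unfolding A_def by measurable
 have AD: "norm z < 1" if "z : A" for z using that rad_less_1[of "n + 2 + L"] by (auto simp: A_def)
 define M where "M s = (\<integral>\<^sup>+t\<in>{0..2*pi}. ennreal (norm (F (rcis s t)) powr q) \<partial>lborel)" for s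
 interpret \<mu>: finite_measure \<mu>
  using fin_\<mu> sets_eq_imp_space_eq[OF sets_\<mu>] by (intro finite_measureI) (auto simp: less_top)
 interpret P: pair_sigma_finite lborel \<mu> ..
 have mc: "(%p. cis (fst p) * snd p) : borel_measurable (borel \<Otimes>\<^sub>M borel)"
  unfolding borel_prod cis_conv_exp by (intro borel_measurable_continuous_onI continuous_intros)
 have mcis: "(%z. cis t * z) : borel_measurable borel" for t
  by (intro borel_measurable_continuous_onI continuous_intros)
 have mcis2: "(%t. cis t * z) : borel_measurable borel" for z
  unfolding cis_conv_exp by (intro borel_measurable_continuous_onI continuous_intros)
 define \<psi> where "\<psi> z = \<phi> z * indicator A z" for z
 have m\<psi>[measurable]: "\<psi> : borel_measurable borel" unfolding \<psi>_def by measurable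
 have "ennreal (W n) * M (rad (n + 2)) <= ennreal cl * emeasure \<mu> A * M (rad (n + 2))"
  using W_ann[of n] unfolding A_def by (rule mult_right_mono) simp
 also have "... = ennreal cl * (\<integral>\<^sup>+z. M (rad (n + 2)) * indicator A z \<partial>\<mu>)"
  by (subst nn_integral_cmult_indicator) (simp_all add: sets_\<mu> mult_ac)
 also have "... <= ennreal cl * (\<integral>\<^sup>+z. (\<integral>\<^sup>+t. \<psi> (cis t * z) * indicator {0..2*pi} t \<partial>lborel) \<partial>\<mu>)"
 proof (intro mult_left_mono nn_integral_mono)
  fix z
  show "M (rad (n + 2)) * indicator A z <= (\<integral>\<^sup>+t. \<psi> (cis t * z) * indicator {0..2*pi} t \<partial>lborel)"
  proof (cases "z : A")
   case True
   have "M (rad (n + 2)) <= M (norm z)"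
    unfolding M_def using True AD[OF True] rad_nonneg[of "n+2"] by (intro nn_powr_mean_mono[OF F]) (auto simp: A_def)
   also have "... = (\<integral>\<^sup>+t. \<psi> (rcis (norm z) t) * indicator {0..2*pi} t \<partial>lborel)"
    unfolding M_def using True AD[OF True]
    by (intro nn_integral_cong) (auto simp: \<psi>_def \<phi>_def A_def rcis_def norm_mult indicator_def)
   also have "... = (\<integral>\<^sup>+t. \<psi> (cis t * z) * indicator {0..2*pi} t \<partial>lborel)"
    by (rule circle_integral_rot[symmetric]) measurable
   finally show ?thesis using True by simp
  qed simp
 qed simp
 also have "(\<integral>\<^sup>+z. (\<integral>\<^sup>+t. \<psi> (cis t * z) * indicator {0..2*pi} t \<partial>lborel) \<partial>\<mu>)
   = (\<integral>\<^sup>+t. (\<integral>\<^sup>+z. \<psi> (cis t * z) * indicator {0..2*pi} t \<partial>\<mu>) \<partial>lborel)"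
 proof (rule P.Fubini')
  have "(%p. \<psi> (cis (fst p) * snd p)) : borel_measurable (borel \<Otimes>\<^sub>M borel)"
   by (rule measurable_compose[OF mc m\<psi>])
  moreover have "(%p. indicator {0..2*pi} (fst p) :: ennreal) : borel_measurable (borel \<Otimes>\<^sub>M borel)" by measurable
  ultimately have "(%p. \<psi> (cis (fst p) * snd p) * indicator {0..2*pi} (fst p)) : borel_measurable (borel \<Otimes>\<^sub>M borel)"
   by (intro borel_measurable_times_ennreal)
  moreover have S: "sets (lborel \<Otimes>\<^sub>M \<mu>) = sets (borel \<Otimes>\<^sub>M borel)"
   by (intro sets_pair_measure_cong sets_\<mu>) simp
  ultimately show "case_prod (%t z. \<psi> (cis t * z) * indicator {0..2*pi} t) : borel_measurable (lborel \<Otimes>\<^sub>M \<mu>)"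
   unfolding measurable_cong_sets[OF S refl] case_prod_unfold by blast
 qed
 also have "... = (\<integral>\<^sup>+t. (\<integral>\<^sup>+z. \<psi> z \<partial>\<mu>) * indicator {0..2*pi} t \<partial>lborel)"
 proof (rule nn_integral_cong)
  fix t :: real
  have "(\<integral>\<^sup>+z. \<psi> (cis t * z) * indicator {0..2*pi} t \<partial>\<mu>) = (\<integral>\<^sup>+z. \<psi> (cis t * z) \<partial>\<mu>) * indicator {0..2*pi} t"
   by (intro nn_integral_multc measurable_\<mu> measurable_compose[OF mcis m\<psi>])
  thus "(\<integral>\<^sup>+z. \<psi> (cis t * z) * indicator {0..2*pi} t \<partial>\<mu>) = (\<integral>\<^sup>+z. \<psi> z \<partial>\<mu>) * indicator {0..2*pi} t"
   by (simp add: nn_integral_rot)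
 qed
 also have "... = (\<integral>\<^sup>+z. \<psi> z \<partial>\<mu>) * ennreal (2 * pi)"
  by (subst nn_integral_cmult_indicator) simp_all
 also have "(\<integral>\<^sup>+z. \<psi> z \<partial>\<mu>) = emeasure (fm q F) A"
  unfolding \<psi>_def \<phi>_def by (rule emeasure_fm[OF F, symmetric]) simp
 also have "ennreal cl * (emeasure (fm q F) A * ennreal (2 * pi)) = ennreal (2 * pi * cl) * emeasure (fm q F) A"
  using cl_pos by (simp add: ennreal_mult' mult_ac)
 finally show ?thesis unfolding M_def A_def .
qed

text \<open>A point lies in at most L of the outer annuli. The 384 is 64 from the squared disc
  radius times 3 from the overlap times 2 from the circle mean.\<close>

lemma sampled_sum_le:
 assumes F: "hol F" "0 < q" and \<zeta>: "!!k. node k ==> nearbox k (\<zeta> k)"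
 shows "(\<Sum>k\<in>boxes H. ennreal (norm (F (\<zeta> k)) powr q * w k)) <= ennreal (384 * cl * L) * emeasure (fm q F) \<DD>"
proof -
 let ?A = "%n. {z::complex. rad (n + 2) <= norm z & norm z < rad (n + 2 + L)}"
 let ?M = "%n. \<integral>\<^sup>+t\<in>{0..2*pi}. ennreal (norm (F (rcis (rad (n + 2)) t)) powr q) \<partial>lborel"
 have "(\<Sum>k\<in>boxes H. ennreal (norm (F (\<zeta> k)) powr q * w k))
   = (\<Sum>n\<le>H. \<Sum>j<2^n. ennreal (norm (F (\<zeta> (n, j))) powr q * w (n, j)))"
  unfolding boxes_def by (subst sum.Sigma) (auto simp: case_prod_unfold)
 also have "... <= (\<Sum>n\<le>H. ennreal (384 * cl) * emeasure (fm q F) (?A n))"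
 proof (rule sum_mono)
  fix n
  let ?c = "64 * 2 ^ n * W n / pi"
  have c0: "0 <= ?c" using W_pos[of n] by simp
  have "(\<Sum>j<2^n. ennreal (norm (F (\<zeta> (n, j))) powr q * w (n, j)))
    = (\<Sum>j<2^n. ennreal ?c * ennreal (pi * ((1/2) ^ (n + 3))\<^sup>2 * norm (F (\<zeta> (n, j))) powr q))"
  proof (intro sum.cong refl)
   fix j
   have "norm (F (\<zeta> (n, j))) powr q * w (n, j) = ?c * (pi * ((1/2) ^ (n + 3))\<^sup>2 * norm (F (\<zeta> (n, j))) powr q)"
    by (simp add: w_def power_add power_one_over power2_eq_square field_simps)
   thus "ennreal (norm (F (\<zeta> (n, j))) powr q * w (n, j))
    = ennreal ?c * ennreal (pi * ((1/2) ^ (n + 3))\<^sup>2 * norm (F (\<zeta> (n, j))) powr q)"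
    using c0 by (simp only: ennreal_mult')
  qed
  also have "... = ennreal ?c * (\<Sum>j<2^n. ennreal (pi * ((1/2) ^ (n + 3))\<^sup>2 * norm (F (\<zeta> (n, j))) powr q))"
   by (rule sum_distrib_left[symmetric])
  also have "... <= ennreal ?c * (ennreal (3 * (1/2) ^ n) * ?M n)"
   using \<zeta> by (intro mult_left_mono level_sum_le_circle_mean F) (auto simp: node_def)
  also have "... = ennreal (?c * (3 * (1/2) ^ n)) * ?M n"
   using c0 by (simp only: ennreal_mult' mult.assoc)
  also have "?c * (3 * (1/2) ^ n) = 192 / pi * W n" by (simp add: power_one_over)
  also have "ennreal (192 / pi * W n) * ?M n = ennreal (192 / pi) * (ennreal (W n) * ?M n)"
   by (subst ennreal_mult') (simp_all add: mult.assoc)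
  also have "... <= ennreal (192 / pi) * (ennreal (2 * pi * cl) * emeasure (fm q F) (?A n))"
   by (intro mult_left_mono W_circle_mean_le F) simp
  also have "... = ennreal (192 / pi * (2 * pi * cl)) * emeasure (fm q F) (?A n)"
   by (subst ennreal_mult') (simp_all add: mult.assoc)
  also have "192 / pi * (2 * pi * cl) = 384 * cl" by simp
  finally show "(\<Sum>j<2^n. ennreal (norm (F (\<zeta> (n, j))) powr q * w (n, j))) <= ennreal (384 * cl) * emeasure (fm q F) (?A n)" .
 qed
 also have "... = ennreal (384 * cl) * (\<Sum>n\<le>H. emeasure (fm q F) (?A n))" by (rule sum_distrib_left[symmetric])
 also have "(\<Sum>n\<le>H. emeasure (fm q F) (?A n)) <= of_nat L * emeasure (fm q F) \<DD>"
 proof -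
  have "(\<Sum>n\<le>H. emeasure (fm q F) (?A n)) = (\<Sum>n\<le>H. \<integral>\<^sup>+z. indicator (?A n) z \<partial>fm q F)"
   by (intro sum.cong nn_integral_indicator[symmetric] refl) (simp, measurable)
  also have "... = (\<integral>\<^sup>+z. (\<Sum>n\<le>H. indicator (?A n) z) \<partial>fm q F)"
   by (rule nn_integral_sum[symmetric]) (intro borel_measurable_indicator, simp, measurable)
  also have "... <= (\<integral>\<^sup>+z. of_nat L * indicator \<DD> z \<partial>fm q F)"
  proof (rule nn_integral_mono)
   fix z :: complex
   show "(\<Sum>n\<le>H. indicator (?A n) z) <= of_nat L * (indicator \<DD> z :: ennreal)"
   proof (cases "norm z < 1")
    case True
    obtain m where m: "rad m <= norm z" "norm z < rad (Suc m)" using ex_level[of "norm z"] True by auto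
    have "n + 2 <= m & m < n + 2 + L" if "z : ?A n" for n
    proof -
     have z: "rad (n + 2) <= norm z" "norm z < rad (n + 2 + L)" using that by auto
     have "~ Suc m <= n + 2" using rad_mono[of "Suc m" "n+2"] m z by linarith
     moreover have "~ n + 2 + L <= m" using rad_mono[of "n+2+L" m] m z by linarith
     ultimately show ?thesis by simp
    qed
    hence sub: "{n. n <= H & z : ?A n} <= {n. n + 2 <= m & m < n + 2 + L}" by blast
    have "{n. n + 2 <= m & m < n + 2 + L} <= {m - 1 - L..<m - 1}" by auto
    hence "card {n. n <= H & z : ?A n} <= card {m - 1 - L..<m - 1}"
     using sub by (intro card_mono) auto
    also have "... <= L" by simp
    finally have c: "card {n. n <= H & z : ?A n} <= L" .
    have "(\<Sum>n\<le>H. indicator (?A n) z :: ennreal) = (\<Sum>n\<in>{n. n <= H & z : ?A n}. 1)"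
     by (rule sum.mono_neutral_cong_right) (auto simp: indicator_def)
    also have "... = of_nat (card {n. n <= H & z : ?A n})" by simp
    also have "... <= of_nat L" using c by simp
    finally show ?thesis using True by simp
   next
    case False
    hence "z ~: ?A n" for n using rad_less_1[of "n + 2 + L"] by auto
    hence "(\<Sum>n\<le>H. indicator (?A n) z :: ennreal) = 0"
     by (intro sum.neutral ballI) (simp only: indicator_def of_bool_eq simp_thms)
    thus ?thesis by (simp only: zero_le)
   qed
  qed
  also have "... = of_nat L * emeasure (fm q F) \<DD>" by (rule nn_integral_cmult_indicator) simp
  finally show ?thesis .
 qed
 finally show ?thesis
  using cl_pos by (simp add: ennreal_mult' ennreal_of_nat_eq_real_of_nat mult.assoc mult_left_mono)
qed

end

section \<open>Box maxima of a function and of its derivative\<close>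

definition supb :: "(complex => complex) => nat \<times> nat => real" where
 "supb f k = (SUP z\<in>dbox k. norm (f z))"

definition dsup :: "(complex => complex) => nat \<times> nat => real" where
 "dsup f k = (1/2) ^ fst k * supb (deriv f) k"

lemma dbox_subset_cball: "dbox k <= cball 0 (rad (Suc (fst k)))"
 by (auto simp: dbox_def)

lemma cball_rad_subset_disk: "cball 0 (rad n) <= \<DD>"
 using rad_less_1[of n] by auto

lemma bdd_above_dbox:
 assumes "continuous_on \<DD> f" shows "bdd_above ((%z. norm (f z)) ` dbox k)"
proof -
 have "compact (f ` cball 0 (rad (Suc (fst k))))"
  using continuous_on_subset[OF assms cball_rad_subset_disk] by (intro compact_continuous_image) auto
 hence "bounded (f ` dbox k)"
  using dbox_subset_cball compact_imp_bounded bounded_subset image_mono by metis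
 then obtain B where "\<forall>x\<in>f ` dbox k. norm x <= B" by (auto simp: bounded_iff)
 thus ?thesis by (intro bdd_aboveI[of _ B]) auto
qed

lemma norm_le_supb: "continuous_on \<DD> f ==> z : dbox k ==> norm (f z) <= supb f k"
 unfolding supb_def by (rule cSUP_upper[OF _ bdd_above_dbox])

lemma supb_nonneg: "continuous_on \<DD> f ==> node k ==> 0 <= supb f k"
 by (rule order_trans[OF norm_ge_zero norm_le_supb[OF _ corner_in_dbox]])

lemma supb_le: "node k ==> (!!z. z : dbox k ==> norm (f z) <= B) ==> supb f k <= B"
 unfolding supb_def using corner_in_dbox[of k] by (intro cSUP_least) auto

lemma supb_attained_half:
 assumes "continuous_on \<DD> f" "node k"
 obtains z where "z : dbox k" "supb f k <= 2 * norm (f z)"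
proof (cases "supb f k <= 0")
 case True
 hence "supb f k <= 2 * norm (f (corner k))" by (rule order_trans) simp
 thus thesis using that corner_in_dbox[OF assms(2)] by blast
next
 case False
 hence "supb f k / 2 < (SUP z\<in>dbox k. norm (f z))" by (simp add: supb_def)
 then obtain z where "z : dbox k" "supb f k / 2 < norm (f z)"
  using corner_in_dbox[OF assms(2)] bdd_above_dbox[OF assms(1)]
  by (subst (asm) less_cSUP_iff) auto
 thus thesis using that[of z] by simp
qed

lemma dsup_nonneg: "hol f ==> node k ==> 0 <= dsup f k"
 unfolding dsup_def
 by (intro mult_nonneg_nonneg supb_nonneg hol_cont holomorphic_deriv) auto

text \<open>Cauchy's inequality on the circle of radius 2^(-(n+3)); the point where |F| is largest
  on that circle satisfies \<open>nearbox\<close> and serves as a sample.\<close>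

lemma deriv_le_sphere:
 assumes F: "hol F" and z: "z : dbox k"
 obtains \<zeta> where "norm (\<zeta> - z) = (1/2) ^ (fst k + 3)" "norm (deriv F z) <= norm (F \<zeta>) * (8 * 2 ^ fst k)"
proof -
 let ?r = "(1/2) ^ (fst k + 3) :: real"
 have sub: "cball z ?r <= \<DD>"
 proof
  fix y assume "y : cball z ?r"
  hence "norm y <= norm z + ?r"
   using norm_triangle_ineq[of z "y - z"] by (simp add: dist_norm norm_minus_commute)
  also have "... < rad (Suc (fst k)) + ?r" using z by (simp add: dbox_def)
  also have "... <= 1" by (simp add: rad_def power_add power_one_over)
  finally show "y : \<DD>" by simp
 qed
 have cF: "continuous_on (cball z ?r) F" using F sub hol_cont continuous_on_subset by blast
 have "continuous_on (sphere z ?r) (%y. norm (F y))"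
  using cF continuous_on_subset sphere_cball by (intro continuous_on_norm) blast
 then obtain \<zeta> where \<zeta>: "\<zeta> : sphere z ?r" "!!y. y : sphere z ?r ==> norm (F y) <= norm (F \<zeta>)"
  using continuous_attains_sup[of "sphere z ?r" "%y. norm (F y)"] by auto
 have "norm ((deriv ^^ 1) F z) <= fact 1 * norm (F \<zeta>) / ?r ^ 1"
 proof (rule Cauchy_inequality)
  show "F holomorphic_on ball z ?r" using F sub ball_subset_cball holomorphic_on_subset by blast
  show "norm (F x) <= norm (F \<zeta>)" if "norm (z - x) = ?r" for x
   using \<zeta>(2)[of x] that by (simp add: dist_norm)
 qed (use cF in auto)
 moreover have "norm (F \<zeta>) / ?r = norm (F \<zeta>) * (8 * 2 ^ fst k)" by (simp add: power_add power_one_over)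
 ultimately have "norm (deriv F z) <= norm (F \<zeta>) * (8 * 2 ^ fst k)" by simp
 moreover have "norm (\<zeta> - z) = ?r" using \<zeta>(1) by (simp add: dist_norm norm_minus_commute)
 ultimately show thesis using that by blast
qed

context tent_measure begin

lemma nearboxI: "z : dbox k ==> nearbox k z"
 by (auto simp: nearbox_def intro!: bexI[of _ z])

lemma emeasure_fm_tbox_le_tmean:
 assumes K: "node K" and \<sigma>: "!!a. norm a = rad (fst K - 3) ==> tmean q f a <= ennreal s" and s: "0 <= s"
 shows "emeasure (fm q f) (tbox K) <= ennreal (8 * (1/2) ^ fst K * s)"
proof -
 obtain a where a: "norm a = rad (fst K - 3)" "tbox K <= carleson_square a"
  using tbox_subset_carleson_square[OF K] by blast
 have h: "1 - norm a = (1/2) ^ (fst K - 3)" by (simp add: a rad_def)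
 have h8: "(1/2::real) ^ (fst K - 3) <= 8 * (1/2) ^ fst K"
 proof (cases "fst K <= 3")
  case True
  hence "(1/2::real) ^ 3 <= (1/2) ^ fst K" by (intro power_decreasing) auto
  thus ?thesis using True by (simp add: power_one_over)
 next
  case False
  hence "(1/2::real) ^ fst K = (1/2) ^ (fst K - 3) * (1/2) ^ 3" by (simp add: power_add[symmetric])
  thus ?thesis by (simp add: power_one_over)
 qed
 have "emeasure (fm q f) (tbox K) <= emeasure (fm q f) (carleson_square a)"
  by (rule emeasure_mono[OF a(2)]) simp
 also have "... = ennreal ((1 - norm a) * (1 / (1 - norm a))) * emeasure (fm q f) (carleson_square a)"
  unfolding h by simp
 also have "... = ennreal (1 - norm a) * tmean q f a"
  unfolding tmean_def h by (subst ennreal_mult') (simp_all add: mult.assoc)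
 also have "... <= ennreal (8 * (1/2) ^ fst K) * ennreal s"
  unfolding h by (intro mult_mono \<sigma> a ennreal_leI h8) auto
 also have "... = ennreal (8 * (1/2) ^ fst K * s)" by (rule ennreal_mult'[symmetric]) simp
 finally show ?thesis .
qed

text \<open>The global estimate \<open>sampled_sum_le\<close> is localised to the tent of
  \<open>K\<close> by multiplying F with a power of the kernel anchored at \<open>K\<close>. This
  factor is bounded below on the tent, and its decay, summed over the tents next to ancestors of
  \<open>K\<close>, gives the convolution. The shift l - 3 comes from covering a tent by a Carleson
  square three levels up.\<close>

lemma carl_sampled:
 assumes q: "0 < q"
 obtains C where "0 < C"
  "!!F \<zeta> \<sigma>. [|hol F; !!n. 0 <= \<sigma> n;
   !!a n. norm a = rad n ==> tmean q F a <= ennreal (\<sigma> n); !!k. node k ==> nearbox k (\<zeta> k)|]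
   ==> carl (%k. norm (F (\<zeta> k)) powr q) (%N. C * conv (1/2) (%l. \<sigma> (l - 3)) N)"
proof -
 \<comment> \<open>With m q >= 2 the kernel loses 4^(-i) over i levels while the tents grow by 2^i,
   so 2^(-i) remains.\<close>
 define m where "m = nat \<lceil>2 / q\<rceil>"
 have "2 / q <= real m" unfolding m_def by (rule real_nat_ceiling_ge)
 hence mq: "2 <= real m * q" using q by (simp add: divide_le_eq)
 define c4 where "c4 = (4::real) powr (real m * q)"
 define c11 where "c11 = (11::real) powr (real m * q)"
 have c: "0 < c4" "0 < c11" by (simp_all add: c4_def c11_def)
 define C where "C = c11 * (384 * cl * (L + 1)) * (24 * c4)"
 have C: "0 < C" using c cl_pos by (simp add: C_def)
 show thesis
 proof (rule that[OF C])
  fix F \<zeta> and \<sigma> :: "nat => real"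
  assume F: "hol F" and \<sigma>0: "!!n. 0 <= \<sigma> n"
   and \<sigma>: "!!a n. norm a = rad n ==> tmean q F a <= ennreal (\<sigma> n)" and \<zeta>: "!!k. node k ==> nearbox k (\<zeta> k)"
  show "carl (%k. norm (F (\<zeta> k)) powr q) (%N. C * conv (1/2) (%l. \<sigma> (l - 3)) N)"
   unfolding carl_def
  proof (intro allI impI)
   fix H K assume K: "node K"
   let ?N = "fst K"
   let ?a = "corner K"
   have na: "norm ?a < 1" using rad_less_1 by simp
   have rn: "0 <= rad ?N" by (rule rad_nonneg)
   have den: "1 - cnj ?a * z ~= 0" if "norm z < 1" for z
   proof
    assume "1 - cnj ?a * z = 0"
    hence "norm (cnj ?a * z) = 1" by (metis eq_iff_diff_eq_0 norm_one)
    moreover have "norm ?a * norm z <= norm ?a * 1" using that by (intro mult_left_mono norm_ge_zero) auto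
    ultimately show False using na by (simp add: norm_mult)
   qed
   define \<kappa> where "\<kappa> z = ((1/2) ^ ?N / (1 - cnj ?a * z)) ^ m" for z
   have n\<kappa>: "norm (\<kappa> z) powr q = ((1/2) ^ ?N / norm (1 - cnj ?a * z)) powr (real m * q)" if "norm z < 1" for z
   proof -
    have "0 < (1/2) ^ ?N / norm (1 - cnj ?a * z)" using den[OF that] by simp
    thus ?thesis
     by (simp add: \<kappa>_def norm_power norm_divide powr_realpow[symmetric] powr_powr)
   qed
   define G where "G z = F z * \<kappa> z" for z
   have G: "hol G"
    unfolding G_def \<kappa>_def using den by (intro holomorphic_intros F) auto
   have nG: "norm (G z) powr q = norm (F z) powr q * norm (\<kappa> z) powr q" for z
    by (simp add: G_def norm_mult powr_mult)
   \<comment> \<open>The 10 of \<open>kernel_lower\<close> becomes 11 because a sample may lie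
     slightly off its box.\<close>
   have lower: "norm (F (\<zeta> k)) powr q <= c11 * norm (G (\<zeta> k)) powr q" if k: "node k" "below k K" for k
   proof -
    obtain z' where z': "z' : dbox k" "norm (\<zeta> k - z') <= (1/2) ^ (fst k + 3)"
     using \<zeta>[OF k(1)] by (auto simp: nearbox_def)
    have z1: "norm (\<zeta> k) < 1" using nearbox_norm \<zeta>[OF k(1)] .
    have "norm (1 - cnj ?a * z') <= 10 * (1/2) ^ ?N"
     using dbox_subset_tbox[OF k(2)] z'(1) by (intro kernel_lower) auto
    moreover have "norm (cnj ?a * (\<zeta> k - z')) <= 1 * (1/2) ^ ?N"
    proof -
     have p3: "(1/2::real) ^ (fst k + 3) <= (1/2) ^ ?N" using k(2) by (intro power_decreasing) (auto simp: below_def)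
     show ?thesis unfolding norm_mult by (intro mult_mono order_trans[OF z'(2) p3]) (use na rn in auto)
    qed
    moreover have "norm (1 - cnj ?a * \<zeta> k) <= norm (1 - cnj ?a * z') + norm (cnj ?a * (\<zeta> k - z'))"
     using norm_triangle_ineq4[of "1 - cnj ?a * z'" "cnj ?a * (\<zeta> k - z')"] by (simp add: algebra_simps)
    ultimately have le: "norm (1 - cnj ?a * \<zeta> k) <= 11 * (1/2) ^ ?N" by simp
    have "1 / 11 <= (1/2) ^ ?N / norm (1 - cnj ?a * \<zeta> k)" using le den[OF z1] by (simp add: field_simps)
    hence "(1 / 11) powr (real m * q) <= norm (\<kappa> (\<zeta> k)) powr q"
     unfolding n\<kappa>[OF z1] using q by (intro powr_mono2) auto
    hence "1 <= c11 * norm (\<kappa> (\<zeta> k)) powr q" by (simp add: c11_def powr_divide field_simps)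
    hence "norm (F (\<zeta> k)) powr q * 1 <= norm (F (\<zeta> k)) powr q * (c11 * norm (\<kappa> (\<zeta> k)) powr q)"
     by (intro mult_left_mono) auto
    thus ?thesis unfolding nG by (simp add: mult_ac)
   qed
   have upper: "norm (\<kappa> z) powr q <= c4 * (1/4) ^ (?N - prox K k)" if z: "z : dbox k" for z k
   proof -
    have z1: "norm z < 1" by (rule dbox_subset_disk[OF z])
    have "(1/2) ^ ?N / norm (1 - cnj ?a * z) <= 4 * (1/2) ^ (?N - prox K k)"
     using kernel_upper[OF K z] den[OF z1] by (simp add: pos_divide_le_eq)
    hence "norm (\<kappa> z) powr q <= (4 * (1/2) ^ (?N - prox K k)) powr (real m * q)"
     unfolding n\<kappa>[OF z1] using mq by (intro powr_mono2) auto
    also have "... = c4 * ((1/2) powr (real m * q)) ^ (?N - prox K k)"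
     by (simp add: powr_mult power_powr_commute c4_def)
    also have "... <= c4 * (1/4) ^ (?N - prox K k)"
    proof -
     have "(1/2::real) powr (real m * q) <= (1/2) powr 2" using mq by (intro powr_mono') auto
     also have "... = 1/4" by (simp add: power2_eq_square)
     finally show ?thesis using c by (intro mult_left_mono power_mono) auto
    qed
    finally show ?thesis .
   qed
   \<comment> \<open>A point of box k lies in the tent of the level-\<open>prox K k\<close> ancestor
     of k, which neighbours the corresponding ancestor of \<open>K\<close>. The integral of G is
     thus dominated by a finite sum over tents.\<close>
   have eG: "emeasure (fm q G) \<DD> <= ennreal (24 * c4 * (conv (1/2) (%l. \<sigma> (l - 3)) ?N / 2 ^ ?N))"
   proof -
    let ?\<phi> = "%z. ennreal (norm (F z) powr q) * indicator \<DD> z"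
    have "emeasure (fm q G) \<DD> = (\<integral>\<^sup>+z. ennreal (norm (G z) powr q) * indicator \<DD> z * indicator \<DD> z \<partial>\<mu>)"
     by (rule emeasure_fm[OF G q disk_measurable])
    also have "... <= (\<integral>\<^sup>+z. (\<Sum>l\<le>?N. \<Sum>u\<in>nbrs (anc l K). ennreal (c4 * (1/4) ^ (?N - l)) * (?\<phi> z * indicator (tbox u) z)) \<partial>\<mu>)"
    proof (rule nn_integral_mono)
     fix z :: complex
     show "ennreal (norm (G z) powr q) * indicator \<DD> z * indicator \<DD> z
      <= (\<Sum>l\<le>?N. \<Sum>u\<in>nbrs (anc l K). ennreal (c4 * (1/4) ^ (?N - l)) * (?\<phi> z * indicator (tbox u) z))"
     proof (cases "norm z < 1")
      case True
      obtain k where k: "node k" "z : dbox k" using ex_dbox[OF True] by blast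
      let ?l = "prox K k"
      have l: "?l <= ?N" "?l <= fst k" "near ?l K k" using prox_near[OF K k(1)] by (auto simp: near_def)
      let ?u = "anc ?l k"
      have u: "?u : nbrs (anc ?l K)" using l node_anc[OF k(1) l(2)] by (auto simp: nbrs_def near_def adj_sym)
      have zu: "z : tbox ?u" by (rule dbox_anc[OF k(2) l(2)])
      let ?g = "%l u. ennreal (c4 * (1/4) ^ (?N - l)) * (?\<phi> z * indicator (tbox u) z)"
      have "ennreal (norm (G z) powr q) <= ennreal ((c4 * (1/4) ^ (?N - ?l)) * norm (F z) powr q)"
      proof (rule ennreal_leI)
       have "norm (F z) powr q * norm (\<kappa> z) powr q <= norm (F z) powr q * (c4 * (1/4) ^ (?N - ?l))"
        by (intro mult_left_mono upper[OF k(2)]) simp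
       thus "norm (G z) powr q <= (c4 * (1/4) ^ (?N - ?l)) * norm (F z) powr q"
        unfolding nG by (simp add: mult_ac)
      qed
      also have "... = ?g ?l ?u" using True zu c by (subst ennreal_mult') auto
      also have "... <= (\<Sum>u\<in>nbrs (anc ?l K). ?g ?l u)" using u by (intro member_le_sum[where f="?g ?l"]) auto
      also have "... <= (\<Sum>l\<le>?N. \<Sum>u\<in>nbrs (anc l K). ?g l u)"
       using l by (intro member_le_sum[where f="%l. \<Sum>u\<in>nbrs (anc l K). ?g l u"]) auto
      finally show ?thesis using True by simp
     qed simp
    qed
    also have "... = (\<Sum>l\<le>?N. \<Sum>u\<in>nbrs (anc l K). ennreal (c4 * (1/4) ^ (?N - l)) * emeasure (fm q F) (tbox u))"
    proof -
     have m1: "(%z. ?\<phi> z * indicator (tbox u) z) : borel_measurable \<mu>" for u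
      by (intro measurable_\<mu> borel_measurable_times_ennreal norm_powr_disk_measurable F q borel_measurable_indicator tbox_measurable)
     hence m2: "(%z. ennreal (c4 * (1/4) ^ (?N - l)) * (?\<phi> z * indicator (tbox u) z)) : borel_measurable \<mu>" for u l
      by (intro borel_measurable_times_ennreal[OF borel_measurable_const])
     have "(\<integral>\<^sup>+z. (\<Sum>l\<le>?N. \<Sum>u\<in>nbrs (anc l K). ennreal (c4 * (1/4) ^ (?N - l)) * (?\<phi> z * indicator (tbox u) z)) \<partial>\<mu>)
       = (\<Sum>l\<le>?N. \<integral>\<^sup>+z. (\<Sum>u\<in>nbrs (anc l K). ennreal (c4 * (1/4) ^ (?N - l)) * (?\<phi> z * indicator (tbox u) z)) \<partial>\<mu>)"
      by (rule nn_integral_sum) (intro borel_measurable_sum m2)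
     also have "... = (\<Sum>l\<le>?N. \<Sum>u\<in>nbrs (anc l K). \<integral>\<^sup>+z. ennreal (c4 * (1/4) ^ (?N - l)) * (?\<phi> z * indicator (tbox u) z) \<partial>\<mu>)"
      by (intro sum.cong refl nn_integral_sum m2)
     also have "... = (\<Sum>l\<le>?N. \<Sum>u\<in>nbrs (anc l K). ennreal (c4 * (1/4) ^ (?N - l)) * emeasure (fm q F) (tbox u))"
      by (intro sum.cong refl) (simp only: nn_integral_cmult[OF m1] emeasure_fm[OF F q tbox_measurable])
     finally show ?thesis .
    qed
    also have "... <= (\<Sum>l\<le>?N. \<Sum>u\<in>nbrs (anc l K). ennreal (8 * c4 * ((1/2) ^ (?N - l) * \<sigma> (l - 3)) / 2 ^ ?N))"
    proof (intro sum_mono)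
     fix l u assume l: "l : {..?N}" and u: "u : nbrs (anc l K)"
     have fu: "fst u = l" "node u" using u by (auto simp: nbrs_def)
     have "emeasure (fm q F) (tbox u) <= ennreal (8 * (1/2) ^ fst u * \<sigma> (l - 3))"
      by (rule emeasure_fm_tbox_le_tmean[OF fu(2)]) (use \<sigma> \<sigma>0 fu in auto)
     hence "ennreal (c4 * (1/4) ^ (?N - l)) * emeasure (fm q F) (tbox u)
       <= ennreal (c4 * (1/4) ^ (?N - l)) * ennreal (8 * (1/2) ^ l * \<sigma> (l - 3))"
      unfolding fu by (rule mult_left_mono) simp
     also have "... = ennreal (c4 * (1/4) ^ (?N - l) * (8 * (1/2) ^ l * \<sigma> (l - 3)))"
      using c by (intro ennreal_mult'[symmetric]) simp
     also have "c4 * (1/4) ^ (?N - l) * (8 * (1/2) ^ l * \<sigma> (l - 3)) = 8 * c4 * ((1/2) ^ (?N - l) * \<sigma> (l - 3)) / 2 ^ ?N"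
     proof -
      have "(1/4::real) ^ (?N - l) = (1/2) ^ (?N - l) * (1/2) ^ (?N - l)"
       by (simp add: power_mult_distrib[symmetric])
      moreover have "(1/2::real) ^ (?N - l) * (1/2) ^ l = 1 / 2 ^ ?N"
       using l by (simp add: power_add[symmetric] power_one_over)
      ultimately show ?thesis by (simp add: mult_ac)
     qed
     finally show "ennreal (c4 * (1/4) ^ (?N - l)) * emeasure (fm q F) (tbox u)
       <= ennreal (8 * c4 * ((1/2) ^ (?N - l) * \<sigma> (l - 3)) / 2 ^ ?N)" .
    qed
    also have "... = ennreal (\<Sum>l\<le>?N. \<Sum>u\<in>nbrs (anc l K). 8 * c4 * ((1/2) ^ (?N - l) * \<sigma> (l - 3)) / 2 ^ ?N)"
     using c \<sigma>0 by (simp add: sum_ennreal sum_nonneg del: sum_constant)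
    also have "... <= ennreal (\<Sum>l\<le>?N. 3 * (8 * c4 * ((1/2) ^ (?N - l) * \<sigma> (l - 3)) / 2 ^ ?N))"
    proof (intro ennreal_leI sum_mono)
     fix l
     have "(\<Sum>u\<in>nbrs (anc l K). 8 * c4 * ((1/2) ^ (?N - l) * \<sigma> (l - 3)) / 2 ^ ?N)
       = real (card (nbrs (anc l K))) * (8 * c4 * ((1/2) ^ (?N - l) * \<sigma> (l - 3)) / 2 ^ ?N)" by (rule sum_constant)
     also have "... <= 3 * (8 * c4 * ((1/2) ^ (?N - l) * \<sigma> (l - 3)) / 2 ^ ?N)"
      using card_nbrs[of "anc l K"] c \<sigma>0[of "l - 3"] by (intro mult_right_mono) auto
     finally show "(\<Sum>u\<in>nbrs (anc l K). 8 * c4 * ((1/2) ^ (?N - l) * \<sigma> (l - 3)) / 2 ^ ?N)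
       <= 3 * (8 * c4 * ((1/2) ^ (?N - l) * \<sigma> (l - 3)) / 2 ^ ?N)" .
    qed
    also have "(\<Sum>l\<le>?N. 3 * (8 * c4 * ((1/2) ^ (?N - l) * \<sigma> (l - 3)) / 2 ^ ?N))
      = 24 * c4 * (conv (1/2) (%l. \<sigma> (l - 3)) ?N / 2 ^ ?N)"
     by (simp add: conv_def sum_distrib_left sum_divide_distrib mult_ac)
    finally show ?thesis .
   qed
   have "(\<Sum>k\<in>boxes H. ennreal (norm (G (\<zeta> k)) powr q * w k)) <= ennreal (384 * cl * L) * emeasure (fm q G) \<DD>"
    by (rule sampled_sum_le[OF G q]) (rule \<zeta>)
   also have "... <= ennreal (384 * cl * L) * ennreal (24 * c4 * (conv (1/2) (%l. \<sigma> (l - 3)) ?N / 2 ^ ?N))"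
    by (intro mult_left_mono eG) simp
   finally have "(\<Sum>k\<in>boxes H. ennreal (norm (G (\<zeta> k)) powr q * w k))
     <= ennreal (384 * cl * L) * ennreal (24 * c4 * (conv (1/2) (%l. \<sigma> (l - 3)) ?N / 2 ^ ?N))" .
   moreover have "(\<Sum>k\<in>boxes H. ennreal (norm (G (\<zeta> k)) powr q * w k)) = ennreal (\<Sum>k\<in>boxes H. norm (G (\<zeta> k)) powr q * w k)"
    using less_imp_le[OF w_pos] by (intro sum_ennreal) auto
   moreover have "ennreal (384 * cl * L) * ennreal (24 * c4 * (conv (1/2) (%l. \<sigma> (l - 3)) ?N / 2 ^ ?N))
     = ennreal (384 * cl * L * (24 * c4 * (conv (1/2) (%l. \<sigma> (l - 3)) ?N / 2 ^ ?N)))"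
    using cl_pos by (intro ennreal_mult'[symmetric]) simp
   ultimately have "ennreal (\<Sum>k\<in>boxes H. norm (G (\<zeta> k)) powr q * w k)
     <= ennreal (384 * cl * L * (24 * c4 * (conv (1/2) (%l. \<sigma> (l - 3)) ?N / 2 ^ ?N)))"
    by (simp only:)
   hence gs: "(\<Sum>k\<in>boxes H. norm (G (\<zeta> k)) powr q * w k)
     <= 384 * cl * L * (24 * c4 * (conv (1/2) (%l. \<sigma> (l - 3)) ?N / 2 ^ ?N))"
    using cl_pos c \<sigma>0 conv_nonneg[of "1/2" "%l. \<sigma> (l - 3)"] by (subst (asm) ennreal_le_iff) auto
   have "(\<Sum>k | k : boxes H & below k K. norm (F (\<zeta> k)) powr q * w k)
     <= (\<Sum>k | k : boxes H & below k K. c11 * (norm (G (\<zeta> k)) powr q * w k))"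
    using lower less_imp_le[OF w_pos]
    by (intro sum_mono) (auto simp: mem_boxes mult.assoc[symmetric] intro!: mult_right_mono)
   also have "... <= (\<Sum>k\<in>boxes H. c11 * (norm (G (\<zeta> k)) powr q * w k))"
    using c less_imp_le[OF w_pos] by (intro sum_mono2) auto
   also have "... = c11 * (\<Sum>k\<in>boxes H. norm (G (\<zeta> k)) powr q * w k)" by (simp add: sum_distrib_left)
   also have "... <= c11 * (384 * cl * L * (24 * c4 * (conv (1/2) (%l. \<sigma> (l - 3)) ?N / 2 ^ ?N)))"
    using c by (intro mult_left_mono gs) auto
   finally have "cmean (%k. norm (F (\<zeta> k)) powr q) H K
     <= 2 ^ ?N * (c11 * (384 * cl * L * (24 * c4 * (conv (1/2) (%l. \<sigma> (l - 3)) ?N / 2 ^ ?N))))"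
    unfolding cmean_def by (rule mult_left_mono) simp
   also have "... = c11 * (384 * cl * L) * (24 * c4) * conv (1/2) (%l. \<sigma> (l - 3)) ?N" by simp
   also have "... <= C * conv (1/2) (%l. \<sigma> (l - 3)) ?N"
    unfolding C_def using c cl_pos \<sigma>0 conv_nonneg[of "1/2" "%l. \<sigma> (l - 3)" ?N]
    by (intro mult_right_mono mult_left_mono) auto
   finally show "cmean (%k. norm (F (\<zeta> k)) powr q) H K <= C * conv (1/2) (%l. \<sigma> (l - 3)) ?N" .
  qed
 qed
qed

text \<open>Both maxima are at most 16 times a value at a near point: 2 because a supremum is taken
  up to a half, 8 from Cauchy's inequality.\<close>

lemma carl_supb_dsup:
 assumes q: "0 < q"
 obtains C where "0 < C"
  "!!F \<sigma>. [|hol F; !!n. 0 <= \<sigma> n; !!a n. norm a = rad n ==> tmean q F a <= ennreal (\<sigma> n)|]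
   ==> carl (%k. supb F k powr q) (%N. C * conv (1/2) (%l. \<sigma> (l - 3)) N) &
     carl (%k. dsup F k powr q) (%N. C * conv (1/2) (%l. \<sigma> (l - 3)) N)"
proof -
 obtain C where C: "0 < C"
  and cs: "!!F \<zeta> \<sigma>. [|hol F; !!n. 0 <= \<sigma> n;
   !!a n. norm a = rad n ==> tmean q F a <= ennreal (\<sigma> n); !!k. node k ==> nearbox k (\<zeta> k)|]
   ==> carl (%k. norm (F (\<zeta> k)) powr q) (%N. C * conv (1/2) (%l. \<sigma> (l - 3)) N)"
  using carl_sampled[OF q] by blast
 show thesis
 proof (rule that[of "16 powr q * C"])
  show "0 < 16 powr q * C" using C by simp
  fix F and \<sigma> :: "nat => real"
  assume F: "hol F" and \<sigma>0: "!!n. 0 <= \<sigma> n"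
   and \<sigma>: "!!a n. norm a = rad n ==> tmean q F a <= ennreal (\<sigma> n)"
  let ?b = "conv (1/2) (%l. \<sigma> (l - 3))"
  have cF: "continuous_on \<DD> F" by (rule hol_cont[OF F])
  have cdF: "continuous_on \<DD> (deriv F)"
   by (intro hol_cont holomorphic_deriv F) simp
  have gen: "carl (%k. X k powr q) (%N. 16 powr q * C * ?b N)"
   if X: "!!k. node k ==> 0 <= X k & X k <= 16 * norm (F (\<zeta> k))" and \<zeta>: "!!k. node k ==> nearbox k (\<zeta> k)" for X \<zeta>
  proof (rule carl_mono[OF carl_cmult[OF cs[OF F \<sigma>0 \<sigma> \<zeta>]]])
   fix k assume k: "node k"
   have "X k powr q <= (16 * norm (F (\<zeta> k))) powr q" using X[OF k] q by (intro powr_mono2) auto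
   thus "X k powr q <= 16 powr q * norm (F (\<zeta> k)) powr q" by (simp add: powr_mult)
  qed (auto simp: mult.assoc)
  have "\<exists>z. z : dbox k & supb F k <= 2 * norm (F z)" if "node k" for k
   using supb_attained_half[OF cF that] by blast
  then obtain \<zeta> where \<zeta>: "!!k. node k ==> \<zeta> k : dbox k & supb F k <= 2 * norm (F (\<zeta> k))" by metis
  have 1: "carl (%k. supb F k powr q) (%N. 16 powr q * C * ?b N)"
  proof (rule gen)
   fix k assume k: "node k"
   have "2 * norm (F (\<zeta> k)) <= 16 * norm (F (\<zeta> k))" by simp
   thus "0 <= supb F k & supb F k <= 16 * norm (F (\<zeta> k))"
    using \<zeta>[OF k] supb_nonneg[OF cF k] by linarith
   show "nearbox k (\<zeta> k)" using \<zeta>[OF k] nearboxI by blast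
  qed
  have "\<exists>z. nearbox k z & dsup F k <= 16 * norm (F z)" if k: "node k" for k
  proof -
   obtain z where z: "z : dbox k" "supb (deriv F) k <= 2 * norm (deriv F z)"
    using supb_attained_half[OF cdF k] by blast
   obtain \<xi> where \<xi>: "norm (\<xi> - z) = (1/2) ^ (fst k + 3)" "norm (deriv F z) <= norm (F \<xi>) * (8 * 2 ^ fst k)"
    using deriv_le_sphere[OF F z(1)] by blast
   have "supb (deriv F) k <= 2 * (norm (F \<xi>) * (8 * 2 ^ fst k))" using z(2) \<xi>(2) by linarith
   hence "dsup F k <= (1/2) ^ fst k * (2 * (norm (F \<xi>) * (8 * 2 ^ fst k)))"
    unfolding dsup_def by (intro mult_left_mono) auto
   also have "... = 16 * norm (F \<xi>)" by (simp add: power_one_over)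
   finally show ?thesis using \<xi>(1) z(1) by (auto simp: nearbox_def intro!: exI[of _ \<xi>] bexI[of _ z])
  qed
  then obtain \<xi> where \<xi>: "!!k. node k ==> nearbox k (\<xi> k) & dsup F k <= 16 * norm (F (\<xi> k))" by metis
  have 2: "carl (%k. dsup F k powr q) (%N. 16 powr q * C * ?b N)"
   by (rule gen[of _ \<xi>]) (use \<xi> dsup_nonneg[OF F] in auto)
  show "carl (%k. supb F k powr q) (%N. 16 powr q * C * ?b N) & carl (%k. dsup F k powr q) (%N. 16 powr q * C * ?b N)"
   using 1 2 by blast
 qed
qed

text \<open>The derivative is integrated along the radius ending in z, cut at the dyadic radii. The
  piece l lies in the box of the level-l ancestor and has length at most 2^(-l).\<close>

lemma supb_le_sum_dsup:
 assumes F: "hol F" "F 0 = 0" and k: "node k"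
 shows "supb F k <= (\<Sum>l\<le>fst k. dsup F (anc l k))"
proof (rule supb_le[OF k])
 fix z assume z: "z : dbox k"
 let ?n = "fst k"
 have cdF: "continuous_on \<DD> (deriv F)"
  by (intro hol_cont holomorphic_deriv F) simp
 define e where "e = rcis 1 (2 * pi * turn z)"
 have ne: "norm e = 1" by (simp add: e_def rcis_def)
 have zt: "z = of_real (norm z) * e" using rcis_turn[of z] by (simp add: e_def rcis_def)
 have nz: "rad ?n <= norm z" "norm z < rad (Suc ?n)" "norm z < 1"
  using z dbox_subset_disk[OF z] by (auto simp: dbox_def)
 \<comment> \<open>The minimum with |z| ends the last piece at z, so the differences telescope from
   0 to z.\<close>
 define s where "s l = min (rad l) (norm z)" for l
 have s0: "s 0 = 0" by (simp add: s_def)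
 have sn: "s (Suc ?n) = norm z" using nz by (simp add: s_def)
 have step: "norm (F (of_real (s (Suc l)) * e) - F (of_real (s l) * e)) <= dsup F (anc l k)" if l: "l <= ?n" for l
 proof -
  let ?a = "of_real (s l) * e" and ?b = "of_real (s (Suc l)) * e"
  let ?B = "supb (deriv F) (anc l k)"
  have sl: "s l = rad l" using rad_mono[OF l] nz by (simp add: s_def)
  have sb: "s l <= s (Suc l)" "s (Suc l) <= rad (Suc l)" "s (Suc l) <= norm z"
   using rad_mono[of l "Suc l"] by (auto simp: s_def)
  have d0: "0 <= dsup F (anc l k)" using dsup_nonneg[OF F(1) node_anc[OF k l]] .
  have B0: "0 <= ?B" using supb_nonneg[OF cdF node_anc[OF k l]] .
  show ?thesis
  proof (cases "s l = s (Suc l)")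
   case False
   hence lt: "s l < s (Suc l)" using sb by simp
   have in1: "norm (of_real t * e) < 1" if "0 <= t" "t <= s (Suc l)" for t
    using that sb nz by (simp add: norm_mult ne)
   have s0l: "0 <= s l" using sl rad_nonneg by simp
   have "norm (F ?b - F ?a) <= ?B * s (Suc l) - ?B * s l"
   proof (rule differentiable_bound_general[where f="%t. F (of_real t * e)" and \<phi>="%t. ?B * t"
      and f'="%t. deriv F (of_real t * e) * e" and \<phi>'="%_. ?B", OF lt])
    show "continuous_on {s l..s (Suc l)} (%t. F (of_real t * e))"
     using in1 s0l
     by (intro continuous_on_compose2[OF hol_cont[OF F(1)]] continuous_intros) auto
    show "((%t. F (of_real t * e)) has_vector_derivative deriv F (of_real t * e) * e) (at t)"
     if "s l < t" "t < s (Suc l)" for t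
    proof -
     have "(F has_field_derivative deriv F (of_real t * e)) (at (of_real t * e))"
      using in1[of t] that s0l by (intro holomorphic_derivI[OF F(1)]) auto
     moreover have "((%t. of_real t * e) has_vector_derivative e) (at t)"
      by (auto intro!: derivative_eq_intros)
     ultimately show ?thesis
      using field_vector_diff_chain_at[of "%t. of_real t * e" e t F "deriv F (of_real t * e)"]
      by (simp add: o_def mult.commute)
    qed
    show "norm (deriv F (of_real t * e) * e) <= ?B" if t: "s l < t" "t < s (Suc l)" for t
    proof -
     have t0: "0 < t" using t s0l by simp
     have "of_real t * e = rcis t (2 * pi * turn z)" by (simp add: e_def rcis_def)
     hence "turn (of_real t * e) = turn z" using turn_rcis[OF t0] by simp
     hence "slot l (of_real t * e) = slot l z" by (simp add: slot_def)
     hence "of_real t * e : dbox (anc l k)"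
      using t t0 sl sb slot_anc[OF z l] by (simp add: dbox_def norm_mult ne)
     thus ?thesis using norm_le_supb[OF cdF] by (simp add: norm_mult ne)
    qed
   qed (auto intro!: continuous_intros derivative_eq_intros)
   also have "... = ?B * (s (Suc l) - s l)" by (simp add: right_diff_distrib)
   also have "... <= ?B * (1/2) ^ l"
   proof (rule mult_left_mono[OF _ B0])
    have "rad (Suc l) - rad l <= (1/2) ^ l" by (simp add: rad_def)
    thus "s (Suc l) - s l <= (1/2) ^ l" using sb sl by linarith
   qed
   finally show ?thesis by (simp add: dsup_def mult.commute)
  qed (use d0 in simp)
 qed
 have "F z = (\<Sum>l<Suc ?n. F (of_real (s (Suc l)) * e) - F (of_real (s l) * e))"
  by (subst sum_lessThan_telescope) (simp add: s0 sn F(2) zt[symmetric])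
 also have "norm ... <= (\<Sum>l<Suc ?n. dsup F (anc l k))"
  by (intro sum_norm_le step) auto
 finally show "norm (F z) <= (\<Sum>l\<le>fst k. dsup F (anc l k))" by (simp only: lessThan_Suc_atMost)
qed

end

subsection \<open>Multipliers of the discrete tent spaces\<close>

lemma volterra_holomorphic:
 assumes f: "hol f" and g: "hol g"
 shows "volterra g f holomorphic_on \<DD>" "volterra g f 0 = 0"
  "!!z. z : \<DD> ==> deriv (volterra g f) z = f z * deriv g z"
proof -
 let ?h = "%\<zeta>. f \<zeta> * deriv g \<zeta>"
 have h: "?h holomorphic_on \<DD>" using f g by (intro holomorphic_intros holomorphic_deriv) auto
 obtain G where G: "!!z. z : \<DD> ==> (G has_field_derivative ?h z) (at z within \<DD>)"
  using holomorphic_convex_primitive'[OF convex_ball open_ball h] by blast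
 have eq: "volterra g f z = G z - G 0" if z: "z : \<DD>" for z
 proof -
  have "(?h has_contour_integral (G (pathfinish (linepath 0 z)) - G (pathstart (linepath 0 z)))) (linepath 0 z)"
   using z by (intro contour_integral_primitive[of \<DD> G] G) (auto simp: closed_segment_subset)
  thus ?thesis using z by (simp add: volterra_def contour_integral_unique)
 qed
 have d: "(volterra g f has_field_derivative ?h z) (at z)" if z: "z : \<DD>" for z
 proof -
  have "(G has_field_derivative ?h z) (at z)" using G[OF z] z by (metis at_within_open open_ball)
  hence "((%z. G z - G 0) has_field_derivative ?h z) (at z)" by (auto intro!: derivative_eq_intros)
  thus ?thesis
   by (rule has_field_derivative_transform_within_open[where S=\<DD>]) (use z eq in auto)
 qed
 show "volterra g f holomorphic_on \<DD>" unfolding holomorphic_on_open[OF open_ball] using d by blast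
 show "volterra g f 0 = 0" using eq[of 0] by simp
 show "!!z. z : \<DD> ==> deriv (volterra g f) z = f z * deriv g z" using d DERIV_imp_deriv by blast
qed

lemma dsup_volterra_le:
 assumes f: "hol f" and g: "hol g" and k: "node k"
 shows "dsup (volterra g f) k <= supb f k * dsup g k"
proof -
 have "supb (deriv (volterra g f)) k <= supb f k * supb (deriv g) k"
 proof (rule supb_le[OF k])
  fix z assume z: "z : dbox k"
  have cg: "continuous_on \<DD> (deriv g)" by (intro hol_cont holomorphic_deriv g) simp
  have cf: "continuous_on \<DD> f" by (rule hol_cont[OF f])
  have "norm (deriv (volterra g f) z) = norm (f z) * norm (deriv g z)"
   using volterra_holomorphic(3)[OF f g, of z] dbox_subset_disk[OF z] by (simp add: norm_mult)
  also have "... <= supb f k * supb (deriv g) k"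
   using norm_le_supb[OF cf z] norm_le_supb[OF cg z] supb_nonneg[OF cf k] by (intro mult_mono) auto
  finally show "norm (deriv (volterra g f) z) <= supb f k * supb (deriv g) k" .
 qed
 hence "(1/2) ^ fst k * supb (deriv (volterra g f)) k <= (1/2) ^ fst k * (supb f k * supb (deriv g) k)"
  by (intro mult_left_mono) auto
 thus ?thesis by (simp add: dsup_def mult_ac)
qed

lemma eventually_to_circle: "eventually P to_circle \<longleftrightarrow> (\<exists>N. \<forall>z. rad N <= norm z & norm z < 1 --> P z)"
proof
 assume "eventually P to_circle"
 then obtain Q where Q: "eventually Q (at_left (1::real))" "!!z. Q (norm z) ==> P z"
  unfolding to_circle_def eventually_filtercomap by blast
 then obtain b where b: "b < 1" "!!y. b < y ==> y < 1 ==> Q y"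
  using eventually_at_left[of "0::real" 1 Q] by auto
 obtain N where N: "b < rad N" using ex_rad_gt[OF b(1)] by blast
 have "P z" if "rad N <= norm z" "norm z < 1" for z
  using Q(2) b(2)[of "norm z"] N that by simp
 thus "\<exists>N. \<forall>z. rad N <= norm z & norm z < 1 --> P z" by blast
next
 assume "\<exists>N. \<forall>z. rad N <= norm z & norm z < 1 --> P z"
 then obtain N where N: "!!z. rad N <= norm z ==> norm z < 1 ==> P z" by blast
 have "eventually (%r. rad N < r & r < 1) (at_left (1::real))"
  using rad_less_1[of N] eventually_at_left[of "rad N" 1] by auto
 thus "eventually P to_circle"
  unfolding to_circle_def eventually_filtercomap using N by (intro exI[of _ "%r. rad N < r & r < 1"]) auto
qed

text \<open>Either v^q is at most \<epsilon> u^(p-q), or u is bounded by a power of v; each case is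
  covered by one of the two terms. The dependence on \<epsilon> is explicit because the first term
  has to be made small later.\<close>

lemma young_powr:
 fixes u v :: real
 assumes "0 <= u" "0 <= v" "0 < \<epsilon>" and pq: "0 < q" "q < p"
 shows "(u * v) powr q <= \<epsilon> * u powr p + \<epsilon> powr (- q / (p - q)) * v powr (p * q / (p - q))"
proof (cases "v powr q <= \<epsilon> * u powr (p - q)")
 case True
 have "(u * v) powr q = u powr q * v powr q" by (rule powr_mult)
 also have "... <= u powr q * (\<epsilon> * u powr (p - q))" using True by (intro mult_left_mono) auto
 also have "... = \<epsilon> * u powr p" using powr_add[of u q "p - q"] by (simp add: mult_ac)
 finally show ?thesis using assms by (simp add: add_increasing2)
next
 case False
 let ?d = "1 / (p - q)"
 have d: "0 < ?d" using pq by simp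
 have "\<epsilon> * u powr (p - q) <= v powr q" using False by simp
 hence "u powr (p - q) <= v powr q / \<epsilon>" using assms by (simp add: field_simps)
 hence "(u powr (p - q)) powr ?d <= (v powr q / \<epsilon>) powr ?d" using d by (intro powr_mono2) auto
 hence "u <= (v powr q / \<epsilon>) powr ?d" using pq assms by (simp add: powr_powr)
 hence "u powr q <= ((v powr q / \<epsilon>) powr ?d) powr q" using pq assms by (intro powr_mono2) auto
 also have "... = (v powr q / \<epsilon>) powr (q / (p - q))" by (simp add: powr_powr)
 also have "... = (v powr q) powr (q / (p - q)) / \<epsilon> powr (q / (p - q))" by (rule powr_divide)
 also have "... = v powr (q * q / (p - q)) * \<epsilon> powr (- q / (p - q))"
  by (simp add: powr_powr powr_minus divide_inverse mult.assoc)
 finally have "u powr q * v powr q <= v powr (q * q / (p - q)) * \<epsilon> powr (- q / (p - q)) * v powr q"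
  by (intro mult_right_mono) auto
 also have "... = \<epsilon> powr (- q / (p - q)) * (v powr (q * q / (p - q)) * v powr q)" by simp
 also have "v powr (q * q / (p - q)) * v powr q = v powr (p * q / (p - q))"
 proof -
  have "q * q / (p - q) + q = p * q / (p - q)" using pq by (simp add: field_simps)
  thus ?thesis by (metis powr_add)
 qed
 finally show ?thesis using assms by (simp add: powr_mult add_increasing)
qed

context dyadic_weight begin

lemma W_tendsto_0: "W \<longlonglongrightarrow> 0"
proof (rule tendsto_sandwich[where f="%_. 0" and h="%n. cr * \<rho> ^ n * W 0"])
 show "\<forall>\<^sub>F n in sequentially. W n <= cr * \<rho> ^ n * W 0" using W_decay[of 0] by simp
 have "(%n. cr * \<rho> ^ n * W 0) \<longlonglongrightarrow> cr * 0 * W 0" using \<rho> by (intro tendsto_intros LIMSEQ_power_zero) auto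
 thus "(%n. cr * \<rho> ^ n * W 0) \<longlonglongrightarrow> 0" by simp
qed (use less_imp_le[OF W_pos] in auto)

lemma carl_const: "0 <= c ==> carl (%_. c) (%n. c * (cr / (1 - \<rho>)) * W n)"
 unfolding carl_def
proof (intro allI impI)
 fix H K assume c: "0 <= c" and K: "node K"
 have "(\<Sum>k | k : boxes H & below k K. w k) <= cr / (1 - \<rho>) * w K"
  using w_sum[of 1 K H] \<rho> K by simp
 hence "2 ^ fst K * (c * (\<Sum>k | k : boxes H & below k K. w k)) <= 2 ^ fst K * (c * (cr / (1 - \<rho>) * w K))"
  using c by (intro mult_left_mono) auto
 thus "cmean (%_. c) H K <= c * (cr / (1 - \<rho>)) * W (fst K)"
  by (simp add: cmean_def sum_distrib_left w_def)
qed

text \<open>The common majorant at a level is the supremum of all means there; uniform decay makes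
  it a null sequence. The inserted 0 keeps the set nonempty and the bound nonnegative.\<close>

lemma carl_family:
 assumes x: "!!x k. x : X ==> node k ==> 0 <= x k" and bd: "!!x. x : X ==> carl x (%_. B)"
  and van: "!!\<eta>. 0 < \<eta> ==> \<exists>N. \<forall>x\<in>X. \<forall>H K. node K --> N <= fst K --> cmean x H K <= \<eta>"
 obtains b where "!!n. 0 <= b n" "!!n. b n <= max 0 B" "b \<longlonglongrightarrow> 0" "!!x. x : X ==> carl x b"
proof -
 define S where "S n = insert 0 {cmean x H K | x H K. x : X & node K & fst K = n}" for n
 define b where "b n = Sup (S n)" for n
 have ub: "s <= max 0 B" if "s : S n" for s n
 proof (cases "s = 0")
  case False
  then obtain x H K where "s = cmean x H K" "x : X" "node K" using \<open>s : S n\<close> unfolding S_def by blast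
  hence "s <= B" using carlD[OF bd] by blast
  thus ?thesis by simp
 qed simp
 have bdd: "bdd_above (S n)" for n using ub by (auto intro!: bdd_aboveI[of _ "max 0 B"])
 have up: "s <= b n" if "s : S n" for s n unfolding b_def using that bdd by (rule cSup_upper)
 have least: "b n <= e" if "!!s. s : S n ==> s <= e" for n e unfolding b_def using that by (intro cSup_least) (auto simp: S_def)
 have b0: "0 <= b n" for n by (rule up) (simp add: S_def)
 show thesis
 proof (rule that)
  show "0 <= b n" for n by (rule b0)
  show "b n <= max 0 B" for n by (rule least[OF ub])
  show "carl x b" if "x : X" for x
   unfolding carl_def
  proof (intro allI impI)
   fix H K assume "node K"
   thus "cmean x H K <= b (fst K)" using that by (intro up) (unfold S_def, blast)
  qed
  show "b \<longlonglongrightarrow> 0"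
  proof (rule LIMSEQ_I)
   fix r :: real assume r: "0 < r"
   then obtain N where N: "\<forall>x\<in>X. \<forall>H K. node K --> N <= fst K --> cmean x H K <= r / 2"
    using van[of "r / 2"] by auto
   have "norm (b n - 0) < r" if "N <= n" for n
   proof -
    have "b n <= r / 2"
    proof (rule least)
     fix s assume s: "s : S n"
     show "s <= r / 2"
     proof (cases "s = 0")
      case False
      then obtain x H K where "s = cmean x H K" "x : X" "node K" "fst K = n" using s unfolding S_def by blast
      thus ?thesis using N that by blast
     qed (use r in simp)
    qed
    thus ?thesis using b0[of n] r by simp
   qed
   thus "\<exists>N. \<forall>n\<ge>N. norm (b n - 0) < r" by blast
  qed
 qed
qed

text \<open>\<open>d\<close> multiplies the discrete \<open>p\<close>-tent space into the vanishing \<open>q\<close>-tent space, uniformly on balls.\<close>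

definition vmult :: "real => real => (nat \<times> nat => real) => bool" where
 "vmult p q d \<longleftrightarrow> (\<forall>Q\<ge>0. \<exists>b B. (\<forall>n. 0 <= b n & b n <= B) & b \<longlonglongrightarrow> 0 &
   (\<forall>M. (\<forall>k. node k --> 0 <= M k) & carl (%k. M k powr p) (%_. Q) --> carl (%k. (M k * d k) powr q) b))"

lemma vmultI:
 assumes "!!Q. 0 <= Q ==> \<exists>B. \<forall>M. (\<forall>k. node k --> 0 <= M k) --> carl (%k. M k powr p) (%_. Q) --> carl (%k. (M k * d k) powr q) (%_. B)"
  "!!Q \<eta>. 0 <= Q ==> 0 < \<eta> ==> \<exists>N. \<forall>M. (\<forall>k. node k --> 0 <= M k) --> carl (%k. M k powr p) (%_. Q) -->
   (\<forall>H K. node K --> N <= fst K --> cmean (%k. (M k * d k) powr q) H K <= \<eta>)"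
 shows "vmult p q d"
 unfolding vmult_def
proof (intro allI impI)
 fix Q :: real assume Q: "0 <= Q"
 let ?X = "{(%k. (M k * d k) powr q) | M. (\<forall>k. node k --> 0 <= M k) & carl (%k. M k powr p) (%_. Q)}"
 obtain B where B: "!!x. x : ?X ==> carl x (%_. B)" using assms(1)[OF Q] by auto
 have van: "\<exists>N. \<forall>x\<in>?X. \<forall>H K. node K --> N <= fst K --> cmean x H K <= \<eta>" if \<eta>: "0 < \<eta>" for \<eta>
 proof -
  obtain N where "\<forall>M. (\<forall>k. node k --> 0 <= M k) --> carl (%k. M k powr p) (%_. Q) -->
   (\<forall>H K. node K --> N <= fst K --> cmean (%k. (M k * d k) powr q) H K <= \<eta>)"
   using assms(2)[OF Q \<eta>] by blast
  thus ?thesis by (intro exI[of _ N]) blast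
 qed
 have nn: "0 <= x k" if "x : ?X" for x k using that by auto
 show "\<exists>b B. (\<forall>n. 0 <= b n & b n <= B) & b \<longlonglongrightarrow> 0 &
   (\<forall>M. (\<forall>k. node k --> 0 <= M k) & carl (%k. M k powr p) (%_. Q) --> carl (%k. (M k * d k) powr q) b)"
 proof (rule carl_family[of ?X B])
  show "0 <= x k" if "x : ?X" for x k by (rule nn[OF that])
  show "carl x (%_. B)" if "x : ?X" for x by (rule B[OF that])
  show "\<exists>N. \<forall>x\<in>?X. \<forall>H K. node K --> N <= fst K --> cmean x H K <= \<eta>" if "0 < \<eta>" for \<eta> by (rule van[OF that])
  fix b assume b: "!!n. 0 <= b n" "!!n. b n <= max 0 B" "b \<longlonglongrightarrow> 0" "!!x. x : ?X ==> carl x b"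
  have "carl (%k. (M k * d k) powr q) b" if "(\<forall>k. node k --> 0 <= M k) & carl (%k. M k powr p) (%_. Q)" for M
   using that by (intro b(4)) blast
  thus ?thesis using b(1-3) by (intro exI[of _ b] exI[of _ "max 0 B"]) simp
 qed
qed

text \<open>M^q splits into M^p M^(q-p). The growth estimate bounds M^(q-p) by a multiple of W^(1 -
  q/p), exactly the power of W that comes with d^q in the hypothesis.\<close>

lemma vmult_le:
 assumes pq: "0 < p" "p <= q" and d: "!!k. node k ==> 0 <= d k"
  and e: "!!k. node k ==> d k * W (fst k) powr (1/q - 1/p) <= e (fst k)" and e0: "e \<longlonglongrightarrow> 0"
 shows "vmult p q d"
proof (rule vmultI)
 have q: "0 < q" using pq by simp
 have pt: "(M k * d k) powr q <= Q powr (q/p - 1) * E powr q * M k powr p"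
  if Q: "0 <= Q" and M: "\<forall>k. node k --> 0 <= M k" and cM: "carl (%k. M k powr p) (%_. Q)"
   and k: "node k" and E: "e (fst k) <= E" for Q M k E
 proof -
  let ?W = "W (fst k)"
  have W: "0 < ?W" by (rule W_pos)
  have Mk: "0 <= M k" using M k by blast
  have "M k powr p * ?W <= Q" using carl_pointwise[OF cM _ k] by simp
  hence "M k powr p <= Q / ?W" using W by (simp add: pos_le_divide_eq)
  hence "(M k powr p) powr (q/p - 1) <= (Q / ?W) powr (q/p - 1)"
   using pq by (intro powr_mono2) (auto simp: field_simps)
  hence M1: "M k powr (q - p) <= Q powr (q/p - 1) * ?W powr (1 - q/p)"
  proof -
   have "p * (q/p - 1) = q - p" using pq by (simp add: field_simps)
   hence "(M k powr p) powr (q/p - 1) = M k powr (q - p)" by (simp only: powr_powr)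
   moreover have "(Q / ?W) powr (q/p - 1) = Q powr (q/p - 1) * ?W powr (1 - q/p)"
   proof -
    have "1 - q/p = - (q/p - 1)" by simp
    hence i: "?W powr (1 - q/p) = inverse (?W powr (q/p - 1))" by (simp only: powr_minus)
    have "(Q / ?W) powr (q/p - 1) = Q powr (q/p - 1) / ?W powr (q/p - 1)" by (rule powr_divide)
    thus ?thesis unfolding i by (simp only: divide_inverse[of "Q powr (q/p - 1)"])
   qed
   ultimately show ?thesis using \<open>(M k powr p) powr (q/p - 1) <= (Q / ?W) powr (q/p - 1)\<close> by simp
  qed
  have "(d k * ?W powr (1/q - 1/p)) powr q <= E powr q"
   using e[OF k] E d[OF k] q by (intro powr_mono2) auto
  hence D: "d k powr q * ?W powr (1 - q/p) <= E powr q"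
   using q pq by (simp add: powr_mult powr_powr left_diff_distrib)
  have "(M k * d k) powr q = M k powr p * (M k powr (q - p) * d k powr q)"
   using powr_add[of "M k" p "q - p"] by (simp add: powr_mult)
  also have "... <= M k powr p * (Q powr (q/p - 1) * ?W powr (1 - q/p) * d k powr q)"
   by (intro mult_left_mono mult_right_mono M1) auto
  also have "... = M k powr p * (Q powr (q/p - 1) * (d k powr q * ?W powr (1 - q/p)))" by (simp add: mult_ac)
  also have "... <= M k powr p * (Q powr (q/p - 1) * E powr q)"
   by (intro mult_left_mono D) auto
  finally show ?thesis by (simp add: mult_ac)
 qed
 have cm: "cmean (%k. (M k * d k) powr q) H K <= Q powr (q/p - 1) * E powr q * Q"
  if Q: "0 <= Q" and M: "\<forall>k. node k --> 0 <= M k" and cM: "carl (%k. M k powr p) (%_. Q)"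
   and K: "node K" and E: "!!n. fst K <= n ==> e n <= E" for Q M H K E
 proof -
  have "cmean (%k. (M k * d k) powr q) H K <= cmean (%k. Q powr (q/p - 1) * E powr q * M k powr p) H K"
   by (rule cmean_mono, rule pt[OF Q M cM]) (auto intro: E simp: below_def)
  also have "... = Q powr (q/p - 1) * E powr q * cmean (%k. M k powr p) H K" by (rule cmean_cmult)
  also have "... <= Q powr (q/p - 1) * E powr q * Q"
   by (intro mult_left_mono carlD[OF cM K]) simp
  finally show ?thesis .
 qed
 have "convergent e" using e0 by (auto simp: convergent_def)
 then obtain E0 where "0 < E0" "\<forall>n. norm (e n) <= E0" using convergent_imp_Bseq BseqE by blast
 hence E0: "e n <= E0" for n by (auto simp: abs_le_iff)
 show "\<exists>B. \<forall>M. (\<forall>k. node k --> 0 <= M k) --> carl (%k. M k powr p) (%_. Q) --> carl (%k. (M k * d k) powr q) (%_. B)"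
  if Q: "0 <= Q" for Q
 proof (intro exI[of _ "Q powr (q/p - 1) * E0 powr q * Q"] allI impI)
  fix M assume M: "\<forall>k. node k --> 0 <= M k" "carl (%k. M k powr p) (%_. Q)"
  show "carl (%k. (M k * d k) powr q) (%_. Q powr (q/p - 1) * E0 powr q * Q)"
   unfolding carl_def by (intro allI impI cm[OF Q M] E0)
 qed
 show "\<exists>N. \<forall>M. (\<forall>k. node k --> 0 <= M k) --> carl (%k. M k powr p) (%_. Q) -->
   (\<forall>H K. node K --> N <= fst K --> cmean (%k. (M k * d k) powr q) H K <= \<eta>)"
  if Q: "0 <= Q" and \<eta>: "0 < \<eta>" for Q \<eta>
 proof -
  define E where "E = (\<eta> / (Q powr (q/p - 1) * Q + 1)) powr (1/q)"
  have den: "0 < Q powr (q/p - 1) * Q + 1" using Q by (simp add: add_nonneg_pos)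
  have E: "0 < E" using \<eta> den by (simp add: E_def)
  have Eq: "E powr q = \<eta> / (Q powr (q/p - 1) * Q + 1)" using \<eta> den q by (simp add: E_def powr_powr)
  have "Q powr (q/p - 1) * E powr q * Q = (Q powr (q/p - 1) * Q) * \<eta> / (Q powr (q/p - 1) * Q + 1)"
   unfolding Eq by simp
  also have "... <= \<eta>" using \<eta> den Q by (simp add: pos_divide_le_eq algebra_simps)
  finally have le: "Q powr (q/p - 1) * E powr q * Q <= \<eta>" .
  obtain N where "\<forall>n\<ge>N. norm (e n - 0) < E" using LIMSEQ_D[OF e0 E] by blast
  hence N: "e n <= E" if "N <= n" for n using that by (auto simp: abs_less_iff dest!: spec[of _ n])
  show ?thesis
  proof (intro exI[of _ N] allI impI)
   fix M H K assume M: "\<forall>k. node k --> 0 <= M k" "carl (%k. M k powr p) (%_. Q)" and K: "node K" "N <= fst K"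
   have "cmean (%k. (M k * d k) powr q) H K <= Q powr (q/p - 1) * E powr q * Q"
    by (rule cm[OF Q M K(1)]) (use N K(2) in auto)
   thus "cmean (%k. (M k * d k) powr q) H K <= \<eta>" using le by (rule order_trans)
  qed
 qed
qed

text \<open>Young's inequality with small \<epsilon>: the first term contributes at most \<epsilon>
  Q over every box, and the means of the second tend to 0 with the level.\<close>

lemma vmult_gt:
 assumes pq: "0 < q" "q < p" and d: "!!k. node k ==> 0 <= d k"
  and cd: "carl (%k. d k powr (p * q / (p - q))) b" and b: "b \<longlonglongrightarrow> 0"
 shows "vmult p q d"
proof (rule vmultI)
 let ?s = "p * q / (p - q)"
 let ?c = "%\<epsilon>. \<epsilon> powr (- q / (p - q))"
 have cm: "cmean (%k. (M k * d k) powr q) H K <= \<epsilon> * Q + ?c \<epsilon> * b (fst K)"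
  if M: "\<forall>k. node k --> 0 <= M k" and cM: "carl (%k. M k powr p) (%_. Q)" and K: "node K" and \<epsilon>: "0 < \<epsilon>" for Q M H K \<epsilon>
 proof -
  have "cmean (%k. (M k * d k) powr q) H K <= cmean (%k. \<epsilon> * M k powr p + ?c \<epsilon> * d k powr ?s) H K"
   using M d \<epsilon> pq by (intro cmean_mono young_powr) auto
  also have "... = \<epsilon> * cmean (%k. M k powr p) H K + ?c \<epsilon> * cmean (%k. d k powr ?s) H K"
   by (simp only: cmean_add cmean_cmult)
  also have "... <= \<epsilon> * Q + ?c \<epsilon> * b (fst K)"
   using \<epsilon> by (intro add_mono mult_left_mono carlD[OF cM K] carlD[OF cd K]) auto
  finally show ?thesis .
 qed
 have "convergent b" using b by (auto simp: convergent_def)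
 then obtain B0 where "0 < B0" "\<forall>n. norm (b n) <= B0" using convergent_imp_Bseq BseqE by blast
 hence B0: "b n <= B0" for n by (auto simp: abs_le_iff)
 show "\<exists>B. \<forall>M. (\<forall>k. node k --> 0 <= M k) --> carl (%k. M k powr p) (%_. Q) --> carl (%k. (M k * d k) powr q) (%_. B)" for Q
 proof (intro exI[of _ "1 * Q + ?c 1 * B0"] allI impI)
  fix M assume M: "\<forall>k. node k --> 0 <= M k" "carl (%k. M k powr p) (%_. Q)"
  have "cmean (%k. (M k * d k) powr q) H K <= 1 * Q + ?c 1 * B0" if "node K" for H K
   by (rule order_trans[OF cm[OF M that, of 1]]) (auto simp: B0)
  thus "carl (%k. (M k * d k) powr q) (%_. 1 * Q + ?c 1 * B0)" unfolding carl_def by blast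
 qed
 show "\<exists>N. \<forall>M. (\<forall>k. node k --> 0 <= M k) --> carl (%k. M k powr p) (%_. Q) -->
   (\<forall>H K. node K --> N <= fst K --> cmean (%k. (M k * d k) powr q) H K <= \<eta>)"
  if Q: "0 <= Q" and \<eta>: "0 < \<eta>" for Q \<eta>
 proof -
  define \<epsilon> where "\<epsilon> = \<eta> / (2 * (Q + 1))"
  have \<epsilon>: "0 < \<epsilon>" using Q \<eta> by (simp add: \<epsilon>_def)
  have e1: "\<epsilon> * Q <= \<eta> / 2" using Q \<eta> by (simp add: \<epsilon>_def field_simps)
  have "0 < \<eta> / 2 / ?c \<epsilon>" using \<eta> \<epsilon> by simp
  then obtain N where "\<forall>n\<ge>N. norm (b n - 0) < \<eta> / 2 / ?c \<epsilon>" using LIMSEQ_D[OF b] by blast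
  hence N: "?c \<epsilon> * b n <= \<eta> / 2" if "N <= n" for n
  proof -
   assume "\<forall>n\<ge>N. norm (b n - 0) < \<eta> / 2 / ?c \<epsilon>"
   hence "b n <= \<eta> / 2 / ?c \<epsilon>" using that by (auto simp: abs_less_iff dest!: spec[of _ n])
   thus ?thesis using \<epsilon> by (simp add: field_simps)
  qed
  show ?thesis
  proof (intro exI[of _ N] allI impI)
   fix M H K assume M: "\<forall>k. node k --> 0 <= M k" "carl (%k. M k powr p) (%_. Q)" and K: "node K" "N <= fst K"
   show "cmean (%k. (M k * d k) powr q) H K <= \<eta>"
    using cm[OF M K(1) \<epsilon>, of H] e1 N[OF K(2)] by linarith
  qed
 qed
qed

end

section \<open>Tent norms and the operator in terms of box maxima\<close>

lemma tendsto_0_ennreal_iff: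
 fixes f :: "'a => ennreal"
 shows "(f \<longlongrightarrow> 0) F \<longleftrightarrow> (\<forall>e>0. eventually (%x. f x <= ennreal e) F)"
proof
 assume f: "(f \<longlongrightarrow> 0) F"
 show "\<forall>e>0. eventually (%x. f x <= ennreal e) F"
 proof (intro allI impI)
  fix e :: real assume "0 < e"
  hence "eventually (%x. f x < ennreal e) F" using order_tendstoD(2)[OF f, of "ennreal e"] by simp
  thus "eventually (%x. f x <= ennreal e) F" by (rule eventually_mono) simp
 qed
next
 assume e: "\<forall>e>0. eventually (%x. f x <= ennreal e) F"
 show "(f \<longlongrightarrow> 0) F"
 proof (rule order_tendstoI)
  fix a :: ennreal assume "0 < a"
  then obtain y where y: "0 < y" "y < a" using dense by blast
  hence yt: "y < top" by (metis order_less_le_trans top_greatest)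
  hence "y = ennreal (enn2real y)" "0 < enn2real y" using y by (simp_all add: enn2real_positive_iff)
  hence "eventually (%x. f x <= y) F" using e by metis
  thus "eventually (%x. f x < a) F" by (rule eventually_mono) (use y in auto)
 qed simp
qed

lemma enn_powr_le_iff:
 assumes "0 < q" "0 <= t"
 shows "enn_powr x (1 / q) <= ennreal t \<longleftrightarrow> x <= ennreal (t powr q)"
proof (cases x)
 case (real r)
 have "r powr (1/q) <= t \<longleftrightarrow> r <= t powr q"
 proof
  assume "r powr (1/q) <= t"
  hence "(r powr (1/q)) powr q <= t powr q" using assms by (intro powr_mono2) auto
  thus "r <= t powr q" using assms real by (simp add: powr_powr)
 next
  assume "r <= t powr q"
  hence "r powr (1/q) <= (t powr q) powr (1/q)" using assms real by (intro powr_mono2) auto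
  thus "r powr (1/q) <= t" using assms by (simp add: powr_powr)
 qed
 thus ?thesis using real assms by (simp add: enn_powr_def)
next
 case top
 thus ?thesis by (simp add: enn_powr_def top_unique)
qed

lemma tent_norm_le_iff:
 assumes "0 < q" "0 <= t"
 shows "tent_norm q \<omega> f <= ennreal t \<longleftrightarrow> (\<forall>a\<in>\<DD>. tent_mean q \<omega> f a <= ennreal (t powr q))"
 unfolding tent_norm_def SUP_le_iff using enn_powr_le_iff[OF assms] by simp

lemma analytic_diskD: "f : \<H>\<DD> ==> hol f" "f : \<H>\<DD> ==> z ~: \<DD> ==> f z = 0"
 by (auto simp: analytic_disk_def)

lemma volterra_diff:
 assumes "hol f" "hol h" "hol g"
 shows "volterra g (%z. f z - h z) = (%z. volterra g f z - volterra g h z)"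
proof
 fix z
 show "volterra g (%z. f z - h z) z = volterra g f z - volterra g h z"
 proof (cases "z : \<DD>")
  case True
  have sub: "path_image (linepath 0 z) <= \<DD>" using True by (simp add: closed_segment_subset)
  have ci: "(%\<zeta>. k \<zeta> * deriv g \<zeta>) contour_integrable_on linepath 0 z" if "hol k" for k
  proof (rule contour_integrable_continuous_linepath)
   have "hol (%\<zeta>. k \<zeta> * deriv g \<zeta>)" using that assms(3) by (intro holomorphic_intros holomorphic_deriv) auto
   thus "continuous_on (closed_segment 0 z) (%\<zeta>. k \<zeta> * deriv g \<zeta>)"
    using sub hol_cont continuous_on_subset by (metis path_image_linepath)
  qed
  show ?thesis using True contour_integral_diff[OF ci[OF assms(1)] ci[OF assms(2)]]
   by (simp add: volterra_def left_diff_distrib)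
 qed (simp add: volterra_def)
qed

lemma volterra_cmult:
 assumes "hol f" "hol g"
 shows "volterra g (%z. c * f z) = (%z. c * volterra g f z)"
proof
 fix z
 show "volterra g (%z. c * f z) z = c * volterra g f z"
 proof (cases "z : \<DD>")
  case True
  have sub: "closed_segment 0 z <= \<DD>" using True by (simp add: closed_segment_subset)
  have "hol (%\<zeta>. f \<zeta> * deriv g \<zeta>)" using assms by (intro holomorphic_intros holomorphic_deriv) auto
  hence "continuous_on (closed_segment 0 z) (%\<zeta>. f \<zeta> * deriv g \<zeta>)"
   using sub hol_cont continuous_on_subset by metis
  hence "(%\<zeta>. f \<zeta> * deriv g \<zeta>) contour_integrable_on linepath 0 z"
   by (rule contour_integrable_continuous_linepath)
  thus ?thesis using True contour_integral_lmul[of "%\<zeta>. f \<zeta> * deriv g \<zeta>" "linepath 0 z" c]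
   by (simp add: volterra_def mult.assoc)
 qed (simp add: volterra_def)
qed

text \<open>Each box lies in a compact disc inside the unit disk, so locally uniform convergence is
  uniform on it.\<close>

lemma supb_tendsto:
 assumes f: "!!i. continuous_on \<DD> (f i)" "continuous_on \<DD> F"
  and lim: "!!K. compact K ==> K <= \<DD> ==> uniform_limit K f F sequentially" and k: "node k"
 shows "(%i. supb (f i) k) \<longlonglongrightarrow> supb F k"
proof (rule tendstoI)
 fix r :: real assume r: "0 < r"
 have "eventually (%i. \<forall>z\<in>cball 0 (rad (Suc (fst k))). dist (f i z) (F z) < r / 2) sequentially"
  using lim[OF compact_cball cball_rad_subset_disk, of "Suc (fst k)"] half_gt_zero[OF r]
  unfolding uniform_limit_iff by blast
 thus "eventually (%i. dist (supb (f i) k) (supb F k) < r) sequentially"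
 proof (rule eventually_mono)
  fix i assume i: "\<forall>z\<in>cball 0 (rad (Suc (fst k))). dist (f i z) (F z) < r / 2"
  have d: "norm (f i z - F z) < r / 2" if "z : dbox k" for z
   using i dbox_subset_cball[of k] that by (auto simp: dist_norm)
  have "supb (f i) k <= supb F k + r / 2"
  proof (rule supb_le[OF k])
   fix z assume z: "z : dbox k"
   show "norm (f i z) <= supb F k + r / 2"
    using norm_triangle_sub[of "f i z" "F z"] d[OF z] norm_le_supb[OF f(2) z] by linarith
  qed
  moreover have "supb F k <= supb (f i) k + r / 2"
  proof (rule supb_le[OF k])
   fix z assume z: "z : dbox k"
   show "norm (F z) <= supb (f i) k + r / 2"
    using norm_triangle_sub[of "F z" "f i z"] norm_minus_commute[of "F z" "f i z"] d[OF z] norm_le_supb[OF f(1) z, of i] by linarith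
  qed
  ultimately show "dist (supb (f i) k) (supb F k) < r" using r by (simp add: dist_real_def abs_less_iff)
 qed
qed

lemma sum_Un_le:
 fixes f :: "'a => real"
 assumes "finite A" "finite B" "!!x. x : A ==> 0 <= f x"
 shows "sum f (A Un B) <= sum f A + sum f B"
 using sum.union_inter[OF assms(1,2), of f] sum_nonneg[of "A Int B" f] assms(3) by auto

context dyadic_weight begin

lemma vmultE:
 assumes v: "vmult p q d" and Q: "0 <= Q"
 obtains b B where "!!n. 0 <= b n" "!!n. b n <= B" "b \<longlonglongrightarrow> 0"
  "!!M. (!!k. node k ==> 0 <= M k) ==> carl (%k. M k powr p) (%_. Q) ==> carl (%k. (M k * d k) powr q) b"
proof -
 from v[unfolded vmult_def, THEN spec, THEN mp, OF Q]
 obtain b B where b: "(\<forall>n. 0 <= b n & b n <= B) & b \<longlonglongrightarrow> 0 &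
   (\<forall>M. (\<forall>k. node k --> 0 <= M k) & carl (%k. M k powr p) (%_. Q) --> carl (%k. (M k * d k) powr q) b)"
  by (elim exE)
 show thesis
 proof (rule that)
  show "0 <= b n" "b n <= B" for n using b by simp_all
  show "b \<longlonglongrightarrow> 0" using b by simp
  show "carl (%k. (M k * d k) powr q) b" if "!!k. node k ==> 0 <= M k" "carl (%k. M k powr p) (%_. Q)" for M
   using b[THEN conjunct2, THEN conjunct2, THEN spec, THEN mp, of M] that by blast
 qed
qed

end

context tent_measure begin

lemma tmean_to_carl:
 assumes q: "0 < q"
 obtains C where "0 < C"
  "!!F t. [|hol F; 0 <= t; !!a. norm a < 1 ==> tmean q F a <= ennreal t|]
   ==> carl (%k. supb F k powr q) (%_. C * t) & carl (%k. dsup F k powr q) (%_. C * t)"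
proof -
 obtain C where C: "0 < C" and
  c: "!!F \<sigma>. [|hol F; !!n. 0 <= \<sigma> n; !!a n. norm a = rad n ==> tmean q F a <= ennreal (\<sigma> n)|]
   ==> carl (%k. supb F k powr q) (%N. C * conv (1/2) (%l. \<sigma> (l - 3)) N) &
     carl (%k. dsup F k powr q) (%N. C * conv (1/2) (%l. \<sigma> (l - 3)) N)"
  using carl_supb_dsup[OF q] by blast
 show thesis
 proof (rule that[of "2 * C"])
  fix F :: "complex => complex" and t :: real
  assume F: "hol F" and t: "0 <= t" and b: "!!a. norm a < 1 ==> tmean q F a <= ennreal t"
  have "tmean q F a <= ennreal t" if "norm a = rad n" for a n using that b rad_less_1 by simp
  hence cc: "carl (%k. supb F k powr q) (%N. C * conv (1/2) (%l. t) N)"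
   "carl (%k. dsup F k powr q) (%N. C * conv (1/2) (%l. t) N)"
   using c[OF F, of "%_. t"] t by auto
  have "C * conv (1/2) (%l. t) N <= 2 * C * t" for N
   using conv_bound[of "1/2" "%_. t" t N] t C by simp
  thus "carl (%k. supb F k powr q) (%_. 2 * C * t) & carl (%k. dsup F k powr q) (%_. 2 * C * t)"
   using carl_mono[OF cc(1)] carl_mono[OF cc(2)] by simp
 qed (use C in simp)
qed

text \<open>The supremum of the means over each dyadic circle is a null sequence, and convolution
  keeps it null.\<close>

lemma tmean_vanishing_to_carl:
 assumes q: "0 < q" and F: "hol F" and t: "0 <= t" "!!a. norm a < 1 ==> tmean q F a <= ennreal t"
  and van: "(tmean q F \<longlongrightarrow> 0) to_circle"
 obtains b where "!!n. 0 <= b n" "b \<longlonglongrightarrow> 0" "carl (%k. supb F k powr q) b" "carl (%k. dsup F k powr q) b"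
proof -
 obtain C where C: "0 < C" and
  c: "!!F \<sigma>. [|hol F; !!n. 0 <= \<sigma> n; !!a n. norm a = rad n ==> tmean q F a <= ennreal (\<sigma> n)|]
   ==> carl (%k. supb F k powr q) (%N. C * conv (1/2) (%l. \<sigma> (l - 3)) N) &
     carl (%k. dsup F k powr q) (%N. C * conv (1/2) (%l. \<sigma> (l - 3)) N)"
  using carl_supb_dsup[OF q] by blast
 define S where "S n = (SUP a\<in>{a. norm a = rad n}. tmean q F a)" for n
 define \<sigma> where "\<sigma> n = enn2real (S n)" for n
 have St: "S n <= ennreal t" for n unfolding S_def using t(2) rad_less_1 by (intro SUP_least) auto
 have S\<sigma>: "S n = ennreal (\<sigma> n)" for n
  unfolding \<sigma>_def using le_less_trans[OF St[of n] ennreal_less_top] by (simp add: less_top)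
 have \<sigma>0: "0 <= \<sigma> n" for n by (simp add: \<sigma>_def)
 have up: "tmean q F a <= ennreal (\<sigma> n)" if "norm a = rad n" for a n
  unfolding S\<sigma>[symmetric] S_def using that by (intro SUP_upper) simp
 have \<sigma>lim: "\<sigma> \<longlonglongrightarrow> 0"
 proof (rule LIMSEQ_I)
  fix r :: real assume r: "0 < r"
  hence "eventually (%a. tmean q F a <= ennreal (r / 2)) to_circle"
   using van unfolding tendsto_0_ennreal_iff by simp
  then obtain N where N: "\<forall>z. rad N <= norm z & norm z < 1 --> tmean q F z <= ennreal (r / 2)"
   unfolding eventually_to_circle by blast
  have "norm (\<sigma> n - 0) < r" if n: "N <= n" for n
  proof -
   have "S n <= ennreal (r / 2)"
    unfolding S_def using N rad_mono[OF n] rad_less_1 by (intro SUP_least) auto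
   hence "\<sigma> n <= r / 2" unfolding S\<sigma> using r \<sigma>0 by simp
   thus ?thesis using r \<sigma>0[of n] by simp
  qed
  thus "\<exists>no. \<forall>n\<ge>no. norm (\<sigma> n - 0) < r" by blast
 qed
 have "(%l. \<sigma> (l - 3)) \<longlonglongrightarrow> 0" by (rule LIMSEQ_offset[of _ 3]) (simp add: \<sigma>lim)
 hence "conv (1/2) (%l. \<sigma> (l - 3)) \<longlonglongrightarrow> 0" by (intro conv_tendsto_0) (auto simp: \<sigma>0)
 hence lim: "(%N. C * conv (1/2) (%l. \<sigma> (l - 3)) N) \<longlonglongrightarrow> 0" by (rule tendsto_mult_right_zero)
 have nn: "0 <= C * conv (1/2) (%l. \<sigma> (l - 3)) N" for N
  using C \<sigma>0 by (intro mult_nonneg_nonneg conv_nonneg) auto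
 have "carl (%k. supb F k powr q) (%N. C * conv (1/2) (%l. \<sigma> (l - 3)) N) &
   carl (%k. dsup F k powr q) (%N. C * conv (1/2) (%l. \<sigma> (l - 3)) N)"
  by (rule c[of F \<sigma>, OF F \<sigma>0 up])
 thus thesis using that[OF nn lim] by blast
qed

lemma carl_to_tmean:
 assumes q: "0 < q" and F: "hol F" and carl: "carl (%k. supb F k powr q) b" and b: "!!n. 0 <= b n"
  and a: "rad N <= norm a" "norm a < rad (Suc N)"
 shows "tmean q F a <= ennreal (4 * ca * b N)"
 by (rule tmean_le[OF F q _ carl b a]) (rule norm_le_supb[OF hol_cont[OF F]])

lemma carl_to_tmean_bounded:
 assumes q: "0 < q" and F: "hol F" and carl: "carl (%k. supb F k powr q) b"
  and b: "!!n. 0 <= b n" "!!n. b n <= B" and a: "norm a < 1"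
 shows "tmean q F a <= ennreal (4 * ca * B)"
proof -
 obtain N where N: "rad N <= norm a" "norm a < rad (Suc N)" using ex_level[of "norm a"] a by auto
 have "tmean q F a <= ennreal (4 * ca * b N)" by (rule carl_to_tmean[OF q F carl b(1) N])
 also have "... <= ennreal (4 * ca * B)" using ca_pos b by (intro ennreal_leI mult_left_mono) auto
 finally show ?thesis .
qed

lemma carl_to_tmean_vanishing:
 assumes q: "0 < q" and F: "hol F" and carl: "carl (%k. supb F k powr q) b"
  and b: "!!n. 0 <= b n" "b \<longlonglongrightarrow> 0"
 shows "(tmean q F \<longlongrightarrow> 0) to_circle"
 unfolding tendsto_0_ennreal_iff
proof (intro allI impI)
 fix e :: real assume e: "0 < e"
 hence "0 < e / (4 * ca)" using ca_pos by simp
 then obtain M where "\<forall>n\<ge>M. norm (b n - 0) < e / (4 * ca)" using LIMSEQ_D[OF b(2)] by blast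
 hence M: "4 * ca * b n <= e" if "M <= n" for n
  using that b(1)[of n] ca_pos by (auto simp: field_simps dest!: spec[of _ n])
 have "tmean q F a <= ennreal e" if a: "rad M <= norm a" "norm a < 1" for a
 proof -
  obtain N where N: "rad N <= norm a" "norm a < rad (Suc N)" using ex_level[of "norm a"] a by auto
  have "M <= N"
  proof (rule ccontr)
   assume "~ M <= N"
   hence "rad (Suc N) <= rad M" by (intro rad_mono) simp
   thus False using a N by simp
  qed
  have "tmean q F a <= ennreal (4 * ca * b N)" by (rule carl_to_tmean[OF q F carl b(1) N])
  also have "... <= ennreal e" by (intro ennreal_leI M \<open>M <= N\<close>)
  finally show ?thesis .
 qed
 thus "eventually (%a. tmean q F a <= ennreal e) to_circle" unfolding eventually_to_circle by blast
qed

lemma carl_bounded_function: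
 assumes "0 < q" "0 <= M" "continuous_on \<DD> F" "!!z. z : \<DD> ==> norm (F z) <= M"
 shows "carl (%k. supb F k powr q) (%n. M powr q * (cr / (1 - \<rho>)) * W n)"
proof (rule carl_mono[OF carl_const])
 fix k assume k: "node k"
 have "supb F k <= M" using assms(4) dbox_subset_disk by (intro supb_le[OF k]) auto
 thus "supb F k powr q <= M powr q" using assms supb_nonneg[OF assms(3) k] by (intro powr_mono2) auto
qed simp_all

lemma carl_supb_of_dsup:
 assumes q: "0 < q"
 obtains C \<theta> where "0 < C" "0 < \<theta>" "\<theta> < 1"
  "!!F b. [|hol F; F 0 = 0; !!n. 0 <= b n; carl (%k. dsup F k powr q) b|]
   ==> carl (%k. supb F k powr q) (%N. C * conv \<theta> b N)"
proof -
 obtain C \<theta> where C: "0 < C" "0 < \<theta>" "\<theta> < 1" and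
  h: "!!x d b. [|!!k. node k ==> 0 <= d k; !!k. node k ==> 0 <= x k; !!n. 0 <= b n;
   !!k. node k ==> x k <= (\<Sum>l\<le>fst k. d (anc l k)); carl (%k. d k powr q) b|]
   ==> carl (%k. x k powr q) (%N. C * conv \<theta> b N)"
  using hardy[OF q] by blast
 show thesis
 proof (rule that[OF C])
  fix F b assume F: "hol F" "F 0 = 0" and b: "!!n. 0 <= b n" and c: "carl (%k. dsup F k powr q) b"
  show "carl (%k. supb F k powr q) (%N. C * conv \<theta> b N)"
   by (rule h[OF dsup_nonneg[OF F(1)] supb_nonneg[OF hol_cont[OF F(1)]] b supb_le_sum_dsup[OF F] c])
 qed
qed

text \<open>The maxima of f times \<open>dsup g\<close> dominate those of the derivative of the
  image, and the Hardy inequality returns to the image itself, which vanishes at 0. One sequence b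
  serves a whole ball.\<close>

lemma carl_supb_volterra:
 assumes q: "0 < q" and g: "hol g" and v: "vmult p q (dsup g)" and Q: "0 <= Q"
 obtains b B where "!!n. 0 <= b n" "!!n. b n <= B" "b \<longlonglongrightarrow> 0"
  "!!f. hol f ==> carl (%k. supb f k powr p) (%_. Q) ==> carl (%k. supb (volterra g f) k powr q) b"
proof -
 obtain b B where b: "!!n. 0 <= b n" "!!n. b n <= B" "b \<longlonglongrightarrow> 0" and
  vb: "!!M. (!!k. node k ==> 0 <= M k) ==> carl (%k. M k powr p) (%_. Q) ==> carl (%k. (M k * dsup g k) powr q) b"
  using vmultE[OF v Q] by blast
 obtain C \<theta> where C: "0 < C" "0 < \<theta>" "\<theta> < 1" and
  h: "!!F b. [|hol F; F 0 = 0; !!n. 0 <= b n; carl (%k. dsup F k powr q) b|]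
   ==> carl (%k. supb F k powr q) (%N. C * conv \<theta> b N)"
  using carl_supb_of_dsup[OF q] by blast
 show thesis
 proof (rule that[of "%N. C * conv \<theta> b N" "C * (B / (1 - \<theta>))"])
  show "0 <= C * conv \<theta> b n" for n using C b by (intro mult_nonneg_nonneg conv_nonneg) auto
  show "C * conv \<theta> b n <= C * (B / (1 - \<theta>))" for n
   using C b order_trans[OF b(1)[of 0] b(2)[of 0]] by (intro mult_left_mono conv_bound) auto
  show "(%N. C * conv \<theta> b N) \<longlonglongrightarrow> 0"
   using C b by (intro tendsto_mult_right_zero conv_tendsto_0) auto
  fix f assume f: "hol f" and cf: "carl (%k. supb f k powr p) (%_. Q)"
  have "carl (%k. dsup (volterra g f) k powr q) b"
  proof (rule carl_mono[OF vb[OF _ cf]])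
   show "0 <= supb f k" if "node k" for k by (rule supb_nonneg[OF hol_cont[OF f] that])
   show "dsup (volterra g f) k powr q <= (supb f k * dsup g k) powr q" if k: "node k" for k
    using q dsup_volterra_le[OF f g k] dsup_nonneg[OF volterra_holomorphic(1)[OF f g] k] by (intro powr_mono2) auto
  qed simp
  thus "carl (%k. supb (volterra g f) k powr q) (%N. C * conv \<theta> b N)"
   by (rule h[OF volterra_holomorphic(1,2)[OF f g] b(1)])
 qed
qed

text \<open>Nodes up to level M form one finite sum. The deeper ones are distributed over the 2^(M -
  fst K) tents of level M below \<open>K\<close>, and averaging the means of these tents gives at
  most \<eta>.\<close>

lemma cmean_split_level:
 assumes x: "!!k. node k ==> 0 <= x k" and K: "node K" and M: "!!H v. node v ==> fst v = M ==> cmean x H v <= \<eta>" and \<eta>: "0 <= \<eta>"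
  and le: "fst K <= M"
 shows "cmean x H K <= 2 ^ M * (\<Sum>k\<in>boxes M. x k * w k) + \<eta>"
proof -
 have w0: "0 <= w k" for k using w_pos[of k] by simp
 let ?S = "{k. k : boxes H & below k K}"
 let ?V = "{v. v : boxes M & fst v = M & below v K}"
 have "(\<Sum>k\<in>?S. x k * w k) <= (\<Sum>k\<in>boxes M. x k * w k) + (\<Sum>k | k : ?S & M <= fst k. x k * w k)"
 proof -
  have "(\<Sum>k\<in>?S. x k * w k) <= (\<Sum>k\<in>boxes M Un {k. k : ?S & M <= fst k}. x k * w k)"
   using x w0 by (intro sum_mono2) (auto simp: mem_boxes)
  also have "... <= (\<Sum>k\<in>boxes M. x k * w k) + (\<Sum>k | k : ?S & M <= fst k. x k * w k)"
   using x w0 by (intro sum_Un_le) (auto simp: mem_boxes)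
  finally show ?thesis .
 qed
 also have "(\<Sum>k | k : ?S & M <= fst k. x k * w k) <= (\<Sum>k\<in>?S. \<Sum>v | v : ?V & below k v. x k * w k)"
 proof -
  have "(\<Sum>k | k : ?S & M <= fst k. x k * w k) <= (\<Sum>k | k : ?S & M <= fst k. \<Sum>v | v : ?V & below k v. x k * w k)"
  proof (rule sum_mono)
   fix k assume k: "k : {k. k : ?S & M <= fst k}"
   have "below (anc M k) K" using k le anc_anc[of "fst K" M k] by (auto simp: below_def)
   hence v: "anc M k : {v. v : ?V & below k v}" using k by (auto simp: mem_boxes node_anc below_anc)
   show "x k * w k <= (\<Sum>v | v : ?V & below k v. x k * w k)"
    by (rule member_le_sum[OF v, of "%_. x k * w k"]) (use k x w0 in \<open>auto simp: mem_boxes\<close>)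
  qed
  also have "... <= (\<Sum>k\<in>?S. \<Sum>v | v : ?V & below k v. x k * w k)"
   using x w0 by (intro sum_mono2) (auto simp: mem_boxes intro!: mult_nonneg_nonneg)
  finally show ?thesis .
 qed
 also have "... = (\<Sum>v\<in>?V. \<Sum>k | k : ?S & below k v. x k * w k)" by (rule sum.swap_restrict) auto
 also have "... <= (\<Sum>v\<in>?V. \<eta> / 2 ^ M)"
 proof (rule sum_mono)
  fix v assume v: "v : ?V"
  have "(\<Sum>k | k : ?S & below k v. x k * w k) <= (\<Sum>k | k : boxes H & below k v. x k * w k)"
   using x w0 by (intro sum_mono2) (auto simp: mem_boxes)
  also have "... <= \<eta> / 2 ^ M"
   using M[of v H] v by (simp add: cmean_def mem_boxes pos_le_divide_eq mult.commute)
  finally show "(\<Sum>k | k : ?S & below k v. x k * w k) <= \<eta> / 2 ^ M" .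
 qed
 also have "... = real (card ?V) * (\<eta> / 2 ^ M)" by simp
 also have "... = \<eta> / 2 ^ fst K"
 proof -
  have "real (card ?V) = (\<Sum>v | v : boxes M & below v K. if fst v = M then 1 else 0)"
   by (subst sum.inter_filter[symmetric]) (auto intro!: arg_cong[where f=card])
  also have "... = (\<Sum>n=fst K..M. 2 ^ (n - fst K) * (if n = M then 1 else 0))" by (rule sum_below_level[OF K])
  also have "... = 2 ^ (M - fst K)" using le by (simp add: if_distrib cong: if_cong)
  finally have "real (card ?V) * 2 ^ fst K = 2 ^ M" using le by (simp add: power_add[symmetric])
  thus ?thesis by (simp add: field_simps)
 qed
 finally have "(\<Sum>k\<in>?S. x k * w k) <= (\<Sum>k\<in>boxes M. x k * w k) + \<eta> / 2 ^ fst K" by simp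
 hence "cmean x H K <= 2 ^ fst K * ((\<Sum>k\<in>boxes M. x k * w k) + \<eta> / 2 ^ fst K)"
  unfolding cmean_def by (intro mult_left_mono) auto
 also have "... = 2 ^ fst K * (\<Sum>k\<in>boxes M. x k * w k) + \<eta>" by (simp add: distrib_left)
 also have "... <= 2 ^ M * (\<Sum>k\<in>boxes M. x k * w k) + \<eta>"
  using le x w0 by (intro add_right_mono mult_right_mono power_increasing sum_nonneg) (auto simp: mem_boxes)
 finally show ?thesis .
qed

text \<open>\<open>vmult\<close> makes the means deep in the tree small uniformly in i, and locally
  uniform convergence takes care of the finitely many remaining nodes.\<close>

lemma volterra_null_sequence:
 assumes p: "0 < p" and q: "0 < q" and g: "hol g" and v: "vmult p q (dsup g)" and Q: "0 <= Q"
  and h: "!!i. h i holomorphic_on \<DD>" "!!i. carl (%k. supb (h i) k powr p) (%_. Q)"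
  and lim: "!!K. compact K ==> K <= \<DD> ==> uniform_limit K h (%_. 0) sequentially"
  and \<eta>: "0 < \<eta>"
 shows "eventually (%i. \<forall>a. norm a < 1 --> tmean q (volterra g (h i)) a <= ennreal \<eta>) sequentially"
proof -
 obtain b B where b: "!!n. 0 <= b n" "!!n. b n <= B" "b \<longlonglongrightarrow> 0" and
  vb: "!!M. (!!k. node k ==> 0 <= M k) ==> carl (%k. M k powr p) (%_. Q) ==> carl (%k. (M k * dsup g k) powr q) b"
  using vmultE[OF v Q] by blast
 obtain C \<theta> where C: "0 < C" "0 < \<theta>" "\<theta> < 1" and
  hd: "!!F b. [|hol F; F 0 = 0; !!n. 0 <= b n; carl (%k. dsup F k powr q) b|]
   ==> carl (%k. supb F k powr q) (%N. C * conv \<theta> b N)"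
  using carl_supb_of_dsup[OF q] by blast
 \<comment> \<open>Inverts the losses to come: 4 ca from the tent means, C and 1/(1 - \<theta>) from
   the Hardy inequality, 2 from the split into deep and finite part.\<close>
 define \<delta> where "\<delta> = \<eta> / (4 * ca * C * 2) * (1 - \<theta>)"
 have \<delta>: "0 < \<delta>" using \<eta> ca_pos C by (simp add: \<delta>_def)
 obtain M where "\<forall>n\<ge>M. norm (b n - 0) < \<delta>" using LIMSEQ_D[OF b(3) \<delta>] by blast
 hence M: "b n <= \<delta>" if "M <= n" for n using that by (auto simp: abs_less_iff dest!: spec[of _ n])
 define x where "x i k = (supb (h i) k * dsup g k) powr q" for i k
 have ch: "continuous_on \<DD> (h i)" for i by (rule hol_cont[OF h(1)])
 have cx: "carl (x i) b" for i unfolding x_def by (rule vb[OF supb_nonneg[OF ch] h(2)])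
 have slim: "(%i. supb (h i) k) \<longlonglongrightarrow> 0" if k: "node k" for k
 proof -
  have "supb (%_. 0) k = 0" by (intro antisym supb_le[OF k] supb_nonneg[OF continuous_on_const k]) simp
  thus ?thesis using supb_tendsto[OF ch continuous_on_const lim k] by simp
 qed
 have "(%i. 2 ^ M * (\<Sum>k\<in>boxes M. x i k * w k)) \<longlonglongrightarrow> 2 ^ M * (\<Sum>k\<in>boxes M. 0 * w k)"
 proof (intro tendsto_intros)
  fix k assume "k : boxes M"
  hence k: "node k" by (simp add: mem_boxes)
  have "(%i. supb (h i) k * dsup g k) \<longlonglongrightarrow> 0 * dsup g k" by (intro tendsto_intros slim k)
  hence "(%i. (supb (h i) k * dsup g k) powr q) \<longlonglongrightarrow> 0 powr q"
   using q supb_nonneg[OF ch k] dsup_nonneg[OF g k] by (intro tendsto_powr') auto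
  thus "(%i. x i k) \<longlonglongrightarrow> 0" using q by (simp add: x_def)
 qed
 hence "(%i. 2 ^ M * (\<Sum>k\<in>boxes M. x i k * w k)) \<longlonglongrightarrow> 0" by simp
 hence "eventually (%i. 2 ^ M * (\<Sum>k\<in>boxes M. x i k * w k) < \<delta>) sequentially"
  using order_tendstoD(2) \<delta> by blast
 thus ?thesis
 proof (rule eventually_mono)
  fix i assume i: "2 ^ M * (\<Sum>k\<in>boxes M. x i k * w k) < \<delta>"
  have xn: "0 <= x i k" for k by (simp add: x_def)
  have "carl (x i) (%_. 2 * \<delta>)"
   unfolding carl_def
  proof (intro allI impI)
   fix H K assume K: "node K"
   show "cmean (x i) H K <= 2 * \<delta>"
   proof (cases "M <= fst K")
    case True
    thus ?thesis using carlD[OF cx K, of i H] M[OF True] \<delta> by simp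
   next
    case False
    have "cmean (x i) H K <= 2 ^ M * (\<Sum>k\<in>boxes M. x i k * w k) + \<delta>"
    proof (rule cmean_split_level[OF xn K])
     show "cmean (x i) H v <= \<delta>" if "node v" "fst v = M" for H v
      using carlD[OF cx that(1), of i H] M[of "fst v"] that by simp
    qed (use \<delta> False in auto)
    thus ?thesis using i by simp
   qed
  qed
  hence "carl (%k. dsup (volterra g (h i)) k powr q) (%_. 2 * \<delta>)"
  proof (rule carl_mono)
   show "dsup (volterra g (h i)) k powr q <= x i k" if k: "node k" for k
    unfolding x_def using q dsup_volterra_le[OF h(1) g k] dsup_nonneg[OF volterra_holomorphic(1)[OF h(1) g] k]
    by (intro powr_mono2) auto
  qed simp
  hence c: "carl (%k. supb (volterra g (h i)) k powr q) (%N. C * conv \<theta> (%_. 2 * \<delta>) N)"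
   using \<delta> by (intro hd volterra_holomorphic h g) auto
  show "\<forall>a. norm a < 1 --> tmean q (volterra g (h i)) a <= ennreal \<eta>"
  proof (intro allI impI)
   fix a :: complex assume a: "norm a < 1"
   have "tmean q (volterra g (h i)) a <= ennreal (4 * ca * (C * (2 * \<delta> / (1 - \<theta>))))"
   proof (rule carl_to_tmean_bounded[OF q volterra_holomorphic(1)[OF h(1) g] c _ _ a])
    show "0 <= C * conv \<theta> (%_. 2 * \<delta>) n" for n using C \<delta> by (intro mult_nonneg_nonneg conv_nonneg) auto
    show "C * conv \<theta> (%_. 2 * \<delta>) n <= C * (2 * \<delta> / (1 - \<theta>))" for n
     using C \<delta> by (intro mult_left_mono conv_bound) auto
   qed
   also have "4 * ca * (C * (2 * \<delta> / (1 - \<theta>))) = \<eta>" using C ca_pos by (simp add: \<delta>_def field_simps)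
   finally show "tmean q (volterra g (h i)) a <= ennreal \<eta>" .
  qed
 qed
qed

end

subsection \<open>Compactness of operators by sequences\<close>

text \<open>Points of the closure are replaced by points of \<open>S\<close> at distance below
  1/(n+1), so subsequences have to be found only for sequences in \<open>S\<close>.\<close>

lemma (in Metric_space) compactin_closure_of_sequentially:
 assumes S: "S <= M"
 shows "compactin mtopology (mtopology closure_of S) \<longleftrightarrow>
  (\<forall>\<sigma>::nat => _. range \<sigma> <= S --> (\<exists>l r. l : M & strict_mono r & (%i. d (\<sigma> (r i)) l) \<longlonglongrightarrow> 0))"
 (is "?L \<longleftrightarrow> ?R")
proof
 assume L: ?L
 show ?R
 proof (intro allI impI)
  fix \<sigma> :: "nat => 'a" assume \<sigma>: "range \<sigma> <= S"
  hence "range \<sigma> <= mtopology closure_of S" using closure_of_subset[of S mtopology] S by simp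
  then obtain l r where lr: "l : mtopology closure_of S" "strict_mono (r :: nat => nat)" "limitin mtopology (\<sigma> \<circ> r) l sequentially"
   using L unfolding compactin_sequentially by blast
  show "\<exists>l r. l : M & strict_mono r & (%i. d (\<sigma> (r i)) l) \<longlonglongrightarrow> 0"
   using lr unfolding limitin_metric_dist_null by (intro exI[of _ l] exI[of _ r]) (auto simp: o_def)
 qed
next
 assume R: ?R
 have cM: "mtopology closure_of S <= M" using closure_of_subset_topspace[of mtopology S] by simp
 show ?L
  unfolding compactin_sequentially
 proof (intro conjI allI impI cM)
  fix \<sigma> :: "nat => 'a" assume \<sigma>: "range \<sigma> <= mtopology closure_of S"
  have "\<exists>y\<in>S. d (\<sigma> n) y < 1 / real (Suc n)" for n
  proof -
   have "\<sigma> n : mtopology closure_of S" using \<sigma> by blast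
   hence "\<forall>r>0. \<exists>y\<in>S. y : mball (\<sigma> n) r" unfolding metric_closure_of by blast
   moreover have "0 < 1 / real (Suc n)" by simp
   ultimately obtain y where "y : S" "y : mball (\<sigma> n) (1 / real (Suc n))" by blast
   thus ?thesis by (auto simp: in_mball)
  qed
  then obtain \<tau> where \<tau>: "!!n. \<tau> n : S" "!!n. d (\<sigma> n) (\<tau> n) < 1 / real (Suc n)" by metis
  obtain l r where l: "l : M" and r: "strict_mono (r :: nat => nat)" and lim: "(%i. d (\<tau> (r i)) l) \<longlonglongrightarrow> 0"
   using R \<tau>(1) by blast
  have \<sigma>M: "\<sigma> n : M" and \<tau>M: "\<tau> n : M" for n using \<sigma> cM \<tau>(1) S by blast+
  have "l : mtopology closure_of S"
   unfolding metric_closure_of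
  proof (intro CollectI conjI allI impI l)
   fix e :: real assume "0 < e"
   hence "eventually (%i. d (\<tau> (r i)) l < e) sequentially" using order_tendstoD(2)[OF lim] by blast
   then obtain i where "d (\<tau> (r i)) l < e" unfolding eventually_sequentially by blast
   thus "\<exists>y\<in>S. y : mball l e" using \<tau>(1) \<tau>M l by (intro bexI[of _ "\<tau> (r i)"]) (auto simp: in_mball commute)
  qed
  moreover have "limitin mtopology (\<sigma> \<circ> r) l sequentially"
   unfolding limitin_metric_dist_null
  proof (intro conjI l)
   show "\<forall>\<^sub>F x in sequentially. (\<sigma> \<circ> r) x : M" using \<sigma>M by simp
   have z: "(%i. 1 / real (Suc (r i)) + d (\<tau> (r i)) l) \<longlonglongrightarrow> 0"
    using tendsto_add[OF LIMSEQ_subseq_LIMSEQ[OF LIMSEQ_Suc[OF lim_1_over_n] r] lim]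
    by (simp add: o_def)
   show "(%x. d ((\<sigma> \<circ> r) x) l) \<longlonglongrightarrow> 0"
   proof (rule tendsto_sandwich[OF _ _ tendsto_const z])
    show "\<forall>\<^sub>F n in sequentially. d ((\<sigma> \<circ> r) n) l <= 1 / real (Suc (r n)) + d (\<tau> (r n)) l"
    proof (rule always_eventually, rule allI)
     fix n
     have "d (\<sigma> (r n)) l <= d (\<sigma> (r n)) (\<tau> (r n)) + d (\<tau> (r n)) l" by (rule triangle[OF \<sigma>M \<tau>M l])
     thus "d ((\<sigma> \<circ> r) n) l <= 1 / real (Suc (r n)) + d (\<tau> (r n)) l" using \<tau>(2)[of "r n"] by simp
    qed
   qed simp
  qed
  ultimately show "\<exists>l r. l : mtopology closure_of S & strict_mono r & limitin mtopology (\<sigma> \<circ> r) l sequentially"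
   using r by blast
 qed
qed

text \<open>The two assumptions make quasi-norm and metric uniformly equivalent; they define the
  same open sets, and compactness can be tested on sequences.\<close>

lemma compact_op_iff_sequences:
 assumes "Metric_space Y D"
  and ND: "!!e. 0 < e ==> \<exists>\<delta>>0. \<forall>f\<in>Y. \<forall>h\<in>Y. NY (%x. h x - f x) < ennreal \<delta> --> D f h < e"
  and DN: "!!e. 0 < e ==> \<exists>\<delta>>0. \<forall>f\<in>Y. \<forall>h\<in>Y. D f h < \<delta> --> NY (%x. h x - f x) < ennreal e"
 shows "compact_op X NX Y NY T \<longleftrightarrow> T ` X <= Y &
  (\<forall>(f::nat => _) C. (\<forall>i. f i : X & NX (f i) <= ennreal C) -->
   (\<exists>h r. h : Y & strict_mono r & (%i. D (T (f (r i))) h) \<longlonglongrightarrow> 0))"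
proof -
 interpret Y: Metric_space Y D by fact
 have top: "qnorm_topology Y NY = Y.mtopology"
  unfolding topology_eq
 proof
  fix U
  show "openin (qnorm_topology Y NY) U \<longleftrightarrow> openin Y.mtopology U"
   unfolding openin_qnorm_topology qnorm_open_def Y.openin_mtopology
  proof (intro conj_cong refl iffI)
   assume UY: "U <= Y" and q: "\<forall>f\<in>U. \<exists>e>0. \<forall>h\<in>Y. NY (%x. h x - f x) < ennreal e --> h : U"
   show "\<forall>x. x : U --> (\<exists>r>0. Y.mball x r <= U)"
   proof (intro allI impI)
    fix f assume f: "f : U"
    obtain e where e: "0 < e" "!!h. h : Y ==> NY (%x. h x - f x) < ennreal e ==> h : U" using q f by blast
    from DN[OF e(1)] obtain \<delta> where \<delta>: "0 < \<delta>" "\<forall>f\<in>Y. \<forall>h\<in>Y. D f h < \<delta> --> NY (%x. h x - f x) < ennreal e"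
     by (elim exE conjE)
    have fY: "f : Y" using f UY by (rule rev_subsetD)
    show "\<exists>r>0. Y.mball f r <= U"
    proof (intro exI[of _ \<delta>] conjI subsetI \<delta>(1))
     fix h assume "h : Y.mball f \<delta>"
     hence h: "h : Y" "D f h < \<delta>" by (simp_all only: Y.in_mball)
     show "h : U" by (rule e(2)[OF h(1) \<delta>(2)[rule_format, OF fY h]])
    qed
   qed
  next
   assume UY: "U <= Y" and q: "\<forall>x. x : U --> (\<exists>r>0. Y.mball x r <= U)"
   show "\<forall>f\<in>U. \<exists>e>0. \<forall>h\<in>Y. NY (%x. h x - f x) < ennreal e --> h : U"
   proof
    fix f assume f: "f : U"
    obtain e where e: "0 < e" "Y.mball f e <= U" using q f by blast
    from ND[OF e(1)] obtain \<delta> where \<delta>: "0 < \<delta>" "\<forall>f\<in>Y. \<forall>h\<in>Y. NY (%x. h x - f x) < ennreal \<delta> --> D f h < e"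
     by (elim exE conjE)
    have fY: "f : Y" using f UY by (rule rev_subsetD)
    show "\<exists>e>0. \<forall>h\<in>Y. NY (%x. h x - f x) < ennreal e --> h : U"
    proof (intro exI[of _ \<delta>] conjI ballI impI \<delta>(1))
     fix h assume h: "h : Y" "NY (%x. h x - f x) < ennreal \<delta>"
     have "D f h < e" by (rule \<delta>(2)[rule_format, OF fY h])
     hence "h : Y.mball f e" using fY h(1) unfolding Y.in_mball by simp
     thus "h : U" using e(2) by (rule rev_subsetD)
    qed
   qed
  qed
 qed
 show ?thesis
 proof (cases "T ` X <= Y")
  case TX: True
  have "(\<forall>B. B <= X & (\<exists>M. \<forall>f\<in>B. NX f <= ennreal M) --> compactin Y.mtopology (Y.mtopology closure_of (T ` B))) \<longleftrightarrow>
    (\<forall>(f::nat => _) C. (\<forall>i. f i : X & NX (f i) <= ennreal C) --> (\<exists>h r. h : Y & strict_mono r & (%i. D (T (f (r i))) h) \<longlonglongrightarrow> 0))"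
   (is "?L \<longleftrightarrow> ?R")
  proof
   assume L: ?L
   show ?R
   proof (intro allI impI)
    fix f :: "nat => _" and C :: real
    assume f: "\<forall>i. f i : X & NX (f i) <= ennreal C"
    have sub: "T ` range f <= Y" using f TX by blast
    have "compactin Y.mtopology (Y.mtopology closure_of (T ` range f))"
     using L f by (intro L[rule_format]) blast
    hence "\<forall>\<sigma>::nat => _. range \<sigma> <= T ` range f --> (\<exists>l r. l : Y & strict_mono r & (%i. D (\<sigma> (r i)) l) \<longlonglongrightarrow> 0)"
     unfolding Y.compactin_closure_of_sequentially[OF sub] .
    from this[THEN spec, of "%i. T (f i)"] show "\<exists>h r. h : Y & strict_mono r & (%i. D (T (f (r i))) h) \<longlonglongrightarrow> 0"
     by blast
   qed
  next
   assume R: ?R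
   show ?L
   proof (intro allI impI)
    fix B assume B: "B <= X & (\<exists>M. \<forall>f\<in>B. NX f <= ennreal M)"
    then obtain M where M: "!!f. f : B ==> NX f <= ennreal M" by blast
    have sub: "T ` B <= Y" using B TX by blast
    show "compactin Y.mtopology (Y.mtopology closure_of (T ` B))"
     unfolding Y.compactin_closure_of_sequentially[OF sub]
    proof (intro allI impI)
     fix \<sigma> :: "nat => _" assume "range \<sigma> <= T ` B"
     hence "\<forall>i. \<exists>f. f : B & \<sigma> i = T f" by blast
     then obtain f where f: "!!i. f i : B" "!!i. \<sigma> i = T (f i)" by metis
     have "\<forall>i. f i : X & NX (f i) <= ennreal M" using f(1) M B by blast
     thus "\<exists>l r. l : Y & strict_mono r & (%i. D (\<sigma> (r i)) l) \<longlonglongrightarrow> 0"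
      unfolding f(2) by (rule R[THEN spec, THEN spec, THEN mp])
    qed
   qed
  qed
  thus ?thesis using TX unfolding compact_op_def top by blast
 qed (simp add: compact_op_def)
qed

section \<open>A metric for the tent quasi-norm\<close>

text \<open>For q <= 1 both coefficients are 1 and this is subadditivity; for q > 1 it is convexity
  with weights s/(s+t) and t/(s+t). With s and t the sizes of two functions it integrates to
  Minkowski's inequality.\<close>

lemma powr_add_le_weighted:
 fixes x y s t q :: real
 assumes "0 <= x" "0 <= y" "0 < s" "0 < t" "0 < q" and e: "e = max 1 q"
 shows "(x + y) powr q <= s / (s + t) * ((s + t) powr e / s powr e) * x powr q + t / (s + t) * ((s + t) powr e / t powr e) * y powr q"
proof (cases "q <= 1")
 case True
 have "(x + y) powr q <= x powr q + y powr q"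
 proof (cases "x + y = 0")
  case False
  hence xy: "0 < x + y" using assms by simp
  have *: "u / (x + y) * (x + y) powr q <= u powr q" if "0 <= u" "u <= x + y" for u
  proof (cases "u = 0")
   case False
   hence u: "0 < u" using that by simp
   have "(x + y) powr (q - 1) <= u powr (q - 1)" using True u that by (intro powr_mono2') auto
   hence "u * (x + y) powr (q - 1) <= u * u powr (q - 1)" using u by (intro mult_left_mono) auto
   thus ?thesis using u xy by (simp add: powr_diff)
  qed simp
  have "(x + y) powr q = x / (x + y) * (x + y) powr q + y / (x + y) * (x + y) powr q"
   using xy unfolding distrib_right[symmetric] add_divide_distrib[symmetric] by simp
  also have "... <= x powr q + y powr q" using assms by (intro add_mono *) auto
  finally show ?thesis .
 qed simp
 moreover have "s / (s + t) * ((s + t) powr e / s powr e) = 1" "t / (s + t) * ((s + t) powr e / t powr e) = 1"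
  using True assms by (simp_all add: max_def)
 ultimately show ?thesis by simp
next
 case False
 hence q: "1 <= q" "e = q" using e by auto
 have st: "0 < s + t" using assms by simp
 have one: "u powr q <= c / (s + t) * ((s + t) powr e / c powr e) * u powr q" if c: "0 < c" "c <= s + t" for c u
 proof -
  have "((s + t) / c) powr 1 <= ((s + t) / c) powr q" using c q by (intro powr_mono) auto
  hence "c / (s + t) * ((s + t) / c) <= c / (s + t) * ((s + t) / c) powr q"
   using c st by (intro mult_left_mono) auto
  hence "1 <= c / (s + t) * ((s + t) powr e / c powr e)"
   unfolding q(2) powr_divide using c st by simp
  thus ?thesis using mult_right_mono[of 1 "c / (s + t) * ((s + t) powr e / c powr e)" "u powr q"] by simp
 qed
 consider "x = 0" | "y = 0" | "0 < x" "0 < y" using assms by linarith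
 thus ?thesis
 proof cases
  case 1
  thus ?thesis using one[of t y] assms by simp
 next
  case 2
  thus ?thesis using one[of s x] assms by simp
 next
  case 3
  have "(s / (s + t) * (x / s) + t / (s + t) * (y / t)) powr q <= s / (s + t) * (x / s) powr q + t / (s + t) * (y / t) powr q"
  proof -
   have "s / (s + t) = 1 - t / (s + t)" using st by (simp add: field_simps)
   thus ?thesis
    using convex_onD[OF powr_convex[OF q(1)], of "t / (s + t)" "x / s" "y / t"] 3 assms st by simp
  qed
  moreover have "s / (s + t) * (x / s) + t / (s + t) * (y / t) = (x + y) / (s + t)"
   using assms by (simp add: add_divide_distrib)
  ultimately have "(x + y) powr q / (s + t) powr q <= s / (s + t) * (x powr q / s powr q) + t / (s + t) * (y powr q / t powr q)"
   by (simp add: powr_divide)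
  hence "(x + y) powr q <= (s / (s + t) * (x powr q / s powr q) + t / (s + t) * (y powr q / t powr q)) * (s + t) powr q"
   using st by (simp add: pos_divide_le_eq)
  moreover have "(a * (b / c) + k * (l / m)) * n = a * (n / c) * b + k * (n / m) * l" for a b c k l m n :: real
   by (simp add: algebra_simps)
  ultimately show ?thesis unfolding q(2) by (simp only:)
 qed
qed

context tent_measure begin

definition tbound :: "real => (complex => complex) => real => bool" where
 "tbound q f t \<longleftrightarrow> (\<forall>a. norm a < 1 --> tmean q f a <= ennreal t)"

lemma tboundD: "tbound q f t ==> norm a < 1 ==> tmean q f a <= ennreal t"
 by (simp add: tbound_def)

lemma tbound_mono: "tbound q f s ==> s <= t ==> tbound q f t"
 unfolding tbound_def using order_trans ennreal_leI by blast

lemma tmean_cong_norm: "(!!z. z : \<DD> ==> norm (f z) = norm (h z)) ==> tmean q f a = tmean q h a"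
proof -
 assume "!!z. z : \<DD> ==> norm (f z) = norm (h z)"
 hence "(%z. ennreal (norm (f z) powr q) * indicator \<DD> z) = (%z. ennreal (norm (h z) powr q) * indicator \<DD> z)"
  by (intro ext) (simp split: split_indicator)
 thus ?thesis by (simp add: tmean_def fm_def)
qed

lemma tmean_diff_commute: "tmean q (%z. f z - h z) = tmean q (%z. h z - f z)"
 by (intro ext tmean_cong_norm norm_minus_commute)

lemma tbound_diff_commute: "tbound q (%z. f z - h z) t \<longleftrightarrow> tbound q (%z. h z - f z) t"
 by (simp only: tbound_def tmean_diff_commute[of q f h])

lemma tmean_cmult:
 assumes "hol f" "0 < q"
 shows "tmean q (%z. c * f z) a = ennreal (norm c powr q) * tmean q f a"
proof -
 have cf: "hol (%z. c * f z)" using assms by (intro holomorphic_intros)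
 have "emeasure (fm q (%z. c * f z)) (carleson_square a) =
   (\<integral>\<^sup>+z. ennreal (norm c powr q) * (ennreal (norm (f z) powr q) * indicator \<DD> z * indicator (carleson_square a) z) \<partial>\<mu>)"
  unfolding emeasure_fm[OF cf assms(2) carleson_square_measurable]
  by (intro nn_integral_cong) (simp add: norm_mult powr_mult ennreal_mult mult.assoc)
 also have "... = ennreal (norm c powr q) * emeasure (fm q f) (carleson_square a)"
  unfolding emeasure_fm[OF assms carleson_square_measurable]
  by (intro nn_integral_cmult measurable_\<mu> borel_measurable_times_ennreal norm_powr_disk_measurable assms borel_measurable_indicator carleson_square_measurable)
 finally show ?thesis by (simp add: tmean_def mult_ac)
qed

lemma tbound_cmult:
 assumes "hol f" "0 < q" "tbound q f t"
 shows "tbound q (%z. c * f z) (norm c powr q * t)"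
 unfolding tbound_def tmean_cmult[OF assms(1,2)]
proof (intro allI impI)
 fix a :: complex assume a: "norm a < 1"
 have "ennreal (norm c powr q) * tmean q f a <= ennreal (norm c powr q) * ennreal t"
  using tboundD[OF assms(3) a] by (rule mult_left_mono) simp
 thus "ennreal (norm c powr q) * tmean q f a <= ennreal (norm c powr q * t)" by (simp add: ennreal_mult')
qed

lemma tmean_add_le:
 assumes u: "hol u" and v: "hol v" and q: "0 < q" and st: "0 < s" "0 < t" and e: "e = max 1 q"
 shows "tmean q (%z. u z + v z) a <= ennreal (s / (s + t) * ((s + t) powr e / s powr e)) * tmean q u a +
   ennreal (t / (s + t) * ((s + t) powr e / t powr e)) * tmean q v a"
proof -
 define \<alpha> where "\<alpha> = s / (s + t) * ((s + t) powr e / s powr e)"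
 define \<beta> where "\<beta> = t / (s + t) * ((s + t) powr e / t powr e)"
 have ab: "0 <= \<alpha>" "0 <= \<beta>" using st by (simp_all add: \<alpha>_def \<beta>_def)
 let ?S = "carleson_square a"
 let ?n = "%f z. ennreal (norm (f z) powr q) * indicator \<DD> z * indicator ?S z"
 have uv: "hol (%z. u z + v z)" using u v by (intro holomorphic_intros)
 have me: "?n f : borel_measurable \<mu>" if "hol f" for f
  by (intro measurable_\<mu> borel_measurable_times_ennreal norm_powr_disk_measurable that q borel_measurable_indicator carleson_square_measurable)
 have pw: "norm (u z + v z) powr q <= \<alpha> * norm (u z) powr q + \<beta> * norm (v z) powr q" for z
 proof -
  have "norm (u z + v z) powr q <= (norm (u z) + norm (v z)) powr q"
   using q by (intro powr_mono2 norm_triangle_ineq) auto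
  also have "... <= \<alpha> * norm (u z) powr q + \<beta> * norm (v z) powr q"
   unfolding \<alpha>_def \<beta>_def by (rule powr_add_le_weighted[OF _ _ st q e]) auto
  finally show ?thesis .
 qed
 have "emeasure (fm q (%z. u z + v z)) ?S <= (\<integral>\<^sup>+z. ennreal \<alpha> * ?n u z + ennreal \<beta> * ?n v z \<partial>\<mu>)"
  unfolding emeasure_fm[OF uv q carleson_square_measurable]
 proof (intro nn_integral_mono)
  fix z
  have "ennreal (norm (u z + v z) powr q) <= ennreal \<alpha> * ennreal (norm (u z) powr q) + ennreal \<beta> * ennreal (norm (v z) powr q)"
   using ennreal_leI[OF pw[of z]] ab by (simp add: ennreal_mult)
  thus "?n (%z. u z + v z) z <= ennreal \<alpha> * ?n u z + ennreal \<beta> * ?n v z" by (simp split: split_indicator)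
 qed
 also have "... = ennreal \<alpha> * emeasure (fm q u) ?S + ennreal \<beta> * emeasure (fm q v) ?S"
 proof -
  have "(\<integral>\<^sup>+z. ennreal \<alpha> * ?n u z + ennreal \<beta> * ?n v z \<partial>\<mu>) = (\<integral>\<^sup>+z. ennreal \<alpha> * ?n u z \<partial>\<mu>) + (\<integral>\<^sup>+z. ennreal \<beta> * ?n v z \<partial>\<mu>)"
   by (intro nn_integral_add borel_measurable_times_ennreal[OF borel_measurable_const] me u v)
  thus ?thesis
   unfolding emeasure_fm[OF u q carleson_square_measurable] emeasure_fm[OF v q carleson_square_measurable]
   using nn_integral_cmult[OF me[OF u], of "ennreal \<alpha>"] nn_integral_cmult[OF me[OF v], of "ennreal \<beta>"] by simp
 qed
 finally have *: "emeasure (fm q (%z. u z + v z)) ?S <= ennreal \<alpha> * emeasure (fm q u) ?S + ennreal \<beta> * emeasure (fm q v) ?S" .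
 have "tmean q (%z. u z + v z) a <= ennreal (1 / (1 - norm a)) * (ennreal \<alpha> * emeasure (fm q u) ?S + ennreal \<beta> * emeasure (fm q v) ?S)"
  unfolding tmean_def by (rule mult_left_mono[OF *]) simp
 also have "... = ennreal \<alpha> * tmean q u a + ennreal \<beta> * tmean q v a"
  by (simp add: tmean_def distrib_left mult_ac)
 finally show ?thesis unfolding \<alpha>_def \<beta>_def .
qed

text \<open>Minkowski's inequality: inserting the two bounds makes the weighted terms add up to (s +
  t)^e exactly.\<close>

lemma tbound_add:
 assumes u: "hol u" and v: "hol v" and q: "0 < q" and st: "0 < s" "0 < t" and e: "e = max 1 q"
  and b: "tbound q u (s powr e)" "tbound q v (t powr e)"
 shows "tbound q (%z. u z + v z) ((s + t) powr e)"
 unfolding tbound_def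
proof (intro allI impI)
 fix a :: complex assume a: "norm a < 1"
 have "tmean q (%z. u z + v z) a <= ennreal (s / (s + t) * ((s + t) powr e / s powr e)) * tmean q u a +
   ennreal (t / (s + t) * ((s + t) powr e / t powr e)) * tmean q v a"
  by (rule tmean_add_le[OF u v q st e])
 also have "... <= ennreal (s / (s + t) * ((s + t) powr e / s powr e)) * ennreal (s powr e) +
   ennreal (t / (s + t) * ((s + t) powr e / t powr e)) * ennreal (t powr e)"
  by (intro add_mono mult_left_mono tboundD b a) auto
 also have "... = ennreal (s / (s + t) * ((s + t) powr e / s powr e) * s powr e + t / (s + t) * ((s + t) powr e / t powr e) * t powr e)"
  using st by (simp add: ennreal_mult[symmetric] ennreal_plus[symmetric] del: ennreal_plus)
 also have "s / (s + t) * ((s + t) powr e / s powr e) * s powr e + t / (s + t) * ((s + t) powr e / t powr e) * t powr e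
   = (s + t) powr e * (s / (s + t) + t / (s + t))"
  using st by (simp add: distrib_left mult.commute)
 also have "s / (s + t) + t / (s + t) = 1" using st by (simp add: add_divide_distrib[symmetric])
 finally show "tmean q (%z. u z + v z) a <= ennreal ((s + t) powr e)" by simp
qed

lemma tbound_pointwise:
 assumes q: "0 < q"
 obtains C where "0 < C" "!!F t k. hol F ==> 0 <= t ==> tbound q F t ==> node k ==> supb F k powr q * W (fst k) <= C * t"
proof -
 obtain C where C: "0 < C" and
  c: "!!F t. [|hol F; 0 <= t; !!a. norm a < 1 ==> tmean q F a <= ennreal t|]
   ==> carl (%k. supb F k powr q) (%_. C * t) & carl (%k. dsup F k powr q) (%_. C * t)"
  using tmean_to_carl[OF q] by blast
 show thesis
 proof (rule that[OF C])
  fix F t k assume F: "hol F" "0 <= t" "tbound q F t" and k: "node k"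
  have "carl (%k. supb F k powr q) (%_. C * t)" using c[OF F(1,2)] tboundD[OF F(3)] by blast
  thus "supb F k powr q * W (fst k) <= C * t" by (rule carl_pointwise) (use k in simp_all)
 qed
qed

lemma tbound_0_eq_0:
 assumes q: "0 < q" and F: "hol F" "tbound q F 0" and z: "norm z < 1"
 shows "F z = 0"
proof -
 obtain C where "0 < C" and C: "!!F t k. hol F ==> 0 <= t ==> tbound q F t ==> node k ==> supb F k powr q * W (fst k) <= C * t"
  by (rule tbound_pointwise[OF q]) blast
 obtain k where k: "node k" "z : dbox k" using ex_dbox[OF z] by blast
 have "supb F k powr q * W (fst k) <= 0" using C[OF F(1) _ F(2) k(1)] by simp
 hence "supb F k powr q <= 0" using W_pos[of "fst k"] by (simp add: mult_le_0_iff)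
 hence "supb F k powr q = 0" using powr_ge_zero[of "supb F k" q] by linarith
 hence "supb F k = 0" by simp
 thus ?thesis using norm_le_supb[OF hol_cont[OF F(1)] k(2)] by simp
qed

text \<open>The power min(1, q) of the tent norm, for which the triangle inequality holds.\<close>

definition qn :: "real => (complex => complex) => real" where
 "qn q u = enn2real (SUP a\<in>\<DD>. tmean q u a) powr (1 / max 1 q)"

text \<open>The bound \<open>T\<close> guarantees a finite supremum; \<open>enn2real\<close> would
  send an infinite one to 0.\<close>

lemma qn_le_iff:
 assumes "tbound q u T" "0 <= t"
 shows "qn q u <= t \<longleftrightarrow> tbound q u (t powr max 1 q)"
proof -
 define S where "S = (SUP a\<in>\<DD>. tmean q u a)"
 have "S <= ennreal T" unfolding S_def using tboundD[OF assms(1)] by (intro SUP_least) auto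
 hence "S < \<infinity>" by (rule le_less_trans) simp
 hence "S ~= \<infinity>" by (rule less_imp_neq)
 hence "qn q u <= t \<longleftrightarrow> enn_powr S (1 / max 1 q) <= ennreal t"
  using assms(2) by (simp add: qn_def enn_powr_def flip: S_def)
 also have "... \<longleftrightarrow> S <= ennreal (t powr max 1 q)" using assms(2) by (intro enn_powr_le_iff) auto
 also have "... \<longleftrightarrow> tbound q u (t powr max 1 q)" unfolding S_def SUP_le_iff tbound_def by auto
 finally show ?thesis .
qed

lemma qn_metric:
 assumes q: "0 < q" and Y: "!!f. f : Y ==> f : \<H>\<DD> & (\<exists>t. tbound q f t)"
 shows "Metric_space Y (%f h. qn q (%z. h z - f z))"
  "f : Y ==> h : Y ==> \<exists>t. tbound q (%z. h z - f z) t"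
proof -
 define e where "e = max 1 q"
 have e: "e = max 1 q" "0 < e" by (auto simp: e_def)
 have hol: "hol f" if "f : Y" for f using Y[OF that] analytic_diskD by blast
 have hold: "hol (%z. h z - f z)" if "f : Y" "h : Y" for f h by (intro holomorphic_on_diff hol that)
 have pos: "\<exists>s>0. tbound q f (s powr e)" if "tbound q f t" for f t
 proof -
  define s where "s = (\<bar>t\<bar> + 1) powr (1 / e)"
  have "s powr e = \<bar>t\<bar> + 1" using e by (simp add: s_def powr_powr)
  hence "tbound q f (s powr e)" using tbound_mono[OF that, of "\<bar>t\<bar> + 1"] by simp
  moreover have "0 < s" by (simp add: s_def)
  ultimately show ?thesis by blast
 qed
 show fin: "\<exists>t. tbound q (%z. h z - f z) t" if fh: "f : Y" "h : Y" for f h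
 proof -
  obtain s where s: "0 < s" "tbound q h (s powr e)" using Y[OF fh(2)] pos by blast
  obtain t where t: "0 < t" "tbound q f (t powr e)" using Y[OF fh(1)] pos by blast
  have "tbound q (%z. - f z) (t powr e)" using t(2) unfolding tbound_def by (subst tmean_cong_norm[of _ f]) auto
  hence "tbound q (%z. h z + - f z) ((s + t) powr e)"
   using fh by (intro tbound_add[OF hol _ q s(1) t(1) e(1) s(2)] holomorphic_on_minus hol) auto
  thus ?thesis by auto
 qed
 have nn: "0 <= qn q u" for u by (simp add: qn_def)
 show "Metric_space Y (%f h. qn q (%z. h z - f z))"
 proof
  show "0 <= qn q (%z. h z - f z)" for f h by (rule nn)
  show "qn q (%z. h z - f z) = qn q (%z. f z - h z)" for f h
   by (simp only: qn_def tmean_diff_commute[of q h f])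
  show "qn q (%z. h z - f z) = 0 \<longleftrightarrow> f = h" if fh: "f : Y" "h : Y" for f h
  proof
   assume "qn q (%z. h z - f z) = 0"
   hence "tbound q (%z. h z - f z) 0"
    using qn_le_iff[of q "%z. h z - f z" _ 0] fin[OF fh] by auto
   hence z: "h z - f z = 0" if "norm z < 1" for z using tbound_0_eq_0[OF q hold[OF fh] _ that] by blast
   \<comment> \<open>Equality on the disk is equality everywhere because members of \<open>Y\<close>
     are 0 off the disk.\<close>
   show "f = h"
   proof
    fix z show "f z = h z"
     using z[of z] analytic_diskD(2)[of f z] analytic_diskD(2)[of h z] Y[OF fh(1)] Y[OF fh(2)] by (cases "z : \<DD>") auto
   qed
  next
   assume "f = h"
   hence "tmean q (%z. h z - f z) a = 0" for a using tmean_cmult[of "%_. 0" q 0 a] q by simp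
   thus "qn q (%z. h z - f z) = 0" by (simp add: qn_def)
  qed
  show "qn q (%z. k z - f z) <= qn q (%z. h z - f z) + qn q (%z. k z - h z)" if fhk: "f : Y" "h : Y" "k : Y" for f h k
  proof (rule field_le_epsilon)
   fix \<epsilon> :: real assume \<epsilon>: "0 < \<epsilon>"
   \<comment> \<open>The margin \<epsilon>/2 makes s and t positive, as \<open>tbound_add\<close>
     demands.\<close>
   define s where "s = qn q (%z. h z - f z) + \<epsilon> / 2"
   define t where "t = qn q (%z. k z - h z) + \<epsilon> / 2"
   have st: "0 < s" "0 < t" using nn \<epsilon> by (auto simp: s_def t_def add_nonneg_pos)
   obtain T1 where T1: "tbound q (%z. h z - f z) T1" using fin fhk by blast
   obtain T2 where T2: "tbound q (%z. k z - h z) T2" using fin fhk by blast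
   obtain T3 where T3: "tbound q (%z. k z - f z) T3" using fin fhk by blast
   have "tbound q (%z. h z - f z) (s powr e)"
    using qn_le_iff[OF T1, of s] st \<epsilon> unfolding e_def by (simp add: s_def)
   moreover have "tbound q (%z. k z - h z) (t powr e)"
    using qn_le_iff[OF T2, of t] st \<epsilon> unfolding e_def by (simp add: t_def)
   ultimately have "tbound q (%z. (h z - f z) + (k z - h z)) ((s + t) powr e)"
    by (intro tbound_add[OF _ _ q st e(1)] hold fhk)
   hence "tbound q (%z. k z - f z) ((s + t) powr max 1 q)" by (simp add: e_def)
   hence "qn q (%z. k z - f z) <= s + t" using qn_le_iff[OF T3, of "s + t"] st by simp
   thus "qn q (%z. k z - f z) <= qn q (%z. h z - f z) + qn q (%z. k z - h z) + \<epsilon>" by (simp add: s_def t_def)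
  qed
 qed
qed

end

section \<open>The tent spaces of the given weight\<close>

locale tent_weight = tent_measure W \<rho> cr cd \<mu> ca cl L
 for W :: "nat => real" and \<rho> cr cd :: real and \<mu> :: "complex measure" and ca cl :: real and L :: nat +
 fixes \<omega> :: "complex => real"
 assumes W_eq: "W n = enn2real (tail \<omega> (of_real (rad n)))"
  and weight_integral: "!!f S q. S <= \<DD> ==> (%z. ennreal (norm (f z) powr q) * indicator S z) : borel_measurable borel ==>
   (\<integral>\<^sup>+z\<in>S. ennreal (norm (f z :: complex) powr q * \<omega> z) \<partial>lebesgue) = (\<integral>\<^sup>+z\<in>S. ennreal (norm (f z) powr q) \<partial>\<mu>)"
  and tail_pos: "!!z. z : \<DD> ==> 0 < enn2real (tail \<omega> z)"
  and tail_antimono: "!!z z'. z' : \<DD> ==> norm z <= norm z' ==> enn2real (tail \<omega> z') <= enn2real (tail \<omega> z)"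
begin

lemma tent_mean_eq:
 assumes f: "hol f" "0 < q"
 shows "tent_mean q \<omega> f = tmean q f"
proof
 fix a
 let ?S = "carleson_square a"
 have ind: "indicator \<DD> z * indicator ?S z = (indicator ?S z :: ennreal)" for z
  using carleson_square_subset[of a] by (auto split: split_indicator)
 have "(%z. ennreal (norm (f z) powr q) * indicator \<DD> z * indicator ?S z) : borel_measurable borel"
  by (intro borel_measurable_times_ennreal norm_powr_disk_measurable f borel_measurable_indicator carleson_square_measurable)
 hence m: "(%z. ennreal (norm (f z) powr q) * indicator ?S z) : borel_measurable borel"
  by (simp add: mult.assoc ind)
 show "tent_mean q \<omega> f a = tmean q f a"
  unfolding tent_mean_def tmean_def emeasure_fm[OF f carleson_square_measurable]
   weight_integral[OF carleson_square_subset m] by (simp add: mult.assoc ind)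
qed

lemma tent_norm_le:
 assumes "hol f" "0 < q" "0 <= t"
 shows "tent_norm q \<omega> f <= ennreal t \<longleftrightarrow> tbound q f (t powr q)"
 unfolding tent_norm_le_iff[OF assms(2,3)] tent_mean_eq[OF assms(1,2)] tbound_def by auto

lemma AT_inf_iff:
 assumes q: "0 < q"
 shows "f : AT_inf q \<omega> \<longleftrightarrow> f : \<H>\<DD> & (\<exists>t\<ge>0. tbound q f t)"
proof
 assume f: "f : AT_inf q \<omega>"
 hence h: "f : \<H>\<DD>" "tent_norm q \<omega> f < \<infinity>" by (auto simp: AT_inf_def T_inf_def)
 hence "tent_norm q \<omega> f <= ennreal (enn2real (tent_norm q \<omega> f))" by simp
 hence "tbound q f (enn2real (tent_norm q \<omega> f) powr q)"
  using tent_norm_le[OF analytic_diskD(1)[OF h(1)] q enn2real_nonneg] by blast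
 thus "f : \<H>\<DD> & (\<exists>t\<ge>0. tbound q f t)" using h(1) powr_ge_zero by blast
next
 assume "f : \<H>\<DD> & (\<exists>t\<ge>0. tbound q f t)"
 then obtain t where f: "f : \<H>\<DD>" and t: "0 <= t" "tbound q f t" by blast
 have hf: "hol f" by (rule analytic_diskD(1)[OF f])
 have "(t powr (1/q)) powr q = t" using t q by (simp add: powr_powr)
 hence "tent_norm q \<omega> f <= ennreal (t powr (1/q))" using tent_norm_le[OF hf q, of "t powr (1/q)"] t by simp
 hence "tent_norm q \<omega> f < \<infinity>" using le_less_trans[OF _ ennreal_less_top] by simp
 moreover have "f : borel_measurable (lebesgue_on \<DD>)"
  by (intro continuous_imp_measurable_on_sets_lebesgue hol_cont hf) simp
 ultimately show "f : AT_inf q \<omega>" using f by (simp add: AT_inf_def T_inf_def)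
qed

lemma AT_zero_iff:
 assumes q: "0 < q"
 shows "f : AT_zero q \<omega> \<longleftrightarrow> f : AT_inf q \<omega> & (tmean q f \<longlongrightarrow> 0) to_circle"
 using tent_mean_eq[of f q, OF _ q] analytic_diskD(1)[of f] by (auto simp: AT_zero_def T_zero_def AT_inf_def)

text \<open>The q-th power of the tent norm and the power max 1 q of the metric are the same
  supremum of means, so the exponents e/q and q/e convert radii of one into radii of the other.
  Boundedness and convergence are then expressed by \<open>tbound\<close>, without roots.\<close>

lemma compact_op_tent_iff:
 assumes p: "0 < p" and q: "0 < q" and X: "X <= \<H>\<DD>" and Y: "Y <= AT_inf q \<omega>"
 shows "compact_op X (tent_norm p \<omega>) Y (tent_norm q \<omega>) T \<longleftrightarrow> T ` X <= Y &
  (\<forall>(f :: nat => _) Q. (\<forall>i. f i : X & tbound p (f i) Q) -->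
   (\<exists>h r. h : Y & strict_mono r & (\<forall>\<eta>>0. eventually (%i. tbound q (%z. T (f (r i)) z - h z) \<eta>) sequentially)))"
proof -
 define D where "D f h = qn q (%z. h z - f z)" for f h
 have Yh: "f : \<H>\<DD> & (\<exists>t. tbound q f t)" if "f : Y" for f using AT_inf_iff[OF q] that Y by blast
 have M: "Metric_space Y D" unfolding D_def by (rule qn_metric(1)[OF q Yh])
 define e where "e = max 1 q"
 have e: "0 < e" by (simp add: e_def)
 have hold: "hol (%z. h z - f z)" if "f : Y" "h : Y" for f h
  using Yh[OF that(1)] Yh[OF that(2)] by (intro holomorphic_on_diff analytic_diskD(1)) auto
 have Dle: "D f h <= t \<longleftrightarrow> tbound q (%z. h z - f z) (t powr e)" if "f : Y" "h : Y" "0 <= t" for f h t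
 proof -
  have "\<exists>T. tbound q (%z. h z - f z) T" by (rule qn_metric(2)[OF q Yh that(1,2)])
  then obtain T where "tbound q (%z. h z - f z) T" by (elim exE)
  thus ?thesis unfolding D_def e_def using qn_le_iff that(3) by blast
 qed
 have Nle: "tent_norm q \<omega> (%z. h z - f z) <= ennreal t \<longleftrightarrow> tbound q (%z. h z - f z) (t powr q)" if "f : Y" "h : Y" "0 <= t" for f h t
  by (rule tent_norm_le[OF hold[OF that(1,2)] q that(3)])
 have co: "compact_op X (tent_norm p \<omega>) Y (tent_norm q \<omega>) T \<longleftrightarrow> T ` X <= Y &
  (\<forall>(f :: nat => _) C. (\<forall>i. f i : X & tent_norm p \<omega> (f i) <= ennreal C) -->
   (\<exists>h r. h : Y & strict_mono r & (%i. D (T (f (r i))) h) \<longlonglongrightarrow> 0))"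
 proof (rule compact_op_iff_sequences[OF M])
  fix \<epsilon> :: real assume \<epsilon>: "0 < \<epsilon>"
  show "\<exists>\<delta>>0. \<forall>f\<in>Y. \<forall>h\<in>Y. tent_norm q \<omega> (%x. h x - f x) < ennreal \<delta> --> D f h < \<epsilon>"
  proof (intro exI[of _ "(\<epsilon> / 2) powr (e / q)"] conjI ballI impI)
   fix f h assume fh: "f : Y" "h : Y" "tent_norm q \<omega> (%x. h x - f x) < ennreal ((\<epsilon> / 2) powr (e / q))"
   have "((\<epsilon> / 2) powr (e / q)) powr q = (\<epsilon> / 2) powr e" using q by (simp add: powr_powr)
   hence "tbound q (%z. h z - f z) ((\<epsilon> / 2) powr e)"
    using Nle[OF fh(1,2), of "(\<epsilon> / 2) powr (e / q)"] less_imp_le[OF fh(3)] by simp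
   hence "D f h <= \<epsilon> / 2" using Dle[OF fh(1,2), of "\<epsilon> / 2"] \<epsilon> by simp
   thus "D f h < \<epsilon>" using \<epsilon> by simp
  qed (use \<epsilon> in simp)
  show "\<exists>\<delta>>0. \<forall>f\<in>Y. \<forall>h\<in>Y. D f h < \<delta> --> tent_norm q \<omega> (%x. h x - f x) < ennreal \<epsilon>"
  proof (intro exI[of _ "(\<epsilon> / 2) powr (q / e)"] conjI ballI impI)
   fix f h assume fh: "f : Y" "h : Y" "D f h < (\<epsilon> / 2) powr (q / e)"
   have "((\<epsilon> / 2) powr (q / e)) powr e = (\<epsilon> / 2) powr q" using e by (simp add: powr_powr)
   hence "tbound q (%z. h z - f z) ((\<epsilon> / 2) powr q)"
    using Dle[OF fh(1,2), of "(\<epsilon> / 2) powr (q / e)"] less_imp_le[OF fh(3)] by simp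
   hence "tent_norm q \<omega> (%z. h z - f z) <= ennreal (\<epsilon> / 2)" using Nle[OF fh(1,2), of "\<epsilon> / 2"] \<epsilon> by simp
   also have "... < ennreal \<epsilon>" using \<epsilon> by (simp add: ennreal_lessI)
   finally show "tent_norm q \<omega> (%x. h x - f x) < ennreal \<epsilon>" .
  qed (use \<epsilon> in simp)
 qed
 have lim: "(%i. D (T (f (r i))) h) \<longlonglongrightarrow> 0 \<longleftrightarrow> (\<forall>\<eta>>0. eventually (%i. tbound q (%z. T (f (r i)) z - h z) \<eta>) sequentially)"
  if TX: "T ` X <= Y" and f: "!!i. f i : X" and h: "h : Y" for f :: "nat => complex => complex" and r :: "nat => nat" and h
 proof
  have Tf: "T (f (r i)) : Y" for i using TX f by blast
  assume l: "(%i. D (T (f (r i))) h) \<longlonglongrightarrow> 0"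
  show "\<forall>\<eta>>0. eventually (%i. tbound q (%z. T (f (r i)) z - h z) \<eta>) sequentially"
  proof (intro allI impI)
   fix \<eta> :: real assume \<eta>: "0 < \<eta>"
   hence "0 < \<eta> powr (1 / e)" by simp
   hence "eventually (%i. D (T (f (r i))) h < \<eta> powr (1 / e)) sequentially" using order_tendstoD(2)[OF l] by blast
   thus "eventually (%i. tbound q (%z. T (f (r i)) z - h z) \<eta>) sequentially"
   proof (rule eventually_mono)
    fix i assume "D (T (f (r i))) h < \<eta> powr (1 / e)"
    hence "tbound q (%z. h z - T (f (r i)) z) ((\<eta> powr (1 / e)) powr e)"
     using Dle[OF Tf h, of "\<eta> powr (1/e)" i] by simp
    moreover have "(\<eta> powr (1 / e)) powr e = \<eta>" using e \<eta> by (simp add: powr_powr)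
    ultimately show "tbound q (%z. T (f (r i)) z - h z) \<eta>" by (subst tbound_diff_commute) simp
   qed
  qed
 next
  have Tf: "T (f (r i)) : Y" for i using TX f by blast
  assume l: "\<forall>\<eta>>0. eventually (%i. tbound q (%z. T (f (r i)) z - h z) \<eta>) sequentially"
  show "(%i. D (T (f (r i))) h) \<longlonglongrightarrow> 0"
  proof (rule tendstoI)
   fix \<epsilon> :: real assume \<epsilon>: "0 < \<epsilon>"
   hence "eventually (%i. tbound q (%z. T (f (r i)) z - h z) ((\<epsilon> / 2) powr e)) sequentially" using l by simp
   thus "eventually (%i. dist (D (T (f (r i))) h) 0 < \<epsilon>) sequentially"
   proof (rule eventually_mono)
    fix i assume "tbound q (%z. T (f (r i)) z - h z) ((\<epsilon> / 2) powr e)"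
    hence "D (T (f (r i))) h <= \<epsilon> / 2" using Dle[OF Tf h, of "\<epsilon> / 2" i] \<epsilon> by (subst (asm) tbound_diff_commute) simp
    moreover have "0 <= D (T (f (r i))) h" by (simp add: D_def qn_def)
    ultimately show "dist (D (T (f (r i))) h) 0 < \<epsilon>" using \<epsilon> by simp
   qed
  qed
 qed
 have bd: "(\<forall>i. f i : X & tent_norm p \<omega> (f i) <= ennreal C) ==> \<forall>i. f i : X & tbound p (f i) (max 0 C powr p)"
  for f :: "nat => complex => complex" and C
 proof (intro allI conjI)
  fix i assume a: "\<forall>i. f i : X & tent_norm p \<omega> (f i) <= ennreal C"
  thus fX: "f i : X" by blast
  have "tent_norm p \<omega> (f i) <= ennreal C" using a by blast
  also have "... <= ennreal (max 0 C)" by (intro ennreal_leI) simp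
  finally show "tbound p (f i) (max 0 C powr p)"
   using tent_norm_le[OF analytic_diskD(1)[of "f i"] p, of "max 0 C"] fX X by auto
 qed
 have bd': "\<forall>i. f i : X & tent_norm p \<omega> (f i) <= ennreal (max 0 Q powr (1 / p))" if a: "\<forall>i. f i : X & tbound p (f i) Q"
  for f :: "nat => complex => complex" and Q
 proof (intro allI conjI)
  fix i
  show fX: "f i : X" using a by blast
  have "tbound p (f i) (max 0 Q)" using a tbound_mono[of p "f i" Q "max 0 Q"] by simp
  moreover have "(max 0 Q powr (1 / p)) powr p = max 0 Q" using p by (simp add: powr_powr)
  ultimately show "tent_norm p \<omega> (f i) <= ennreal (max 0 Q powr (1 / p))"
   using tent_norm_le[OF analytic_diskD(1)[of "f i"] p, of "max 0 Q powr (1 / p)"] fX X by auto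
 qed
 show ?thesis
  unfolding co
 proof (intro conj_cong refl iffI allI impI)
  fix f :: "nat => complex => complex" and Q
  assume TX: "T ` X <= Y" and H: "\<forall>(f :: nat => _) C. (\<forall>i. f i : X & tent_norm p \<omega> (f i) <= ennreal C) -->
   (\<exists>h r. h : Y & strict_mono r & (%i. D (T (f (r i))) h) \<longlonglongrightarrow> 0)"
   and f: "\<forall>i. f i : X & tbound p (f i) Q"
  from H[THEN spec, THEN spec, THEN mp, OF bd'[OF f]]
  obtain h r where h: "h : Y" "strict_mono (r :: nat => nat)" "(%i. D (T (f (r i))) h) \<longlonglongrightarrow> 0" by (elim exE conjE)
  have "f i : X" for i using f by blast
  from lim[where f=f and r=r and h=h, OF TX this h(1)] h
  show "\<exists>h r. h : Y & strict_mono r & (\<forall>\<eta>>0. eventually (%i. tbound q (%z. T (f (r i)) z - h z) \<eta>) sequentially)"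
   by (intro exI[of _ h] exI[of _ r]) simp
 next
  fix f :: "nat => complex => complex" and C
  assume TX: "T ` X <= Y" and H: "\<forall>(f :: nat => _) Q. (\<forall>i. f i : X & tbound p (f i) Q) -->
   (\<exists>h r. h : Y & strict_mono r & (\<forall>\<eta>>0. eventually (%i. tbound q (%z. T (f (r i)) z - h z) \<eta>) sequentially))"
   and f: "\<forall>i. f i : X & tent_norm p \<omega> (f i) <= ennreal C"
  from H[THEN spec, THEN spec, THEN mp, OF bd[OF f]]
  obtain h r where h: "h : Y" "strict_mono (r :: nat => nat)"
   "\<forall>\<eta>>0. eventually (%i. tbound q (%z. T (f (r i)) z - h z) \<eta>) sequentially" by (elim exE conjE)
  have "f i : X" for i using f by blast
  from lim[where f=f and r=r and h=h, OF TX this h(1)] h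
  show "\<exists>h r. h : Y & strict_mono r & (%i. D (T (f (r i))) h) \<longlonglongrightarrow> 0"
   by (intro exI[of _ h] exI[of _ r]) simp
 qed
qed

end

context tent_weight begin

section \<open>Sufficiency of the multiplier condition\<close>

text \<open>A Fatou argument: for each cutoff the mean is a finite sum and converges term by
  term.\<close>

lemma carl_limit:
 assumes p: "0 < p" and f: "!!i. continuous_on \<DD> (f i)" "continuous_on \<DD> F"
  and lim: "!!K. compact K ==> K <= \<DD> ==> uniform_limit K f F sequentially"
  and c: "!!i. carl (%k. supb (f i) k powr p) b"
 shows "carl (%k. supb F k powr p) b"
 unfolding carl_def
proof (intro allI impI)
 fix H K assume K: "node K"
 have "(%i. cmean (%k. supb (f i) k powr p) H K) \<longlonglongrightarrow> cmean (%k. supb F k powr p) H K"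
  unfolding cmean_def
 proof (intro tendsto_mult tendsto_const tendsto_sum)
  fix k assume "k : {k. k : boxes H & below k K}"
  hence k: "node k" unfolding mem_boxes by blast
  show "(%i. supb (f i) k powr p) \<longlonglongrightarrow> supb F k powr p"
   using p supb_nonneg[OF f(1) k] by (intro tendsto_powr' supb_tendsto[OF f lim k] tendsto_const) auto
 qed
 thus "cmean (%k. supb F k powr p) H K <= b (fst K)"
  by (rule LIMSEQ_le_const2) (use carlD[OF c K] in blast)
qed

lemma supb_le_carl:
 assumes p: "0 < p" and f: "continuous_on \<DD> f" and c: "carl (%k. supb f k powr p) (%_. Q)" and k: "node k"
 shows "supb f k <= (Q / W (fst k)) powr (1 / p)"
proof -
 have "supb f k powr p * W (fst k) <= Q" using carl_pointwise[OF c _ k] by simp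
 hence "supb f k powr p <= Q / W (fst k)" using W_pos by (simp add: pos_le_divide_eq)
 hence "(supb f k powr p) powr (1 / p) <= (Q / W (fst k)) powr (1 / p)" using p by (intro powr_mono2) auto
 thus ?thesis using p supb_nonneg[OF f k] by (simp add: powr_powr)
qed

text \<open>A compact subset of the disk meets boxes of finitely many levels only, where the growth
  estimate bounds the family. The limit is set to 0 off the disk to make it a member of
  \<open>analytic_disk\<close>.\<close>

lemma Montel_disk:
 assumes p: "0 < p" and f: "!!i. f i holomorphic_on \<DD>" and c: "!!i. carl (%k. supb (f i) k powr p) (%_. Q)"
 obtains F r where "F : \<H>\<DD>" "strict_mono (r :: nat => nat)"
  "!!K. compact K ==> K <= \<DD> ==> uniform_limit K (%i. f (r i)) F sequentially"
proof -
 have bd: "\<exists>B. \<forall>h\<in>range f. \<forall>z\<in>K. norm (h z) <= B" if K: "compact K" "K <= \<DD>" for K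
 proof (cases "K = {}")
  case False
  have "compact (norm ` K)" by (intro compact_continuous_image K continuous_intros)
  then obtain s where s: "s : norm ` K" "!!t. t : norm ` K ==> t <= s" using compact_attains_sup[of "norm ` K"] False by auto
  hence "s < 1" using K(2) by auto
  then obtain n where n: "s < rad n" using ex_rad_gt by blast
  show ?thesis
  proof (intro exI[of _ "\<Sum>l\<le>n. (Q / W l) powr (1 / p)"] ballI)
   fix h z assume h: "h : range f" and z: "z : K"
   obtain i where i: "h = f i" using h by blast
   have zn: "norm z < rad n" using s(2) z n by fastforce
   hence "norm z < 1" using rad_less_1[of n] by linarith
   then obtain k where k: "node k" "z : dbox k" using ex_dbox by blast
   have "fst k <= n"
   proof (rule ccontr)
    assume "~ fst k <= n"
    hence "rad n <= rad (fst k)" by (intro rad_mono) simp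
    thus False using k(2) zn by (simp add: dbox_def)
   qed
   have ci: "continuous_on \<DD> (f i)" by (rule hol_cont[OF f])
   have "norm (h z) <= supb (f i) k" unfolding i by (rule norm_le_supb[OF ci k(2)])
   also have "... <= (Q / W (fst k)) powr (1 / p)" by (rule supb_le_carl[OF p ci c k(1)])
   also have "... <= (\<Sum>l\<le>n. (Q / W l) powr (1 / p))"
    using \<open>fst k <= n\<close> by (intro member_le_sum[of "fst k" "{..n}" "%l. (Q / W l) powr (1 / p)"]) auto
   finally show "norm (h z) <= (\<Sum>l\<le>n. (Q / W l) powr (1 / p))" .
  qed
 qed simp
 have hr: "hol h" if "h : range f" for h using that f by blast
 obtain G r where G: "hol G" and r: "strict_mono (r :: nat => nat)"
  and lim: "!!K. compact K ==> K <= \<DD> ==> uniform_limit K (f \<circ> r) G sequentially"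
  by (rule Montel[OF open_ball hr bd subset_refl]) blast+
 show thesis
 proof (rule that[OF _ r])
  show "(%z. if z : \<DD> then G z else 0) : \<H>\<DD>"
   using holomorphic_transform[OF G, of "%z. if z : \<DD> then G z else 0"] by (auto simp: analytic_disk_def)
  show "uniform_limit K (%i. f (r i)) (%z. if z : \<DD> then G z else 0) sequentially" if K: "compact K" "K <= \<DD>" for K
  proof (rule uniform_limit_cong'[THEN iffD1, OF _ _ lim[OF K]])
   show "(f \<circ> r) i z = f (r i) z" for i z by simp
   show "G z = (if z : \<DD> then G z else 0)" if "z : K" for z using that K(2) by auto
  qed
 qed
qed

lemma carl_AT_zero:
 assumes q: "0 < q" and f: "f : \<H>\<DD>" and c: "carl (%k. supb f k powr q) b" and b: "!!n. 0 <= b n" "b \<longlonglongrightarrow> 0"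
 shows "f : AT_zero q \<omega>"
proof -
 have hf: "hol f" by (rule analytic_diskD(1)[OF f])
 have "Bseq b" using b(2) convergentI convergent_imp_Bseq by blast
 then obtain B where B: "0 < B" "!!n. norm (b n) <= B" by (rule BseqE) blast
 have bB: "b n <= B" for n using B(2)[of n] by simp
 have "tbound q f (4 * ca * B)"
  unfolding tbound_def using carl_to_tmean_bounded[OF q hf c b(1) bB] by blast
 hence "f : AT_inf q \<omega>" unfolding AT_inf_iff[OF q] using f B(1) ca_pos by (intro conjI exI[of _ "4 * ca * B"]) auto
 thus ?thesis unfolding AT_zero_iff[OF q] using carl_to_tmean_vanishing[OF q hf c b] by blast
qed

lemma tbound_to_carl:
 assumes q: "0 < q"
 obtains C where "0 < C" "!!F t. hol F ==> 0 <= t ==> tbound q F t ==>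
  carl (%k. supb F k powr q) (%_. C * t) & carl (%k. dsup F k powr q) (%_. C * t)"
 by (rule tmean_to_carl[OF q]) (simp add: tbound_def)

lemma volterra_maps:
 assumes p: "0 < p" and q: "0 < q" and g: "hol g" and v: "vmult p q (dsup g)" and Q: "0 <= Q"
 obtains B where "0 <= B" "!!f. f : \<H>\<DD> ==> tbound p f Q ==> volterra g f : AT_zero q \<omega> & tbound q (volterra g f) B"
proof -
 obtain C where C: "0 < C" and c: "!!F t. hol F ==> 0 <= t ==> tbound p F t ==>
  carl (%k. supb F k powr p) (%_. C * t) & carl (%k. dsup F k powr p) (%_. C * t)"
  by (rule tbound_to_carl[OF p]) blast
 have CQ: "0 <= C * Q" using C Q by simp
 obtain b B where b: "!!n. 0 <= b n" "!!n. b n <= B" "b \<longlonglongrightarrow> 0"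
  and bc: "!!f. hol f ==> carl (%k. supb f k powr p) (%_. C * Q) ==> carl (%k. supb (volterra g f) k powr q) b"
  by (rule carl_supb_volterra[OF q g v CQ]) blast
 have B: "0 <= B" using b(1)[of 0] b(2)[of 0] by linarith
 show thesis
 proof (rule that)
  show "0 <= 4 * ca * B" using ca_pos B by simp
  fix f assume f: "f : \<H>\<DD>" "tbound p f Q"
  have hf: "hol f" by (rule analytic_diskD(1)[OF f(1)])
  have cf: "carl (%k. supb (volterra g f) k powr q) b" by (rule bc[OF hf]) (use c[OF hf Q f(2)] in blast)
  have "volterra g f : AT_zero q \<omega>"
   using volterra_holomorphic(1)[OF hf g] by (intro carl_AT_zero[OF q _ cf b(1,3)]) (simp add: analytic_disk_def volterra_def)
  moreover have "tbound q (volterra g f) (4 * ca * B)"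
   unfolding tbound_def using carl_to_tmean_bounded[OF q volterra_holomorphic(1)[OF hf g] cf b(1,2)] by blast
  ultimately show "volterra g f : AT_zero q \<omega> & tbound q (volterra g f) (4 * ca * B)" by blast
 qed
qed

lemma AT_zero_subset: "0 < q ==> AT_zero q \<omega> <= AT_inf q \<omega>"
 using AT_zero_iff by blast

text \<open>A subsequence converges locally uniformly to some F; the differences stay bounded in the
  tent space and tend to 0, so their images tend to 0 in norm.\<close>

lemma compact_volterra:
 assumes p: "0 < p" and q: "0 < q" and g: "hol g" and v: "vmult p q (dsup g)"
  and X: "X <= AT_inf p \<omega>" and Y: "AT_zero q \<omega> <= Y" "Y <= AT_inf q \<omega>"
 shows "compact_op X (tent_norm p \<omega>) Y (tent_norm q \<omega>) (volterra g)"
proof -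
 have XH: "X <= \<H>\<DD>" using X AT_inf_iff[OF p] by blast
 have J: "volterra g f : AT_zero q \<omega>" if f: "f : AT_inf p \<omega>" for f
 proof -
  obtain t where t: "0 <= t" "tbound p f t" "f : \<H>\<DD>" using f unfolding AT_inf_iff[OF p] by blast
  show ?thesis by (rule volterra_maps[OF p q g v t(1)]) (use t in blast)
 qed
 obtain C where C: "0 < C" and c: "!!F t. hol F ==> 0 <= t ==> tbound p F t ==>
  carl (%k. supb F k powr p) (%_. C * t) & carl (%k. dsup F k powr p) (%_. C * t)"
  by (rule tbound_to_carl[OF p]) blast
 define e where "e = max 1 p"
 have e: "e = max 1 p" "0 < e" by (auto simp: e_def)
 show ?thesis
  unfolding compact_op_tent_iff[OF p q XH Y(2)]
 proof (intro conjI allI impI)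
  show "volterra g ` X <= Y" using J X Y(1) by blast
  fix f :: "nat => complex => complex" and Q
  assume f: "\<forall>i. f i : X & tbound p (f i) Q"
  have hf: "f i holomorphic_on \<DD>" for i using f XH by (intro analytic_diskD(1)) auto
  \<comment> \<open>s^e dominates the bound of the sequence as well as that of its limit, so one
    number serves both arguments of \<open>tbound_add\<close>.\<close>
  define s where "s = (\<bar>Q\<bar> + C * \<bar>Q\<bar> * (4 * ca) + 1) powr (1 / e)"
  have s0: "0 <= C * \<bar>Q\<bar> * (4 * ca)" using C ca_pos by simp
  have s: "0 < s" "s powr e = \<bar>Q\<bar> + C * \<bar>Q\<bar> * (4 * ca) + 1"
  proof -
   have pos: "0 < \<bar>Q\<bar> + C * \<bar>Q\<bar> * (4 * ca) + 1" using s0 by linarith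
   show "0 < s" unfolding s_def using pos by (subst powr_gt_zero) simp
   show "s powr e = \<bar>Q\<bar> + C * \<bar>Q\<bar> * (4 * ca) + 1" using e pos by (simp add: s_def powr_powr)
  qed
  have tf: "tbound p (f i) \<bar>Q\<bar>" for i using f tbound_mono[of p "f i" Q "\<bar>Q\<bar>"] by simp
  have cf: "carl (%k. supb (f i) k powr p) (%_. C * \<bar>Q\<bar>)" for i using c[OF hf _ tf] by simp
  obtain F r where F: "F : \<H>\<DD>" and r: "strict_mono (r :: nat => nat)"
   and lim: "!!K. compact K ==> K <= \<DD> ==> uniform_limit K (%i. f (r i)) F sequentially"
   by (rule Montel_disk[where f=f, OF p hf cf]) blast
  have hF: "hol F" by (rule analytic_diskD(1)[OF F])
  have cF: "carl (%k. supb F k powr p) (%_. C * \<bar>Q\<bar>)"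
   by (rule carl_limit[OF p hol_cont[OF hf] hol_cont[OF hF] lim cf])
  have tF: "tbound p F (4 * ca * (C * \<bar>Q\<bar>))"
   unfolding tbound_def using carl_to_tmean_bounded[OF p hF cF] C by simp
  have Fi: "F : AT_inf p \<omega>" unfolding AT_inf_iff[OF p] using F tF C ca_pos by (intro conjI exI[of _ "4 * ca * (C * \<bar>Q\<bar>)"]) auto
  define Q' where "Q' = (s + s) powr e"
  have hd: "tbound p (%z. f (r i) z - F z) Q'" for i
  proof -
   have "tbound p (%z. - F z) (s powr e)"
    using tbound_mono[OF tF, of "s powr e"] s0 unfolding s(2) tbound_def
    by (subst tmean_cong_norm[of _ F]) (auto simp: mult_ac)
   moreover have "tbound p (f (r i)) (s powr e)" using tbound_mono[OF tf[of "r i"], of "s powr e"] s0 unfolding s(2) by simp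
   ultimately have "tbound p (%z. f (r i) z + - F z) ((s + s) powr e)"
    by (intro tbound_add[OF hf _ p s(1) s(1) e(1)] holomorphic_on_minus hF)
   thus ?thesis by (simp add: Q'_def)
  qed
  have hh: "hol (%z. f (r i) z - F z)" for i by (intro holomorphic_on_diff hf hF)
  have Q': "0 <= C * Q'" using C by (simp add: Q'_def)
  show "\<exists>h r. h : Y & strict_mono r & (\<forall>\<eta>>0. eventually (%i. tbound q (%z. volterra g (f (r i)) z - h z) \<eta>) sequentially)"
  proof (intro exI[of _ "volterra g F"] exI[of _ r] conjI allI impI r)
   \<comment> \<open>F is known to lie in the full space only, possibly outside \<open>X\<close>;
     its image nevertheless lies in the vanishing space, hence in \<open>Y\<close>.\<close>
   show "volterra g F : Y" using J[OF Fi] Y(1) by blast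
   fix \<eta> :: real assume \<eta>: "0 < \<eta>"
   have "eventually (%i. \<forall>a. norm a < 1 --> tmean q (volterra g (%z. f (r i) z - F z)) a <= ennreal \<eta>) sequentially"
   proof (rule volterra_null_sequence[OF p q g v Q' hh _ _ \<eta>])
    show "carl (%k. supb (%z. f (r i) z - F z) k powr p) (%_. C * Q')" for i
     using c[OF hh _ hd] by (simp add: Q'_def)
    show "uniform_limit K (%i z. f (r i) z - F z) (%_. 0) sequentially" if "compact K" "K <= \<DD>" for K
     using lim[OF that] by (simp add: uniform_limit_iff dist_norm)
   qed
   thus "eventually (%i. tbound q (%z. volterra g (f (r i)) z - volterra g F z) \<eta>) sequentially"
    unfolding tbound_def volterra_diff[OF hf hF g] .
  qed
 qed
qed

text \<open>The unit ball is mapped into a ball, and homogeneity does the rest. Functions are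
  divided by a positive t slightly above their norm, since the norm may be 0; then t decreases to
  the norm.\<close>

lemma bounded_volterra:
 assumes p: "0 < p" and q: "0 < q" and g: "hol g" and v: "vmult p q (dsup g)"
 shows "bounded_op (AT_inf p \<omega>) (tent_norm p \<omega>) (AT_zero q \<omega>) (tent_norm q \<omega>) (volterra g)"
proof -
 obtain B where B: "0 <= B" and b: "!!f. f : \<H>\<DD> ==> tbound p f 1 ==> volterra g f : AT_zero q \<omega> & tbound q (volterra g f) B"
  by (rule volterra_maps[OF p q g v, of 1]) auto
 define D where "D = B powr (1 / q)"
 have Dq: "D powr q = B" using B q by (simp add: D_def powr_powr)
 have *: "volterra g f : AT_zero q \<omega> & tent_norm q \<omega> (volterra g f) <= ennreal D * tent_norm p \<omega> f" if f: "f : AT_inf p \<omega>" for f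
 proof -
  have fH: "f : \<H>\<DD>" and fin: "tent_norm p \<omega> f < \<infinity>" using f by (auto simp: AT_inf_def T_inf_def)
  have hf: "hol f" by (rule analytic_diskD(1)[OF fH])
  define n where "n = enn2real (tent_norm p \<omega> f)"
  have n: "tent_norm p \<omega> f = ennreal n" "0 <= n" using fin by (auto simp: n_def)
  have st: "volterra g f : AT_zero q \<omega> & tent_norm q \<omega> (volterra g f) <= ennreal (D * t)" if t: "n <= t" "0 < t" for t
  proof -
   let ?u = "%z. of_real (1 / t) * f z"
   have u: "?u : \<H>\<DD>" using fH by (auto simp: analytic_disk_def intro!: holomorphic_intros)
   have hu: "?u holomorphic_on \<DD>" by (rule analytic_diskD(1)[OF u])
   have "tent_norm p \<omega> f <= ennreal t" unfolding n(1) using t by (intro ennreal_leI)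
   hence "tbound p f (t powr p)" using tent_norm_le[OF hf p, of t] t by simp
   hence "tbound p ?u (norm (of_real (1 / t) :: complex) powr p * t powr p)" by (rule tbound_cmult[OF hf p])
   moreover have "norm (of_real (1 / t) :: complex) powr p * t powr p = 1"
    using t by (simp add: norm_divide powr_divide)
   ultimately have "tbound p ?u 1" by simp
   from b[OF u this] have Ju: "volterra g ?u : AT_zero q \<omega>" "tbound q (volterra g ?u) B" by blast+
   have eq: "volterra g f = (%z. of_real t * volterra g ?u z)"
    using volterra_cmult[OF hu g, of "of_real t"] t by simp
   have hJ: "volterra g ?u holomorphic_on \<DD>" by (rule volterra_holomorphic(1)[OF hu g])
   have "tbound q (volterra g f) (norm (of_real t :: complex) powr q * B)"
    unfolding eq by (rule tbound_cmult[OF hJ q Ju(2)])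
   hence "tbound q (volterra g f) ((D * t) powr q)" using t by (simp add: powr_mult Dq mult.commute)
   hence "tent_norm q \<omega> (volterra g f) <= ennreal (D * t)"
    using tent_norm_le[OF volterra_holomorphic(1)[OF hf g] q, of "D * t"] t by (simp add: D_def)
   moreover have "volterra g f : AT_zero q \<omega>"
   proof -
    obtain T where T: "0 <= T" "tbound p f T" using f unfolding AT_inf_iff[OF p] by blast
    show ?thesis by (rule volterra_maps[OF p q g v T(1)]) (use fH T in blast)
   qed
   ultimately show ?thesis by blast
  qed
  have "tent_norm q \<omega> (volterra g f) <= ennreal (D * n)"
  proof (rule ennreal_le_epsilon)
   fix \<epsilon> :: real assume \<epsilon>: "0 < \<epsilon>"
   define t where "t = n + \<epsilon> / (D + 1)"
   have D: "0 <= D" by (simp add: D_def)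
   have t: "n <= t" "0 < t" using n(2) \<epsilon> D by (auto simp: t_def intro!: add_nonneg_pos divide_pos_pos)
   have "D * (\<epsilon> / (D + 1)) <= \<epsilon>" using D \<epsilon> by (simp add: field_simps)
   hence "D * t <= D * n + \<epsilon>" by (simp add: t_def distrib_left)
   hence "ennreal (D * t) <= ennreal (D * n) + ennreal \<epsilon>" using D n(2) \<epsilon> by (simp add: ennreal_plus[symmetric] ennreal_leI del: ennreal_plus)
   thus "tent_norm q \<omega> (volterra g f) <= ennreal (D * n) + ennreal \<epsilon>" using st[OF t] order_trans by blast
  qed
  thus ?thesis using st[of "n + 1"] n by (simp add: ennreal_mult D_def)
 qed
 show ?thesis unfolding bounded_op_def using * by (intro conjI exI[of _ D]) auto
qed

section \<open>Discrete forms of the conditions on g\<close>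

lemma dbox_weight_bounds:
 assumes z: "z : dbox k"
 shows "1 - norm z <= (1/2) ^ fst k" "(1/2) ^ fst k <= 2 * (1 - norm z)"
  "enn2real (tail \<omega> z) <= W (fst k)" "W (fst k) <= cd * enn2real (tail \<omega> z)" "z : \<DD>"
proof -
 have r: "rad (fst k) <= norm z" "norm z < rad (Suc (fst k))" using z by (auto simp: dbox_def)
 show "1 - norm z <= (1/2) ^ fst k" "(1/2) ^ fst k <= 2 * (1 - norm z)" using r by (simp_all add: rad_def)
 show zD: "z : \<DD>" using dbox_subset_disk[OF z] by simp
 show "enn2real (tail \<omega> z) <= W (fst k)" unfolding W_eq
  by (rule tail_antimono) (use zD r rad_nonneg in auto)
 have "W (fst k) <= cd * W (Suc (fst k))" by (rule W_dbl)
 also have "... <= cd * enn2real (tail \<omega> z)" unfolding W_eq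
  by (intro mult_left_mono tail_antimono) (use r rad_nonneg[of "Suc (fst k)"] rad_less_1[of "Suc (fst k)"] cd_pos in auto)
 finally show "W (fst k) <= cd * enn2real (tail \<omega> z)" .
qed

text \<open>Within a box 1 - |z| varies by a factor 2 and the tail by a factor cd. As \<gamma> <= 0,
  the power of the tail reverses inequalities between tails.\<close>

lemma bloch_limit_iff:
 assumes g: "hol g" and \<gamma>: "\<gamma> <= 0"
 shows "((%z. norm (deriv g z) * (1 - norm z) * enn2real (tail \<omega> z) powr \<gamma>) \<longlongrightarrow> 0) to_circle \<longleftrightarrow>
  (\<forall>\<eta>>0. \<exists>N. \<forall>k. node k --> N <= fst k --> dsup g k * W (fst k) powr \<gamma> <= \<eta>)" (is "?L \<longleftrightarrow> ?R")
proof -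
 have cg: "continuous_on \<DD> (deriv g)" by (intro hol_cont holomorphic_deriv g) simp
 let ?u = "%z. norm (deriv g z) * (1 - norm z) * enn2real (tail \<omega> z) powr \<gamma>"
 have u0: "0 <= ?u z" if "norm z < 1" for z using that by simp
 show ?thesis
 proof
  assume L: ?L
  show ?R
  proof (intro allI impI)
   fix \<eta> :: real assume "0 < \<eta>"
   hence "eventually (%z. ?u z < \<eta> / 2) to_circle" by (rule order_tendstoD(2)[OF L half_gt_zero])
   then obtain N where N: "\<forall>z. rad N <= norm z & norm z < 1 --> ?u z < \<eta> / 2" unfolding eventually_to_circle by blast
   show "\<exists>N. \<forall>k. node k --> N <= fst k --> dsup g k * W (fst k) powr \<gamma> <= \<eta>"
   proof (intro exI[of _ N] allI impI)
    fix k assume k: "node k" "N <= fst k"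
    define c where "c = (1/2) ^ fst k * W (fst k) powr \<gamma>"
    have c: "0 < c" using W_pos[of "fst k"] by (simp add: c_def)
    have "supb (deriv g) k <= \<eta> / c"
    proof (rule supb_le[OF k(1)])
     fix z assume z: "z : dbox k"
     note zb = dbox_weight_bounds[OF z]
     have "W (fst k) powr \<gamma> <= enn2real (tail \<omega> z) powr \<gamma>"
      using \<gamma> zb(3) tail_pos[OF zb(5)] by (intro powr_mono2') auto
     hence "c <= (2 * (1 - norm z)) * enn2real (tail \<omega> z) powr \<gamma>"
      unfolding c_def using zb(2,5) by (intro mult_mono) auto
     hence "norm (deriv g z) * c <= norm (deriv g z) * ((2 * (1 - norm z)) * enn2real (tail \<omega> z) powr \<gamma>)"
      by (rule mult_left_mono) simp
     also have "... = 2 * ?u z" by simp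
     also have "... <= \<eta>"
     proof -
      have "rad N <= norm z" using z rad_mono[OF k(2)] by (auto simp: dbox_def)
      hence "?u z < \<eta> / 2" using N zb(5) by simp
      thus ?thesis by simp
     qed
     finally show "norm (deriv g z) <= \<eta> / c" using c by (simp add: pos_le_divide_eq)
    qed
    hence "supb (deriv g) k * c <= \<eta>" using c by (simp add: pos_le_divide_eq)
    thus "dsup g k * W (fst k) powr \<gamma> <= \<eta>" by (simp add: dsup_def c_def mult_ac)
   qed
  qed
 next
  assume R: ?R
  show ?L
  proof (rule order_tendstoI)
   fix a :: real assume a: "a < 0"
   have "?u z > a" if "rad 0 <= norm z & norm z < 1" for z using u0[of z] that a by linarith
   thus "eventually (%z. a < ?u z) to_circle" unfolding eventually_to_circle by blast
  next
   fix a :: real assume a: "0 < a"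
   define \<eta> where "\<eta> = a / 2 / (1 / cd) powr \<gamma>"
   have \<eta>: "0 < \<eta>" using a cd_pos by (simp add: \<eta>_def)
   obtain N where N: "!!k. node k ==> N <= fst k ==> dsup g k * W (fst k) powr \<gamma> <= \<eta>" using R \<eta> by blast
   have "?u z < a" if z: "rad N <= norm z & norm z < 1" for z
   proof -
    obtain k where k: "node k" "z : dbox k" using ex_dbox z by blast
    note zb = dbox_weight_bounds[OF k(2)]
    have "N <= fst k"
    proof (rule ccontr)
     assume "~ N <= fst k"
     hence "rad (Suc (fst k)) <= rad N" by (intro rad_mono) simp
     thus False using k(2) z by (simp add: dbox_def)
    qed
    have "W (fst k) / cd <= enn2real (tail \<omega> z)" using zb(4) cd_pos by (simp add: pos_divide_le_eq mult.commute)
    hence "enn2real (tail \<omega> z) powr \<gamma> <= (W (fst k) * (1 / cd)) powr \<gamma>"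
     using \<gamma> W_pos[of "fst k"] cd_pos by (intro powr_mono2') auto
    hence t: "enn2real (tail \<omega> z) powr \<gamma> <= W (fst k) powr \<gamma> * (1 / cd) powr \<gamma>" unfolding powr_mult .
    have "?u z <= (supb (deriv g) k * (1/2) ^ fst k) * (W (fst k) powr \<gamma> * (1 / cd) powr \<gamma>)"
     using norm_le_supb[OF cg k(2)] zb(1) t z supb_nonneg[OF cg k(1)] by (intro mult_mono) auto
    also have "... = dsup g k * W (fst k) powr \<gamma> * (1 / cd) powr \<gamma>" by (simp add: dsup_def mult_ac)
    also have "... <= \<eta> * (1 / cd) powr \<gamma>" by (intro mult_right_mono N k \<open>N <= fst k\<close>) auto
    also have "... = a / 2" using cd_pos by (simp add: \<eta>_def)
    finally show ?thesis using a by simp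
   qed
   thus "eventually (%z. ?u z < a) to_circle" unfolding eventually_to_circle by blast
  qed
 qed
qed

text \<open>The largest value among the boxes of a level is a null sequence in the level alone, as
  \<open>vmult_le\<close> requires.\<close>

lemma vmult_of_limit:
 assumes pq: "0 < p" "p <= q" and g: "hol g"
  and R: "\<forall>\<eta>>0. \<exists>N. \<forall>k. node k --> N <= fst k --> dsup g k * W (fst k) powr (1/q - 1/p) <= \<eta>"
 shows "vmult p q (dsup g)"
proof -
 let ?v = "%k. dsup g k * W (fst k) powr (1/q - 1/p)"
 define e where "e n = Max ((%j. ?v (n, j)) ` {..<2^n})" for n
 have fin: "finite ((%j. ?v (n, j)) ` {..<2^n})" for n by simp
 have ne: "(%j. ?v (n, j)) ` {..<2^n} ~= {}" for n
 proof -
  have "0 : {..<(2::nat)^n}" by simp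
  thus ?thesis by blast
 qed
 have ve: "?v k <= e (fst k)" if "node k" for k
  unfolding e_def using that by (intro Max_ge fin) (auto simp: node_def intro!: image_eqI[of _ _ "snd k"])
 have v0: "0 <= ?v k" if "node k" for k using dsup_nonneg[OF g that] by simp
 have e0: "0 <= e n" for n using ve[of "(n, 0)"] v0[of "(n, 0)"] by (simp add: node_def)
 have "e \<longlonglongrightarrow> 0"
 proof (rule LIMSEQ_I)
  fix r :: real assume r: "0 < r"
  then obtain N where N: "!!k. node k ==> N <= fst k ==> ?v k <= r / 2" using R half_gt_zero[OF r] by blast
  have "norm (e n - 0) < r" if n: "N <= n" for n
  proof -
   have "e n : (%j. ?v (n, j)) ` {..<2^n}" unfolding e_def by (rule Max_in[OF fin ne])
   then obtain j where "j < 2 ^ n" "e n = ?v (n, j)" by auto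
   hence "e n <= r / 2" using N[of "(n, j)"] n by (simp add: node_def)
   thus ?thesis using e0[of n] r by simp
  qed
  thus "\<exists>no. \<forall>n\<ge>no. norm (e n - 0) < r" by blast
 qed
 thus ?thesis by (intro vmult_le[OF pq dsup_nonneg[OF g] ve])
qed

text \<open>The Hardy inequality asks for a zero at the origin, so g - g(0) is estimated first. The
  constant g(0) adds a multiple of W, which tends to 0.\<close>

lemma AT_zero_iff_carl_dsup:
 assumes q: "0 < q" and g: "g : \<H>\<DD>"
 shows "g : AT_zero q \<omega> \<longleftrightarrow> (\<exists>b. (\<forall>n. 0 <= b n) & b \<longlonglongrightarrow> 0 & carl (%k. dsup g k powr q) b)"
proof
 have hg: "hol g" by (rule analytic_diskD(1)[OF g])
 assume "g : AT_zero q \<omega>"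
 then obtain t where t: "0 <= t" "tbound q g t" and van: "(tmean q g \<longlongrightarrow> 0) to_circle"
  unfolding AT_zero_iff[OF q] AT_inf_iff[OF q] by blast
 show "\<exists>b. (\<forall>n. 0 <= b n) & b \<longlonglongrightarrow> 0 & carl (%k. dsup g k powr q) b"
  by (rule tmean_vanishing_to_carl[OF q hg t(1) tboundD[OF t(2)] van]) blast+
next
 have hg: "hol g" by (rule analytic_diskD(1)[OF g])
 assume "\<exists>b. (\<forall>n. 0 <= b n) & b \<longlonglongrightarrow> 0 & carl (%k. dsup g k powr q) b"
 then obtain b where b: "!!n. 0 <= b n" "b \<longlonglongrightarrow> 0" and c: "carl (%k. dsup g k powr q) b" by blast
 let ?G = "%z. g z - g 0"
 have hG: "?G holomorphic_on \<DD>" by (intro holomorphic_intros hg)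
 have cg: "continuous_on \<DD> g" and cG: "continuous_on \<DD> ?G" using hg hG hol_cont by blast+
 have dG: "dsup ?G k = dsup g k" for k
 proof -
  have "deriv ?G z = deriv g z" if "z : dbox k" for z
  proof -
   have "g field_differentiable at z" using hg dbox_subset_disk[OF that]
    by (intro holomorphic_on_imp_differentiable_at[OF hg]) auto
   thus ?thesis by (subst deriv_diff) auto
  qed
  thus ?thesis unfolding dsup_def supb_def by (intro arg_cong2[where f=times] refl SUP_cong) auto
 qed
 obtain C \<theta> where C: "0 < C" "0 < \<theta>" "\<theta> < 1" and
  h: "!!F b. [|hol F; F 0 = 0; !!n. 0 <= b n; carl (%k. dsup F k powr q) b|]
   ==> carl (%k. supb F k powr q) (%N. C * conv \<theta> b N)"
  by (rule carl_supb_of_dsup[OF q]) blast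
 have c1: "carl (%k. supb ?G k powr q) (%N. C * conv \<theta> b N)"
  by (rule h[OF hG _ b(1)]) (simp_all add: dG c)
 define m where "m = norm (g 0)"
 have c2: "carl (%_. m powr q) (%n. m powr q * (cr / (1 - \<rho>)) * W n)" by (rule carl_const) simp
 define b' where "b' n = 2 powr q * (C * conv \<theta> b n + m powr q * (cr / (1 - \<rho>)) * W n)" for n
 have c3: "carl (%k. supb g k powr q) b'"
 proof (rule carl_mono[OF carl_cmult[OF carl_add[OF c1 c2], of "2 powr q"]])
  fix k assume k: "node k"
  have "supb g k <= supb ?G k + m"
  proof (rule supb_le[OF k])
   fix z assume z: "z : dbox k"
   show "norm (g z) <= supb ?G k + m"
    using norm_triangle_sub[of "g z" "g 0"] norm_le_supb[OF cG z] by (simp add: m_def)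
  qed
  also have "... <= 2 * max (supb ?G k) m" by simp
  finally have "supb g k powr q <= (2 * max (supb ?G k) m) powr q"
   using q supb_nonneg[OF cg k] by (intro powr_mono2) auto
  also have "... = 2 powr q * max (supb ?G k) m powr q" by (rule powr_mult)
  also have "... <= 2 powr q * (supb ?G k powr q + m powr q)" by (intro mult_left_mono) (auto simp: max_def)
  finally show "supb g k powr q <= 2 powr q * (supb ?G k powr q + m powr q)" .
 qed (simp_all add: b'_def)
 have "b' \<longlonglongrightarrow> 2 powr q * (C * 0 + m powr q * (cr / (1 - \<rho>)) * 0)"
  unfolding b'_def using C b W_tendsto_0 by (intro tendsto_intros conv_tendsto_0) auto
 hence b': "b' \<longlonglongrightarrow> 0" by simp
 have "0 <= b' n" for n
  unfolding b'_def using C b \<rho> cr_ge_1 less_imp_le[OF W_pos]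
  by (intro mult_nonneg_nonneg add_nonneg_nonneg conv_nonneg divide_nonneg_nonneg) auto
 thus "g : AT_zero q \<omega>" by (rule carl_AT_zero[OF q g c3 _ b'])
qed

end

subsection \<open>Test functions\<close>

text \<open>Adding j to a set changes the sum at j by c j j, so of the two sets one gives a value of
  at least half of |c j j|, whatever the off-diagonal terms are. Averaging over all subsets yields
  one set that serves the whole weighted sum. The factor is 2^q for the halving and 2 for the
  pairing. The offset \<open>z0\<close> admits a function that is already present.\<close>

lemma exists_selector:
 fixes z0 :: "'a => complex" and c :: "'a => 'a => complex" and v :: "'a => real"
 assumes I: "finite I" and v: "!!j. j : I ==> 0 <= v j" and q: "0 < q"
 obtains A where "A <= I"
  "(\<Sum>j\<in>I. v j * norm (c j j) powr q) <= 2 powr (q + 1) * (\<Sum>j\<in>I. v j * norm (z0 j + (\<Sum>k\<in>A. c k j)) powr q)"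
proof -
 define u where "u A j = norm (z0 j + (\<Sum>k\<in>A. c k j)) powr q" for A j
 have key: "2 ^ card I * norm (c j j) powr q <= 2 powr (q + 1) * (\<Sum>A\<in>Pow I. u A j)" if j: "j : I" for j
 proof -
  define J where "J = I - {j}"
  have J: "finite J" "j ~: J" "I = insert j J" using I j by (auto simp: J_def)
  have two: "(norm (c j j) / 2) powr q <= u A j + u (insert j A) j" if A: "A : Pow J" for A
  proof -
   define x where "x = z0 j + (\<Sum>k\<in>A. c k j)"
   have "finite A" "j ~: A" using A J finite_subset by auto
   hence i: "z0 j + (\<Sum>k\<in>insert j A. c k j) = x + c j j" by (simp add: x_def)
   have "norm (c j j) / 2 <= max (norm x) (norm (x + c j j))"
    using norm_triangle_ineq4[of "x + c j j" x] by simp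
   hence "(norm (c j j) / 2) powr q <= max (norm x) (norm (x + c j j)) powr q"
    using q by (intro powr_mono2) auto
   also have "... <= norm x powr q + norm (x + c j j) powr q" by (simp add: max_def)
   finally show ?thesis unfolding u_def i by (simp add: x_def)
  qed
  have inj: "inj_on (insert j) (Pow J)" using J(2) by (auto intro!: inj_onI)
  have dis: "Pow J Int insert j ` Pow J = {}" using J(2) by blast
  have "2 ^ card J * (norm (c j j) / 2) powr q = (\<Sum>A\<in>Pow J. (norm (c j j) / 2) powr q)"
   using J(1) by (simp add: card_Pow)
  also have "... <= (\<Sum>A\<in>Pow J. u A j + u (insert j A) j)" by (intro sum_mono two)
  also have "... = (\<Sum>A\<in>Pow J. u A j) + (\<Sum>A\<in>insert j ` Pow J. u A j)"
   by (simp add: sum.distrib sum.reindex[OF inj])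
  also have "... = (\<Sum>A\<in>Pow I. u A j)"
   unfolding J(3) Pow_insert using J(1) by (intro sum.union_disjoint[symmetric] dis) auto
  finally have "2 powr (q + 1) * (2 ^ card J * (norm (c j j) / 2) powr q) <= 2 powr (q + 1) * (\<Sum>A\<in>Pow I. u A j)"
   by (intro mult_left_mono) auto
  moreover have "2 powr (q + 1) * (2 ^ card J * (norm (c j j) / 2) powr q) = 2 ^ card I * norm (c j j) powr q"
   using J by (simp add: powr_divide powr_add)
  ultimately show ?thesis by simp
 qed
 let ?S = "\<Sum>j\<in>I. v j * norm (c j j) powr q"
 have "\<exists>A\<in>Pow I. ?S <= 2 powr (q + 1) * (\<Sum>j\<in>I. v j * u A j)"
 proof (rule ccontr)
  assume "~ ?thesis"
  hence "(\<Sum>A\<in>Pow I. 2 powr (q + 1) * (\<Sum>j\<in>I. v j * u A j)) < (\<Sum>A\<in>Pow I. ?S)"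
   using I by (intro sum_strict_mono) (auto simp: not_le)
  also have "... = (\<Sum>j\<in>I. v j * (2 ^ card I * norm (c j j) powr q))"
   using I by (simp add: card_Pow sum_distrib_left mult_ac)
  also have "... <= (\<Sum>j\<in>I. v j * (2 powr (q + 1) * (\<Sum>A\<in>Pow I. u A j)))"
   by (intro sum_mono mult_left_mono key v)
  also have "... = (\<Sum>j\<in>I. \<Sum>A\<in>Pow I. 2 powr (q + 1) * (v j * u A j))"
   by (simp add: sum_distrib_left sum_distrib_right mult_ac)
  also have "... = (\<Sum>A\<in>Pow I. \<Sum>j\<in>I. 2 powr (q + 1) * (v j * u A j))" by (rule sum.swap)
  also have "... = (\<Sum>A\<in>Pow I. 2 powr (q + 1) * (\<Sum>j\<in>I. v j * u A j))" by (simp add: sum_distrib_left)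
  finally show False by simp
 qed
 thus thesis using that unfolding u_def by blast
qed

text \<open>A power of the reproducing type kernel at the corner of box j, normalised to size
  comparable to 1 on that box.\<close>

definition kern :: "nat => nat \<times> nat => complex => complex" where
 "kern m j z = ((1/2) ^ fst j / (1 - cnj (corner j) * z)) ^ m"

lemma norm_kern: "norm (kern m j z) = ((1/2) ^ fst j / norm (1 - cnj (corner j) * z)) ^ m"
 by (simp add: kern_def norm_power norm_divide)

lemma corner_denominator: "norm z < 1 ==> 1 - norm z <= norm (1 - cnj (corner j) * z)"
 by (rule norm_one_minus_ge(2)) (use rad_less_1 less_imp_le in auto)

lemma corner_denominator_pos: "norm z < 1 ==> 0 < norm (1 - cnj (corner j) * z)"
 by (rule less_le_trans[OF _ corner_denominator]) simp_all

lemma kern_holomorphic: "kern m j holomorphic_on \<DD>"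
 unfolding kern_def
proof (intro holomorphic_intros)
 fix z :: complex assume "z : \<DD>"
 hence "0 < norm (1 - cnj (corner j) * z)" by (intro corner_denominator_pos) simp
 thus "1 - cnj (corner j) * z ~= 0" by auto
qed

lemma kern_le:
 assumes j: "node j" and z: "z : dbox k"
 shows "norm (kern m j z) <= 4 ^ m * (1/2) ^ (m * (fst j - prox j k))"
proof -
 have "0 < norm (1 - cnj (corner j) * z)" by (rule corner_denominator_pos[OF dbox_subset_disk[OF z]])
 hence "(1/2) ^ fst j / norm (1 - cnj (corner j) * z) <= 4 * (1/2) ^ (fst j - prox j k)"
  using kernel_upper[OF j z] by (simp add: pos_divide_le_eq)
 hence "norm (kern m j z) <= (4 * (1/2) ^ (fst j - prox j k)) ^ m"
  unfolding norm_kern by (intro power_mono) auto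
 also have "... = 4 ^ m * (1/2) ^ (m * (fst j - prox j k))"
  by (simp only: power_mult_distrib power_mult[symmetric] mult.commute)
 finally show ?thesis .
qed

lemma kern_ge:
 assumes j: "node j" and z: "z : dbox j"
 shows "(1/10) ^ m <= norm (kern m j z)"
proof -
 have "z : tbox j" using dbox_subset_tbox[of j j] below_refl z by blast
 hence u: "norm (1 - cnj (corner j) * z) <= 10 * (1/2) ^ fst j" by (rule kernel_lower)
 have "0 < norm (1 - cnj (corner j) * z)" by (rule corner_denominator_pos[OF dbox_subset_disk[OF z]])
 hence "1/10 <= (1/2) ^ fst j / norm (1 - cnj (corner j) * z)"
  using u by (simp add: pos_le_divide_eq)
 thus ?thesis unfolding norm_kern by (intro power_mono) auto
qed

lemma kern_decay: "norm z < 1 ==> norm (kern m j z) <= (1 / (1 - norm z)) ^ m * ((1/2) ^ m) ^ fst j"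
proof -
 assume z: "norm z < 1"
 have "(1/2) ^ fst j / norm (1 - cnj (corner j) * z) <= (1/2) ^ fst j / (1 - norm z)"
  using z by (intro divide_left_mono mult_pos_pos corner_denominator corner_denominator_pos) auto
 hence "norm (kern m j z) <= ((1 / (1 - norm z)) * (1/2) ^ fst j) ^ m"
  unfolding norm_kern by (intro power_mono) auto
 also have "... = (1 / (1 - norm z)) ^ m * ((1/2) ^ m) ^ fst j"
  by (simp only: power_mult_distrib power_mult[symmetric] mult.commute)
 finally show ?thesis .
qed

definition ksum :: "nat => (nat \<times> nat => real) => (nat \<times> nat) set => complex => complex" where
 "ksum m y A z = (if z : \<DD> then (\<Sum>j\<in>A. of_real (y j) * kern m j z) else 0)"

lemma ksum_analytic: "ksum m y A : \<H>\<DD>"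
proof -
 have "hol (%z. \<Sum>j\<in>A. of_real (y j) * kern m j z)"
  by (intro holomorphic_intros kern_holomorphic)
 hence "ksum m y A holomorphic_on \<DD>" by (rule holomorphic_transform) (simp add: ksum_def)
 thus ?thesis by (auto simp: analytic_disk_def ksum_def)
qed

lemma norm_ksum_le:
 assumes "!!j. j : A ==> 0 <= y j"
 shows "norm (ksum m y A z) <= (\<Sum>j\<in>A. y j * norm (kern m j z))"
proof -
 have "norm (\<Sum>j\<in>A. of_real (y j) * kern m j z) <= (\<Sum>j\<in>A. norm (of_real (y j) * kern m j z))" by (rule norm_sum)
 also have "... = (\<Sum>j\<in>A. y j * norm (kern m j z))" using assms by (intro sum.cong) (auto simp: norm_mult)
 finally show ?thesis using assms by (auto simp: ksum_def intro!: sum_nonneg)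
qed

lemma sum_half_power_le: "M <= N ==> (\<Sum>n\<in>{M..<N}. (1/2) ^ n) <= 2 * (1/2) ^ M - 2 * (1/2 :: real) ^ N"
 by (induction N rule: dec_induct) (auto simp: sum.atLeastLessThan_Suc)

text \<open>At most 2^n nodes lie on level n, which leaves a geometric series of ratio 1/2 starting
  at M.\<close>

lemma sum_quarter_nodes_le:
 assumes I: "finite I" "!!j. j : I ==> node j" "!!j. j : I ==> M <= fst j"
 shows "(\<Sum>j\<in>I. (1/4) ^ fst j) <= 2 * (1/2 :: real) ^ M"
proof -
 obtain N where N: "!!j. j : I ==> fst j < N"
  using finite_nat_set_iff_bounded[of "fst ` I"] I(1) by auto
 define N' where "N' = max M N"
 have "(\<Sum>j\<in>I. (1/4) ^ fst j) <= (\<Sum>j\<in>(SIGMA n:{M..<N'}. {..<(2::nat)^n}). (1/4 :: real) ^ fst j)"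
 proof (rule sum_mono2)
  show "I <= (SIGMA n:{M..<N'}. {..<2^n})"
  proof
   fix j assume j: "j : I"
   have "fst j < N'" using N[OF j] unfolding N'_def by linarith
   thus "j : (SIGMA n:{M..<N'}. {..<2^n})" using I(2,3)[OF j] by (cases j) (simp add: node_def)
  qed
 qed auto
 also have "... = (\<Sum>n\<in>{M..<N'}. \<Sum>i\<in>{..<(2::nat)^n}. (1/4) ^ n)"
  by (subst sum.Sigma) (auto intro!: sum.cong)
 also have "... = (\<Sum>n\<in>{M..<N'}. (1/2) ^ n)"
  by (intro sum.cong refl) (simp add: power_mult_distrib[symmetric] power_divide[symmetric] flip: power_mult_distrib)
 also have "... <= 2 * (1/2) ^ M - 2 * (1/2 :: real) ^ N'" by (rule sum_half_power_le) (simp add: N'_def)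
 also have "... <= 2 * (1/2) ^ M" by simp
 finally show ?thesis .
qed

context tent_weight begin

definition tail_const :: "real => real" where "tail_const p = 2 * (1 / W 0) powr (1 / p)"

text \<open>Growth estimate and doubling bound y j by a multiple of cd^(n/p) on level n. The
  condition on m makes this times the decay of the kernel at most 4^(-n), so sums over deep nodes
  are locally uniformly small.\<close>

lemma kern_tail:
 assumes p: "0 < p" and m: "cd powr (1 / p) * (1/2) ^ m <= 1 / 4"
  and I: "finite I" "!!j. j : I ==> node j" "!!j. j : I ==> M <= fst j"
  and y: "!!j. j : I ==> 0 <= y j" and c: "carl (%k. if k : I then y k powr p else 0) (%_. 1)"
  and z: "norm z < 1"
 shows "(\<Sum>j\<in>I. y j * norm (kern m j z)) <= tail_const p * (1 / (1 - norm z)) ^ m * (1/2) ^ M"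
proof -
 define E where "E = cd powr (1 / p)"
 define a where "a = (1 / W 0) powr (1 / p)"
 have a: "0 <= a" by (simp add: a_def)
 have yj: "y j <= a * E ^ fst j" if j: "j : I" for j
 proof -
  have "y j powr p * W (fst j) <= 1" using carl_pointwise[OF c _ I(2)[OF j]] j by simp
  hence "y j powr p <= 1 / W (fst j)" using W_pos by (simp add: pos_le_divide_eq)
  also have "... <= cd ^ fst j * (1 / W 0)"
   using W_dbl_iter[of 0 "fst j"] W_pos[of 0] W_pos[of "fst j"] by (simp add: field_simps)
  finally have "(y j powr p) powr (1 / p) <= (cd ^ fst j * (1 / W 0)) powr (1 / p)" using p by (intro powr_mono2) auto
  hence "y j <= (cd ^ fst j) powr (1 / p) * a" using p y[OF j] unfolding powr_mult a_def[symmetric] by (simp add: powr_powr)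
  thus ?thesis unfolding power_powr_commute[OF cd_pos] E_def by (simp add: mult.commute)
 qed
 have "(\<Sum>j\<in>I. y j * norm (kern m j z)) <= (\<Sum>j\<in>I. a * (1 / (1 - norm z)) ^ m * (1/4) ^ fst j)"
 proof (rule sum_mono)
  fix j assume j: "j : I"
  have "y j * norm (kern m j z) <= (a * E ^ fst j) * ((1 / (1 - norm z)) ^ m * ((1/2) ^ m) ^ fst j)"
   using a by (intro mult_mono yj[OF j] kern_decay[OF z]) (auto simp: E_def)
  also have "... = a * (1 / (1 - norm z)) ^ m * (E * (1/2) ^ m) ^ fst j" by (simp only: power_mult_distrib mult_ac)
  also have "... <= a * (1 / (1 - norm z)) ^ m * (1/4) ^ fst j"
   using m z a unfolding E_def by (intro mult_left_mono power_mono mult_nonneg_nonneg zero_le_power) auto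
  finally show "y j * norm (kern m j z) <= a * (1 / (1 - norm z)) ^ m * (1/4) ^ fst j" .
 qed
 also have "... = a * (1 / (1 - norm z)) ^ m * (\<Sum>j\<in>I. (1/4) ^ fst j)" by (simp only: sum_distrib_left)
 also have "... <= a * (1 / (1 - norm z)) ^ m * (2 * (1/2) ^ M)"
  using z a by (intro mult_left_mono sum_quarter_nodes_le I mult_nonneg_nonneg zero_le_power) auto
 finally show ?thesis by (simp add: tail_const_def a_def mult_ac)
qed

text \<open>The power m serves two purposes, the tent norm through \<open>kernel_sum\<close> and
  local smallness through \<open>kern_tail\<close>; the larger of the two demands is taken.\<close>

lemma ksum_carl:
 assumes p: "0 < p"
 obtains m C where "0 < C" "cd powr (1 / p) * (1/2) ^ m <= 1 / 4"
  "!!I y. [|finite I; !!j. j : I ==> node j; !!j. j : I ==> 0 <= y j; carl (%k. if k : I then y k powr p else 0) (%_. 1)|]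
   ==> carl (%k. supb (ksum m y I) k powr p) (%_. C)"
proof -
 obtain \<theta> m0 where \<theta>: "0 < \<theta>" "\<theta> < 1"
  and ks: "!!m. m0 <= m ==> \<exists>C>0. \<forall>I y x b. finite I --> (\<forall>j\<in>I. node j) --> (\<forall>j\<in>I. 0 <= y j) -->
   (\<forall>k. node k --> 0 <= x k & x k <= (\<Sum>j\<in>I. y j * (1/2) ^ (m * (fst j - prox j k)))) -->
   carl (%k. if k : I then y k powr p else 0) b --> carl (%k. x k powr p) (%N. C * conv \<theta> b N)"
  by (rule kernel_sum[OF p]) blast
 have "0 < 1 / (4 * cd powr (1 / p))" using cd_pos by simp
 hence "\<exists>n. (1/2 :: real) ^ n < 1 / (4 * cd powr (1 / p))" by (rule real_arch_pow_inv) simp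
 then obtain m1 where m1: "(1/2 :: real) ^ m1 < 1 / (4 * cd powr (1 / p))" by (elim exE)
 define m where "m = max m0 m1"
 have "(1/2 :: real) ^ m <= (1/2) ^ m1" by (intro power_decreasing) (auto simp: m_def)
 hence "(1/2 :: real) ^ m <= 1 / (4 * cd powr (1 / p))" using m1 by linarith
 hence "cd powr (1 / p) * (1/2) ^ m <= cd powr (1 / p) * (1 / (4 * cd powr (1 / p)))" by (rule mult_left_mono) simp
 hence mm: "cd powr (1 / p) * (1/2) ^ m <= 1 / 4" using cd_pos by simp
 have "m0 <= m" by (simp add: m_def)
 from ks[OF this] obtain C where C: "0 < C" and ksC: "\<forall>I y x b. finite I --> (\<forall>j\<in>I. node j) --> (\<forall>j\<in>I. 0 <= y j) -->
   (\<forall>k. node k --> 0 <= x k & x k <= (\<Sum>j\<in>I. y j * (1/2) ^ (m * (fst j - prox j k)))) -->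
   carl (%k. if k : I then y k powr p else 0) b --> carl (%k. x k powr p) (%N. C * conv \<theta> b N)" by (elim exE conjE)
 show thesis
 proof (rule that[OF _ mm])
  show "0 < (4 ^ m) powr p * (C * (1 / (1 - \<theta>)))" using C \<theta> by simp
  fix I :: "(nat \<times> nat) set" and y
  assume I: "finite I" "!!j. j : I ==> node j" and y: "!!j. j : I ==> 0 <= y j"
   and c: "carl (%k. if k : I then y k powr p else 0) (%_. 1)"
  define x where "x k = supb (ksum m y I) k / 4 ^ m" for k
  have hc: "continuous_on \<DD> (ksum m y I)" by (intro hol_cont analytic_diskD(1) ksum_analytic)
  have xk: "0 <= x k & x k <= (\<Sum>j\<in>I. y j * (1/2) ^ (m * (fst j - prox j k)))" if k: "node k" for k
  proof
   show "0 <= x k" using supb_nonneg[OF hc k] by (simp add: x_def)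
   have "supb (ksum m y I) k <= 4 ^ m * (\<Sum>j\<in>I. y j * (1/2) ^ (m * (fst j - prox j k)))"
   proof (rule supb_le[OF k])
    fix z assume z: "z : dbox k"
    have "norm (ksum m y I z) <= (\<Sum>j\<in>I. y j * norm (kern m j z))" by (rule norm_ksum_le[OF y])
    also have "... <= (\<Sum>j\<in>I. y j * (4 ^ m * (1/2) ^ (m * (fst j - prox j k))))"
     by (intro sum_mono mult_left_mono kern_le I(2) z y)
    also have "... = 4 ^ m * (\<Sum>j\<in>I. y j * (1/2) ^ (m * (fst j - prox j k)))" by (simp only: sum_distrib_left mult_ac)
    finally show "norm (ksum m y I z) <= 4 ^ m * (\<Sum>j\<in>I. y j * (1/2) ^ (m * (fst j - prox j k)))" .
   qed
   thus "x k <= (\<Sum>j\<in>I. y j * (1/2) ^ (m * (fst j - prox j k)))" by (simp add: x_def pos_divide_le_eq mult.commute)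
  qed
  have "carl (%k. x k powr p) (%N. C * conv \<theta> (%_. 1) N)"
   using ksC[THEN spec, THEN spec, THEN spec, THEN spec, of I y x "%_. 1"] I y xk c by blast
  from carl_cmult[OF this, of "(4 ^ m) powr p"]
  have "carl (%k. (4 ^ m) powr p * x k powr p) (%N. (4 ^ m) powr p * (C * conv \<theta> (%_. 1) N))" by simp
  thus "carl (%k. supb (ksum m y I) k powr p) (%_. (4 ^ m) powr p * (C * (1 / (1 - \<theta>))))"
  proof (rule carl_mono)
   show "supb (ksum m y I) k powr p <= (4 ^ m) powr p * x k powr p" for k
    unfolding powr_mult[symmetric] by (simp add: x_def)
   show "(4 ^ m) powr p * (C * conv \<theta> (%_. 1) n) <= (4 ^ m) powr p * (C * (1 / (1 - \<theta>)))" for n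
    using C conv_bound[of \<theta> "%_. 1" 1 n] \<theta> by (intro mult_left_mono) auto
  qed
 qed
qed

text \<open>A kernel sum is bounded on the disk, and bounded functions have means of order W, which
  tends to 0.\<close>

lemma ksum_AT_zero:
 assumes p: "0 < p" and I: "!!j. j : I ==> node j" and y: "!!j. j : I ==> 0 <= y j"
 shows "ksum m y I : AT_zero p \<omega>"
proof -
 define B where "B = (\<Sum>j\<in>I. y j * 4 ^ m)"
 have B: "0 <= B" using y by (auto simp: B_def intro!: sum_nonneg)
 have hc: "continuous_on \<DD> (ksum m y I)" by (intro hol_cont analytic_diskD(1) ksum_analytic)
 have b: "norm (ksum m y I z) <= B" if z: "z : \<DD>" for z
 proof -
  have "norm z < 1" using z by simp
  then obtain k where k: "z : dbox k" using ex_dbox by blast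
  have "norm (ksum m y I z) <= (\<Sum>j\<in>I. y j * norm (kern m j z))" by (rule norm_ksum_le[OF y])
  also have "... <= B"
   unfolding B_def
  proof (intro sum_mono mult_left_mono y)
   fix j assume j: "j : I"
   have "norm (kern m j z) <= 4 ^ m * (1/2) ^ (m * (fst j - prox j k))" by (rule kern_le[OF I[OF j] k])
   also have "... <= 4 ^ m * 1" by (intro mult_left_mono power_le_one) auto
   finally show "norm (kern m j z) <= 4 ^ m" by simp
  qed
  finally show ?thesis .
 qed
 show ?thesis
 proof (rule carl_AT_zero[OF p ksum_analytic carl_bounded_function[OF p B hc b]])
  show "0 <= B powr p * (cr / (1 - \<rho>)) * W n" for n
   using \<rho> cr_ge_1 less_imp_le[OF W_pos] by (intro mult_nonneg_nonneg divide_nonneg_nonneg) auto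
  show "(%n. B powr p * (cr / (1 - \<rho>)) * W n) \<longlonglongrightarrow> 0" by (intro tendsto_mult_right_zero W_tendsto_0)
 qed
qed

text \<open>\<open>exists_selector\<close> with the weights w d^q on the nodes below
  \<open>K\<close>, evaluated at the sample points. By \<open>kern_ge\<close> the diagonal term is
  at least 10^(-m) y, whence 10^(m q). \<open>B\<close> carries what has already been chosen in the
  gliding hump.\<close>

lemma select_cmean:
 assumes q: "0 < q" and I: "finite I" "!!j. j : I ==> node j" and y: "!!j. j : I ==> 0 <= y j"
  and d: "!!k. node k ==> 0 <= d k" and \<zeta>: "!!k. node k ==> \<zeta> k : dbox k"
 obtains A where "A <= I"
  "cmean (%k. if k : I then (y k * d k) powr q else 0) H K
   <= 10 powr (m * q) * 2 powr (q + 1) * cmean (%k. (norm (B (\<zeta> k) + ksum m y A (\<zeta> k)) * d k) powr q) H K"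
proof -
 let ?R = "{k. k : boxes H & below k K}"
 have w0: "0 <= w k" for k using w_pos[of k] by simp
 have fR: "finite ?R" by (rule finite_subset[OF _ finite_boxes[of H]]) blast
 define v where "v j = (if j : ?R then w j * d j powr q else 0)" for j
 obtain A where A: "A <= I" and
  s: "(\<Sum>j\<in>I. v j * norm (of_real (y j) * kern m j (\<zeta> j)) powr q) <= 2 powr (q + 1) *
   (\<Sum>j\<in>I. v j * norm (B (\<zeta> j) + (\<Sum>k\<in>A. of_real (y k) * kern m k (\<zeta> j))) powr q)"
  by (rule exists_selector[of I v q "%k j. of_real (y k) * kern m k (\<zeta> j)" "%j. B (\<zeta> j)", OF I(1) _ q])
   (use w0 in \<open>auto simp: v_def\<close>)
 let ?u = "%k. (norm (B (\<zeta> k) + ksum m y A (\<zeta> k)) * d k) powr q"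
 have L: "(\<Sum>k\<in>?R. (if k : I then (y k * d k) powr q else 0) * w k) <= 10 powr (m * q) * (\<Sum>j\<in>I. v j * norm (of_real (y j) * kern m j (\<zeta> j)) powr q)"
 proof -
  have "(\<Sum>k\<in>?R. (if k : I then (y k * d k) powr q else 0) * w k) = (\<Sum>k\<in>?R Int I. (y k * d k) powr q * w k)"
   by (subst sum.inter_restrict[OF fR]) (auto intro!: sum.cong)
  also have "... = (\<Sum>k\<in>I Int ?R. (y k * d k) powr q * w k)" by (simp only: Int_commute)
  also have "... = (\<Sum>k\<in>I. if k : ?R then (y k * d k) powr q * w k else 0)" by (rule sum.inter_restrict[OF I(1)])
  also have "... <= (\<Sum>j\<in>I. 10 powr (m * q) * (v j * norm (of_real (y j) * kern m j (\<zeta> j)) powr q))"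
  proof (rule sum_mono)
   fix j assume j: "j : I"
   have "y j * (1/10) ^ m <= norm (of_real (y j) * kern m j (\<zeta> j))"
    using kern_ge[OF I(2)[OF j] \<zeta>[OF I(2)[OF j]], of m] y[OF j] by (simp add: norm_mult mult_left_mono)
   hence "y j <= 10 ^ m * norm (of_real (y j) * kern m j (\<zeta> j))" by (simp add: power_divide pos_divide_le_eq mult.commute)
   hence "y j powr q <= (10 ^ m * norm (of_real (y j) * kern m j (\<zeta> j))) powr q" using q y[OF j] by (intro powr_mono2) auto
   also have "... = 10 powr (m * q) * norm (of_real (y j) * kern m j (\<zeta> j)) powr q"
    unfolding powr_mult by (simp add: powr_powr flip: powr_realpow)
   finally have "y j powr q * (d j powr q * w j) <= 10 powr (m * q) * norm (of_real (y j) * kern m j (\<zeta> j)) powr q * (d j powr q * w j)"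
    using w0 by (intro mult_right_mono) auto
   hence "(y j * d j) powr q * w j <= 10 powr (m * q) * ((w j * d j powr q) * norm (of_real (y j) * kern m j (\<zeta> j)) powr q)"
    unfolding powr_mult[of "y j"] by (simp only: mult_ac)
   thus "(if j : ?R then (y j * d j) powr q * w j else 0) <= 10 powr (m * q) * (v j * norm (of_real (y j) * kern m j (\<zeta> j)) powr q)"
    by (cases "j : ?R") (simp_all only: v_def if_True if_False mult_zero_left mult_zero_right order_refl)
  qed
  finally show ?thesis by (simp only: sum_distrib_left)
 qed
 have R: "(\<Sum>j\<in>I. v j * norm (B (\<zeta> j) + (\<Sum>k\<in>A. of_real (y k) * kern m k (\<zeta> j))) powr q) <= (\<Sum>k\<in>?R. ?u k * w k)"
 proof -
  have "(\<Sum>j\<in>I. v j * norm (B (\<zeta> j) + (\<Sum>k\<in>A. of_real (y k) * kern m k (\<zeta> j))) powr q) = (\<Sum>j\<in>I. if j : ?R then ?u j * w j else 0)"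
  proof (rule sum.cong[OF refl])
   fix j assume j: "j : I"
   have "ksum m y A (\<zeta> j) = (\<Sum>k\<in>A. of_real (y k) * kern m k (\<zeta> j))"
    using dbox_subset_disk[OF \<zeta>[OF I(2)[OF j]]] by (simp add: ksum_def)
   thus "v j * norm (B (\<zeta> j) + (\<Sum>k\<in>A. of_real (y k) * kern m k (\<zeta> j))) powr q = (if j : ?R then ?u j * w j else 0)"
    by (simp add: v_def powr_mult mult_ac)
  qed
  also have "... = (\<Sum>j\<in>I Int ?R. ?u j * w j)" by (rule sum.inter_restrict[OF I(1), symmetric])
  also have "... <= (\<Sum>k\<in>?R. ?u k * w k)" using fR w0 by (intro sum_mono2) auto
  finally show ?thesis .
 qed
 have "(\<Sum>k\<in>?R. (if k : I then (y k * d k) powr q else 0) * w k) <= 10 powr (m * q) * (2 powr (q + 1) * (\<Sum>k\<in>?R. ?u k * w k))"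
  using L order_trans[OF s mult_left_mono[OF R]] by (smt (verit) mult_left_mono powr_ge_zero)
 hence "2 ^ fst K * (\<Sum>k\<in>?R. (if k : I then (y k * d k) powr q else 0) * w k) <= 2 ^ fst K * (10 powr (m * q) * (2 powr (q + 1) * (\<Sum>k\<in>?R. ?u k * w k)))"
  by (intro mult_left_mono) auto
 thus thesis using that[OF A] by (simp only: cmean_def mult_ac)
qed

text \<open>Where |g'| is at least half its maximum over the box, f is controlled by the derivative
  f g' of the image. This is the converse of \<open>dsup_volterra_le\<close>, at selected
  points.\<close>

lemma dsup_volterra_ge:
 assumes f: "hol f" and g: "hol g" and z: "z : dbox k" "supb (deriv g) k <= 2 * norm (deriv g z)"
 shows "norm (f z) * dsup g k <= 2 * dsup (volterra g f) k"
proof -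
 have cJ: "continuous_on \<DD> (deriv (volterra g f))"
  by (intro hol_cont holomorphic_deriv volterra_holomorphic f g) simp
 have "norm (f z) * supb (deriv g) k <= norm (f z) * (2 * norm (deriv g z))" by (intro mult_left_mono z) simp
 also have "... = 2 * norm (deriv (volterra g f) z)"
  using volterra_holomorphic(3)[OF f g, of z] dbox_subset_disk[OF z(1)] by (simp add: norm_mult)
 also have "... <= 2 * supb (deriv (volterra g f)) k" using norm_le_supb[OF cJ z(1)] by simp
 finally have "(1/2) ^ fst k * (norm (f z) * supb (deriv g) k) <= (1/2) ^ fst k * (2 * supb (deriv (volterra g f)) k)"
  by (intro mult_left_mono) auto
 thus ?thesis by (simp add: dsup_def mult_ac)
qed

lemma carl_volterra_samples:
 assumes q: "0 < q" and f: "hol f" and g: "hol g"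
  and \<zeta>: "!!k. node k ==> \<zeta> k : dbox k & supb (deriv g) k <= 2 * norm (deriv g (\<zeta> k))"
  and c: "carl (%k. dsup (volterra g f) k powr q) b"
 shows "carl (%k. (norm (f (\<zeta> k)) * dsup g k) powr q) (%n. 2 powr q * b n)"
proof (rule carl_mono[OF carl_cmult[OF c, of "2 powr q"]])
 fix k assume k: "node k"
 have "(norm (f (\<zeta> k)) * dsup g k) powr q <= (2 * dsup (volterra g f) k) powr q"
  using q \<zeta>[OF k] dsup_volterra_ge[OF f g] dsup_nonneg[OF g k] by (intro powr_mono2) auto
 thus "(norm (f (\<zeta> k)) * dsup g k) powr q <= 2 powr q * dsup (volterra g f) k powr q" unfolding powr_mult .
qed simp_all

lemma ex_sample_points:
 assumes g: "hol g"
 obtains \<zeta> where "!!k. node k ==> \<zeta> k : dbox k & supb (deriv g) k <= 2 * norm (deriv g (\<zeta> k))"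
proof -
 have cg: "continuous_on \<DD> (deriv g)" by (intro hol_cont holomorphic_deriv g) simp
 have "\<exists>z. node k --> z : dbox k & supb (deriv g) k <= 2 * norm (deriv g z)" for k
 proof (cases "node k")
  case True
  show ?thesis by (rule supb_attained_half[OF cg True]) blast
 qed simp
 then obtain \<zeta> where "\<forall>k. node k --> \<zeta> k : dbox k & supb (deriv g) k <= 2 * norm (deriv g (\<zeta> k))" by metis
 thus thesis using that by blast
qed

end

section \<open>Necessary conditions from test functions\<close>

context tent_weight begin

text \<open>The coefficients of a normalised test function; the least level \<open>N\<close> governs
  how small its kernel sum is on compact sets.\<close>

definition admissible :: "real => nat => (nat \<times> nat) set => (nat \<times> nat => real) => bool" where
 "admissible p N I y \<longleftrightarrow> finite I & (\<forall>j\<in>I. node j & N <= fst j & 0 <= y j) &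
   carl (%k. if k : I then y k powr p else 0) (%_. 1)"

text \<open>What the operator leaves behind on the tree: a multiplier inequality for coefficients
  from level N on. For a compact operator any c > 0 is reached by taking N large.\<close>

definition test_bound :: "real => real => (nat \<times> nat => real) => nat => real => bool" where
 "test_bound p q d N c \<longleftrightarrow> (\<forall>I y H K. admissible p N I y --> node K -->
   cmean (%k. if k : I then (y k * d k) powr q else 0) H K <= c)"

lemma admissible_subset:
 assumes "admissible p N I y" "A <= I"
 shows "admissible p N A y"
proof -
 have "carl (%k. if k : I then y k powr p else 0) (%_. 1)" using assms(1) by (simp add: admissible_def)
 hence "carl (%k. if k : A then y k powr p else 0) (%_. 1)" by (rule carl_mono) (use assms(2) in auto)
 thus ?thesis using assms finite_subset unfolding admissible_def by blast
qed

lemma admissibleD: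
 assumes "admissible p N I y"
 shows "finite I" "j : I ==> node j" "j : I ==> N <= fst j" "j : I ==> 0 <= y j"
  "carl (%k. if k : I then y k powr p else 0) (%_. 1)"
 using assms unfolding admissible_def by blast+

text \<open>The constants are independent of N, I and y. The subset \<open>A\<close> may depend on
  the box and the cutoff, but it is admissible for the same N, so its kernel sum has all the listed
  properties too.\<close>

lemma test_functions:
 assumes p: "0 < p" and q: "0 < q" and g: "hol g"
 obtains m C D where "0 < C" "0 < D"
  "!!N I y z. admissible p N I y ==> norm z < 1 ==> norm (ksum m y I z) <= tail_const p * (1 / (1 - norm z)) ^ m * (1/2) ^ N"
  "!!N I y. admissible p N I y ==> ksum m y I : AT_zero p \<omega> & tbound p (ksum m y I) C"
  "!!N I y H K. admissible p N I y ==> node K ==> \<exists>A. admissible p N A y &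
   (\<forall>T\<ge>0. tbound q (volterra g (ksum m y A)) T --> cmean (%k. if k : I then (y k * dsup g k) powr q else 0) H K <= D * T)"
proof -
 obtain m C where C: "0 < C" and m: "cd powr (1 / p) * (1/2) ^ m <= 1 / 4" and
  kc: "!!I y. [|finite I; !!j. j : I ==> node j; !!j. j : I ==> 0 <= y j; carl (%k. if k : I then y k powr p else 0) (%_. 1)|]
   ==> carl (%k. supb (ksum m y I) k powr p) (%_. C)"
  by (rule ksum_carl[OF p]) blast
 obtain Cq where Cq: "0 < Cq" and cq: "!!F t. hol F ==> 0 <= t ==> tbound q F t ==>
  carl (%k. supb F k powr q) (%_. Cq * t) & carl (%k. dsup F k powr q) (%_. Cq * t)"
  by (rule tbound_to_carl[OF q]) blast
 obtain \<zeta> where \<zeta>: "!!k. node k ==> \<zeta> k : dbox k & supb (deriv g) k <= 2 * norm (deriv g (\<zeta> k))"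
  by (rule ex_sample_points[OF g]) blast
 have hk: "ksum m y I holomorphic_on \<DD>" for y I by (rule analytic_diskD(1)[OF ksum_analytic])
 define D0 where "D0 = 10 powr (m * q) * 2 powr (q + 1)"
 define D where "D = D0 * (2 powr q * Cq)"
 have D: "0 < D" using Cq by (simp add: D_def D0_def)
 show thesis
 proof (rule that[OF _ D])
  show "0 < 4 * ca * C" using C ca_pos by simp
  fix N I y assume a: "admissible p N I y"
  note ad = admissibleD[OF a]
  show "norm (ksum m y I z) <= tail_const p * (1 / (1 - norm z)) ^ m * (1/2) ^ N" if z: "norm z < 1" for z
   by (rule order_trans[OF norm_ksum_le[OF ad(4)] kern_tail[OF p m ad z]])
  have ck: "carl (%k. supb (ksum m y I) k powr p) (%_. C)" by (rule kc[OF ad(1,2,4,5)])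
  have "ksum m y I : AT_zero p \<omega>" by (rule ksum_AT_zero[OF p ad(2,4)])
  moreover have "tbound p (ksum m y I) (4 * ca * C)"
   unfolding tbound_def using carl_to_tmean_bounded[OF p hk ck] C by simp
  ultimately show "ksum m y I : AT_zero p \<omega> & tbound p (ksum m y I) (4 * ca * C)" by blast
  fix H K assume K: "node K"
  obtain A where A: "A <= I" and s: "cmean (%k. if k : I then (y k * dsup g k) powr q else 0) H K
   <= D0 * cmean (%k. (norm (0 + ksum m y A (\<zeta> k)) * dsup g k) powr q) H K"
   unfolding D0_def by (rule select_cmean[OF q ad(1,2,4) dsup_nonneg[OF g] \<zeta>[THEN conjunct1], where B="%_. 0" and m=m and H=H and K=K])
  show "\<exists>A. admissible p N A y & (\<forall>T\<ge>0. tbound q (volterra g (ksum m y A)) T -->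
   cmean (%k. if k : I then (y k * dsup g k) powr q else 0) H K <= D * T)"
  proof (intro exI[of _ A] conjI allI impI)
   show "admissible p N A y" by (rule admissible_subset[OF a A])
   fix T assume T: "0 <= T" "tbound q (volterra g (ksum m y A)) T"
   have "carl (%k. dsup (volterra g (ksum m y A)) k powr q) (%_. Cq * T)"
    using cq[OF volterra_holomorphic(1)[OF hk g] T] by blast
   from carlD[OF carl_volterra_samples[OF q hk g \<zeta> this] K, of H]
   have "cmean (%k. (norm (0 + ksum m y A (\<zeta> k)) * dsup g k) powr q) H K <= 2 powr q * (Cq * T)" by simp
   hence "D0 * cmean (%k. (norm (0 + ksum m y A (\<zeta> k)) * dsup g k) powr q) H K <= D0 * (2 powr q * (Cq * T))"
    by (intro mult_left_mono) (auto simp: D0_def)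
   thus "cmean (%k. if k : I then (y k * dsup g k) powr q else 0) H K <= D * T" using s by (simp add: D_def mult.assoc)
  qed
 qed
qed

text \<open>If no N worked, there would be for every N a kernel sum from level N on, bounded in the
  domain, whose image fails the bound c / D. These functions tend to 0 locally uniformly, so a limit
  of their images can only be 0, and convergence to 0 contradicts the failure.\<close>

lemma compact_test_bound:
 assumes p: "0 < p" and q: "0 < q" and g: "hol g"
  and co: "compact_op X (tent_norm p \<omega>) Y (tent_norm q \<omega>) (volterra g)"
  and X: "AT_zero p \<omega> <= X" "X <= AT_inf p \<omega>" and Y: "Y <= AT_inf q \<omega>" and c: "0 < c"
 shows "\<exists>N. test_bound p q (dsup g) N c"
proof (rule ccontr)
 assume neg: "\<nexists>N. test_bound p q (dsup g) N c"
 obtain m C D where C: "0 < C" and D: "0 < D"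
  and small: "!!N I y z. admissible p N I y ==> norm z < 1 ==> norm (ksum m y I z) <= tail_const p * (1 / (1 - norm z)) ^ m * (1/2) ^ N"
  and bd: "!!N I y. admissible p N I y ==> ksum m y I : AT_zero p \<omega> & tbound p (ksum m y I) C"
  and low: "!!N I y H K. admissible p N I y ==> node K ==> \<exists>A. admissible p N A y &
   (\<forall>T\<ge>0. tbound q (volterra g (ksum m y A)) T --> cmean (%k. if k : I then (y k * dsup g k) powr q else 0) H K <= D * T)"
  by (rule test_functions[OF p q g]) blast
 have "\<exists>F. F : AT_zero p \<omega> & tbound p F C & (\<forall>z. norm z < 1 --> norm (F z) <= tail_const p * (1 / (1 - norm z)) ^ m * (1/2) ^ N)
   & ~ tbound q (volterra g F) (c / D)" for N
 proof -
  obtain I y H K where a: "admissible p N I y" "node K" and l: "~ cmean (%k. if k : I then (y k * dsup g k) powr q else 0) H K <= c"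
   using neg unfolding test_bound_def by blast
  obtain A where A: "admissible p N A y" and T: "\<forall>T\<ge>0. tbound q (volterra g (ksum m y A)) T -->
    cmean (%k. if k : I then (y k * dsup g k) powr q else 0) H K <= D * T" using low[OF a, of H] by blast
  have "~ tbound q (volterra g (ksum m y A)) (c / D)"
  proof
   assume "tbound q (volterra g (ksum m y A)) (c / D)"
   hence "cmean (%k. if k : I then (y k * dsup g k) powr q else 0) H K <= D * (c / D)" using T[THEN spec, of "c / D"] c D by simp
   thus False using l D by simp
  qed
  thus ?thesis using bd[OF A] small[OF A] by (intro exI[of _ "ksum m y A"]) blast
 qed
 then obtain F where F: "!!N. F N : AT_zero p \<omega>" "!!N. tbound p (F N) C"
  and Fs: "!!N z. norm z < 1 ==> norm (F N z) <= tail_const p * (1 / (1 - norm z)) ^ m * (1/2) ^ N"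
  and Fn: "!!N. ~ tbound q (volterra g (F N)) (c / D)" by metis
 have FH: "F N : \<H>\<DD>" for N using F(1)[of N] by (simp add: AT_zero_def)
 have hF: "F N holomorphic_on \<DD>" for N by (rule analytic_diskD(1)[OF FH])
 have XH: "X <= \<H>\<DD>" using X(2) by (auto simp: AT_inf_def)
 have FX: "\<forall>i. F i : X & tbound p (F i) C" using F X(1) by blast
 from co[unfolded compact_op_tent_iff[OF p q XH Y], THEN conjunct2, THEN spec, THEN spec, THEN mp, OF FX]
 obtain h r where h: "h : Y" and r: "strict_mono (r :: nat => nat)"
  and lim: "\<forall>\<eta>>0. eventually (%i. tbound q (%z. volterra g (F (r i)) z - h z) \<eta>) sequentially" by (elim exE conjE)
 have hH: "h : \<H>\<DD>" using h Y by (auto simp: AT_inf_def)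
 have hh: "hol h" by (rule analytic_diskD(1)[OF hH])
 have cF: "continuous_on \<DD> (F N)" for N by (rule hol_cont[OF hF])
 have half: "(%N. (1/2 :: real) ^ N) \<longlonglongrightarrow> 0" by (rule LIMSEQ_power_zero) simp
 have supF: "(%N. supb (F N) k) \<longlonglongrightarrow> 0" if k: "node k" for k
 proof (rule tendsto_sandwich[of "%_. 0" _ _ "%N. tail_const p * (2 ^ Suc (fst k)) ^ m * (1/2) ^ N"])
  have "supb (F N) k <= tail_const p * (2 ^ Suc (fst k)) ^ m * (1/2) ^ N" for N
  proof (rule supb_le[OF k])
   fix z assume z: "z : dbox k"
   have z1: "norm z < 1" by (rule dbox_subset_disk[OF z])
   have "(1/2) ^ Suc (fst k) <= 1 - norm z" using z by (auto simp: dbox_def rad_def)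
   hence "1 / (1 - norm z) <= 2 ^ Suc (fst k)" using z1 by (simp add: power_divide field_simps)
   hence "tail_const p * (1 / (1 - norm z)) ^ m * (1/2) ^ N <= tail_const p * (2 ^ Suc (fst k)) ^ m * (1/2) ^ N"
    using z1 by (intro mult_right_mono mult_left_mono power_mono) (auto simp: tail_const_def)
   thus "norm (F N z) <= tail_const p * (2 ^ Suc (fst k)) ^ m * (1/2) ^ N" using Fs[OF z1, of N] by linarith
  qed
  thus "\<forall>\<^sub>F N in sequentially. supb (F N) k <= tail_const p * (2 ^ Suc (fst k)) ^ m * (1/2) ^ N" by simp
  show "\<forall>\<^sub>F N in sequentially. 0 <= supb (F N) k" using supb_nonneg[OF cF k] by simp
  show "(%N. tail_const p * (2 ^ Suc (fst k)) ^ m * (1/2) ^ N) \<longlonglongrightarrow> 0" by (rule tendsto_mult_right_zero[OF half])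
 qed simp
 have hJ: "volterra g (F N) holomorphic_on \<DD>" for N by (rule volterra_holomorphic(1)[OF hF g])
 have cJ: "continuous_on \<DD> (volterra g (F N))" for N by (rule hol_cont[OF hJ])
 have supJ: "(%N. supb (volterra g (F N)) k) \<longlonglongrightarrow> 0" if k: "node k" for k
 proof (rule tendsto_sandwich[of "%_. 0" _ _ "%N. \<Sum>l\<le>fst k. supb (F N) (anc l k) * dsup g (anc l k)"])
  have an: "node (anc l k)" if "l <= fst k" for l using node_anc k that by blast
  have "supb (volterra g (F N)) k <= (\<Sum>l\<le>fst k. supb (F N) (anc l k) * dsup g (anc l k))" for N
  proof -
   have "supb (volterra g (F N)) k <= (\<Sum>l\<le>fst k. dsup (volterra g (F N)) (anc l k))"
    by (rule supb_le_sum_dsup[OF hJ volterra_holomorphic(2)[OF hF g] k])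
   also have "... <= (\<Sum>l\<le>fst k. supb (F N) (anc l k) * dsup g (anc l k))"
    using an by (intro sum_mono dsup_volterra_le hF g) auto
   finally show ?thesis .
  qed
  thus "\<forall>\<^sub>F N in sequentially. supb (volterra g (F N)) k <= (\<Sum>l\<le>fst k. supb (F N) (anc l k) * dsup g (anc l k))" by simp
  show "\<forall>\<^sub>F N in sequentially. 0 <= supb (volterra g (F N)) k" using supb_nonneg[OF cJ k] by simp
  show "(%N. \<Sum>l\<le>fst k. supb (F N) (anc l k) * dsup g (anc l k)) \<longlonglongrightarrow> 0"
   using an by (intro tendsto_null_sum tendsto_mult_left_zero supF) auto
 qed simp
 obtain Cq where Cq: "0 < Cq" and pw: "!!F t k. hol F ==> 0 <= t ==> tbound q F t ==> node k ==> supb F k powr q * W (fst k) <= Cq * t"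
  by (rule tbound_pointwise[OF q]) blast
 \<comment> \<open>Convergence in the tent space implies convergence at each point by the growth
   estimate, while the images tend to 0 on each box.\<close>
 have h0: "h z = 0" if z: "norm z < 1" for z
 proof (rule ccontr)
  assume "h z ~= 0"
  define \<delta> where "\<delta> = norm (h z) / 2"
  have \<delta>: "0 < \<delta>" using \<open>h z ~= 0\<close> by (simp add: \<delta>_def)
  obtain k where k: "node k" "z : dbox k" using ex_dbox[OF z] by blast
  define \<eta> where "\<eta> = \<delta> powr q * W (fst k) / (2 * Cq)"
  have \<eta>: "0 < \<eta>" using \<delta> W_pos Cq by (simp add: \<eta>_def)
  have "(%i. supb (volterra g (F (r i))) k) \<longlonglongrightarrow> 0"
   using LIMSEQ_subseq_LIMSEQ[OF supJ[OF k(1)] r] by (simp add: o_def)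
  hence "eventually (%i. supb (volterra g (F (r i))) k < \<delta>) sequentially" using order_tendstoD(2) \<delta> by blast
  with lim[THEN spec, THEN mp, OF \<eta>]
  have "eventually (%i. tbound q (%z. volterra g (F (r i)) z - h z) \<eta> & supb (volterra g (F (r i))) k < \<delta>) sequentially"
   by (rule eventually_conj)
  then obtain i where i: "tbound q (%z. volterra g (F (r i)) z - h z) \<eta>" "supb (volterra g (F (r i))) k < \<delta>"
   unfolding eventually_sequentially by blast
  have hd: "hol (%z. volterra g (F (r i)) z - h z)" by (intro holomorphic_on_diff hJ hh)
  let ?s = "supb (%z. volterra g (F (r i)) z - h z) k"
  have "?s powr q * W (fst k) <= Cq * \<eta>" by (rule pw[OF hd less_imp_le[OF \<eta>] i(1) k(1)])
  also have "... < \<delta> powr q * W (fst k)" using Cq \<delta> W_pos by (simp add: \<eta>_def)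
  finally have "?s powr q < \<delta> powr q" using W_pos[of "fst k"] by simp
  hence "?s < \<delta>" using \<delta> q by (metis not_le powr_mono2 less_imp_le)
  moreover have "norm (volterra g (F (r i)) z - h z) <= ?s" by (rule norm_le_supb[OF hol_cont[OF hd] k(2)])
  moreover have "norm (volterra g (F (r i)) z) <= supb (volterra g (F (r i))) k" by (rule norm_le_supb[OF cJ k(2)])
  moreover have "norm (h z) <= norm (volterra g (F (r i)) z) + norm (volterra g (F (r i)) z - h z)"
   using norm_triangle_sub[of "h z" "volterra g (F (r i)) z"] by (simp add: norm_minus_commute)
  ultimately show False using i(2) by (simp add: \<delta>_def)
 qed
 hence "h = (%_. 0)" using analytic_diskD(2)[OF hH] by (intro ext) (metis mem_ball_0)
 hence "eventually (%i. tbound q (volterra g (F (r i))) (c / D)) sequentially"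
  using lim c D by simp
 thus False using Fn unfolding eventually_sequentially by blast
qed

lemma bounded_test_bound:
 assumes p: "0 < p" and q: "0 < q" and g: "hol g"
  and bo: "bounded_op (AT_inf p \<omega>) (tent_norm p \<omega>) (AT_zero q \<omega>) (tent_norm q \<omega>) (volterra g)"
 shows "\<exists>c>0. test_bound p q (dsup g) 0 c"
proof -
 obtain m C D where C: "0 < C" and D: "0 < D"
  and bd: "!!N I y. admissible p N I y ==> ksum m y I : AT_zero p \<omega> & tbound p (ksum m y I) C"
  and low: "!!N I y H K. admissible p N I y ==> node K ==> \<exists>A. admissible p N A y &
   (\<forall>T\<ge>0. tbound q (volterra g (ksum m y A)) T --> cmean (%k. if k : I then (y k * dsup g k) powr q else 0) H K <= D * T)"
  by (rule test_functions[OF p q g]) blast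
 obtain C0 :: real where C0: "!!f. f : AT_inf p \<omega> ==> tent_norm q \<omega> (volterra g f) <= ennreal C0 * tent_norm p \<omega> f"
  using bo unfolding bounded_op_def by blast
 define t where "t = max 0 C0 * C powr (1 / p)"
 have t: "0 <= t" by (simp add: t_def)
 \<comment> \<open>The added 1 only makes the bound positive.\<close>
 have "cmean (%k. if k : I then (y k * dsup g k) powr q else 0) H K <= D * t powr q + 1"
  if a: "admissible p 0 I y" "node K" for I y H K
 proof -
  obtain A where A: "admissible p 0 A y" and T: "\<forall>T\<ge>0. tbound q (volterra g (ksum m y A)) T -->
    cmean (%k. if k : I then (y k * dsup g k) powr q else 0) H K <= D * T" using low[OF a, of H] by blast
  let ?F = "ksum m y A"
  have F: "?F : AT_inf p \<omega>" "tbound p ?F C" using bd[OF A] AT_zero_subset[OF p] by blast+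
  have hF: "?F holomorphic_on \<DD>" by (rule analytic_diskD(1)[OF ksum_analytic])
  have "tent_norm p \<omega> ?F <= ennreal (C powr (1 / p))"
   using tent_norm_le[OF hF p, of "C powr (1 / p)"] F(2) C p by (simp add: powr_powr)
  hence "ennreal C0 * tent_norm p \<omega> ?F <= ennreal (max 0 C0) * ennreal (C powr (1 / p))"
   by (intro mult_mono ennreal_leI) auto
  hence "tent_norm q \<omega> (volterra g ?F) <= ennreal t"
   using order_trans[OF C0[OF F(1)]] by (simp add: t_def ennreal_mult)
  hence "tbound q (volterra g ?F) (t powr q)" using tent_norm_le[OF volterra_holomorphic(1)[OF hF g] q t] by blast
  thus ?thesis using T[THEN spec, of "t powr q"] by simp
 qed
 moreover have "0 < D * t powr q + 1" using D by (simp add: add_nonneg_pos)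
 ultimately show ?thesis unfolding test_bound_def by blast
qed

text \<open>A single node k with coefficient W^(-1/p) is admissible, since its p-th power times W is
  1.\<close>

lemma test_bound_pointwise:
 assumes tb: "test_bound p q d N c" and p: "0 < p" and q: "0 < q" and d: "!!k. node k ==> 0 <= d k"
  and k: "node k" "N <= fst k"
 shows "d k * W (fst k) powr (1 / q - 1 / p) <= c powr (1 / q)"
proof -
 define y :: "nat \<times> nat => real" where "y = (%_. W (fst k) powr (- 1 / p))"
 have Wk: "0 < W (fst k)" by (rule W_pos)
 have "- 1 / p * p = - 1" using p by simp
 hence "y k powr p = W (fst k) powr (- 1)" by (simp only: y_def powr_powr)
 hence yp: "y k powr p * W (fst k) = 1" using Wk by (simp add: powr_minus)
 have one: "cmean (%i. if i : {k} then x i else 0) H K = (if k : boxes H & below k K then 2 ^ fst K * (x k * w k) else 0)" for x :: "nat \<times> nat => real" and H K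
 proof -
  let ?R = "{i. i : boxes H & below i K}"
  have fR: "finite ?R" by (rule finite_subset[OF _ finite_boxes[of H]]) blast
  have "(\<Sum>i\<in>?R. (if i : {k} then x i else 0) * w i) = (\<Sum>i\<in>?R. if i = k then x i * w i else 0)"
   by (intro sum.cong) auto
  also have "... = (if k : ?R then x k * w k else 0)" using fR by (subst sum.delta) auto
  finally show ?thesis by (simp add: cmean_def)
 qed
 have "carl (%i. if i : {k} then y i powr p else 0) (%_. 1)"
  unfolding carl_def one
 proof (intro allI impI)
  fix H K
  have "2 ^ fst K * (y k powr p * w k) <= 1" if "below k K"
  proof -
   have "2 ^ fst K * (y k powr p * w k) = 2 ^ fst K / 2 ^ fst k" using yp by (simp add: w_def)
   also have "... <= 1" using that by (simp add: below_def)
   finally show ?thesis .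
  qed
  thus "(if k : boxes H & below k K then 2 ^ fst K * (y k powr p * w k) else 0) <= 1" by simp
 qed
 moreover have "0 <= y k" by (simp add: y_def)
 ultimately have "admissible p N {k} y" using k by (simp add: admissible_def)
 hence "cmean (%i. if i : {k} then (y i * d i) powr q else 0) (fst k) k <= c" using tb k unfolding test_bound_def by blast
 hence "2 ^ fst k * ((y k * d k) powr q * w k) <= c" unfolding one using k by (simp add: mem_boxes below_refl)
 hence "(y k * d k) powr q * W (fst k) <= c" by (simp add: w_def)
 moreover have "(y k * d k) powr q * W (fst k) = (d k * W (fst k) powr (1 / q - 1 / p)) powr q"
 proof -
  have "(W (fst k) powr (1 / q - 1 / p)) powr q = W (fst k) powr (- 1 / p * q) * W (fst k) powr 1"
   using q by (simp only: powr_powr powr_add[symmetric]) (simp add: algebra_simps)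
  thus ?thesis using Wk by (simp add: powr_mult y_def powr_powr mult_ac)
 qed
 ultimately have "((d k * W (fst k) powr (1 / q - 1 / p)) powr q) powr (1 / q) <= c powr (1 / q)" using q by (intro powr_mono2) auto
 thus ?thesis using q d[OF k(1)] by (simp add: powr_powr)
qed

text \<open>Let Q be the largest mean of d^s restricted to the nodes below \<open>K\<close> up to
  the cutoff. Then y = (d^s/Q)^(1/p) is admissible and (y d)^q = Q^(-q/p) d^s, so testing over the
  box where Q is attained gives Q^(1 - q/p) <= c. Because of the cutoff Q is a finite number from
  the outset.\<close>

lemma test_bound_cmean:
 assumes tb: "test_bound p q d N c" and pq: "0 < q" "q < p" and c: "0 < c" and d: "!!k. node k ==> 0 <= d k"
  and K: "node K" "N <= fst K"
 shows "cmean (%k. d k powr (p * q / (p - q))) H K <= c powr (p / (p - q))"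
proof -
 define s where "s = p * q / (p - q)"
 have p: "0 < p" using pq by simp
 define I where "I = {k. k : boxes H & below k K}"
 have fI: "finite I" unfolding I_def by (rule finite_subset[OF _ finite_boxes[of H]]) blast
 have In: "node k & N <= fst k" if "k : I" for k using that K(2) unfolding I_def mem_boxes below_def by force
 define x where "x k = (if k : I then d k powr s else 0)" for k
 have x0: "0 <= x k" for k by (simp add: x_def)
 have w0: "0 <= w k" for k using w_pos[of k] by simp
 have cx: "cmean (%k. d k powr s) H K = cmean x H K"
  unfolding cmean_def by (intro arg_cong[where f="times (2 ^ fst K)"] sum.cong refl) (simp add: x_def I_def)
 define Q where "Q = Max ((%K'. cmean x H K') ` boxes H)"
 have ne: "boxes H ~= {}" using mem_boxes[of "(0, 0)" H] by (auto simp: node_def)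
 have Qge: "cmean x H K' <= Q" if "K' : boxes H" for K'
  unfolding Q_def using that by (intro Max_ge finite_imageI finite_boxes imageI)
 have "Q : (%K'. cmean x H K') ` boxes H" unfolding Q_def using ne by (intro Max_in finite_imageI finite_boxes) simp
 then obtain Ks where Ks: "Ks : boxes H" "Q = cmean x H Ks" by blast
 have Q0: "0 <= Q" unfolding Ks(2) by (rule cmean_nonneg[OF x0])
 \<comment> \<open>The restricted sequence vanishes beyond the cutoff, so Q bounds its means for
   every box and every cutoff.\<close>
 have all: "cmean x H' K' <= Q" if K': "node K'" for H' K'
 proof -
  let ?S = "{k. k : boxes H' & below k K'}" and ?T = "{k. k : boxes H & below k K'}"
  have fin: "finite ?S" "finite ?T" by (rule finite_subset[OF _ finite_boxes], blast)+
  have "(\<Sum>k\<in>?S. x k * w k) = (\<Sum>k\<in>?S Int ?T. x k * w k)"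
   using fin by (intro sum.mono_neutral_right) (auto simp: x_def I_def)
  also have "... <= (\<Sum>k\<in>?T. x k * w k)" using fin x0 w0 by (intro sum_mono2) auto
  finally have le: "cmean x H' K' <= cmean x H K'" unfolding cmean_def by (intro mult_left_mono) auto
  show ?thesis
  proof (cases "K' : boxes H")
   case True
   thus ?thesis using le Qge by fastforce
  next
   case False
   hence "?T = {}" using K' unfolding mem_boxes below_def by fastforce
   hence "cmean x H K' = 0" by (simp only: cmean_def) simp
   thus ?thesis using le Q0 by simp
  qed
 qed
 have "Q <= c powr (p / (p - q))"
 proof (cases "Q = 0")
  case False
  hence Q: "0 < Q" using Q0 by simp
  define y where "y k = (d k powr s / Q) powr (1 / p)" for k
  have yp: "y k powr p = d k powr s / Q" for k using p Q by (simp add: y_def powr_powr)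
  have cQ: "carl x (%_. Q)" unfolding carl_def using all by blast
  have "carl (%k. if k : I then y k powr p else 0) (%_. 1)"
   by (rule carl_mono[OF carl_cmult[OF cQ, of "1 / Q"]]) (use Q in \<open>auto simp: yp x_def\<close>)
  hence ad: "admissible p N I y" using fI In by (auto simp: admissible_def y_def)
  have Ksn: "node Ks" using Ks(1) unfolding mem_boxes by blast
  have t: "cmean (%k. if k : I then (y k * d k) powr q else 0) H Ks <= c" using tb ad Ksn unfolding test_bound_def by blast
  have "(%k. if k : I then (y k * d k) powr q else 0) = (%k. Q powr (- q / p) * x k)"
  proof
   fix k
   have "s * (q / p) + q = s" using pq by (simp add: s_def field_simps)
   hence "(d k powr s) powr (q / p) * d k powr q = d k powr s" by (simp only: powr_powr powr_add[symmetric])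
   moreover have "y k powr q = (d k powr s / Q) powr (q / p)" by (simp add: y_def powr_powr)
   ultimately have "(y k * d k) powr q = d k powr s / Q powr (q / p)" by (simp add: powr_mult powr_divide)
   thus "(if k : I then (y k * d k) powr q else 0) = Q powr (- q / p) * x k"
    using Q by (simp add: x_def powr_minus divide_inverse mult.commute)
  qed
  hence "Q powr (- q / p) * Q <= c" using t unfolding Ks(2) by (simp only: cmean_cmult)
  moreover have "Q powr (- q / p) * Q = Q powr ((p - q) / p)"
  proof -
   have "Q powr (- q / p) * Q powr 1 = Q powr (- q / p + 1)" by (simp only: powr_add)
   moreover have "- q / p + 1 = (p - q) / p" using p by (simp add: field_simps)
   ultimately show ?thesis using Q by simp
  qed
  ultimately have "(Q powr ((p - q) / p)) powr (p / (p - q)) <= c powr (p / (p - q))"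
   using pq by (intro powr_mono2) auto
  thus ?thesis using pq Q by (simp add: powr_powr)
 qed simp
 thus ?thesis using all[OF K(1), of H] cx unfolding s_def by simp
qed

text \<open>Vanishing means are automatically bounded: deep boxes by hypothesis, the others by
  \<open>cmean_split_level\<close>. Then \<open>carl_family\<close> applies to a single
  sequence.\<close>

lemma carl_of_vanishing:
 assumes x: "!!k. 0 <= x k" and van: "!!\<eta>. 0 < \<eta> ==> \<exists>N. \<forall>H K. node K --> N <= fst K --> cmean x H K <= \<eta>"
 shows "\<exists>b. (\<forall>n. 0 <= b n) & b \<longlonglongrightarrow> 0 & carl x b"
proof -
 have "\<exists>N. \<forall>H K. node K --> N <= fst K --> cmean x H K <= 1" by (rule van) simp
 then obtain M where M: "!!H K. node K ==> M <= fst K ==> cmean x H K <= 1" by blast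
 define B where "B = 2 ^ M * (\<Sum>k\<in>boxes M. x k * w k) + 1"
 have s0: "0 <= (\<Sum>k\<in>boxes M. x k * w k)" using x less_imp_le[OF w_pos] by (intro sum_nonneg mult_nonneg_nonneg) auto
 have bd: "carl x (%_. B)"
  unfolding carl_def
 proof (intro allI impI)
  fix H K assume K: "node K"
  show "cmean x H K <= B"
  proof (cases "M <= fst K")
   case True
   thus ?thesis using M[OF K True, of H] s0 by (simp add: B_def add_increasing)
  next
   case False
   thus ?thesis unfolding B_def by (intro cmean_split_level[OF x K M]) auto
  qed
 qed
 show ?thesis
  by (rule carl_family[of "{x}" B]) (use x bd van in blast)+
qed

end

subsection \<open>The theorem\<close>

context tent_weight begin

section \<open>Bounded maps into the vanishing space\<close>

text \<open>The infinite sum is a Montel limit of partial sums; the tail estimate is uniform in the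
  partial sum and survives the limit.\<close>

lemma infinite_kernel_sum:
 assumes p: "0 < p" and m: "cd powr (1 / p) * (1/2) ^ m <= 1 / 4"
  and kc: "!!I y. [|finite I; !!j. j : I ==> node j; !!j. j : I ==> 0 <= y j; carl (%k. if k : I then y k powr p else 0) (%_. 1)|]
   ==> carl (%k. supb (ksum m y I) k powr p) (%_. C)" and C: "0 <= C"
  and y: "!!k. 0 <= y k" "carl (%k. y k powr p) (%_. 1)"
 obtains F where "F : AT_inf p \<omega>"
  "!!M z. norm z < 1 ==> norm (F z - ksum m y (A Int boxes M) z) <= tail_const p * (1 / (1 - norm z)) ^ m * (1/2) ^ M"
proof -
 have fin: "finite (A Int boxes i)" for i using finite_boxes by blast
 have nd: "node j" if "j : A Int boxes i" for i j using that unfolding Int_iff mem_boxes by blast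
 have cI: "carl (%k. if k : I then y k powr p else 0) (%_. 1)" for I
  by (rule carl_mono[OF y(2)]) auto
 define f where "f i = ksum m y (A Int boxes i)" for i
 have hf: "f i holomorphic_on \<DD>" for i unfolding f_def by (rule analytic_diskD(1)[OF ksum_analytic])
 have cf: "carl (%k. supb (f i) k powr p) (%_. C)" for i unfolding f_def by (rule kc[OF fin nd y(1) cI])
 obtain F r where F: "F : \<H>\<DD>" and r: "strict_mono (r :: nat => nat)"
  and lim: "!!K. compact K ==> K <= \<DD> ==> uniform_limit K (%i. f (r i)) F sequentially"
  by (rule Montel_disk[where f=f, OF p hf cf]) blast
 have hF: "hol F" by (rule analytic_diskD(1)[OF F])
 have cF: "carl (%k. supb F k powr p) (%_. C)"
  by (rule carl_limit[OF p hol_cont[OF hf] hol_cont[OF hF] lim cf])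
 have "tbound p F (4 * ca * C)" unfolding tbound_def using carl_to_tmean_bounded[OF p hF cF] C by simp
 hence FA: "F : AT_inf p \<omega>" unfolding AT_inf_iff[OF p] using F C ca_pos by (intro conjI exI[of _ "4 * ca * C"]) auto
 show thesis
 proof (rule that[OF FA])
  fix M and z :: complex assume z: "norm z < 1"
  let ?\<tau> = "tail_const p * (1 / (1 - norm z)) ^ m * (1/2) ^ M"
  have d: "norm (f i z - f M z) <= ?\<tau>" if i: "M <= i" for i
  proof -
   let ?I = "A Int boxes i - A Int boxes M"
   have sub: "A Int boxes M <= A Int boxes i"
   proof
    fix k assume "k : A Int boxes M"
    thus "k : A Int boxes i" using i unfolding Int_iff mem_boxes by linarith
   qed
   have "f i z - f M z = ksum m y ?I z" using z sum_diff[OF fin sub, of "%j. of_real (y j) * kern m j z"] by (simp add: f_def ksum_def)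
   hence "norm (f i z - f M z) <= (\<Sum>j\<in>?I. y j * norm (kern m j z))" using norm_ksum_le[of ?I y m z] y(1) by simp
   also have "... <= ?\<tau>"
   proof (rule kern_tail[OF p m _ _ _ y(1) cI z])
    show "finite ?I" using fin by blast
    show "node j" if "j : ?I" for j using that unfolding Diff_iff Int_iff mem_boxes by blast
    show "M <= fst j" if "j : ?I" for j using that unfolding Diff_iff Int_iff mem_boxes by linarith
   qed
   finally show ?thesis .
  qed
  have "uniform_limit {z} (%i. f (r i)) F sequentially" using z by (intro lim) auto
  hence "(%i. f (r i) z) \<longlonglongrightarrow> F z" by (rule tendsto_uniform_limitI) simp
  hence "(%i. norm (f (r i) z - f M z)) \<longlonglongrightarrow> norm (F z - f M z)" by (intro tendsto_intros)
  hence "norm (F z - f M z) <= ?\<tau>"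
  proof (rule LIMSEQ_le_const2)
   show "\<exists>N. \<forall>n\<ge>N. norm (f (r n) z - f M z) <= ?\<tau>"
   proof (intro exI[of _ M] allI impI d)
    fix n assume "M <= n"
    thus "M <= r n" using seq_suble[OF r, of n] by linarith
   qed
  qed
  thus "norm (F z - ksum m y (A Int boxes M) z) <= ?\<tau>" by (simp add: f_def)
 qed
qed

text \<open>A gliding hump: if the means of \<open>d powr s\<close> did not vanish, finite blocks \<open>A\<^sub>i\<close> of nodes could be chosen
  successively so that, for the union \<open>A\<close> of the blocks, the image of the kernel sum over \<open>A\<close> keeps
  a fixed mean over smaller and smaller boxes.\<close>

lemma bounded_into_zero_vanishing:
 assumes pq: "0 < q" "q < p" and g: "hol g"
  and bo: "bounded_op (AT_inf p \<omega>) (tent_norm p \<omega>) (AT_zero q \<omega>) (tent_norm q \<omega>) (volterra g)"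
  and \<eta>: "0 < \<eta>"
 shows "\<exists>N. \<forall>H K. node K --> N <= fst K --> cmean (%k. dsup g k powr (p * q / (p - q))) H K <= \<eta>"
proof (rule ccontr)
 assume neg: "~ ?thesis"
 define s where "s = p * q / (p - q)"
 have p: "0 < p" and q: "0 < q" using pq by auto
 let ?d = "dsup g"
 have d0: "0 <= ?d k" if "node k" for k by (rule dsup_nonneg[OF g that])
 obtain c where c: "0 < c" "test_bound p q ?d 0 c" using bounded_test_bound[OF p q g bo] by blast
 define Q where "Q = c powr (p / (p - q))"
 have Q: "0 < Q" using c by (simp add: Q_def)
 have cQ: "carl (%k. ?d k powr s) (%_. Q)"
  unfolding carl_def Q_def s_def using test_bound_cmean[OF c(2) pq c(1) d0] by blast
 \<comment> \<open>The extremal coefficients of \<open>test_bound_cmean\<close>, now on the whole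
   tree and normalised by the bound Q for all means that boundedness of the operator
   supplies.\<close>
 define y where "y k = (?d k powr s / Q) powr (1 / p)" for k
 have y0: "0 <= y k" for k by (simp add: y_def)
 have yp: "y k powr p = 1 / Q * ?d k powr s" for k using p Q by (simp add: y_def powr_powr)
 have cy: "carl (%k. y k powr p) (%_. 1)"
  unfolding yp using carl_cmult[OF cQ, of "1 / Q"] Q by simp
 have yd: "(y k * ?d k) powr q = Q powr (- q / p) * ?d k powr s" for k
 proof -
  have "s * (q / p) + q = s" using pq by (simp add: s_def field_simps)
  hence "(?d k powr s) powr (q / p) * ?d k powr q = ?d k powr s" by (simp only: powr_powr powr_add[symmetric])
  moreover have "y k powr q = (?d k powr s / Q) powr (q / p)" by (simp add: y_def powr_powr)
  ultimately have "(y k * ?d k) powr q = ?d k powr s / Q powr (q / p)" by (simp add: powr_mult powr_divide)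
  thus ?thesis using Q by (simp add: powr_minus divide_inverse mult.commute)
 qed
 obtain m C where C: "0 < C" and m: "cd powr (1 / p) * (1/2) ^ m <= 1 / 4" and
  kc: "!!I y. [|finite I; !!j. j : I ==> node j; !!j. j : I ==> 0 <= y j; carl (%k. if k : I then y k powr p else 0) (%_. 1)|]
   ==> carl (%k. supb (ksum m y I) k powr p) (%_. C)"
  by (rule ksum_carl[OF p]) blast
 obtain \<zeta> where \<zeta>: "!!k. node k ==> \<zeta> k : dbox k & supb (deriv g) k <= 2 * norm (deriv g (\<zeta> k))"
  by (rule ex_sample_points[OF g]) blast
 define D0 where "D0 = 10 powr (m * q) * 2 powr (q + 1)"
 have D0: "0 < D0" by (simp add: D0_def)
 define c1 where "c1 = Q powr (- q / p) * \<eta> / D0"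
 have c1: "0 < c1" using Q \<eta> D0 by (simp add: c1_def)
 \<comment> \<open>2^q for separating F from the error of approximation, and one half to absorb that
   error.\<close>
 define c0 where "c0 = c1 / 2 powr q / 2"
 have c0: "0 < c0" using c1 by (simp add: c0_def)
 \<comment> \<open>All that is used of the final function F, stated before F exists: up to level M
   it is close to the kernel sum over its node set.\<close>
 define near_ksum where "near_ksum A F \<longleftrightarrow> (\<forall>M z. norm z < 1 -->
  norm (F z - ksum m y (A Int boxes M) z) <= tail_const p * (1 / (1 - norm z)) ^ m * (1/2) ^ M)" for A F
 define G where "G F H K = cmean (%k. (norm (F (\<zeta> k)) * ?d k) powr q) H K" for F :: "complex => complex" and H K
 \<comment> \<open>A state is a level together with the nodes chosen up to it. The lower bound is
   demanded for every F whose node set agrees with the new state, so that later choices cannot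
   destroy it.\<close>
 define step where "step X X' \<longleftrightarrow> fst X < fst X' & snd X' Int boxes (fst X) = snd X &
  (\<exists>H K. node K & fst X <= fst K & (\<forall>A F. A Int boxes (fst X') = snd X' --> near_ksum A F --> c0 <= G F H K))"
  for X X' :: "nat \<times> (nat \<times> nat) set"
 have ex_step: "\<exists>X'. snd X' <= boxes (fst X') & step X X'" if X: "snd X <= boxes (fst X)" for X
 proof -
  obtain N S where NS: "X = (N, S)" by (cases X)
  have S: "S <= boxes N" using X NS by simp
  obtain H K where K: "node K" "Suc N <= fst K" and big: "\<eta> < cmean (%k. ?d k powr s) H K"
   using neg unfolding s_def by (meson not_le)
  define I where "I = {k. k : boxes H & below k K}"
  have fI: "finite I" unfolding I_def by (rule finite_subset[OF _ finite_boxes[of H]]) blast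
  have In: "node k" "Suc N <= fst k" "k : boxes H" if "k : I" for k
   using that K(2) unfolding I_def mem_boxes below_def by force+
  have fS: "finite S" using S finite_boxes finite_subset by blast
  have cI: "cmean (%k. if k : I then (y k * ?d k) powr q else 0) H K = Q powr (- q / p) * cmean (%k. ?d k powr s) H K"
  proof -
   have "cmean (%k. if k : I then (y k * ?d k) powr q else 0) H K = cmean (%k. Q powr (- q / p) * ?d k powr s) H K"
    unfolding cmean_def by (intro arg_cong[where f="times (2 ^ fst K)"] sum.cong refl) (simp add: I_def yd)
   thus ?thesis by (simp only: cmean_cmult)
  qed
  \<comment> \<open>The kernel sum over the earlier blocks enters as the offset, so it cannot cancel
    the contribution of the new block.\<close>
  obtain A0 where A0: "A0 <= I" and sel: "cmean (%k. if k : I then (y k * ?d k) powr q else 0) H K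
   <= D0 * cmean (%k. (norm (ksum m y S (\<zeta> k) + ksum m y A0 (\<zeta> k)) * ?d k) powr q) H K"
   unfolding D0_def by (rule select_cmean[OF q fI In(1) y0 d0 \<zeta>[THEN conjunct1], where B="ksum m y S" and m=m and H=H and K=K])
  define S' where "S' = S Un A0"
  have dis: "S Int A0 = {}"
  proof -
   have "~ k : S" if "k : A0" for k
    using In(2)[of k] A0 S that mem_boxes[of k N] by force
   thus ?thesis by blast
  qed
  have fA0: "finite A0" using A0 fI finite_subset by blast
  have ks: "ksum m y S z + ksum m y A0 z = ksum m y S' z" for z
   by (simp add: S'_def ksum_def sum.union_disjoint[OF fS fA0 dis])
  have GS': "c1 <= G (ksum m y S') H K"
  proof -
   have "Q powr (- q / p) * \<eta> <= Q powr (- q / p) * cmean (%k. ?d k powr s) H K"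
    using big by (intro mult_left_mono) auto
   also have "... <= D0 * G (ksum m y S') H K" using sel unfolding cI ks G_def .
   finally show ?thesis using D0 by (simp add: c1_def pos_divide_le_eq mult.commute)
  qed
  \<comment> \<open>Bounds, at the sample points, the effect of all nodes chosen beyond level n. It
    tends to 0 on the finitely many boxes of this mean, and N' is taken so large that it contributes
    less than \<open>c0\<close>.\<close>
  define e where "e n k = tail_const p * (1 / (1 - norm (\<zeta> k))) ^ m * (1/2) ^ n" for n :: nat and k
  have e0: "0 <= e n k" if "node k" for n k
   using dbox_subset_disk[OF \<zeta>[OF that, THEN conjunct1]] by (simp add: e_def tail_const_def)
  have "(%n. cmean (%k. (e n k * ?d k) powr q) H K) \<longlonglongrightarrow> 2 ^ fst K * (\<Sum>k | k : boxes H & below k K. 0 * w k)"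
   unfolding cmean_def
  proof (intro tendsto_mult tendsto_const tendsto_sum)
   fix k assume "k : {k. k : boxes H & below k K}"
   hence k: "node k" unfolding mem_boxes by blast
   have "(%n. (1/2 :: real) ^ n) \<longlonglongrightarrow> 0" by (rule LIMSEQ_power_zero) simp
   hence "(%n. e n k * ?d k) \<longlonglongrightarrow> 0" unfolding e_def by (intro tendsto_mult_left_zero tendsto_mult_right_zero)
   hence "(%n. (e n k * ?d k) powr q) \<longlonglongrightarrow> 0 powr q"
    using q e0[OF k] d0[OF k] by (intro tendsto_powr' tendsto_const) auto
   thus "(%n. (e n k * ?d k) powr q) \<longlonglongrightarrow> 0" using q by simp
  qed
  hence "(%n. cmean (%k. (e n k * ?d k) powr q) H K) \<longlonglongrightarrow> 0" by simp
  hence "eventually (%n. cmean (%k. (e n k * ?d k) powr q) H K < c0) sequentially" using order_tendstoD(2) c0 by blast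
  then obtain N0 where N0: "!!n. N0 <= n ==> cmean (%k. (e n k * ?d k) powr q) H K < c0" unfolding eventually_sequentially by blast
  define N' where "N' = N0 + H + Suc N"
  have "step X (N', S')"
   unfolding step_def NS fst_conv snd_conv
  proof (intro conjI)
   show "N < N'" by (simp add: N'_def)
   have "k ~: boxes N" if "k : A0" for k using In(2)[of k] A0 that mem_boxes[of k N] by force
   thus "S' Int boxes N = S" using S unfolding S'_def by blast
   show "\<exists>H K. node K & N <= fst K & (\<forall>A F. A Int boxes N' = S' --> near_ksum A F --> c0 <= G F H K)"
   proof (intro exI[of _ H] exI[of _ K] conjI allI impI K(1))
    show "N <= fst K" using K(2) by simp
    fix A F assume A: "A Int boxes N' = S'" and F: "near_ksum A F"
    have "G (ksum m y S') H K <= cmean (%k. 2 powr q * ((norm (F (\<zeta> k)) * ?d k) powr q + (e N' k * ?d k) powr q)) H K"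
     unfolding G_def
    proof (rule cmean_mono)
     fix k assume k: "node k"
     have z: "norm (\<zeta> k) < 1" by (rule dbox_subset_disk[OF \<zeta>[OF k, THEN conjunct1]])
     have "norm (F (\<zeta> k) - ksum m y S' (\<zeta> k)) <= e N' k"
      using F[unfolded near_ksum_def, THEN spec, THEN spec, THEN mp, OF z, of N'] unfolding A e_def .
     hence "norm (ksum m y S' (\<zeta> k)) <= norm (F (\<zeta> k)) + e N' k"
      using norm_triangle_sub[of "ksum m y S' (\<zeta> k)" "F (\<zeta> k)"] by (simp add: norm_minus_commute)
     also have "... <= 2 * max (norm (F (\<zeta> k))) (e N' k)" by simp
     finally have "norm (ksum m y S' (\<zeta> k)) * ?d k <= 2 * max (norm (F (\<zeta> k))) (e N' k) * ?d k"
      using d0[OF k] by (rule mult_right_mono)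
     hence "(norm (ksum m y S' (\<zeta> k)) * ?d k) powr q <= (2 * (max (norm (F (\<zeta> k))) (e N' k) * ?d k)) powr q"
      using q d0[OF k] by (intro powr_mono2) auto
     also have "... = 2 powr q * (max (norm (F (\<zeta> k))) (e N' k) * ?d k) powr q" by (rule powr_mult)
     also have "... <= 2 powr q * ((norm (F (\<zeta> k)) * ?d k) powr q + (e N' k * ?d k) powr q)"
      by (intro mult_left_mono) (auto simp: max_def)
     finally show "(norm (ksum m y S' (\<zeta> k)) * ?d k) powr q <= 2 powr q * ((norm (F (\<zeta> k)) * ?d k) powr q + (e N' k * ?d k) powr q)" .
    qed
    also have "... = 2 powr q * (G F H K + cmean (%k. (e N' k * ?d k) powr q) H K)"
     by (simp only: cmean_cmult cmean_add G_def)
    finally have "c1 <= 2 powr q * (G F H K + cmean (%k. (e N' k * ?d k) powr q) H K)" using GS' by linarith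
    hence "c1 / 2 powr q <= G F H K + cmean (%k. (e N' k * ?d k) powr q) H K" by (simp add: pos_divide_le_eq mult.commute)
    moreover have "cmean (%k. (e N' k * ?d k) powr q) H K < c0" by (rule N0) (simp add: N'_def)
    moreover have "c1 / 2 powr q = c0 + c0" by (simp add: c0_def)
    ultimately show "c0 <= G F H K" by linarith
   qed
  qed
  moreover have "S' <= boxes N'"
  proof
   fix k assume "k : S'"
   hence "k : boxes N \<or> k : boxes H" using S A0 In(3) unfolding S'_def by blast
   thus "k : boxes N'" unfolding mem_boxes N'_def by linarith
  qed
  ultimately show ?thesis by (intro exI[of _ "(N', S')"]) simp
 qed
 have "\<exists>f. \<forall>n. snd (f n) <= boxes (fst (f n)) & step (f n) (f (Suc n))"
  by (rule dependent_nat_choice[where P="%_ X. snd X <= boxes (fst X)" and Q="%_. step"])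
   (use ex_step in \<open>auto intro: exI[of _ "(0, {})"]\<close>)
 then obtain f where f: "!!n. snd (f n) <= boxes (fst (f n))" "!!n. step (f n) (f (Suc n))" by blast
 define A where "A = (\<Union>n. snd (f n))"
 have lt: "fst (f n) < fst (f (Suc n))" for n using f(2)[of n] unfolding step_def by blast
 have mono: "fst (f n) <= fst (f (n + i))" for n i
 proof (induction i)
  case (Suc i)
  thus ?case using lt[of "n + i"] by simp
 qed simp
 have bm: "boxes (fst (f n)) <= boxes (fst (f (n + i)))" for n i
 proof
  fix k assume "k : boxes (fst (f n))"
  thus "k : boxes (fst (f (n + i)))" using mono[of n i] unfolding mem_boxes by linarith
 qed
 have cons: "snd (f (n + i)) Int boxes (fst (f n)) = snd (f n)" for n i
 proof (induction i)
  case 0 show ?case using f(1)[of n] by auto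
 next
  case (Suc i)
  have "snd (f (Suc (n + i))) Int boxes (fst (f (n + i))) = snd (f (n + i))" using f(2)[of "n + i"] unfolding step_def by blast
  thus ?case using Suc bm[of n i] by auto
 qed
 \<comment> \<open>The union of all blocks agrees with each state up to the level of that state, so
   all the lower bounds hold for one and the same F.\<close>
 have An: "A Int boxes (fst (f n)) = snd (f n)" for n
 proof
  show "snd (f n) <= A Int boxes (fst (f n))" using f(1)[of n] unfolding A_def by blast
  show "A Int boxes (fst (f n)) <= snd (f n)"
  proof
   fix k assume k: "k : A Int boxes (fst (f n))"
   then obtain j where j: "k : snd (f j)" unfolding A_def by blast
   show "k : snd (f n)"
   proof (cases "n <= j")
    case True
    thus ?thesis using cons[of n "j - n"] j k by auto
   next
    case False
    thus ?thesis using cons[of j "n - j"] j by auto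
   qed
  qed
 qed
 obtain F where F: "F : AT_inf p \<omega>" and near: "!!M z. norm z < 1 ==> norm (F z - ksum m y (A Int boxes M) z) <= tail_const p * (1 / (1 - norm z)) ^ m * (1/2) ^ M"
  by (rule infinite_kernel_sum[where A=A, OF p m kc less_imp_le[OF C] y0 cy]) blast+
 have nF: "near_ksum A F" unfolding near_ksum_def using near by blast
 have FH: "F : \<H>\<DD>" using F by (simp add: AT_inf_def)
 have hF: "hol F" by (rule analytic_diskD(1)[OF FH])
 have JF: "volterra g F : AT_zero q \<omega>" using bo F unfolding bounded_op_def by blast
 have JH: "volterra g F : \<H>\<DD>" using JF by (simp add: AT_zero_def)
 obtain b where b: "b \<longlonglongrightarrow> 0" and cb: "carl (%k. dsup (volterra g F) k powr q) b"
  using AT_zero_iff_carl_dsup[OF q JH] JF by blast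
 have Gb: "G F H K <= 2 powr q * b (fst K)" if "node K" for H K
  using carlD[OF carl_volterra_samples[OF q hF g \<zeta> cb] that] unfolding G_def by simp
 have "(%n. 2 powr q * b n) \<longlonglongrightarrow> 0" by (rule tendsto_mult_right_zero[OF b])
 hence "eventually (%n. 2 powr q * b n < c0) sequentially" using order_tendstoD(2) c0 by blast
 then obtain n0 where n0: "!!n. n0 <= n ==> 2 powr q * b n < c0" unfolding eventually_sequentially by blast
 obtain H K where K: "node K" "fst (f n0) <= fst K" and low: "\<forall>A F. A Int boxes (fst (f (Suc n0))) = snd (f (Suc n0)) --> near_ksum A F --> c0 <= G F H K"
  using f(2)[of n0] unfolding step_def by blast
 have "n <= fst (f n)" for n
 proof (induction n)
  case (Suc n)
  thus ?case using lt[of n] by simp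
 qed simp
 hence "n0 <= fst K" using K(2) order_trans by blast
 hence "2 powr q * b (fst K) < c0" by (rule n0)
 moreover have "c0 <= G F H K" using low An nF by blast
 ultimately show False using Gb[OF K(1), of H] by linarith
qed

text \<open>The test functions lie in the vanishing domain and the sufficiency part maps into the
  vanishing range, so \<open>X\<close> and \<open>Y\<close> may be anything in between.\<close>

lemma le_case:
 assumes p: "0 < p" and pq: "p <= q" and g: "hol g"
  and X: "AT_zero p \<omega> <= X" "X <= AT_inf p \<omega>" and Y: "AT_zero q \<omega> <= Y" "Y <= AT_inf q \<omega>"
 shows "compact_op X (tent_norm p \<omega>) Y (tent_norm q \<omega>) (volterra g) \<longleftrightarrow>
  ((%z. norm (deriv g z) * (1 - norm z) * enn2real (tail \<omega> z) powr (1 / q - 1 / p)) \<longlongrightarrow> 0) to_circle"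
proof -
 have q: "0 < q" using p pq by simp
 have \<gamma>: "1 / q - 1 / p <= 0" using p pq by (simp add: frac_le)
 show ?thesis
  unfolding bloch_limit_iff[OF g \<gamma>]
 proof
  assume co: "compact_op X (tent_norm p \<omega>) Y (tent_norm q \<omega>) (volterra g)"
  show "\<forall>\<eta>>0. \<exists>N. \<forall>k. node k --> N <= fst k --> dsup g k * W (fst k) powr (1 / q - 1 / p) <= \<eta>"
  proof (intro allI impI)
   fix \<eta> :: real assume \<eta>: "0 < \<eta>"
   hence "0 < \<eta> powr q" by simp
   from compact_test_bound[OF p q g co X Y(2) this]
   obtain N where N: "test_bound p q (dsup g) N (\<eta> powr q)" by blast
   have "(\<eta> powr q) powr (1 / q) = \<eta>" using \<eta> q by (simp add: powr_powr)
   thus "\<exists>N. \<forall>k. node k --> N <= fst k --> dsup g k * W (fst k) powr (1 / q - 1 / p) <= \<eta>"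
    using test_bound_pointwise[OF N p q dsup_nonneg[OF g]] by (intro exI[of _ N]) simp
  qed
 next
  assume "\<forall>\<eta>>0. \<exists>N. \<forall>k. node k --> N <= fst k --> dsup g k * W (fst k) powr (1 / q - 1 / p) <= \<eta>"
  thus "compact_op X (tent_norm p \<omega>) Y (tent_norm q \<omega>) (volterra g)"
   by (intro compact_volterra[OF p q g vmult_of_limit[OF p pq g] X(2) Y])
 qed
qed

lemma gt_case_sufficient:
 assumes pq: "0 < q" "q < p" and g: "g : \<H>\<DD>" "g : AT_zero (p * q / (p - q)) \<omega>"
 shows "vmult p q (dsup g)"
proof -
 have s: "0 < p * q / (p - q)" using pq by simp
 have hg: "hol g" by (rule analytic_diskD(1)[OF g(1)])
 obtain b where b: "\<forall>n. 0 <= b n" "b \<longlonglongrightarrow> 0" "carl (%k. dsup g k powr (p * q / (p - q))) b"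
  using AT_zero_iff_carl_dsup[OF s g(1)] g(2) by blast
 show ?thesis by (rule vmult_gt) (use pq b dsup_nonneg[OF hg] in auto)
qed

lemma gt_case_necessary:
 assumes pq: "0 < q" "q < p" and g: "g : \<H>\<DD>"
  and van: "!!\<eta>. 0 < \<eta> ==> \<exists>N. \<forall>H K. node K --> N <= fst K --> cmean (%k. dsup g k powr (p * q / (p - q))) H K <= \<eta>"
 shows "g : AT_zero (p * q / (p - q)) \<omega>"
proof -
 have s: "0 < p * q / (p - q)" using pq by simp
 show ?thesis unfolding AT_zero_iff_carl_dsup[OF s g] by (rule carl_of_vanishing[OF powr_ge_zero van])
qed

lemma gt_case:
 assumes pq: "0 < q" "q < p" and g: "g : \<H>\<DD>"
  and X: "AT_zero p \<omega> <= X" "X <= AT_inf p \<omega>" and Y: "AT_zero q \<omega> <= Y" "Y <= AT_inf q \<omega>"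
 shows "compact_op X (tent_norm p \<omega>) Y (tent_norm q \<omega>) (volterra g) \<longleftrightarrow> g : AT_zero (p * q / (p - q)) \<omega>"
proof
 have p: "0 < p" using pq by simp
 have hg: "hol g" by (rule analytic_diskD(1)[OF g])
 {
  assume co: "compact_op X (tent_norm p \<omega>) Y (tent_norm q \<omega>) (volterra g)"
  show "g : AT_zero (p * q / (p - q)) \<omega>"
  proof (rule gt_case_necessary[OF pq g])
   fix \<eta> :: real assume \<eta>: "0 < \<eta>"
   hence c: "0 < \<eta> powr ((p - q) / p)" by simp
   from compact_test_bound[OF p pq(1) hg co X Y(2) this]
   obtain N where N: "test_bound p q (dsup g) N (\<eta> powr ((p - q) / p))" by blast
   have "(\<eta> powr ((p - q) / p)) powr (p / (p - q)) = \<eta>" using \<eta> pq by (simp add: powr_powr)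
   thus "\<exists>N. \<forall>H K. node K --> N <= fst K --> cmean (%k. dsup g k powr (p * q / (p - q))) H K <= \<eta>"
    using test_bound_cmean[OF N pq c dsup_nonneg[OF hg]] by (intro exI[of _ N]) simp
  qed
 next
  assume "g : AT_zero (p * q / (p - q)) \<omega>"
  thus "compact_op X (tent_norm p \<omega>) Y (tent_norm q \<omega>) (volterra g)"
   by (intro compact_volterra[OF p pq(1) hg _ X(2) Y] gt_case_sufficient[OF pq g])
 }
qed

lemma gt_case_bounded:
 assumes pq: "0 < q" "q < p" and g: "g : \<H>\<DD>"
 shows "bounded_op (AT_inf p \<omega>) (tent_norm p \<omega>) (AT_zero q \<omega>) (tent_norm q \<omega>) (volterra g) \<longleftrightarrow> g : AT_zero (p * q / (p - q)) \<omega>"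
proof
 have p: "0 < p" using pq by simp
 have hg: "hol g" by (rule analytic_diskD(1)[OF g])
 {
  assume "bounded_op (AT_inf p \<omega>) (tent_norm p \<omega>) (AT_zero q \<omega>) (tent_norm q \<omega>) (volterra g)"
  thus "g : AT_zero (p * q / (p - q)) \<omega>"
   by (intro gt_case_necessary[OF pq g] bounded_into_zero_vanishing[OF pq hg])
 next
  assume "g : AT_zero (p * q / (p - q)) \<omega>"
  thus "bounded_op (AT_inf p \<omega>) (tent_norm p \<omega>) (AT_zero q \<omega>) (tent_norm q \<omega>) (volterra g)"
   by (intro bounded_volterra[OF p pq(1) hg] gt_case_sufficient[OF pq g])
 }
qed

end

lemma D_class_tent_weight:
 assumes "\<omega> : D_class"
 obtains W \<rho> cr cd \<mu> ca cl L where "tent_weight W \<rho> cr cd \<mu> ca cl L \<omega>"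
proof (rule D_class_tent_measure[OF assms])
 fix \<rho> cr cd \<mu> ca cl L
 assume tm: "tent_measure (%n. enn2real (tail \<omega> (of_real (rad n)))) \<rho> cr cd \<mu> ca cl L"
  and wi: "!!f S q. S <= \<DD> ==> (%z. ennreal (norm (f z) powr q) * indicator S z) : borel_measurable borel ==>
   (\<integral>\<^sup>+z\<in>S. ennreal (norm (f z :: complex) powr q * \<omega> z) \<partial>lebesgue) = (\<integral>\<^sup>+z\<in>S. ennreal (norm (f z) powr q) \<partial>\<mu>)"
  and tp: "!!z. z : \<DD> ==> 0 < enn2real (tail \<omega> z)"
  and ta: "!!z z'. z' : \<DD> ==> norm z <= norm z' ==> enn2real (tail \<omega> z') <= enn2real (tail \<omega> z)"
 have "tent_weight (%n. enn2real (tail \<omega> (of_real (rad n)))) \<rho> cr cd \<mu> ca cl L \<omega>"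
  by (intro tent_weight.intro tm tent_weight_axioms.intro wi tp ta) auto
 thus thesis by (rule that)
qed

theorem theorem5p2:
  fixes p q :: real and \<omega> :: "complex \<Rightarrow> real" and g :: "complex \<Rightarrow> complex"
  assumes "0 < p" and "0 < q" and "\<omega> \<in> D_class" and "g \<in> \<H>\<DD>"
  shows
    "(p \<le> q \<longrightarrow>
       (compact_op (AT_inf p \<omega>) (tent_norm p \<omega>) (AT_inf q \<omega>) (tent_norm q \<omega>) (volterra g)
         \<longleftrightarrow> compact_op (AT_zero p \<omega>) (tent_norm p \<omega>) (AT_zero q \<omega>) (tent_norm q \<omega>) (volterra g))
       \<and>
       (compact_op (AT_zero p \<omega>) (tent_norm p \<omega>) (AT_zero q \<omega>) (tent_norm q \<omega>) (volterra g)
         \<longleftrightarrow> ((\<lambda>z. norm (deriv g z) * (1 - norm z) * enn2real (tail \<omega> z) powr (1 / q - 1 / p))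
               \<longlongrightarrow> 0) to_circle))
     \<and>
     (p > q \<longrightarrow>
       (compact_op (AT_inf p \<omega>) (tent_norm p \<omega>) (AT_inf q \<omega>) (tent_norm q \<omega>) (volterra g)
         \<longleftrightarrow> compact_op (AT_zero p \<omega>) (tent_norm p \<omega>) (AT_zero q \<omega>) (tent_norm q \<omega>) (volterra g))
       \<and>
       (compact_op (AT_zero p \<omega>) (tent_norm p \<omega>) (AT_zero q \<omega>) (tent_norm q \<omega>) (volterra g)
         \<longleftrightarrow> bounded_op (AT_inf p \<omega>) (tent_norm p \<omega>) (AT_zero q \<omega>) (tent_norm q \<omega>) (volterra g))
       \<and>
       (bounded_op (AT_inf p \<omega>) (tent_norm p \<omega>) (AT_zero q \<omega>) (tent_norm q \<omega>) (volterra g)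
         \<longleftrightarrow> g \<in> AT_zero (p * q / (p - q)) \<omega>))"
proof -
 obtain W \<rho> cr cd \<mu> ca cl L where "tent_weight W \<rho> cr cd \<mu> ca cl L \<omega>"
  by (rule D_class_tent_weight[OF assms(3)])
 then interpret tent_weight W \<rho> cr cd \<mu> ca cl L \<omega> .
 have hg: "hol g" by (rule analytic_diskD(1)[OF assms(4)])
 note sub = AT_zero_subset[OF assms(1)] AT_zero_subset[OF assms(2)]
 \<comment> \<open>\<open>X\<close> and \<open>Y\<close> are taken at both extremes: the full spaces
   for (a), the vanishing ones for (b).\<close>
 show ?thesis
  using le_case[OF assms(1) _ hg sub(1) subset_refl sub(2) subset_refl]
   le_case[OF assms(1) _ hg subset_refl sub(1) subset_refl sub(2)]
   gt_case[OF assms(2) _ assms(4) sub(1) subset_refl sub(2) subset_refl]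
   gt_case[OF assms(2) _ assms(4) subset_refl sub(1) subset_refl sub(2)]
   gt_case_bounded[OF assms(2) _ assms(4)]
  by blast
qed

end
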